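(* The modular curve attached to $\Gamma^{2}\cap\Gamma_1(7)$ has model \[ W^2=X(X-1)(X^3-8X^2+5X+1), \] and genus $2$.
   Context: $\Gamma^2\subset\mathrm{SL}_2(\mathbf Z)$ is the inverse image of the subgroup of order $3$ of $\mathrm{SL}_2(\mathbf F_2)$ under reduction modulo $2$. The modular curve attached to a congruence subgroup $G$ is the compactified quotient of the upper half-plane by $G$, and a model is a curve over $\mathbf C$ with the same function field (the field of modular functions for $G$). *)

theory Defs
  imports
    "HOL-Complex_Analysis.Complex_Analysis"
    "HOL-Computational_Algebra.Computational_Algebra"
    "HOL-Algebra.QuotRing"
    "HOL-Number_Theory.Cong"
    "HOL-Library.Z2"
    "HOL-Library.Function_Algebras"
begin

definition SL2 :: "('a::comm_ring_1 ^ 2 ^ 2) monoid" where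
  "SL2 = \<lparr>carrier = {A. det A = 1}, mult = (**), one = mat 1\<rparr>"

definition reduce_mod2 :: "int ^ 2 ^ 2 \<Rightarrow> bit ^ 2 ^ 2" where
  "reduce_mod2 A = (\<chi> i j. of_int (A $ i $ j))"

definition Gamma_sup2 :: "(int ^ 2 ^ 2) set" where
  "Gamma_sup2 = {A \<in> carrier SL2. reduce_mod2 A \<in> (THE H. subgroup H SL2 \<and> card H = 3)}"

definition Gamma1 :: "int \<Rightarrow> (int ^ 2 ^ 2) set" where
  "Gamma1 N = {A \<in> carrier SL2.
     [A $ 1 $ 1 = 1] (mod N) \<and> [A $ 2 $ 2 = 1] (mod N) \<and> [A $ 2 $ 1 = 0] (mod N)}"


definition upper_half_plane :: "complex set" where
  "upper_half_plane = {z. Im z > 0}"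

definition moebius :: "int ^ 2 ^ 2 \<Rightarrow> complex \<Rightarrow> complex" where
  "moebius A z = (of_int (A $ 1 $ 1) * z + of_int (A $ 1 $ 2)) /
                 (of_int (A $ 2 $ 1) * z + of_int (A $ 2 $ 2))"

text \<open>
  The compactified quotient \<open>X(G)\<close> of the upper half-plane \<open>\<H>\<close> by \<open>G\<close> is the set of \<open>G\<close>-orbits
  on the union of \<open>\<H>\<close> and the cusps \<open>\<rat> \<union> {\<infinity>}\<close>. Its complex structure is given by the
  following local coordinates, written as functions on \<open>\<H>\<close>. The order of the stabiliser is
  taken in \<open>PSL\<^sub>2(\<int>)\<close>, hence the identification of \<open>A\<close> with \<open>-A\<close>.
\<close>

definition stabilizer_order :: "(int ^ 2 ^ 2) set \<Rightarrow> complex \<Rightarrow> nat" where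
  "stabilizer_order G z = card ((\<lambda>A. {A, - A}) ` {A \<in> G. moebius A z = z})"

definition interior_coord :: "(int ^ 2 ^ 2) set \<Rightarrow> complex \<Rightarrow> complex \<Rightarrow> complex" where
  "interior_coord G z0 z = ((z - z0) / (z - cnj z0)) ^ stabilizer_order G z0"

text \<open>
  A cusp is given by any matrix \<open>S \<in> SL\<^sub>2(\<int>)\<close> that sends it to \<open>\<infinity>\<close>; every element of
  \<open>\<rat> \<union> {\<infinity>}\<close> arises in this way. The width is the least \<open>h > 0\<close> such that
  \<open>S\<^sup>-\<^sup>1 T\<^sup>h S\<close> or its negative lies in \<open>G\<close>, where \<open>T\<^sup>h\<close> is the translation by \<open>h\<close>.
  The sets \<open>{z. Im (S z) > M}\<close> are contained in \<open>\<H>\<close> for \<open>M \<ge> 0\<close> and generate the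
  neighbourhood filter of the cusp.
\<close>

definition translation_matrix :: "int \<Rightarrow> int ^ 2 ^ 2" where
  "translation_matrix h = vector [vector [1, h], vector [0, 1]]"

definition cusp_width :: "(int ^ 2 ^ 2) set \<Rightarrow> int ^ 2 ^ 2 \<Rightarrow> nat" where
  "cusp_width G S = (LEAST h. h > 0 \<and>
     (\<exists>A\<in>G. S ** A = translation_matrix (int h) ** S \<or>
            S ** A = - (translation_matrix (int h) ** S)))"

definition cusp_coord :: "(int ^ 2 ^ 2) set \<Rightarrow> int ^ 2 ^ 2 \<Rightarrow> complex \<Rightarrow> complex" where
  "cusp_coord G S z = exp (2 * of_real pi * \<i> * moebius S z / of_nat (cusp_width G S))"

definition cusp_filter :: "int ^ 2 ^ 2 \<Rightarrow> complex filter" where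
  "cusp_filter S = filtercomap (\<lambda>z. Im (moebius S z)) at_top"


text \<open>
  A meromorphic function on \<open>\<H>\<close> is represented by the unique function that takes the
  value \<open>0\<close> at poles and outside \<open>\<H>\<close> and is continuous at all other points of \<open>\<H>\<close>. Pointwise
  sums and products have to be brought back to this form.
\<close>

definition modular_functions :: "(int ^ 2 ^ 2) set \<Rightarrow> (complex \<Rightarrow> complex) set" where
  "modular_functions G = {f.
     f nicely_meromorphic_on upper_half_plane \<and>
     (\<forall>z. z \<notin> upper_half_plane \<longrightarrow> f z = 0) \<and>
     (\<forall>A\<in>G. \<forall>z\<in>upper_half_plane. f (moebius A z) = f z) \<and>
     (\<forall>S\<in>carrier SL2. \<exists>g. g meromorphic_on {0} \<and>
        (\<forall>\<^sub>F z in cusp_filter S. f z = g (cusp_coord G S z)))}"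

definition normalize_merom :: "(complex \<Rightarrow> complex) \<Rightarrow> complex \<Rightarrow> complex" where
  "normalize_merom f z = (if z \<in> upper_half_plane then remove_sings f z else 0)"

definition const_modular_function :: "complex \<Rightarrow> complex \<Rightarrow> complex" where
  "const_modular_function c z = (if z \<in> upper_half_plane then c else 0)"

definition modular_function_field :: "(int ^ 2 ^ 2) set \<Rightarrow> (complex \<Rightarrow> complex) ring" where
  "modular_function_field G =
     \<lparr>carrier = modular_functions G,
      mult = (\<lambda>f g. normalize_merom (\<lambda>z. f z * g z)),
      one = const_modular_function 1,
      zero = const_modular_function 0,
      add = (\<lambda>f g. normalize_merom (\<lambda>z. f z + g z))\<rparr>"


text \<open>
  Plane curves \<open>F(X, W) = 0\<close> over \<open>\<complex>\<close>, with \<open>F\<close> regarded as a polynomial in \<open>W\<close> whose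
  coefficients are polynomials in \<open>X\<close>. For irreducible \<open>F\<close>, the function field of the curve
  consists of the rational functions of the plane whose denominator does not vanish
  identically on the curve, modulo those whose numerator does; it is the fraction field
  of \<open>\<complex>[X, W]/(F)\<close>.
\<close>

definition curve_local_ring :: "complex poly poly \<Rightarrow> complex poly poly fract ring" where
  "curve_local_ring F =
     \<lparr>carrier = {Fract P Q | P Q. \<not> F dvd Q}, mult = (*), one = 1, zero = 0, add = (+)\<rparr>"

definition curve_vanishing_ideal :: "complex poly poly \<Rightarrow> complex poly poly fract set" where
  "curve_vanishing_ideal F = {Fract P Q | P Q. F dvd P \<and> \<not> F dvd Q}"

definition curve_function_field :: "complex poly poly \<Rightarrow> complex poly poly fract set ring" where
  "curve_function_field F = curve_local_ring F Quot curve_vanishing_ideal F"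

definition const_on_curve :: "complex poly poly \<Rightarrow> complex \<Rightarrow> complex poly poly fract set" where
  "const_on_curve F c = curve_vanishing_ideal F +>\<^bsub>curve_local_ring F\<^esub> Fract [:[:c:]:] 1"

definition is_model_of_modular_curve :: "(int ^ 2 ^ 2) set \<Rightarrow> complex poly poly \<Rightarrow> bool" where
  "is_model_of_modular_curve G F \<longleftrightarrow> irreducible F \<and>
     (\<exists>h \<in> ring_iso (curve_function_field F) (modular_function_field G).
        \<forall>c. h (const_on_curve F c) = const_modular_function c)"


text \<open>
  A differential on \<open>X(G)\<close> is given by its pullback \<open>f(z) dz\<close> to \<open>\<H>\<close>, which is \<open>G\<close>-invariant. It is
  holomorphic if at every point of \<open>X(G)\<close> it has the form \<open>g(t) dt\<close> with \<open>t\<close> the local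
  coordinate and \<open>g\<close> holomorphic near \<open>0\<close>. The genus of \<open>X(G)\<close> is the dimension of
  the complex vector space of holomorphic differentials.
\<close>

definition holomorphic_differentials :: "(int ^ 2 ^ 2) set \<Rightarrow> (complex \<Rightarrow> complex) set" where
  "holomorphic_differentials G = {f.
     (\<forall>z. z \<notin> upper_half_plane \<longrightarrow> f z = 0) \<and>
     (\<forall>A\<in>G. \<forall>z\<in>upper_half_plane. f (moebius A z) * deriv (moebius A) z = f z) \<and>
     (\<forall>z0\<in>upper_half_plane. \<exists>g. g analytic_on {0} \<and>
        (\<forall>\<^sub>F z in nhds z0. f z = g (interior_coord G z0 z) * deriv (interior_coord G z0) z)) \<and>
     (\<forall>S\<in>carrier SL2. \<exists>g. g analytic_on {0} \<and>
        (\<forall>\<^sub>F z in cusp_filter S. f z = g (cusp_coord G S z) * deriv (cusp_coord G S) z))}"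

definition modular_curve_genus :: "(int ^ 2 ^ 2) set \<Rightarrow> nat" where
  "modular_curve_genus G =
     vector_space.dim (\<lambda>(c::complex) f z. c * f z) (holomorphic_differentials G)"

end

theory Submission
  imports Defs "HOL-Real_Asymp.Real_Asymp"
begin

text \<open>
  Differences of values of the Weierstrass function at points of order 7 are forms of weight 2 for
  \<open>\<Gamma>\<^sub>1(7)\<close> without zeros in the upper half-plane. The quotient
  \<open>X = (\<wp>(3/7) - \<wp>(2/7)) / (\<wp>(1/7) - \<wp>(2/7))\<close> has a single simple pole, at a cusp, so by a Liouville argument
  every modular function for \<open>\<Gamma>\<^sub>1(7)\<close> is a rational function of \<open>X\<close>. The product \<open>\<delta>\<close> of the differences of
  the values at the points of order 2 transforms under \<open>SL\<^sub>2(\<int>)\<close> with weight 6 and the sign character,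
  whose kernel is \<open>\<Gamma>\<^sup>2\<close>. Dividing \<open>X (X - 1) \<delta>\<close> by a form of weight 6 for \<open>\<Gamma>\<^sub>1(7)\<close> and scaling gives \<open>W\<close>; its square
  is a polynomial in \<open>X\<close>, which is determined by the values of \<open>X\<close> at the cusps.

  A function \<open>f\<close> for \<open>\<Gamma>\<^sup>2 \<inter> \<Gamma>\<^sub>1(7)\<close> is the sum of an even and an odd part under \<open>z \<mapsto> z + 1\<close>. The even part
  and \<open>W\<close> times the odd part are functions for \<open>\<Gamma>\<^sub>1(7)\<close>, hence rational in \<open>X\<close>, so \<open>f\<close> is rational in \<open>X\<close> and \<open>W\<close>.
  For a holomorphic differential, divided by the form \<open>om 0 1\<close>, the even part is a polynomial in \<open>X\<close> of degree at
  most 1, and \<open>W\<close> times the odd part is a polynomial of degree at most 4 that vanishes at the five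
  values of \<open>X\<close> at the remaining cusps, hence is 0.
\<close>

text \<open>The notation for power series coefficients clashes with the one for vector components and makes
  parsing of nested matrix entries exponential.\<close>

no_notation fps_nth (infixl "$" 75)

subsection \<open>The Weierstrass function as a sum of cosecants\<close>

text \<open>The group has index 2 in \<open>\<Gamma>\<^sub>1(7)\<close>, with \<open>z + 1\<close>
  as the other coset, so the curve is a double cover of the \<open>X\<close>-line. All six cusps of
  \<open>\<Gamma>\<^sub>1(7)\<close> ramify: conjugates of odd translations have sign -1, so the
  widths 7 and 1 double to 14 and 2. The branch points are the values of \<open>X\<close> there: 0,
  infinity and 1 where the lower left entry is \<plusminus>1, \<plusminus>2, \<plusminus>3 modulo 7,
  and the three roots of the cubic, real numbers in the field of \<open>2 cos (2 \<pi> / 7)\<close>,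
  where it is 0.

  Zeros are never counted by a valence formula. That differences of Weierstrass values have no zeros
  comes from the theta quotient for \<open>\<wp>(u) - \<wp>(v)\<close>; their orders at cusps come
  from the cosecant expansion, and all other orders are sums of these. Poles at the cusp of
  \<open>g0\<close> are removed one step at a time by subtracting powers of \<open>X\<close>, until
  the maximum principle applies to the product over all translates under
  \<open>SL\<^sub>2(\<int>)\<close>.

  The genus is a dimension, so holomorphy of two differentials is shown as well as an upper
  bound.\<close>

definition csc_sq :: "complex \<Rightarrow> complex" where
  "csc_sq u = inverse (sin (of_real pi * u) ^ 2)"

definition ee :: "complex \<Rightarrow> complex" where
  "ee z = exp (2 * of_real pi * \<i> * z)"

lemma ee_add: "ee (x + y) = ee x * ee y"
  by (simp add: ee_def exp_add algebra_simps)

lemma ee_minus: "ee (- x) = inverse (ee x)"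
  by (simp add: ee_def exp_minus)

lemma ee_diff: "ee (x - y) = ee x / ee y"
  by (simp add: ee_def exp_diff algebra_simps)

lemma ee_nonzero [simp]: "ee x \<noteq> 0"
  by (simp add: ee_def)

lemma ee_of_int [simp]: "ee (of_int n) = 1"
  unfolding ee_def by (rule exp_integer_2pi[THEN trans[rotated]]) (auto simp: mult_ac)

lemma norm_ee: "norm (ee z) = exp (- 2 * pi * Im z)"
  by (simp add: ee_def norm_exp_eq_Re)

lemma ee_holomorphic [holomorphic_intros]:
  "f holomorphic_on A \<Longrightarrow> (\<lambda>z. ee (f z)) holomorphic_on A"
  unfolding ee_def by (intro holomorphic_intros)

lemma ee_eq_1_iff: "ee z = 1 \<longleftrightarrow> z \<in> \<int>"
proof
  assume "ee z = 1"
  then obtain n :: int where "Im (2 * pi * \<i> * z) = of_int (2 * n) * pi" "Re (2 * pi * \<i> * z) = 0"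
    unfolding ee_def exp_eq_1 by auto
  then have "z = of_int n" by (auto simp: complex_eq_iff)
  then show "z \<in> \<int>" by auto
next
  assume "z \<in> \<int>" then show "ee z = 1" by (auto elim: Ints_cases)
qed

text \<open>In \<open>w = ee u\<close> the squared cosecant is the rational function
  \<open>- 4 w / (1 - w)^2\<close>. Its decay in the imaginary direction, the orders in
  \<open>q\<close> and the values at points of order 7 are all read off from this form.\<close>

lemma csc_sq_ee: "csc_sq u = - 4 * ee u / (1 - ee u)\<^sup>2"
proof -
  define w where "w = exp (\<i> * (of_real pi * u))"
  have w0: "w \<noteq> 0" by (simp add: w_def)
  have ew: "ee u = w ^ 2" by (simp add: ee_def w_def power2_eq_square flip: exp_add) (simp add: mult_ac)
  have s: "sin (of_real pi * u) = - \<i> / 2 * (w - inverse w)"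
    unfolding sin_exp_eq w_def exp_minus by (simp add: field_simps)
  have "sin (of_real pi * u) ^ 2 = - (1 - w\<^sup>2)\<^sup>2 / (4 * w\<^sup>2)"
    unfolding s using w0 by (simp add: field_simps power2_eq_square)
  then show ?thesis unfolding csc_sq_def ew by simp
qed

lemma csc_sq_minus [simp]: "csc_sq (- u) = csc_sq u"
  by (simp add: csc_sq_def)

lemma csc_sq_plus_of_int [simp]: "csc_sq (u + of_int n) = csc_sq u"
  by (simp add: csc_sq_ee ee_add)

text \<open>Evenness reduces to \<open>Im u \<ge> 1\<close>. There \<open>ee u\<close> has norm at
  most 1/2, so the denominator of the rational form has norm at least 1/4, and 4 divided by 1/4 is
  the constant 16.\<close>

lemma norm_csc_sq_le:
  assumes "\<bar>Im u\<bar> \<ge> 1"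
  shows "norm (csc_sq u) \<le> 16 * exp (- 2 * pi * \<bar>Im u\<bar>)"
proof -
  have *: "norm (csc_sq u) \<le> 16 * exp (- 2 * pi * Im u)" if "Im u \<ge> 1" for u
  proof -
    have pi3: "pi > 3" by (rule pi_gt3)
    have "norm (ee u) \<le> exp (-1)"
      unfolding norm_ee using that pi3 mult_mono[of 1 pi 1 "Im u"] by simp
    also have "\<dots> \<le> 1/2"
      using exp_ge_add_one_self[of 1] by (simp add: exp_minus divide_simps)
    finally have le: "norm (ee u) \<le> 1/2" .
    have "norm (1 - ee u) \<ge> 1/2" using norm_triangle_ineq2[of 1 "ee u"] le by simp
    then have "norm ((1 - ee u)\<^sup>2) \<ge> (1/2)\<^sup>2" unfolding norm_power by (intro power_mono) auto
    then have "norm (csc_sq u) \<le> 4 * norm (ee u) / (1/2)\<^sup>2"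
      unfolding csc_sq_ee norm_divide norm_mult by (intro divide_mono) auto
    then show ?thesis by (simp add: norm_ee power2_eq_square)
  qed
  show ?thesis
    using *[of u] *[of "- u"] assms by (cases "Im u \<ge> 0") auto
qed

text \<open>Euler's reflection formula: its logarithmic derivative expresses
  \<open>Digamma z - Digamma (1 - z)\<close> by the cotangent, and differentiating again gives the
  squared cosecant. The two values of \<open>Polygamma 1\<close> that arise are the sums over
  \<open>n \<ge> 0\<close> and over \<open>n < 0\<close>.\<close>

lemma csc_sq_partial_fractions:
  assumes u: "u \<notin> \<int>"
  shows "((\<lambda>n::int. 1 / (u + of_int n)\<^sup>2) has_sum (of_real pi)\<^sup>2 * csc_sq u) UNIV"
proof -
  have nonpos: "z \<notin> \<int>\<^sub>\<le>\<^sub>0" "1 - z \<notin> \<int>\<^sub>\<le>\<^sub>0" "sin (of_real pi * z) \<noteq> 0" if z: "z \<notin> \<int>" for z :: complex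
  proof -
    show "z \<notin> \<int>\<^sub>\<le>\<^sub>0" using z nonpos_Ints_Int by blast
    show "1 - z \<notin> \<int>\<^sub>\<le>\<^sub>0"
    proof
      assume "1 - z \<in> \<int>\<^sub>\<le>\<^sub>0"
      then have "1 - (1 - z) \<in> \<int>" using nonpos_Ints_Int by (intro Ints_diff) auto
      with z show False by simp
    qed
    show "sin (of_real pi * z) \<noteq> 0" using z by (auto simp: sin_eq_0)
  qed
  have dig: "Digamma z - Digamma (1 - z) = - of_real pi * cos (of_real pi * z) / sin (of_real pi * z)"
    if z: "z \<notin> \<int>" for z :: complex
  proof -
    note np = nonpos[OF z]
    have "((\<lambda>z. Gamma z * Gamma (1 - z)) has_field_derivative
        Gamma z * Digamma z * Gamma (1 - z) - Gamma z * (Gamma (1 - z) * Digamma (1 - z))) (at z)"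
      using np by (auto intro!: derivative_eq_intros simp: algebra_simps)
    moreover have "((\<lambda>z. Gamma z * Gamma (1 - z)) has_field_derivative
        - of_real pi * (cos (of_real pi * z) * of_real pi) / (sin (of_real pi * z))\<^sup>2) (at z)"
      unfolding Gamma_reflection_complex
      using np by (auto intro!: derivative_eq_intros simp: power2_eq_square)
    ultimately have "Gamma z * Gamma (1 - z) * (Digamma z - Digamma (1 - z)) =
        - of_real pi * (cos (of_real pi * z) * of_real pi) / (sin (of_real pi * z))\<^sup>2"
      using DERIV_unique by (fastforce simp: algebra_simps)
    note eq = this[unfolded Gamma_reflection_complex]
    have gen: "A = - p * c / s" if "p / s * A = - p * (c * p) / s\<^sup>2" "s \<noteq> 0" "p \<noteq> 0" for A p c s :: complex
    proof -
      have "A = (p / s * A) * (s / p)" using that(2,3) by simp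
      also have "\<dots> = - p * c / s" unfolding that(1) using that(2,3) by (simp add: power2_eq_square)
      finally show ?thesis .
    qed
    show ?thesis by (rule gen[OF eq]) (use np in auto)
  qed
  note np = nonpos[OF u]
  have opn: "open (- \<int> :: complex set)" using closed_Ints by auto
  have "((\<lambda>z. Digamma z - Digamma (1 - z)) has_field_derivative
      Polygamma 1 u + Polygamma 1 (1 - u)) (at u)"
    using np by (auto intro!: derivative_eq_intros)
  moreover have "((\<lambda>z. Digamma z - Digamma (1 - z)) has_field_derivative
      (of_real pi)\<^sup>2 * csc_sq u) (at u)"
  proof (rule has_field_derivative_transform_within_open[OF _ opn])
    let ?s = "sin (complex_of_real pi * u)" and ?c = "cos (complex_of_real pi * u)"
    have gen: "(- p * (- s * p)) * s - (- p * c) * (c * p) = p\<^sup>2 * (s\<^sup>2 + c\<^sup>2)" for p s c :: complex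
      by (simp add: power2_eq_square algebra_simps)
    have "((\<lambda>z. - of_real pi * cos (of_real pi * z) / sin (of_real pi * z)) has_field_derivative
      ((- of_real pi * (- ?s * of_real pi)) * ?s - (- of_real pi * ?c) * (?c * of_real pi)) / (?s * ?s)) (at u)"
      using np by (intro DERIV_divide) (auto intro!: derivative_eq_intros)
    also have "((- of_real pi * (- ?s * of_real pi)) * ?s - (- of_real pi * ?c) * (?c * of_real pi)) =
        (of_real pi)\<^sup>2 * (?s\<^sup>2 + ?c\<^sup>2)" by (rule gen)
    also have "\<dots> = (of_real pi)\<^sup>2" by (simp only: sin_cos_squared_add mult_1_right)
    finally show "((\<lambda>z. - of_real pi * cos (of_real pi * z) / sin (of_real pi * z)) has_field_derivative
      (of_real pi)\<^sup>2 * csc_sq u) (at u)"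
      unfolding csc_sq_def by (simp add: divide_inverse power2_eq_square)
  qed (use u dig in auto)
  ultimately have PG: "Polygamma 1 u + Polygamma 1 (1 - u) = (of_real pi)\<^sup>2 * csc_sq u"
    by (rule DERIV_unique)
  have hs: "((\<lambda>k. inverse ((z + of_nat k)\<^sup>2)) has_sum Polygamma 1 z) (UNIV::nat set)"
    if z: "z \<notin> \<int>\<^sub>\<le>\<^sub>0" for z :: complex
  proof (rule norm_summable_imp_has_sum)
    have z0: "z \<noteq> 0" using z by auto
    from Polygamma_converges'[of z 2] z0 show "(\<lambda>k. inverse ((z + of_nat k)\<^sup>2)) sums Polygamma 1 z"
      by (simp add: Polygamma_def numeral_2_eq_2 summable_sums)
    show "summable (\<lambda>n. norm (inverse ((z + of_nat n)\<^sup>2)))"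
    proof (rule summable_comparison_test_ev)
      have "\<forall>\<^sub>F n in sequentially. real n \<ge> 2 * norm z + 1"
        by real_asymp
      then show "\<forall>\<^sub>F n in sequentially. norm (norm (inverse ((z + of_nat n)\<^sup>2))) \<le> 4 / (of_nat n ^ 2)"
      proof eventually_elim
        case (elim n)
        have "norm (z + of_nat n) \<ge> real n / 2"
          using norm_triangle_ineq2[of "of_nat n" "- z"] elim by (simp add: add.commute)
        then have "(real n / 2)\<^sup>2 \<le> norm (z + of_nat n) ^ 2" by (intro power_mono) auto
        moreover have "real n > 0" using elim norm_ge_zero[of z] by linarith
        then have "(real n / 2)\<^sup>2 > 0" by simp
        ultimately show ?case
          using le_imp_inverse_le[of "(real n / 2)\<^sup>2" "norm (z + of_nat n) ^ 2"]
          by (simp add: norm_inverse norm_power power_divide)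
      qed
      show "summable (\<lambda>n. 4 / (real n ^ 2))"
        unfolding divide_inverse by (intro summable_mult inverse_power_summable) auto
    qed
  qed
  have A: "((\<lambda>n::int. 1 / (u + of_int n)\<^sup>2) has_sum Polygamma 1 u) (range int)"
    using hs[OF np(1)] by (subst has_sum_reindex) (auto simp: o_def field_simps)
  \<comment> \<open>With \<open>n = - 1 - k\<close> one has \<open>u + n = - (1 - u + k)\<close>, so
    the squares are those of the series at \<open>1 - u\<close>.\<close>
  have inj: "inj (\<lambda>k. - 1 - int k)" by (auto simp: inj_on_def)
  have B: "((\<lambda>n::int. 1 / (u + of_int n)\<^sup>2) has_sum Polygamma 1 (1 - u)) (range (\<lambda>k. - 1 - int k))"
  proof (subst has_sum_reindex[OF inj])
    have "(u + of_int (- 1 - int k))\<^sup>2 = (1 - u + of_nat k)\<^sup>2" for k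
      by (simp add: power2_eq_square algebra_simps)
    then show "((\<lambda>n::int. 1 / (u + of_int n)\<^sup>2) \<circ> (\<lambda>k. - 1 - int k) has_sum Polygamma 1 (1 - u)) UNIV"
      using hs[OF np(2)] by (simp add: o_def field_simps)
  qed
  have "range int \<union> range (\<lambda>k. - 1 - int k) = UNIV"
  proof -
    have "n \<in> range int \<union> range (\<lambda>k. - 1 - int k)" for n
      by (cases "n \<ge> 0") (auto simp: image_iff intro: exI[of _ "nat n"] exI[of _ "nat (- 1 - n)"])
    then show ?thesis by blast
  qed
  moreover have "range int \<inter> range (\<lambda>k. - 1 - int k) = {}" by auto
  ultimately show ?thesis using has_sum_Un_disjoint[OF A B] PG by simp
qed

section \<open>Convergence, periodicity and holomorphy of the Weierstrass sum\<close>

definition period_lattice :: "complex \<Rightarrow> complex set" where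
  "period_lattice \<tau> = {of_int m * \<tau> + of_int n |m n. True}"

text \<open>Up to the factor \<open>\<pi>\<^sup>2\<close> and an additive term depending on \<open>\<tau>\<close> only, this is the Weierstrass
  function of the lattice \<open>\<int>\<tau> + \<int>\<close>; differences of its values therefore have weight 2.\<close>

definition wp :: "complex \<Rightarrow> complex \<Rightarrow> complex" where
  "wp \<tau> u = (\<Sum>\<^sub>\<infinity>n::int. csc_sq (u + of_int n * \<tau>))"

lemma summable_on_power_nat_abs:
  fixes r :: real
  assumes "0 \<le> r" "r < 1"
  shows "(\<lambda>n::int. r ^ nat \<bar>n\<bar>) summable_on UNIV"
proof -
  have geo: "(\<lambda>k::nat. r ^ k) summable_on UNIV"
    using assms by (intro norm_summable_imp_summable_on) (auto simp: summable_geometric)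
  have A: "(\<lambda>n::int. r ^ nat \<bar>n\<bar>) summable_on (range int)"
    using geo by (subst summable_on_reindex) (auto simp: o_def)
  have B: "(\<lambda>n::int. r ^ nat \<bar>n\<bar>) summable_on (range (\<lambda>k. - int k))"
    using geo by (subst summable_on_reindex) (auto simp: o_def inj_on_def)
  have "n \<in> range int \<union> range (\<lambda>k. - int k)" for n
    by (cases "n \<ge> 0") (auto simp: image_iff intro: exI[of _ "nat n"] exI[of _ "nat (- n)"])
  then have "range int \<union> range (\<lambda>k. - int k) = UNIV" by blast
  with summable_on_union[OF A B] show ?thesis by simp
qed

text \<open>The majorant depends on \<open>u\<close> and \<open>\<tau>\<close> only through the
  bounds \<open>B\<close> and \<open>\<eta>\<close>, so it serves a Weierstrass M-test in which both
  vary. The condition on \<open>n\<close> keeps the imaginary part of the argument at distance at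
  least 1 from 0.\<close>

lemma norm_csc_sq_term_le:
  assumes "\<bar>Im u\<bar> \<le> B" "\<eta> > 0" "Im \<tau> \<ge> \<eta>" "of_int \<bar>n\<bar> * \<eta> \<ge> B + 1"
  shows "norm (csc_sq (u + of_int n * \<tau>)) \<le> 16 * exp (2 * pi * B) * exp (- 2 * pi * \<eta>) ^ nat \<bar>n\<bar>"
proof -
  have "\<bar>of_int n * Im \<tau>\<bar> = of_int \<bar>n\<bar> * Im \<tau>" using assms by (simp add: abs_mult)
  moreover have "of_int \<bar>n\<bar> * Im \<tau> \<ge> of_int \<bar>n\<bar> * \<eta>" using assms by (intro mult_left_mono) auto
  ultimately have im: "\<bar>Im (u + of_int n * \<tau>)\<bar> \<ge> of_int \<bar>n\<bar> * \<eta> - B" using assms(1) by simp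
  then have "norm (csc_sq (u + of_int n * \<tau>)) \<le> 16 * exp (- 2 * pi * \<bar>Im (u + of_int n * \<tau>)\<bar>)"
    using assms(4) by (intro norm_csc_sq_le) linarith
  also have "\<dots> \<le> 16 * exp (- 2 * pi * (of_int \<bar>n\<bar> * \<eta> - B))"
    using im by simp
  also have "- 2 * pi * (of_int \<bar>n\<bar> * \<eta> - B) = 2 * pi * B + of_nat (nat \<bar>n\<bar>) * (- 2 * pi * \<eta>)"
    by (simp add: algebra_simps)
  also have "16 * exp \<dots> = 16 * exp (2 * pi * B) * exp (- 2 * pi * \<eta>) ^ nat \<bar>n\<bar>"
    unfolding exp_add exp_of_nat_mult by simp
  finally show ?thesis .
qed

lemma wp_abs_summable:
  assumes "Im \<tau> > 0"
  shows "(\<lambda>n. norm (csc_sq (u + of_int n * \<tau>))) summable_on (UNIV :: int set)"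
proof -
  define N where "N = nat \<lceil>(\<bar>Im u\<bar> + 1) / Im \<tau>\<rceil>"
  define F where "F = {- int N..int N}"
  have "(\<lambda>n. norm (csc_sq (u + of_int n * \<tau>))) summable_on (- F)"
  proof (rule Infinite_Sum.abs_summable_on_comparison_test')
    show "(\<lambda>n. 16 * exp (2 * pi * \<bar>Im u\<bar>) * exp (- 2 * pi * Im \<tau>) ^ nat \<bar>n\<bar>) summable_on (- F)"
      by (rule summable_on_subset_banach[OF summable_on_cmult_right[OF summable_on_power_nat_abs]])
        (use assms in auto)
    fix n assume "n \<in> - F"
    then have "\<bar>n\<bar> \<ge> int N" by (auto simp: F_def)
    then have "of_int \<bar>n\<bar> \<ge> (\<bar>Im u\<bar> + 1) / Im \<tau>" unfolding N_def by linarith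
    then show "norm (csc_sq (u + of_int n * \<tau>)) \<le> 16 * exp (2 * pi * \<bar>Im u\<bar>) * exp (- 2 * pi * Im \<tau>) ^ nat \<bar>n\<bar>"
      using assms by (intro norm_csc_sq_term_le) (auto simp: field_simps)
  qed
  moreover have "(\<lambda>n. norm (csc_sq (u + of_int n * \<tau>))) summable_on F"
    by (intro summable_on_finite) (auto simp: F_def)
  ultimately show ?thesis using summable_on_union by (metis Compl_partition)
qed

lemma wp_summable:
  assumes "Im \<tau> > 0"
  shows "(\<lambda>n. csc_sq (u + of_int n * \<tau>)) summable_on (UNIV :: int set)"
  using wp_abs_summable[OF assms] by (rule abs_summable_summable)

lemma wp_minus: "wp \<tau> (- u) = wp \<tau> u"
proof -
  have "wp \<tau> (- u) = (\<Sum>\<^sub>\<infinity>n::int. csc_sq (- u + of_int (- n) * \<tau>))"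
    unfolding wp_def
    by (rule infsum_reindex_bij_betw[symmetric, where g = uminus]) (auto intro!: bij_betwI[of _ _ _ uminus])
  also have "\<dots> = (\<Sum>\<^sub>\<infinity>n::int. csc_sq (- (u + of_int n * \<tau>)))" by simp
  finally show ?thesis by (simp only: csc_sq_minus wp_def)
qed

lemma wp_plus_lattice:
  assumes "l \<in> period_lattice \<tau>"
  shows "wp \<tau> (u + l) = wp \<tau> u"
proof -
  obtain m n where l: "l = of_int m * \<tau> + of_int n" using assms by (auto simp: period_lattice_def)
  have "wp \<tau> u = (\<Sum>\<^sub>\<infinity>k::int. csc_sq (u + of_int (m + k) * \<tau>))"
    unfolding wp_def
    by (rule infsum_reindex_bij_betw[symmetric, where g = "\<lambda>k. m + k"])
       (auto intro!: bij_betwI[of _ _ _ "\<lambda>k. k - m"])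
  also have "\<dots> = (\<Sum>\<^sub>\<infinity>k::int. csc_sq (u + of_int (m + k) * \<tau> + of_int n))" by simp
  also have "\<dots> = wp \<tau> (u + l)"
    unfolding wp_def l by (simp add: algebra_simps)
  finally show ?thesis by simp
qed

text \<open>Locally all but finitely many terms are dominated by a geometric series. The index set
  is arbitrary because two cases occur: all integers for \<open>wp\<close> itself, and the nonzero
  integers for the part of \<open>wp\<close> that is regular at 0.\<close>

lemma csc_sq_sum_holomorphic:
  fixes I :: "int set"
  assumes "open A" and u: "u holomorphic_on A" and t: "t holomorphic_on A"
    and tpos: "\<And>z. z \<in> A \<Longrightarrow> Im (t z) > 0"
    and ul: "\<And>z n. z \<in> A \<Longrightarrow> n \<in> I \<Longrightarrow> u z + of_int n * t z \<notin> \<int>"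
  shows "(\<lambda>z. \<Sum>\<^sub>\<infinity>n\<in>I. csc_sq (u z + of_int n * t z)) holomorphic_on A"
proof -
  let ?S = "\<lambda>z. \<Sum>\<^sub>\<infinity>n\<in>I. csc_sq (u z + of_int n * t z)"
  have hol: "(\<lambda>z. \<Sum>n\<in>X. csc_sq (u z + of_int n * t z)) holomorphic_on A" if "X \<subseteq> I" for X
  proof (intro holomorphic_on_sum)
    fix n assume n: "n \<in> X"
    have "sin (of_real pi * (u z + of_int n * t z)) \<noteq> 0" if z: "z \<in> A" for z
      using ul[OF z, of n] n \<open>X \<subseteq> I\<close> by (auto simp: sin_eq_0)
    then show "(\<lambda>z. csc_sq (u z + of_int n * t z)) holomorphic_on A"
      unfolding csc_sq_def using u t by (intro holomorphic_intros) auto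
  qed
  have loc: "\<exists>r>0. ?S holomorphic_on ball z0 r" if z0: "z0 \<in> A" for z0
  proof -
    obtain r where r: "r > 0" "cball z0 r \<subseteq> A" using \<open>open A\<close> z0 open_contains_cball by blast
    have cu: "continuous_on (cball z0 r) u" and ct: "continuous_on (cball z0 r) t"
      using u t r holomorphic_on_imp_continuous_on holomorphic_on_subset by blast+
    have ne: "cball z0 r \<noteq> {}" using r by auto
    \<comment> \<open>Compactness provides the constants of \<open>norm_csc_sq_term_le\<close>, so
      one finite set \<open>F\<close> of exceptional terms serves the whole disc.\<close>
    obtain x1 where x1: "x1 \<in> cball z0 r" "\<And>z. z \<in> cball z0 r \<Longrightarrow> \<bar>Im (u z)\<bar> \<le> \<bar>Im (u x1)\<bar>"
      using continuous_attains_sup[OF compact_cball ne continuous_on_rabs[OF continuous_on_Im[OF cu]]]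
      by blast
    obtain x2 where x2: "x2 \<in> cball z0 r" "\<And>z. z \<in> cball z0 r \<Longrightarrow> Im (t x2) \<le> Im (t z)"
      using continuous_attains_inf[OF compact_cball ne continuous_on_Im[OF ct]] by blast
    define B where "B = \<bar>Im (u x1)\<bar>"
    define \<eta> where "\<eta> = Im (t x2)"
    have \<eta>: "\<eta> > 0" using tpos x2 r by (auto simp: \<eta>_def)
    define N where "N = nat \<lceil>(B + 1) / \<eta>\<rceil>"
    define F where "F = I \<inter> {- int N..int N}"
    have rest: "(\<lambda>z. \<Sum>\<^sub>\<infinity>n\<in>I-F. csc_sq (u z + of_int n * t z)) holomorphic_on ball z0 r"
    proof (rule holomorphic_uniform_limit[THEN conjunct2])
      show "uniform_limit (cball z0 r) (\<lambda>X z. \<Sum>n\<in>X. csc_sq (u z + of_int n * t z))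
          (\<lambda>z. \<Sum>\<^sub>\<infinity>n\<in>I-F. csc_sq (u z + of_int n * t z)) (finite_subsets_at_top (I - F))"
      proof (rule Weierstrass_m_test_general)
        fix n z assume n: "n \<in> I - F" and z: "z \<in> cball z0 r"
        from n have "\<bar>n\<bar> \<ge> int N" by (auto simp: F_def)
        then have "of_int \<bar>n\<bar> \<ge> (B + 1) / \<eta>" unfolding N_def by linarith
        then show "norm (csc_sq (u z + of_int n * t z)) \<le> 16 * exp (2 * pi * B) * exp (- 2 * pi * \<eta>) ^ nat \<bar>n\<bar>"
          using \<eta> x1(2)[OF z] x2(2)[OF z]
          by (intro norm_csc_sq_term_le) (auto simp: field_simps B_def \<eta>_def)
      next
        show "(\<lambda>n. 16 * exp (2 * pi * B) * exp (- 2 * pi * \<eta>) ^ nat \<bar>n\<bar>) summable_on (I - F)"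
          by (rule summable_on_subset_banach[OF summable_on_cmult_right[OF summable_on_power_nat_abs]])
            (use \<eta> in auto)
      qed
      have "\<forall>\<^sub>F X in finite_subsets_at_top (I - F). X \<subseteq> I"
        by (subst eventually_finite_subsets_at_top) auto
      then show "\<forall>\<^sub>F X in finite_subsets_at_top (I - F). continuous_on (cball z0 r) (\<lambda>z. \<Sum>n\<in>X. csc_sq (u z + of_int n * t z))
          \<and> (\<lambda>z. \<Sum>n\<in>X. csc_sq (u z + of_int n * t z)) holomorphic_on ball z0 r"
      proof eventually_elim
        case (elim X)
        show ?case using hol[OF elim] r ball_subset_cball[of z0 r]
          by (meson holomorphic_on_imp_continuous_on holomorphic_on_subset subset_trans)
      qed
    qed auto
    have fin: "(\<lambda>z. \<Sum>n\<in>F. csc_sq (u z + of_int n * t z)) holomorphic_on ball z0 r"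
      using hol[of F] holomorphic_on_subset r ball_subset_cball unfolding F_def by blast
    have "?S z = (\<Sum>n\<in>F. csc_sq (u z + of_int n * t z)) + (\<Sum>\<^sub>\<infinity>n\<in>I-F. csc_sq (u z + of_int n * t z))"
      if "z \<in> ball z0 r" for z
    proof -
      have "Im (t z) > 0" using that r tpos ball_subset_cball by blast
      note sm = wp_summable[OF this, of "u z"]
      have "F \<union> (I - F) = I" by (auto simp: F_def)
      then have "?S z = infsum (\<lambda>n. csc_sq (u z + of_int n * t z)) (F \<union> (I - F))" by simp
      also have "\<dots> = infsum (\<lambda>n. csc_sq (u z + of_int n * t z)) F + (\<Sum>\<^sub>\<infinity>n\<in>I-F. csc_sq (u z + of_int n * t z))"
        by (intro infsum_Un_disjoint summable_on_subset_banach[OF sm]) auto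
      finally show ?thesis by (simp add: F_def)
    qed
    then have "?S holomorphic_on ball z0 r"
      using holomorphic_on_add[OF fin rest] by (subst holomorphic_cong[OF refl]) auto
    with r show ?thesis by blast
  qed
  show ?thesis
    unfolding holomorphic_on_open[OF \<open>open A\<close>]
  proof
    fix z assume "z \<in> A"
    then obtain r where "r > 0" "?S holomorphic_on ball z r" using loc by blast
    then show "\<exists>f'. (?S has_field_derivative f') (at z)"
      using holomorphic_on_open[OF open_ball] by auto
  qed
qed

lemma not_lattice_imp_not_Ints:
  assumes "u \<notin> period_lattice \<tau>"
  shows "u + of_int n * \<tau> \<notin> \<int>"
proof
  assume "u + of_int n * \<tau> \<in> \<int>"
  then obtain k where "u + of_int n * \<tau> = of_int k" by (elim Ints_cases)
  then have "u = of_int (- n) * \<tau> + of_int k" by (simp add: algebra_simps)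
  with assms show False unfolding period_lattice_def by blast
qed

lemma wp_holomorphic:
  assumes "open A" "u holomorphic_on A" "t holomorphic_on A"
    and "\<And>z. z \<in> A \<Longrightarrow> Im (t z) > 0" "\<And>z. z \<in> A \<Longrightarrow> u z \<notin> period_lattice (t z)"
  shows "(\<lambda>z. wp (t z) (u z)) holomorphic_on A"
  unfolding wp_def by (rule csc_sq_sum_holomorphic) (use assms not_lattice_imp_not_Ints in auto)

text \<open>For \<open>u\<close> in this strip only the rows \<open>n = 0\<close> and
  \<open>n = -1\<close> can be large. The other rows form two tails, each bounded by
  \<open>16 * (r / (1 - r)) \<le> 32 * r\<close>, since \<open>r\<close> is at most 1/2; together
  they give 64.\<close>

lemma wp_approx:
  assumes "Im \<tau> \<ge> 1" "0 \<le> Im u" "Im u < Im \<tau>"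
  shows "norm (wp \<tau> u - csc_sq u - csc_sq (u - \<tau>)) \<le> 64 * exp (- 2 * pi * Im \<tau>)"
proof -
  define f where "f = (\<lambda>n::int. csc_sq (u + of_int n * \<tau>))"
  define r where "r = exp (- 2 * pi * Im \<tau>)"
  have "r \<le> exp (-1)"
    unfolding r_def using assms(1) pi_gt3 mult_mono[of 1 pi 1 "Im \<tau>"] by simp
  also have "\<dots> \<le> 1/2"
    using exp_ge_add_one_self[of 1] by (simp add: exp_minus divide_simps)
  finally have r: "0 < r" "r \<le> 1/2" by (auto simp: r_def)
  have pos: "Im \<tau> > 0" using assms by simp
  note sm = wp_abs_summable[OF pos, of u, folded f_def]
  have smf: "f summable_on S" for S
    using summable_on_subset_banach[OF abs_summable_summable[of f UNIV]] wp_abs_summable[OF pos, of u]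
    unfolding f_def by blast
  define A where "A = range (\<lambda>k. int (Suc k))"
  define B where "B = range (\<lambda>k. - 2 - int k)"
  have "n \<in> {0,-1} \<union> (A \<union> B)" for n
  proof -
    consider "n \<ge> 1" | "n = 0" | "n = -1" | "n \<le> -2" by linarith
    then show ?thesis
    proof cases
      case 1 then show ?thesis by (auto simp: A_def image_iff intro: exI[of _ "nat (n - 1)"])
    next
      case 4 then show ?thesis by (auto simp: B_def image_iff intro: exI[of _ "nat (- 2 - n)"])
    qed auto
  qed
  then have U: "UNIV = {0,-1} \<union> (A \<union> B)" by blast
  have AB: "A \<inter> B = {}" and D: "{0,-1} \<inter> (A \<union> B) = {}" by (auto simp: A_def B_def)
  have geo: "((\<lambda>k::nat. 16 * r ^ Suc k) has_sum 16 * (r / (1 - r))) UNIV"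
  proof (rule norm_summable_imp_has_sum)
    have "(\<lambda>k. 16 * r * r ^ k) sums (16 * r * (1 / (1 - r)))" using r by (intro sums_mult geometric_sums) auto
    then show s: "(\<lambda>k. 16 * r ^ Suc k) sums (16 * (r / (1 - r)))" by (simp add: mult_ac)
    then show "summable (\<lambda>n. norm (16 * r ^ Suc n))" using r by (simp add: sums_iff)
  qed
  have bound: "norm (infsum f (range g)) \<le> 32 * r"
    if g: "inj g" "\<And>k. norm (f (g k)) \<le> 16 * r ^ Suc k" for g :: "nat \<Rightarrow> int"
  proof -
    have eq: "infsum f (range g) = infsum (f \<circ> g) UNIV" using g(1) by (rule infsum_reindex)
    have abs: "(\<lambda>k. norm ((f \<circ> g) k)) summable_on UNIV"
      by (rule Infinite_Sum.abs_summable_on_comparison_test'[OF has_sum_imp_summable[OF geo]]) (use g in auto)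
    have "norm (infsum (f \<circ> g) UNIV) \<le> infsum (\<lambda>k. norm ((f \<circ> g) k)) UNIV"
      by (rule norm_infsum_bound[OF abs])
    also have "\<dots> \<le> infsum (\<lambda>k. 16 * r ^ Suc k) UNIV"
      by (rule infsum_mono[OF abs has_sum_imp_summable[OF geo]]) (use g in auto)
    also have "\<dots> = 16 * (r / (1 - r))" using geo by (rule infsumI)
    also have "\<dots> \<le> 32 * r" using r by (simp add: field_simps)
    finally show ?thesis unfolding eq .
  qed
  have b1: "norm (infsum f A) \<le> 32 * r"
    unfolding A_def
  proof (rule bound)
    fix k
    have im: "Im (u + of_int (int (Suc k)) * \<tau>) \<ge> real (Suc k) * Im \<tau>"
      using assms by simp
    have ge1: "real (Suc k) * Im \<tau> \<ge> 1" using assms mult_mono[of 1 "real (Suc k)" 1 "Im \<tau>"] by simp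
    have "norm (f (int (Suc k))) \<le> 16 * exp (- 2 * pi * \<bar>Im (u + of_int (int (Suc k)) * \<tau>)\<bar>)"
      unfolding f_def by (rule norm_csc_sq_le) (use im ge1 in linarith)
    also have "\<dots> \<le> 16 * exp (- 2 * pi * (real (Suc k) * Im \<tau>))"
      using im by simp
    also have "- 2 * pi * (real (Suc k) * Im \<tau>) = of_nat (Suc k) * (- 2 * pi * Im \<tau>)" by simp
    finally show "norm (f (int (Suc k))) \<le> 16 * r ^ Suc k" unfolding exp_of_nat_mult r_def .
  qed (auto simp: inj_on_def)
  have b2: "norm (infsum f B) \<le> 32 * r"
    unfolding B_def
  proof (rule bound)
    fix k
    have im: "\<bar>Im (u + of_int (- 2 - int k) * \<tau>)\<bar> \<ge> real (Suc k) * Im \<tau>"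
      using assms by (simp add: algebra_simps)
    have ge1: "real (Suc k) * Im \<tau> \<ge> 1" using assms mult_mono[of 1 "real (Suc k)" 1 "Im \<tau>"] by simp
    have "norm (f (- 2 - int k)) \<le> 16 * exp (- 2 * pi * \<bar>Im (u + of_int (- 2 - int k) * \<tau>)\<bar>)"
      unfolding f_def by (rule norm_csc_sq_le) (use im ge1 in linarith)
    also have "\<dots> \<le> 16 * exp (- 2 * pi * (real (Suc k) * Im \<tau>))"
      using im by simp
    also have "- 2 * pi * (real (Suc k) * Im \<tau>) = of_nat (Suc k) * (- 2 * pi * Im \<tau>)" by simp
    finally show "norm (f (- 2 - int k)) \<le> 16 * r ^ Suc k" unfolding exp_of_nat_mult r_def .
  qed (auto simp: inj_on_def)
  have "wp \<tau> u = infsum f ({0,-1} \<union> (A \<union> B))" unfolding U[symmetric] by (simp add: wp_def f_def)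
  also have "\<dots> = infsum f {0,-1} + (infsum f A + infsum f B)"
    using AB D smf by (simp only: infsum_Un_disjoint)
  also have "infsum f {0,-1} = csc_sq u + csc_sq (u - \<tau>)" by (simp add: f_def)
  finally have "wp \<tau> u - csc_sq u - csc_sq (u - \<tau>) = infsum f A + infsum f B" by simp
  then show ?thesis using b1 b2 norm_triangle_ineq[of "infsum f A" "infsum f B"] by (simp add: r_def)
qed

subsection \<open>Modular transformation of Weierstrass differences\<close>

lemma infsum_minus:
  fixes f g :: "'a \<Rightarrow> complex"
  assumes "f summable_on A" "g summable_on A"
  shows "(\<Sum>\<^sub>\<infinity>x\<in>A. f x - g x) = infsum f A - infsum g A"
  using infsum_add[of f A "\<lambda>x. - g x"] assms by (simp add: infsum_uminus summable_on_uminus)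

lemma not_Ints_imp_bounded_away:
  fixes x :: real
  assumes "x \<notin> \<int>"
  shows "\<exists>e>0. \<forall>m::int. e \<le> \<bar>of_int m + x\<bar>"
proof (intro exI[of _ "min (frac x) (1 - frac x)"] conjI allI)
  show "0 < min (frac x) (1 - frac x)"
    using assms frac_lt_1[of x] by (simp add: frac_gt_0_iff)
  fix m :: int
  define k where "k = m + \<lfloor>x\<rfloor>"
  have eq: "of_int m + x = of_int k + frac x" by (simp add: k_def frac_def)
  have f: "0 \<le> frac x" "frac x < 1" by (auto simp: frac_lt_1)
  show "min (frac x) (1 - frac x) \<le> \<bar>of_int m + x\<bar>"
  proof (cases "k \<ge> 0")
    case True
    then have "of_int k \<ge> (0::real)" by simp
    then show ?thesis unfolding eq using f by linarith
  next
    case False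
    then have "of_int k \<le> (-1::real)" by linarith
    then show ?thesis unfolding eq using f by linarith
  qed
qed

text \<open>Writing \<open>u = s \<tau> + t\<close> with real \<open>s\<close> and \<open>t\<close>,
  the norm controls \<open>|m + s|\<close> and \<open>|n + t|\<close>. Off the lattice it is also
  bounded below by a positive constant, which absorbs the additive terms in \<open>s\<close> and
  \<open>t\<close>.\<close>

lemma lattice_lower_bound:
  assumes \<tau>: "Im \<tau> > 0" and u: "u \<notin> period_lattice \<tau>"
  shows "\<exists>K>0. \<forall>m n::int. 1 + \<bar>of_int m\<bar> + \<bar>of_int n\<bar> \<le> K * norm (u + of_int m * \<tau> + of_int n)"
proof -
  define y where "y = Im \<tau>"
  define s where "s = Im u / y"
  define t where "t = Re u - s * Re \<tau>"
  define z where "z = (\<lambda>(m::int) (n::int). u + of_int m * \<tau> + of_int n)"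
  have y: "y > 0" using \<tau> by (simp add: y_def)
  have imz: "Im (z m n) = (of_int m + s) * y" for m n
    using y by (simp add: z_def s_def y_def algebra_simps)
  have rez: "Re (z m n) = (of_int m + s) * Re \<tau> + (of_int n + t)" for m n
    by (simp add: z_def t_def algebra_simps)
  have ms: "\<bar>of_int m + s\<bar> \<le> norm (z m n) / y" for m n
    using abs_Im_le_cmod[of "z m n"] y unfolding imz by (simp add: abs_mult pos_le_divide_eq)
  have nt: "\<bar>of_int n + t\<bar> \<le> norm (z m n) + norm (z m n) / y * \<bar>Re \<tau>\<bar>" for m n
  proof -
    have "\<bar>of_int n + t\<bar> \<le> \<bar>Re (z m n)\<bar> + \<bar>(of_int m + s) * Re \<tau>\<bar>" unfolding rez by linarith
    also have "\<bar>(of_int m + s) * Re \<tau>\<bar> \<le> norm (z m n) / y * \<bar>Re \<tau>\<bar>"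
      unfolding abs_mult by (intro mult_right_mono ms) auto
    finally show ?thesis using abs_Re_le_cmod[of "z m n"] by linarith
  qed
  have "\<exists>e>0. \<forall>m n. e \<le> norm (z m n)"
  \<comment> \<open>If \<open>s\<close> is not an integer, the imaginary parts stay away from 0. If
    \<open>s = k\<close>, only the row \<open>m = - k\<close> can come close to 0, and there
    \<open>t\<close> is not an integer.\<close>
  proof (cases "s \<in> \<int>")
    case False
    then obtain e where e: "e > 0" "\<And>m::int. e \<le> \<bar>of_int m + s\<bar>" using not_Ints_imp_bounded_away by blast
    have "e * y \<le> norm (z m n)" for m n
      using order_trans[OF e(2)[of m] ms[of m n]] y by (simp add: field_simps)
    then show ?thesis using e y by (intro exI[of _ "e * y"]) auto
  next
    case True
    then obtain k where k: "s = of_int k" by (elim Ints_cases)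
    have "t \<notin> \<int>"
    proof
      assume "t \<in> \<int>"
      then obtain l where "t = of_int l" by (elim Ints_cases)
      moreover have "Im u = of_int k * Im \<tau>" using k y by (simp add: s_def y_def field_simps)
      ultimately have "u = of_int k * \<tau> + of_int l" unfolding t_def k by (simp add: complex_eq_iff)
      with u show False by (auto simp: period_lattice_def)
    qed
    then obtain e where e: "e > 0" "\<And>m::int. e \<le> \<bar>of_int m + t\<bar>" using not_Ints_imp_bounded_away by blast
    have "min e y \<le> norm (z m n)" for m n
    proof (cases "m = - k")
      case True
      then have "Re (z m n) = of_int n + t" unfolding rez k by simp
      then show ?thesis using e(2)[of n] abs_Re_le_cmod[of "z m n"] by linarith
    next
      case False
      then have "\<bar>of_int (m + k)\<bar> \<ge> (1::real)" by linarith
      then have "\<bar>Im (z m n)\<bar> \<ge> y" unfolding imz k abs_mult using y by simp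
      then show ?thesis using abs_Im_le_cmod[of "z m n"] by linarith
    qed
    then show ?thesis using e y by (intro exI[of _ "min e y"]) auto
  qed
  then obtain e where e: "e > 0" "\<And>m n. e \<le> norm (z m n)" by blast
  define B where "B = 1 + \<bar>s\<bar> + \<bar>t\<bar>"
  define K where "K = B / e + 1 / y + 1 + 1 / y * \<bar>Re \<tau>\<bar>"
  have "1 + \<bar>of_int m\<bar> + \<bar>of_int n\<bar> \<le> K * norm (z m n)" for m n
  proof -
    have "1 + \<bar>of_int m\<bar> + \<bar>of_int n\<bar> \<le> B + \<bar>of_int m + s\<bar> + \<bar>of_int n + t\<bar>"
      unfolding B_def by linarith
    also have "B \<le> B / e * norm (z m n)"
      using e(1) e(2)[of m n] mult_left_mono[of e "norm (z m n)" B] by (simp add: B_def field_simps)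
    finally show ?thesis using ms[of m n] nt[of n m] by (simp add: K_def algebra_simps)
  qed
  moreover have "K > 0" unfolding K_def B_def using e y by (simp add: add_pos_nonneg add_nonneg_pos)
  ultimately show ?thesis unfolding z_def by blast
qed

text \<open>With \<open>a = 1 + |m|\<close>, \<open>b = 1 + |n|\<close> and
  \<open>c = 1 + |m| + |n|\<close> one has \<open>a b \<le> c^2\<close>, so the term is at most
  \<open>(a b) powr (-3/2)\<close>, a product of two summable functions of one variable.\<close>

lemma summable_on_cubes:
  "(\<lambda>(m::int, n::int). 1 / (1 + \<bar>of_int m\<bar> + \<bar>of_int n\<bar> :: real) ^ 3) summable_on UNIV"
proof -
  define h where "h = (\<lambda>m::int. (1 + \<bar>of_int m\<bar> :: real) powr (-(3/2)))"
  have nat: "(\<lambda>k::nat. (1 + real k) powr (-(3/2))) summable_on UNIV"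
  proof (rule norm_summable_imp_summable_on)
    have "summable (\<lambda>k. real (Suc k) powr (-(3/2)))"
      by (subst summable_Suc_iff) (simp add: summable_real_powr_iff)
    then show "summable (\<lambda>k. norm ((1 + real k) powr (-(3/2))))" by simp
  qed
  have A: "h summable_on (range int)"
    using nat by (subst summable_on_reindex) (auto simp: o_def h_def)
  have B: "h summable_on (range (\<lambda>k. - int k))"
    using nat by (subst summable_on_reindex) (auto simp: o_def h_def inj_on_def)
  have "n \<in> range int \<union> range (\<lambda>k. - int k)" for n
    by (cases "n \<ge> 0") (auto simp: image_iff intro: exI[of _ "nat n"] exI[of _ "nat (- n)"])
  then have "range int \<union> range (\<lambda>k. - int k) = UNIV" by blast
  with summable_on_union[OF A B] have h: "h summable_on UNIV" by simp
  have "(\<lambda>(m, n). h m * h n) summable_on (UNIV \<times> UNIV)"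
  proof (rule summable_on_SigmaI[where g = "\<lambda>m. h m * infsum h UNIV"])
    show "((\<lambda>n. case (m, n) of (m, n) \<Rightarrow> h m * h n) has_sum h m * infsum h UNIV) UNIV" for m
      using h by (auto intro!: has_sum_cmult_right)
    show "(\<lambda>m. h m * infsum h UNIV) summable_on UNIV" using h by (rule summable_on_cmult_left)
  qed (auto simp: h_def)
  then have "(\<lambda>p. norm (case p of (m::int, n::int) \<Rightarrow> 1 / (1 + \<bar>of_int m\<bar> + \<bar>of_int n\<bar> :: real) ^ 3)) summable_on (UNIV \<times> UNIV)"
  proof (rule Infinite_Sum.abs_summable_on_comparison_test')
    fix p :: "int \<times> int" assume "p \<in> UNIV \<times> UNIV"
    obtain m n where p: "p = (m, n)" by (cases p)
    define a where "a = 1 + \<bar>of_int m :: real\<bar>"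
    define b where "b = 1 + \<bar>of_int n :: real\<bar>"
    define c where "c = 1 + \<bar>of_int m\<bar> + \<bar>of_int n :: real\<bar>"
    have pos: "a \<ge> 1" "b \<ge> 1" "c \<ge> 1" by (auto simp: a_def b_def c_def)
    have "a * b \<le> c * c" using pos by (intro mult_mono) (auto simp: a_def b_def c_def)
    then have "(a * b) powr (3/2) \<le> (c * c) powr (3/2)" using pos by (intro powr_mono2) auto
    also have "\<dots> = c powr 3" using pos by (simp add: powr_mult flip: powr_add)
    also have "\<dots> = c ^ 3" using pos by (simp add: powr_numeral)
    finally have "1 / c ^ 3 \<le> 1 / (a * b) powr (3/2)" using pos by (intro divide_left_mono) auto
    also have "\<dots> = h m * h n"
      unfolding h_def a_def[symmetric] b_def[symmetric]
      using pos by (simp add: powr_mult powr_minus inverse_eq_divide)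
    finally show "norm (case p of (m::int, n::int) \<Rightarrow> 1 / (1 + \<bar>of_int m\<bar> + \<bar>of_int n\<bar> :: real) ^ 3) \<le> (case p of (m, n) \<Rightarrow> h m * h n)"
      by (simp add: p c_def)
  qed
  from abs_summable_summable[OF this] show ?thesis by simp
qed

text \<open>The sum of the inverse squares alone is only conditionally convergent, but differences
  of two such terms are of the order of inverse cubes and may be summed in any order. Summing row by
  row gives the cosecants. This is why everything later is phrased with differences of Weierstrass
  values.\<close>

lemma wp_diff_lattice_sum:
  assumes \<tau>: "Im \<tau> > 0" and u: "u \<notin> period_lattice \<tau>" and v: "v \<notin> period_lattice \<tau>"
  shows "(\<Sum>\<^sub>\<infinity>(m::int, n::int). 1 / (u + of_int m * \<tau> + of_int n)\<^sup>2 - 1 / (v + of_int m * \<tau> + of_int n)\<^sup>2)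
    = (of_real pi)\<^sup>2 * (wp \<tau> u - wp \<tau> v)"
proof -
  define f where "f = (\<lambda>(m::int, n::int). 1 / (u + of_int m * \<tau> + of_int n)\<^sup>2 - 1 / (v + of_int m * \<tau> + of_int n)\<^sup>2)"
  obtain K where K: "K > 0" "\<And>m n::int. 1 + \<bar>of_int m\<bar> + \<bar>of_int n\<bar> \<le> K * norm (u + of_int m * \<tau> + of_int n)"
    using lattice_lower_bound[OF \<tau> u] by blast
  obtain L where L: "L > 0" "\<And>m n::int. 1 + \<bar>of_int m\<bar> + \<bar>of_int n\<bar> \<le> L * norm (v + of_int m * \<tau> + of_int n)"
    using lattice_lower_bound[OF \<tau> v] by blast
  define C where "C = norm (v - u) * (K * L ^ 2 + K ^ 2 * L)"
  have "(\<lambda>p. norm (f p)) summable_on UNIV"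
  proof (rule Infinite_Sum.abs_summable_on_comparison_test'[OF summable_on_cmult_right[OF summable_on_cubes]])
    fix p :: "int \<times> int"
    obtain m n where p: "p = (m, n)" by (cases p)
    define a where "a = u + of_int m * \<tau> + of_int n"
    define b where "b = v + of_int m * \<tau> + of_int n"
    define c where "c = 1 + \<bar>of_int m\<bar> + \<bar>of_int n :: real\<bar>"
    have c: "c \<ge> 1" by (simp add: c_def)
    have ac: "c \<le> K * norm a" and bc: "c \<le> L * norm b" using K L by (auto simp: a_def b_def c_def)
    have a0: "a \<noteq> 0" and b0: "b \<noteq> 0" using ac bc c by auto
    have ia: "1 / norm a \<le> K / c" and ib: "1 / norm b \<le> L / c"
      using ac bc a0 b0 c by (auto simp: field_simps)
    \<comment> \<open>The factor \<open>b - a\<close> equals \<open>v - u\<close>, independent of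
      the lattice point; what remains consists of two terms of degree -3.\<close>
    have "f p = (b - a) * (1 / a * (1 / b)\<^sup>2 + (1 / a)\<^sup>2 * (1 / b))"
      using a0 b0 by (simp add: f_def p flip: a_def b_def) (simp add: field_simps power2_eq_square)
    also have "norm \<dots> \<le> norm (b - a) * (1 / norm a * (1 / norm b)\<^sup>2 + (1 / norm a)\<^sup>2 * (1 / norm b))"
      unfolding norm_mult by (intro mult_left_mono order_trans[OF norm_triangle_ineq]) (auto simp: norm_mult norm_divide norm_power)
    also have "\<dots> \<le> norm (b - a) * (K / c * (L / c)\<^sup>2 + (K / c)\<^sup>2 * (L / c))"
      using ia ib K L c by (intro mult_left_mono add_mono mult_mono power_mono) auto
    also have "\<dots> = C * (1 / c ^ 3)"
      using c by (simp add: C_def a_def b_def field_simps power2_eq_square power3_eq_cube)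
    finally show "norm (f p) \<le> C * (case p of (m, n) \<Rightarrow> 1 / (1 + \<bar>of_int m\<bar> + \<bar>of_int n\<bar>) ^ 3)"
      by (simp add: p c_def)
  qed
  then have sm: "f summable_on (UNIV \<times> UNIV)" using abs_summable_summable by simp
  have inner: "(\<Sum>\<^sub>\<infinity>n. f (m, n)) = (of_real pi)\<^sup>2 * (csc_sq (u + of_int m * \<tau>) - csc_sq (v + of_int m * \<tau>))" for m
  proof -
    note A = csc_sq_partial_fractions[OF not_lattice_imp_not_Ints[OF u], of m] and B = csc_sq_partial_fractions[OF not_lattice_imp_not_Ints[OF v], of m]
    have "(\<Sum>\<^sub>\<infinity>n. f (m, n)) = (\<Sum>\<^sub>\<infinity>n. 1 / (u + of_int m * \<tau> + of_int n)\<^sup>2) - (\<Sum>\<^sub>\<infinity>n. 1 / (v + of_int m * \<tau> + of_int n)\<^sup>2)"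
      unfolding f_def prod.case by (rule infsum_minus[OF has_sum_imp_summable[OF A] has_sum_imp_summable[OF B]])
    then show ?thesis unfolding infsumI[OF A] infsumI[OF B] by (simp add: right_diff_distrib)
  qed
  have "infsum f UNIV = (\<Sum>\<^sub>\<infinity>m. \<Sum>\<^sub>\<infinity>n. f (m, n))"
    using infsum_Sigma_banach[OF sm] by simp
  also have "\<dots> = (\<Sum>\<^sub>\<infinity>m. (of_real pi)\<^sup>2 * (csc_sq (u + of_int m * \<tau>) - csc_sq (v + of_int m * \<tau>)))"
    by (simp only: inner)
  also have "\<dots> = (of_real pi)\<^sup>2 * (wp \<tau> u - wp \<tau> v)"
    using wp_summable[OF \<tau>, of u] wp_summable[OF \<tau>, of v]
    by (simp add: infsum_cmult_right' infsum_minus wp_def)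
  finally show ?thesis by (simp add: f_def)
qed

text \<open>Division by \<open>j\<close> carries the lattice of \<open>\<tau>\<close> onto that of
  \<open>\<tau>'\<close>, since the two bases differ by an integral matrix of determinant 1. The
  lattice sums agree after reindexing, each term being multiplied by
  \<open>j\<^sup>2\<close>.\<close>

lemma wp_diff_transform:
  fixes a b c d :: int
  assumes \<tau>: "Im \<tau> > 0" and u: "u \<notin> period_lattice \<tau>" and v: "v \<notin> period_lattice \<tau>" and det: "a * d - b * c = 1"
  defines "j \<equiv> of_int c * \<tau> + of_int d" and "\<tau>' \<equiv> (of_int a * \<tau> + of_int b) / (of_int c * \<tau> + of_int d)"
  assumes \<tau>': "Im \<tau>' > 0"
  shows "wp \<tau>' (u / j) - wp \<tau>' (v / j) = j\<^sup>2 * (wp \<tau> u - wp \<tau> v)"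
proof -
  have j0: "j \<noteq> 0" using \<tau>' by (auto simp: \<tau>'_def j_def)
  have lin: "w / j + of_int m * \<tau>' + of_int n = (w + of_int (m * a + n * c) * \<tau> + of_int (m * b + n * d)) / j" for w m n
    using j0 unfolding \<tau>'_def j_def[symmetric] by (simp add: field_simps) (simp add: j_def algebra_simps)
  have nl: "w / j \<notin> period_lattice \<tau>'" if w: "w \<notin> period_lattice \<tau>" for w
  proof
    assume "w / j \<in> period_lattice \<tau>'"
    then obtain m n where "w / j = of_int m * \<tau>' + of_int n" by (auto simp: period_lattice_def)
    then have "w / j + of_int (- m) * \<tau>' + of_int (- n) = 0" by simp
    then have "w + of_int (- m * a + - n * c) * \<tau> + of_int (- m * b + - n * d) = 0"
      unfolding lin using j0 by simp
    then have "w = of_int (m * a + n * c) * \<tau> + of_int (m * b + n * d)" by (simp add: algebra_simps eq_neg_iff_add_eq_0)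
    with w show False unfolding period_lattice_def by blast
  qed
  \<comment> \<open>Index pairs are multiplied as row vectors by the matrix; the inverse map is
    multiplication by the adjugate, integral because the determinant is 1.\<close>
  define g where "g = (\<lambda>(m::int, n::int). (m * a + n * c, m * b + n * d))"
  have bij: "bij g"
  proof (rule bij_betwI[where g = "\<lambda>(m, n). (m * d - n * c, n * a - m * b)"])
    have "d * a = 1 + b * c" using det by (simp add: algebra_simps)
    then have *: "d * (a * x) = x + b * (c * x)" for x
      by (metis mult.assoc distrib_right mult_1)
    show "(case g p of (m, n) \<Rightarrow> (m * d - n * c, n * a - m * b)) = p" for p
      using * by (cases p) (auto simp: g_def algebra_simps)
    show "g (case p of (m, n) \<Rightarrow> (m * d - n * c, n * a - m * b)) = p" for p
      using * by (cases p) (auto simp: g_def algebra_simps)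
  qed auto
  define f where "f = (\<lambda>(m::int, n::int). 1 / (u + of_int m * \<tau> + of_int n)\<^sup>2 - 1 / (v + of_int m * \<tau> + of_int n)\<^sup>2)"
  have "(of_real pi)\<^sup>2 * (wp \<tau>' (u / j) - wp \<tau>' (v / j)) =
    (\<Sum>\<^sub>\<infinity>(m::int, n::int). 1 / (u / j + of_int m * \<tau>' + of_int n)\<^sup>2 - 1 / (v / j + of_int m * \<tau>' + of_int n)\<^sup>2)"
    by (rule wp_diff_lattice_sum[symmetric]) (use \<tau>' nl u v in auto)
  also have "\<dots> = (\<Sum>\<^sub>\<infinity>p. j\<^sup>2 * f (g p))"
    unfolding lin by (intro infsum_cong) (auto simp: f_def g_def power_divide right_diff_distrib)
  also have "\<dots> = j\<^sup>2 * (\<Sum>\<^sub>\<infinity>p. f (g p))" by (rule infsum_cmult_right')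
  also have "(\<Sum>\<^sub>\<infinity>p. f (g p)) = infsum f UNIV" by (rule infsum_reindex_bij_betw) (fact bij)
  also have "\<dots> = (of_real pi)\<^sup>2 * (wp \<tau> u - wp \<tau> v)"
    unfolding f_def by (rule wp_diff_lattice_sum[OF \<tau> u v])
  finally have "(of_real pi)\<^sup>2 * (wp \<tau>' (u / j) - wp \<tau>' (v / j)) = (of_real pi)\<^sup>2 * (j\<^sup>2 * (wp \<tau> u - wp \<tau> v))"
    by (simp add: mult_ac)
  then show ?thesis by simp
qed

subsection \<open>Coincidences of Weierstrass values via theta products\<close>

definition qpoch :: "complex \<Rightarrow> complex \<Rightarrow> complex" where
  "qpoch q x = prodinf (\<lambda>n. 1 - q ^ n * x)"

lemma qpoch_convergent:
  fixes q x :: complex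
  assumes "norm q < 1"
  shows "convergent_prod (\<lambda>n. 1 - q ^ n * x)"
proof -
  have "summable (\<lambda>n. norm q ^ n * norm x)" using assms by (intro summable_mult2 summable_geometric) auto
  then have "summable (\<lambda>n. norm (1 - q ^ n * x - 1))" by (simp add: norm_mult norm_power)
  then have "abs_convergent_prod (\<lambda>n. 1 - q ^ n * x)" by (rule summable_imp_abs_convergent_prod)
  then show ?thesis by (rule abs_convergent_prod_imp_convergent_prod)
qed

lemma qpoch_nonzero:
  assumes "norm q < 1" "\<And>n. q ^ n * x \<noteq> 1"
  shows "qpoch q x \<noteq> 0"
  unfolding qpoch_def using assms by (intro prodinf_nonzero qpoch_convergent) auto

lemma qpoch_LIMSEQ:
  assumes "norm q < 1"
  shows "(\<lambda>N. \<Prod>n<N. 1 - q ^ n * x) \<longlonglongrightarrow> qpoch q x"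
  using convergent_prod_LIMSEQ[OF qpoch_convergent[OF assms]]
  by (simp add: qpoch_def LIMSEQ_lessThan_iff_atMost)

lemma qpoch_unfold:
  assumes "norm q < 1"
  shows "qpoch q x = (1 - x) * qpoch q (q * x)"
proof (rule LIMSEQ_unique)
  show "(\<lambda>N. \<Prod>n<Suc N. 1 - q ^ n * x) \<longlonglongrightarrow> qpoch q x"
    using LIMSEQ_Suc[OF qpoch_LIMSEQ[OF assms]] .
  have "(\<lambda>N. (1 - x) * (\<Prod>n<N. 1 - q ^ n * (q * x))) \<longlonglongrightarrow> (1 - x) * qpoch q (q * x)"
    by (intro tendsto_intros qpoch_LIMSEQ assms)
  moreover have "(\<Prod>n<Suc N. 1 - q ^ n * x) = (1 - x) * (\<Prod>n<N. 1 - q ^ n * (q * x))" for N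
    by (subst prod.lessThan_Suc_shift) (simp add: mult_ac)
  ultimately show "(\<lambda>N. \<Prod>n<Suc N. 1 - q ^ n * x) \<longlonglongrightarrow> (1 - x) * qpoch q (q * x)" by simp
qed

lemma qpoch_holomorphic:
  assumes q: "norm q < 1"
  shows "qpoch q holomorphic_on UNIV"
proof -
  have "qpoch q holomorphic_on ball 0 r" if r: "r > 0" for r
  proof (rule holomorphic_uniform_limit[THEN conjunct2])
    have "uniformly_convergent_on (cball 0 r) (\<lambda>N x. \<Prod>n<N. 1 + (- (q ^ n * x)))"
    proof (rule uniformly_convergent_on_prod)
      show "uniformly_convergent_on (cball 0 r) (\<lambda>N x. \<Sum>n<N. norm (- (q ^ n * x)))"
      proof (rule Weierstrass_m_test')
        show "summable (\<lambda>n. norm q ^ n * r)" using q by (intro summable_mult2 summable_geometric) auto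
        fix n x assume "x \<in> cball (0::complex) r"
        then show "norm (norm (- (q ^ n * x))) \<le> norm q ^ n * r"
          by (auto simp: norm_mult norm_power intro!: mult_left_mono)
      qed
    qed (auto intro!: continuous_intros)
    then have "uniform_limit (cball 0 r) (\<lambda>N x. \<Prod>n<N. 1 - q ^ n * x) (\<lambda>x. lim (\<lambda>N. \<Prod>n<N. 1 - q ^ n * x)) sequentially"
      by (simp add: uniformly_convergent_uniform_limit_iff)
    moreover have "lim (\<lambda>N. \<Prod>n<N. 1 - q ^ n * x) = qpoch q x" for x
      using qpoch_LIMSEQ[OF q] by (rule limI)
    ultimately show "uniform_limit (cball 0 r) (\<lambda>N x. \<Prod>n<N. 1 - q ^ n * x) (qpoch q) sequentially" by simp
    show "\<forall>\<^sub>F N in sequentially. continuous_on (cball 0 r) (\<lambda>x. \<Prod>n<N. 1 - q ^ n * x) \<and>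
        (\<lambda>x. \<Prod>n<N. 1 - q ^ n * x) holomorphic_on ball 0 r"
      by (intro always_eventually allI conjI continuous_intros holomorphic_intros)
  qed auto
  then have "qpoch q field_differentiable at x" for x
    using holomorphic_on_imp_differentiable_at[of "qpoch q" "ball 0 (norm x + 1)" x]
    by (auto simp: add_nonneg_pos)
  then show ?thesis by (simp add: holomorphic_on_def field_differentiable_at_within)
qed

text \<open>Up to a factor independent of \<open>u\<close> and an exponential of a linear function
  of \<open>u\<close>, this is the Jacobi theta function with simple zeros at the lattice points.
  The normalization gives exact period 1, at the cost of oddness.\<close>

definition theta :: "complex \<Rightarrow> complex \<Rightarrow> complex" where
  "theta \<tau> u = qpoch (ee \<tau>) (ee u) * qpoch (ee \<tau>) (ee (\<tau> - u))"

context
  fixes \<tau> :: complex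
  assumes \<tau>: "Im \<tau> > 0"
begin

lemma norm_ee_\<tau>: "norm (ee \<tau>) < 1"
  using \<tau> by (simp add: norm_ee)

lemma ee_power: "ee \<tau> ^ n = ee (of_nat n * \<tau>)"
  by (simp add: ee_def mult_ac flip: exp_of_nat_mult)

lemma qpoch_ee_nonzero:
  assumes "\<And>n::nat. of_nat n * \<tau> + u \<notin> \<int>"
  shows "qpoch (ee \<tau>) (ee u) \<noteq> 0"
  by (rule qpoch_nonzero[OF norm_ee_\<tau>]) (use assms in \<open>simp add: ee_power ee_eq_1_iff flip: ee_add\<close>)

lemma Ints_imp_Im_0: "z \<in> \<int> \<Longrightarrow> Im z = 0"
  by (auto elim: Ints_cases)

lemma qpoch_ee_tau_nonzero: "qpoch (ee \<tau>) (ee \<tau>) \<noteq> 0"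
proof (rule qpoch_ee_nonzero)
  fix n :: nat
  have "Im (of_nat n * \<tau> + \<tau>) > 0" using \<tau> by (simp add: add_nonneg_pos)
  then show "of_nat n * \<tau> + \<tau> \<notin> \<int>" using Ints_imp_Im_0 by force
qed

lemma theta_nonzero:
  assumes "u \<notin> period_lattice \<tau>"
  shows "theta \<tau> u \<noteq> 0"
proof -
  have "qpoch (ee \<tau>) (ee u) \<noteq> 0"
    using not_lattice_imp_not_Ints[OF assms, of "int _"] by (intro qpoch_ee_nonzero) (simp add: add.commute)
  moreover have "qpoch (ee \<tau>) (ee (\<tau> - u)) \<noteq> 0"
  proof (rule qpoch_ee_nonzero)
    fix n :: nat
    have "u + of_int (- 1 - int n) * \<tau> \<notin> \<int>" by (rule not_lattice_imp_not_Ints[OF assms])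
    moreover have "of_nat n * \<tau> + (\<tau> - u) = - (u + of_int (- 1 - int n) * \<tau>)" by (simp add: algebra_simps)
    ultimately show "of_nat n * \<tau> + (\<tau> - u) \<notin> \<int>" by (simp only: minus_in_Ints_iff not_False_eq_True)
  qed
  ultimately show ?thesis by (simp add: theta_def)
qed

lemma theta_holomorphic [holomorphic_intros]:
  "f holomorphic_on A \<Longrightarrow> (\<lambda>u. theta \<tau> (f u)) holomorphic_on A"
proof -
  assume f: "f holomorphic_on A"
  have *: "(\<lambda>u. qpoch (ee \<tau>) (g u)) holomorphic_on A" if "g holomorphic_on A" for g
    using holomorphic_on_compose_gen[OF that qpoch_holomorphic[OF norm_ee_\<tau>]] by (simp add: o_def)
  show ?thesis unfolding theta_def by (intro holomorphic_intros * f)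
qed

lemma theta_plus_1: "theta \<tau> (u + 1) = theta \<tau> u"
proof -
  have e1: "ee 1 = 1" using ee_of_int[of 1] by simp
  have "ee (u + 1) = ee u" by (simp add: ee_add e1)
  moreover have "ee (\<tau> - (u + 1)) = ee (\<tau> - u)" by (simp add: ee_diff ee_add e1)
  ultimately show ?thesis by (simp add: theta_def)
qed

text \<open>The shift removes the factor \<open>1 - ee u\<close> from the first product and adds
  \<open>1 - ee (- u)\<close> to the second; their quotient is \<open>- ee (- u)\<close>.\<close>

lemma theta_plus_\<tau>: "theta \<tau> (u + \<tau>) = - ee (- u) * theta \<tau> u"
proof -
  let ?E = "qpoch (ee \<tau>)"
  have 1: "?E (ee u) = (1 - ee u) * ?E (ee (u + \<tau>))"
    using qpoch_unfold[OF norm_ee_\<tau>, of "ee u"] by (simp add: ee_add mult.commute)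
  have 2: "?E (ee (- u)) = (1 - ee (- u)) * ?E (ee (\<tau> - u))"
    using qpoch_unfold[OF norm_ee_\<tau>, of "ee (- u)"] by (simp add: ee_add[symmetric])
  have "1 - ee (- u) = - ee (- u) * (1 - ee u)" by (simp add: ee_minus field_simps)
  then show ?thesis unfolding theta_def using 1 2 by simp
qed

text \<open>Isolates the simple zero at \<open>u = 0\<close>: the second factor is nonzero
  there.\<close>

lemma theta_split: "theta \<tau> u = (1 - ee u) * (qpoch (ee \<tau>) (ee (u + \<tau>)) * qpoch (ee \<tau>) (ee (\<tau> - u)))"
  using qpoch_unfold[OF norm_ee_\<tau>, of "ee u"] by (simp add: theta_def ee_add mult.commute mult.assoc)

text \<open>Every value is already taken on a disc containing a period parallelogram, so the
  function is bounded and the classical theorem of Liouville applies.\<close>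

lemma elliptic_entire_constant:
  assumes g: "g holomorphic_on UNIV" and p1: "\<And>u. g (u + 1) = g u" and pt: "\<And>u. g (u + \<tau>) = g u"
  shows "\<exists>c. \<forall>u. g u = c"
proof -
  have per_nat1: "g (u + of_nat m * \<tau>) = g u" for m u
  proof (induction m)
    case (Suc m)
    have "u + of_nat (Suc m) * \<tau> = (u + of_nat m * \<tau>) + \<tau>" by (simp add: algebra_simps)
    then show ?case using Suc by (simp only: pt)
  qed simp
  have per_nat2: "g (u + of_nat m) = g u" for m u
  proof (induction m)
    case (Suc m)
    have "u + of_nat (Suc m) = (u + of_nat m) + 1" by (simp add: algebra_simps)
    then show ?case using Suc by (simp only: p1)
  qed simp
  have per: "g (u + of_int m * \<tau> + of_int n) = g u" for m n u
  proof -
    have *: "g (u + of_int m * \<tau>) = g u" for u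
      using per_nat1[of u "nat m"] per_nat1[of "u + of_int m * \<tau>" "nat (- m)"] by (cases "m \<ge> 0") auto
    have "g (u + of_int n) = g u" for u
      using per_nat2[of u "nat n"] per_nat2[of "u + of_int n" "nat (- n)"] by (cases "n \<ge> 0") auto
    then show ?thesis using * by simp
  qed
  define K where "K = cball (0::complex) (norm \<tau> + 1)"
  have "compact (g ` K)" unfolding K_def
    by (intro compact_continuous_image holomorphic_on_imp_continuous_on holomorphic_on_subset[OF g]) auto
  then have bK: "bounded (g ` K)" by (rule compact_imp_bounded)
  have "g u \<in> g ` K" for u
  proof -
    define s where "s = Im u / Im \<tau>"
    define t where "t = Re u - s * Re \<tau>"
    have u: "u = of_real s * \<tau> + of_real t" using \<tau> by (auto simp: complex_eq_iff s_def t_def)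
    define w where "w = u + of_int (- \<lfloor>s\<rfloor>) * \<tau> + of_int (- \<lfloor>t\<rfloor>)"
    have "w = of_real (frac s) * \<tau> + of_real (frac t)"
      unfolding w_def by (subst u) (simp add: frac_def algebra_simps)
    then have "norm w \<le> frac s * norm \<tau> + frac t"
      by (metis abs_of_nonneg frac_ge_0 norm_mult norm_of_real norm_triangle_ineq)
    also have "\<dots> \<le> 1 * norm \<tau> + 1" using frac_lt_1[of s] frac_lt_1[of t]
      by (intro add_mono mult_right_mono) auto
    finally have "w \<in> K" by (simp add: K_def)
    moreover have "g w = g u" unfolding w_def by (rule per)
    ultimately show ?thesis by (metis imageI)
  qed
  then have "range g \<subseteq> g ` K" by blast
  then have "bounded (range g)" using bK bounded_subset by blast
  then show ?thesis using Liouville_theorem[OF g] unfolding constant_on_def by blast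
qed

lemma lattice_isolated: "\<exists>e>0. \<forall>l\<in>period_lattice \<tau>. l \<noteq> z \<longrightarrow> e \<le> dist z l"
proof (cases "z \<in> period_lattice \<tau>")
  case False
  obtain K where K: "K > 0" "\<And>m n::int. 1 + \<bar>of_int m\<bar> + \<bar>of_int n\<bar> \<le> K * norm (z + of_int m * \<tau> + of_int n)"
    using lattice_lower_bound[OF \<tau> False] by blast
  have "1 / K \<le> dist z l" if l: "l \<in> period_lattice \<tau>" for l
  proof -
    obtain m n where l: "l = of_int m * \<tau> + of_int n" using l by (auto simp: period_lattice_def)
    have "1 \<le> K * norm (z + of_int (- m) * \<tau> + of_int (- n))"
      using K(2)[of "- m" "- n"] by simp
    also have "z + of_int (- m) * \<tau> + of_int (- n) = z - l" by (simp add: l)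
    finally show ?thesis using K(1) by (simp add: dist_norm field_simps)
  qed
  then show ?thesis using K(1) by (intro exI[of _ "1 / K"]) auto
next
  case True
  then obtain a b where z: "z = of_int a * \<tau> + of_int b" by (auto simp: period_lattice_def)
  have "min (Im \<tau>) 1 \<le> dist z l" if l: "l \<in> period_lattice \<tau>" "l \<noteq> z" for l
  proof -
    obtain m n where l': "l = of_int m * \<tau> + of_int n" using l by (auto simp: period_lattice_def)
    have im: "\<bar>Im (z - l)\<bar> = \<bar>of_int (a - m)\<bar> * Im \<tau>" using \<tau> by (simp add: z l' abs_mult flip: left_diff_distrib)
    show ?thesis
    proof (cases "a = m")
      case False
      then have "\<bar>of_int (a - m)\<bar> \<ge> (1::real)" by linarith
      then have "\<bar>Im (z - l)\<bar> \<ge> Im \<tau>" unfolding im using \<tau> by simp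
      then show ?thesis using abs_Im_le_cmod[of "z - l"] unfolding dist_norm by linarith
    next
      case True
      with l(2) have "b \<noteq> n" by (auto simp: z l')
      then have "\<bar>of_int (b - n)\<bar> \<ge> (1::real)" by linarith
      moreover have "Re (z - l) = of_int (b - n)" using True by (simp add: z l')
      ultimately show ?thesis using abs_Re_le_cmod[of "z - l"] unfolding dist_norm by linarith
    qed
  qed
  then show ?thesis using \<tau> by (intro exI[of _ "min (Im \<tau>) 1"]) auto
qed

lemma lattice_uminus: "l \<in> period_lattice \<tau> \<Longrightarrow> - l \<in> period_lattice \<tau>"
proof -
  assume "l \<in> period_lattice \<tau>"
  then obtain c d where "l = of_int c * \<tau> + of_int d" by (auto simp: period_lattice_def)
  then have "- l = of_int (- c) * \<tau> + of_int (- d)" by (simp add: algebra_simps)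
  then show ?thesis unfolding period_lattice_def by blast
qed

lemma lattice_closed: "closed (period_lattice \<tau>)"
proof -
  have "\<exists>e>0. ball z e \<subseteq> - period_lattice \<tau>" if "z \<in> - period_lattice \<tau>" for z
  proof -
    obtain e where "e > 0" "\<And>l. l \<in> period_lattice \<tau> \<Longrightarrow> l \<noteq> z \<Longrightarrow> e \<le> dist z l" using lattice_isolated by blast
    with that show ?thesis by (intro exI[of _ e]) force
  qed
  then show ?thesis unfolding closed_def open_contains_ball by blast
qed

lemma wp_fixed_holomorphic: "wp \<tau> holomorphic_on (- period_lattice \<tau>)"
  by (rule wp_holomorphic) (use \<tau> lattice_closed in \<open>auto intro!: holomorphic_intros\<close>)

lemma theta_lattice_0: "theta \<tau> 0 = 0"
proof -
  have "ee 0 = 1" by (simp add: ee_def)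
  then show ?thesis by (subst theta_split) simp
qed

lemma one_in_lattice: "1 \<in> period_lattice \<tau>"
proof -
  have "1 = of_int 0 * \<tau> + of_int 1" by simp
  then show ?thesis unfolding period_lattice_def by blast
qed

lemma tau_in_lattice: "\<tau> \<in> period_lattice \<tau>"
proof -
  have "\<tau> = of_int 1 * \<tau> + of_int 0" by simp
  then show ?thesis unfolding period_lattice_def by blast
qed

text \<open>The sigma-function formula for \<open>\<wp>(u) - \<wp>(v)\<close>, with
  \<open>theta \<tau> v * theta \<tau> (- v)\<close> in place of the square of sigma at
  \<open>v\<close> because \<open>theta\<close> is not odd. The quotient \<open>f\<close> of the two
  sides is elliptic. The square of \<open>theta\<close> cancels the double pole at 0, and at
  \<open>v\<close> and \<open>- v\<close>, which are distinct modulo the lattice, simple zeros of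
  the denominator meet zeros of the numerator. Hence \<open>f\<close> is constant, and its value is
  found at 0.\<close>

lemma wp_theta_identity_generic:
  assumes v: "v \<notin> period_lattice \<tau>" and v2: "2 * v \<notin> period_lattice \<tau>" and u: "u \<notin> period_lattice \<tau>"
  shows "(wp \<tau> u - wp \<tau> v) * (theta \<tau> u)\<^sup>2 * (theta \<tau> v * theta \<tau> (- v)) =
    - 4 * qpoch (ee \<tau>) (ee \<tau>) ^ 4 * (theta \<tau> (u + v) * theta \<tau> (u - v))"
proof -
  define S where "S = {z. z \<in> period_lattice \<tau> \<or> z + v \<in> period_lattice \<tau> \<or> z - v \<in> period_lattice \<tau>}"
  define f where "f = (\<lambda>z. (wp \<tau> z - wp \<tau> v) * (theta \<tau> z)\<^sup>2 / (theta \<tau> (z + v) * theta \<tau> (z - v)))"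
  have S_isol: "\<exists>e>0. ball z e - {z} \<subseteq> - S" for z
  proof -
    obtain e1 where e1: "e1 > 0" "\<And>l. l \<in> period_lattice \<tau> \<Longrightarrow> l \<noteq> z \<Longrightarrow> e1 \<le> dist z l" using lattice_isolated by blast
    obtain e2 where e2: "e2 > 0" "\<And>l. l \<in> period_lattice \<tau> \<Longrightarrow> l \<noteq> z + v \<Longrightarrow> e2 \<le> dist (z + v) l" using lattice_isolated by blast
    obtain e3 where e3: "e3 > 0" "\<And>l. l \<in> period_lattice \<tau> \<Longrightarrow> l \<noteq> z - v \<Longrightarrow> e3 \<le> dist (z - v) l" using lattice_isolated by blast
    have "ball z (min e1 (min e2 e3)) - {z} \<subseteq> - S"
    proof
      fix w assume w: "w \<in> ball z (min e1 (min e2 e3)) - {z}"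
      then have "w \<notin> period_lattice \<tau>" using e1(2)[of w] by auto
      moreover have "w + v \<notin> period_lattice \<tau>" using e2(2)[of "w + v"] w by (auto simp: dist_norm)
      moreover have "w - v \<notin> period_lattice \<tau>" using e3(2)[of "w - v"] w by (auto simp: dist_norm)
      ultimately show "w \<in> - S" by (auto simp: S_def)
    qed
    then show ?thesis using e1(1) e2(1) e3(1) by (intro exI[of _ "min e1 (min e2 e3)"]) auto
  qed
  have S_open: "open (- S)"
  proof -
    have "closed S"
    proof -
      have "S = period_lattice \<tau> \<union> ((\<lambda>z. z + v) -` period_lattice \<tau> \<union> (\<lambda>z. z - v) -` period_lattice \<tau>)" by (auto simp: S_def)
      also have "closed \<dots>" by (intro closed_Un closed_vimage lattice_closed continuous_intros)
      finally show ?thesis .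
    qed
    then show ?thesis by auto
  qed
  have hol: "f holomorphic_on (- S)"
    unfolding f_def
  proof (intro holomorphic_intros)
    show "wp \<tau> holomorphic_on - S" by (rule holomorphic_on_subset[OF wp_fixed_holomorphic]) (auto simp: S_def)
    show "\<And>z. z \<in> - S \<Longrightarrow> theta \<tau> (z + v) * theta \<tau> (z - v) \<noteq> 0" using theta_nonzero by (auto simp: S_def)
  qed
  have f1: "f (z + 1) = f z" for z
  proof -
    have "1 \<in> period_lattice \<tau>" by (rule one_in_lattice)
    then have "wp \<tau> (z + 1) = wp \<tau> z" by (rule wp_plus_lattice)
    moreover have "z + 1 + v = z + v + 1" "z + 1 - v = z - v + 1" by auto
    ultimately show ?thesis unfolding f_def by (simp only: theta_plus_1)
  qed
  have ft: "f (z + \<tau>) = f z" for z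
  proof -
    have "\<tau> \<in> period_lattice \<tau>" by (rule tau_in_lattice)
    moreover have "theta \<tau> (z + v + \<tau>) * theta \<tau> (z - v + \<tau>) = (ee (- z))\<^sup>2 * (theta \<tau> (z + v) * theta \<tau> (z - v))"
    proof -
      have "ee (- (z + v)) * ee (- (z - v)) = (ee (- z))\<^sup>2"
        by (simp add: power2_eq_square flip: ee_add)
      moreover have "theta \<tau> (z + v + \<tau>) * theta \<tau> (z - v + \<tau>) =
          ee (- (z + v)) * ee (- (z - v)) * (theta \<tau> (z + v) * theta \<tau> (z - v))"
        unfolding theta_plus_\<tau> by (simp add: mult_ac)
      ultimately show ?thesis by simp
    qed
    moreover have "(theta \<tau> (z + \<tau>))\<^sup>2 = (ee (- z))\<^sup>2 * (theta \<tau> z)\<^sup>2"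
      unfolding theta_plus_\<tau> by (simp add: power_mult_distrib)
    moreover have eqs: "z + \<tau> + v = z + v + \<tau>" "z + \<tau> - v = z - v + \<tau>" by auto
    moreover have "wp \<tau> (z + \<tau>) = wp \<tau> z" by (rule wp_plus_lattice[OF tau_in_lattice])
    ultimately show ?thesis unfolding f_def eqs by simp
  qed
  \<comment> \<open>This is \<open>theta\<close> without its vanishing factor
    \<open>1 - ee z\<close>; its value at 0 accounts for the fourth power in the constant, as
    \<open>theta\<close> enters squared.\<close>
  define k where "k = (\<lambda>z. qpoch (ee \<tau>) (ee (z + \<tau>)) * qpoch (ee \<tau>) (ee (\<tau> - z)))"
  have k_hol: "k holomorphic_on A" for A
  proof -
    have *: "(\<lambda>u. qpoch (ee \<tau>) (g u)) holomorphic_on A" if "g holomorphic_on A" for g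
      using holomorphic_on_compose_gen[OF that qpoch_holomorphic[OF norm_ee_\<tau>]] by (simp add: o_def)
    show ?thesis unfolding k_def by (intro holomorphic_intros *)
  qed
  have k_cont: "isCont k z" for z
    using holomorphic_on_imp_continuous_on[OF k_hol[of UNIV]] by (simp add: continuous_on_eq_continuous_at)
  have k0: "k 0 = qpoch (ee \<tau>) (ee \<tau>) ^ 2" by (simp add: k_def power2_eq_square)
  have th: "theta \<tau> z = (1 - ee z) * k z" for z unfolding k_def by (rule theta_split)
  have th_cont: "isCont (theta \<tau>) z" for z
    using holomorphic_on_imp_continuous_on[OF theta_holomorphic[of "\<lambda>z. z" UNIV]]
    by (auto simp: continuous_on_eq_continuous_at holomorphic_intros)
  note qq = qpoch_ee_tau_nonzero
  have lim0: "f \<midarrow>0\<rightarrow> - 4 * qpoch (ee \<tau>) (ee \<tau>) ^ 4 / (theta \<tau> v * theta \<tau> (- v))"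
  proof -
    obtain e where e: "e > 0" "ball 0 e - {0} \<subseteq> - S" using S_isol by blast
    \<comment> \<open>Without the row \<open>n = 0\<close> the sum is holomorphic near 0. The double
      pole of the omitted term is cancelled by the factor \<open>(1 - ee z)\<^sup>2\<close> of the
      squared theta function, leaving \<open>- 4 * ee z * (k z)\<^sup>2\<close>.\<close>
    define rst where "rst = (\<lambda>z. \<Sum>\<^sub>\<infinity>n\<in>-{0::int}. csc_sq (z + of_int n * \<tau>))"
    obtain e' where e': "e' > 0" "\<And>l. l \<in> period_lattice \<tau> \<Longrightarrow> l \<noteq> 0 \<Longrightarrow> e' \<le> dist 0 l" using lattice_isolated by blast
    have "rst holomorphic_on ball 0 (min e' (Im \<tau>))"
      unfolding rst_def
    proof (rule csc_sq_sum_holomorphic)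
      fix z :: complex and n assume z: "z \<in> ball 0 (min e' (Im \<tau>))" and n: "n \<in> - {0::int}"
      have "\<bar>of_int n\<bar> \<ge> (1::real)" using n by auto
      then have "\<bar>Im (of_int n * \<tau>)\<bar> \<ge> Im \<tau>" using \<tau> by (simp add: abs_mult)
      moreover have "\<bar>Im z\<bar> < Im \<tau>" using z abs_Im_le_cmod[of z] by (auto simp: dist_norm)
      ultimately have "Im (z + of_int n * \<tau>) \<noteq> 0" by auto
      then show "z + of_int n * \<tau> \<notin> \<int>" using Ints_imp_Im_0 by blast
    qed (use \<tau> in \<open>auto intro!: holomorphic_intros\<close>)
    then have rc: "isCont rst 0" using e' \<tau>
      by (auto dest!: holomorphic_on_imp_continuous_on simp: continuous_on_eq_continuous_at)
    have wps: "wp \<tau> z = csc_sq z + rst z" for z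
    proof -
      have "wp \<tau> z = infsum (\<lambda>n. csc_sq (z + of_int n * \<tau>)) ({0} \<union> - {0})" by (simp add: wp_def)
      also have "\<dots> = csc_sq z + rst z" unfolding rst_def
        by (subst infsum_Un_disjoint) (auto intro!: summable_on_subset_banach[OF wp_summable[OF \<tau>]])
      finally show ?thesis .
    qed
    have "(\<lambda>z. (- 4 * ee z * (k z)\<^sup>2 + (rst z - wp \<tau> v) * (theta \<tau> z)\<^sup>2) / (theta \<tau> (z + v) * theta \<tau> (z - v)))
        \<midarrow>0\<rightarrow> (- 4 * ee 0 * (k 0)\<^sup>2 + (rst 0 - wp \<tau> v) * (theta \<tau> 0)\<^sup>2) / (theta \<tau> (0 + v) * theta \<tau> (0 - v))"
    proof -
      have "theta \<tau> (0 + v) * theta \<tau> (0 - v) \<noteq> 0" using theta_nonzero v lattice_uminus by fastforce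
      moreover have "isCont (\<lambda>z. theta \<tau> (z + v)) 0" "isCont (\<lambda>z. theta \<tau> (z - v)) 0"
        by (rule isCont_o2[OF _ th_cont], intro continuous_intros)+
      moreover have "isCont ee 0" unfolding ee_def by (intro continuous_intros)
      ultimately have "isCont (\<lambda>z. (- 4 * ee z * (k z)\<^sup>2 + (rst z - wp \<tau> v) * (theta \<tau> z)\<^sup>2) / (theta \<tau> (z + v) * theta \<tau> (z - v))) 0"
        using rc k_cont th_cont by (intro continuous_intros) auto
      then show ?thesis unfolding isCont_def by simp
    qed
    also have "(- 4 * ee 0 * (k 0)\<^sup>2 + (rst 0 - wp \<tau> v) * (theta \<tau> 0)\<^sup>2) / (theta \<tau> (0 + v) * theta \<tau> (0 - v))
       = - 4 * qpoch (ee \<tau>) (ee \<tau>) ^ 4 / (theta \<tau> v * theta \<tau> (- v))"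
      by (simp add: k0 theta_lattice_0) (simp add: ee_def)
    finally show ?thesis
    proof (rule Lim_transform_within_open[OF _ open_ball])
      show "0 \<in> ball (0::complex) e" using e by simp
      fix z :: complex assume z: "z \<in> ball 0 e" "z \<noteq> 0"
      then have "z \<notin> period_lattice \<tau>" using e by (auto simp: S_def)
      then have "z \<notin> \<int>" using not_lattice_imp_not_Ints[of z \<tau> 0] by simp
      then have "1 - ee z \<noteq> 0" using ee_eq_1_iff by auto
      then have "csc_sq z * (1 - ee z)\<^sup>2 = - 4 * ee z" by (simp add: csc_sq_ee)
      then have "csc_sq z * (theta \<tau> z)\<^sup>2 = - 4 * ee z * (k z)\<^sup>2" unfolding th power_mult_distrib mult.assoc[symmetric] by simp
      then show "(- 4 * ee z * (k z)\<^sup>2 + (rst z - wp \<tau> v) * (theta \<tau> z)\<^sup>2) / (theta \<tau> (z + v) * theta \<tau> (z - v)) = f z"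
        unfolding f_def wps by (simp add: algebra_simps)
    qed
  qed
  have limv: "\<exists>c. f \<midarrow>p\<rightarrow> c" if p: "p = v \<or> p = - v" for p
  proof -
    have pl: "p \<notin> period_lattice \<tau>" and p2: "2 * p \<notin> period_lattice \<tau>"
      using p v v2 lattice_uminus[of p] lattice_uminus[of "2 * p"] by auto
    define h where "h = (\<lambda>z. (wp \<tau> z - wp \<tau> v) * (theta \<tau> z)\<^sup>2)"
    \<comment> \<open>The numerator vanishes at \<open>v\<close>, and at \<open>- v\<close> because
      \<open>wp\<close> is even, while \<open>1 - ee (z - p)\<close> has a simple zero at
      \<open>p\<close>; the limit exists by l'Hospital.\<close>
    have "h holomorphic_on - period_lattice \<tau>" unfolding h_def by (intro holomorphic_intros wp_fixed_holomorphic)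
    then have "(h has_field_derivative deriv h p) (at p)"
      using lattice_closed pl by (intro holomorphic_derivI[of _ "- period_lattice \<tau>"]) auto
    moreover have "((\<lambda>z. 1 - ee (z - p)) has_field_derivative - (2 * of_real pi * \<i>)) (at p)"
      unfolding ee_def by (auto intro!: derivative_eq_intros)
    moreover have "h p = 0" unfolding h_def using p by (auto simp: wp_minus)
    ultimately have "((\<lambda>z. h z / (1 - ee (z - p))) \<longlongrightarrow> deriv h p / - (2 * of_real pi * \<i>)) (at p)"
      by (rule lhopital_complex_simple) (auto simp: ee_def)
    moreover have "((\<lambda>z. k (z - p) * theta \<tau> (z + p)) \<longlongrightarrow> k (p - p) * theta \<tau> (p + p)) (at p)"
    proof -
      have "isCont (\<lambda>z. k (z - p)) p" "isCont (\<lambda>z. theta \<tau> (z + p)) p"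
        by (rule isCont_o2[OF _ k_cont] isCont_o2[OF _ th_cont], intro continuous_intros)+
      then have "isCont (\<lambda>z. k (z - p) * theta \<tau> (z + p)) p" by (intro continuous_intros)
      then show ?thesis unfolding isCont_def .
    qed
    moreover have "k (p - p) * theta \<tau> (p + p) \<noteq> 0" using k0 qq theta_nonzero p2 by simp
    ultimately have "((\<lambda>z. h z / (1 - ee (z - p)) / (k (z - p) * theta \<tau> (z + p))) \<longlongrightarrow>
       deriv h p / - (2 * of_real pi * \<i>) / (k (p - p) * theta \<tau> (p + p))) (at p)"
      by (rule tendsto_divide)
    moreover have "(\<lambda>z. h z / (1 - ee (z - p)) / (k (z - p) * theta \<tau> (z + p))) = f"
    proof
      fix z
      have "theta \<tau> (z + v) * theta \<tau> (z - v) = theta \<tau> (z - p) * theta \<tau> (z + p)" using p by (auto simp: mult.commute)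
      then show "h z / (1 - ee (z - p)) / (k (z - p) * theta \<tau> (z + p)) = f z"
        unfolding f_def h_def by (simp add: th[of "z - p"] mult_ac)
    qed
    ultimately show ?thesis by metis
  qed
  have per: "f (z + l) = f z" if l: "l \<in> period_lattice \<tau>" for z l
  proof -
    have *: "f (z + of_nat m * \<tau>) = f z" for m z
    proof (induction m)
      case (Suc m)
      have "z + of_nat (Suc m) * \<tau> = (z + of_nat m * \<tau>) + \<tau>" by (simp add: algebra_simps)
      then show ?case using Suc by (simp only: ft)
    qed simp
    have **: "f (z + of_nat m) = f z" for m z
    proof (induction m)
      case (Suc m)
      have "z + of_nat (Suc m) = (z + of_nat m) + 1" by (simp add: algebra_simps)
      then show ?case using Suc by (simp only: f1)
    qed simp
    obtain m n where l': "l = of_int m * \<tau> + of_int n" using l by (auto simp: period_lattice_def)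
    have a: "f (z + of_int m * \<tau>) = f z" for z
      using *[of z "nat m"] *[of "z + of_int m * \<tau>" "nat (- m)"] by (cases "m \<ge> 0") auto
    have b: "f (z + of_int n) = f z" for z
      using **[of z "nat n"] **[of "z + of_int n" "nat (- n)"] by (cases "n \<ge> 0") auto
    show ?thesis using a[of "z"] b[of "z + of_int m * \<tau>"] by (simp add: l' add.assoc)
  qed
  have lim: "\<exists>c. f \<midarrow>z\<rightarrow> c" for z
  proof (cases "z \<in> S")
    case False
    then have "isCont f z" using hol S_open
      by (auto dest!: holomorphic_on_imp_continuous_on simp: continuous_on_eq_continuous_at)
    then show ?thesis by (auto simp: isCont_def)
  next
    case True
    then consider "z \<in> period_lattice \<tau>" | "z + v \<in> period_lattice \<tau>" | "z - v \<in> period_lattice \<tau>"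
      by (auto simp: S_def)
    \<comment> \<open>By periodicity of \<open>f\<close>, every singularity is a lattice translate
      of 0, \<open>v\<close> or \<open>- v\<close>, where the limits are known.\<close>
    then obtain l where l: "l \<in> period_lattice \<tau>" "z - l = 0 \<or> z - l = v \<or> z - l = - v"
    proof cases
      case 1 then show ?thesis using that[of z] by simp
    next
      case 2 then show ?thesis using that[of "z + v"] by simp
    next
      case 3 then show ?thesis using that[of "z - v"] by simp
    qed
    then obtain c where "f \<midarrow>z - l\<rightarrow> c" using lim0 limv by metis
    then have "(\<lambda>w. f (w - l)) \<midarrow>z - l + l\<rightarrow> c" by (rule LIM_offset[where k = "- l", simplified])
    moreover have "f (w - l) = f w" for w using per[OF l(1), of "w - l"] by simp
    ultimately show ?thesis by auto
  qed
  define g where "g = remove_sings f"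
  have "g analytic_on {z}" for z
  proof -
    obtain c where c: "f \<midarrow>z\<rightarrow> c" using lim by blast
    obtain e where e: "e > 0" "ball z e - {z} \<subseteq> - S" using S_isol by blast
    have "isolated_singularity_at f z"
      unfolding isolated_singularity_at_def
      using e hol by (intro exI[of _ e] conjI) (auto simp: analytic_on_open open_delete intro: holomorphic_on_subset)
    then show ?thesis unfolding g_def using c by (rule remove_sings_analytic_at)
  qed
  then have "g analytic_on UNIV" by (subst analytic_on_analytic_at) auto
  then have g_hol: "g holomorphic_on UNIV" by (rule analytic_imp_holomorphic)
  have g_per: "g (z + l) = g z" if "l \<in> period_lattice \<tau>" for z l
  proof -
    have "g (z + l) = remove_sings (\<lambda>w. f (z + l + w)) 0" unfolding g_def by (rule remove_sings_shift_0)
    also have "(\<lambda>w. f (z + l + w)) = (\<lambda>w. f (z + w))"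
    proof
      fix w
      show "f (z + l + w) = f (z + w)" using per[OF that, of "z + w"] by (simp add: add_ac)
    qed
    also have "remove_sings \<dots> 0 = g z" unfolding g_def by (rule remove_sings_shift_0[symmetric])
    finally show ?thesis .
  qed
  obtain c where c: "\<And>z. g z = c"
    using elliptic_entire_constant[OF g_hol] g_per one_in_lattice tau_in_lattice by blast
  have "c = - 4 * qpoch (ee \<tau>) (ee \<tau>) ^ 4 / (theta \<tau> v * theta \<tau> (- v))"
    using c[of 0] lim0 unfolding g_def by (auto dest: remove_sings_eqI)
  moreover have "theta \<tau> v * theta \<tau> (- v) \<noteq> 0" using theta_nonzero v lattice_uminus by fastforce
  ultimately have cc: "c * (theta \<tau> v * theta \<tau> (- v)) = - 4 * qpoch (ee \<tau>) (ee \<tau>) ^ 4" by simp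
  show ?thesis
  proof (cases "u \<in> S")
    case False
    then have "f analytic_on {u}" using hol S_open by (meson ComplI analytic_at)
    then have "f u = c" using c[of u] by (simp add: g_def)
    moreover have nz: "theta \<tau> (u + v) * theta \<tau> (u - v) \<noteq> 0" using False theta_nonzero by (auto simp: S_def)
    ultimately have "(wp \<tau> u - wp \<tau> v) * (theta \<tau> u)\<^sup>2 = c * (theta \<tau> (u + v) * theta \<tau> (u - v))"
      unfolding f_def by (simp add: field_simps)
    then have "(wp \<tau> u - wp \<tau> v) * (theta \<tau> u)\<^sup>2 * (theta \<tau> v * theta \<tau> (- v)) =
        c * (theta \<tau> v * theta \<tau> (- v)) * (theta \<tau> (u + v) * theta \<tau> (u - v))" by simp
    then show ?thesis unfolding cc .
  next
    case True
    \<comment> \<open>Here \<open>u + v\<close> or \<open>u - v\<close> is a lattice point and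
      \<open>f\<close> says nothing, but both sides vanish: the right one by the zeros of
      \<open>theta\<close>, the left one because \<open>wp\<close> is even and periodic.\<close>
    have thl: "theta \<tau> l = 0" if ll: "l \<in> period_lattice \<tau>" for l
    proof -
      obtain m n where l: "l = of_int m * \<tau> + of_int n" using ll by (auto simp: period_lattice_def)
      have A: "theta \<tau> (z + of_int n) = theta \<tau> z" for z
      proof -
        have **: "theta \<tau> (z + of_nat m) = theta \<tau> z" for m z
        proof (induction m)
          case (Suc m)
          have "z + of_nat (Suc m) = (z + of_nat m) + 1" by (simp add: algebra_simps)
          then show ?case using Suc by (simp only: theta_plus_1)
        qed simp
        show ?thesis using **[of z "nat n"] **[of "z + of_int n" "nat (- n)"] by (cases "n \<ge> 0") auto
      qed
      have B: "theta \<tau> (z + of_nat m * \<tau>) = 0 \<longleftrightarrow> theta \<tau> z = 0" for m z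
      proof (induction m)
        case (Suc m)
        have "z + of_nat (Suc m) * \<tau> = (z + of_nat m * \<tau>) + \<tau>" by (simp add: algebra_simps)
        then show ?case using Suc by (simp only: theta_plus_\<tau>) simp
      qed simp
      have "theta \<tau> (0 + of_int m * \<tau>) = 0"
        using B[of 0 "nat m"] B[of "0 + of_int m * \<tau>" "nat (- m)"] theta_lattice_0 by (cases "m \<ge> 0") auto
      then show ?thesis using A by (simp add: l)
    qed
    have "u + v \<in> period_lattice \<tau> \<or> u - v \<in> period_lattice \<tau>" using True u by (auto simp: S_def)
    then have "theta \<tau> (u + v) * theta \<tau> (u - v) = 0" using thl by auto
    moreover have "wp \<tau> u = wp \<tau> v"
      using \<open>u + v \<in> period_lattice \<tau> \<or> u - v \<in> period_lattice \<tau>\<close> wp_plus_lattice[of "u - v" \<tau> v] wp_plus_lattice[of "u + v" \<tau> "- v"]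
      by (auto simp: wp_minus)
    ultimately show ?thesis by simp
  qed
qed

text \<open>The two-torsion case \<open>2v \<in> \<Lambda>\<close> follows by continuity in \<open>v\<close>.\<close>

lemma wp_eq_imp:
  assumes u: "u \<notin> period_lattice \<tau>" and v: "v \<notin> period_lattice \<tau>" and eq: "wp \<tau> u = wp \<tau> v"
  shows "u + v \<in> period_lattice \<tau> \<or> u - v \<in> period_lattice \<tau>"
proof -
  define L where "L = (\<lambda>v. (wp \<tau> u - wp \<tau> v) * (theta \<tau> u)\<^sup>2 * (theta \<tau> v * theta \<tau> (- v)))"
  define R where "R = (\<lambda>v. - 4 * qpoch (ee \<tau>) (ee \<tau>) ^ 4 * (theta \<tau> (u + v) * theta \<tau> (u - v)))"
  have "continuous_on (- period_lattice \<tau>) L" "continuous_on (- period_lattice \<tau>) R"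
    unfolding L_def R_def
    by (intro holomorphic_on_imp_continuous_on holomorphic_intros wp_fixed_holomorphic)+
  then have "isCont L v" "isCont R v" using v by (auto simp: continuous_on_eq_continuous_at[OF open_Compl[OF lattice_closed]])
  then have lims: "L \<midarrow>v\<rightarrow> L v" "R \<midarrow>v\<rightarrow> R v" by (auto simp: isCont_def)
  obtain e1 where e1: "e1 > 0" "\<And>l. l \<in> period_lattice \<tau> \<Longrightarrow> l \<noteq> v \<Longrightarrow> e1 \<le> dist v l" using lattice_isolated by blast
  obtain e2 where e2: "e2 > 0" "\<And>l. l \<in> period_lattice \<tau> \<Longrightarrow> l \<noteq> 2 * v \<Longrightarrow> e2 \<le> dist (2 * v) l" using lattice_isolated by blast
  have "R \<midarrow>v\<rightarrow> L v"
  proof (rule Lim_transform_within_open[OF lims(1) open_ball])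
    show "v \<in> ball v (min e1 (e2 / 2))" using e1 e2 by simp
    fix x assume x: "x \<in> ball v (min e1 (e2 / 2))" "x \<noteq> v"
    then have "x \<notin> period_lattice \<tau>" using e1(2)[of x] by auto
    moreover have "2 * v - 2 * x = 2 * (v - x)" by (simp add: algebra_simps)
    then have "dist (2 * v) (2 * x) = 2 * dist v x" by (simp only: dist_norm norm_mult) simp
    then have "2 * x \<notin> period_lattice \<tau>" using e2(2)[of "2 * x"] x by auto
    ultimately show "L x = R x" unfolding L_def R_def by (intro wp_theta_identity_generic u)
  qed
  then have "L v = R v" using lims(2) LIM_unique by blast
  moreover have "L v = 0" using eq by (simp add: L_def)
  moreover note qpoch_ee_tau_nonzero
  ultimately have "theta \<tau> (u + v) = 0 \<or> theta \<tau> (u - v) = 0" by (auto simp: R_def)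
  then show ?thesis using theta_nonzero by blast
qed

end

subsection \<open>The modular group and a Liouville theorem\<close>

abbreviation SLZ :: "(int ^ 2 ^ 2) set" where "SLZ \<equiv> carrier SL2"

abbreviation (input) UHP :: "complex set" where "UHP \<equiv> upper_half_plane"

definition mat22 :: "int \<Rightarrow> int \<Rightarrow> int \<Rightarrow> int \<Rightarrow> int ^ 2 ^ 2" where
  "mat22 a b c d = vector [vector [a, b], vector [c, d]]"

lemma mat22_nth [simp]:
  "mat22 a b c d $ 1 $ 1 = a" "mat22 a b c d $ 1 $ 2 = b" "mat22 a b c d $ 2 $ 1 = c" "mat22 a b c d $ 2 $ 2 = d"
  by (simp_all add: mat22_def)

lemma mat22_eqI:
  fixes A B :: "'a ^ 2 ^ 2"
  assumes "A $ 1 $ 1 = B $ 1 $ 1" "A $ 1 $ 2 = B $ 1 $ 2" "A $ 2 $ 1 = B $ 2 $ 1" "A $ 2 $ 2 = B $ 2 $ 2"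
  shows "A = B"
  using assms by (auto simp: vec_eq_iff forall_2)

lemma mat_mult_nth:
  fixes A B :: "'a::semiring_1 ^ 2 ^ 2"
  shows "(A ** B) $ i $ j = A $ i $ 1 * B $ 1 $ j + A $ i $ 2 * B $ 2 $ j"
  by (simp add: matrix_matrix_mult_def sum_2)

lemma SL2_iff: "A \<in> carrier SL2 \<longleftrightarrow> A $ 1 $ 1 * A $ 2 $ 2 - A $ 1 $ 2 * A $ 2 $ 1 = 1"
  by (simp add: SL2_def det_2)

lemma SL2_mult: "A \<in> carrier SL2 \<Longrightarrow> B \<in> carrier SL2 \<Longrightarrow> A ** B \<in> carrier SL2"
  by (simp add: SL2_def det_mul)

lemma SL2_one: "mat 1 \<in> carrier SL2"
  by (simp add: SL2_def)

lemma mat_1_nth [simp]: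
  shows "(mat 1 :: 'a::zero_neq_one ^ 2 ^ 2) $ 1 $ 1 = 1" and "(mat 1 :: 'a::zero_neq_one ^ 2 ^ 2) $ 1 $ 2 = 0"
    and "(mat 1 :: 'a::zero_neq_one ^ 2 ^ 2) $ 2 $ 1 = 0" and "(mat 1 :: 'a::zero_neq_one ^ 2 ^ 2) $ 2 $ 2 = 1"
  by (simp_all add: mat_def)

definition SL2_inv :: "int ^ 2 ^ 2 \<Rightarrow> int ^ 2 ^ 2" where
  "SL2_inv A = mat22 (A $ 2 $ 2) (- (A $ 1 $ 2)) (- (A $ 2 $ 1)) (A $ 1 $ 1)"

lemma SL2_inv_nth [simp]:
  "SL2_inv A $ 1 $ 1 = A $ 2 $ 2" "SL2_inv A $ 1 $ 2 = - (A $ 1 $ 2)"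
  "SL2_inv A $ 2 $ 1 = - (A $ 2 $ 1)" "SL2_inv A $ 2 $ 2 = A $ 1 $ 1"
  by (simp_all add: SL2_inv_def)

lemma SL2_inv_in [simp]: "A \<in> SLZ \<Longrightarrow> SL2_inv A \<in> SLZ"
  by (simp add: SL2_iff mult.commute[of "A $ 2 $ 2"])

lemma SL2_inv_mult: "A \<in> SLZ \<Longrightarrow> SL2_inv A ** A = mat 1" "A \<in> SLZ \<Longrightarrow> A ** SL2_inv A = mat 1"
proof -
  assume A: "A \<in> SLZ"
  have "(SL2_inv A ** A) $ 1 $ 1 = A $ 1 $ 1 * A $ 2 $ 2 - A $ 1 $ 2 * A $ 2 $ 1"
    "(SL2_inv A ** A) $ 2 $ 2 = A $ 1 $ 1 * A $ 2 $ 2 - A $ 1 $ 2 * A $ 2 $ 1"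
    "(A ** SL2_inv A) $ 1 $ 1 = A $ 1 $ 1 * A $ 2 $ 2 - A $ 1 $ 2 * A $ 2 $ 1"
    "(A ** SL2_inv A) $ 2 $ 2 = A $ 1 $ 1 * A $ 2 $ 2 - A $ 1 $ 2 * A $ 2 $ 1"
    "(SL2_inv A ** A) $ 1 $ 2 = 0" "(SL2_inv A ** A) $ 2 $ 1 = 0"
    "(A ** SL2_inv A) $ 1 $ 2 = 0" "(A ** SL2_inv A) $ 2 $ 1 = 0"
    by (simp_all add: mat_mult_nth algebra_simps)
  then show "SL2_inv A ** A = mat 1" "A ** SL2_inv A = mat 1"
    using A unfolding SL2_iff by (auto intro!: mat22_eqI)
qed

definition aut :: "int ^ 2 ^ 2 \<Rightarrow> complex \<Rightarrow> complex" where
  "aut A z = of_int (A $ 2 $ 1) * z + of_int (A $ 2 $ 2)"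

lemma aut_nonzero:
  assumes "A \<in> SLZ" "z \<in> UHP"
  shows "aut A z \<noteq> 0"
proof
  assume "aut A z = 0"
  then have "Im (aut A z) = 0" "Re (aut A z) = 0" by auto
  then have "A $ 2 $ 1 = 0" "A $ 2 $ 2 = 0" using assms by (auto simp: aut_def upper_half_plane_def)
  with assms(1) show False by (simp add: SL2_iff)
qed

lemma Im_moebius:
  assumes "A \<in> SLZ"
  shows "Im (moebius A z) = Im z / (norm (aut A z))\<^sup>2"
proof -
  define a b c d where "a = real_of_int (A $ 1 $ 1)" and "b = real_of_int (A $ 1 $ 2)"
    and "c = real_of_int (A $ 2 $ 1)" and "d = real_of_int (A $ 2 $ 2)"
  have det: "a * d - b * c = 1" using assms unfolding SL2_iff a_def b_def c_def d_def
    by (metis of_int_1 of_int_diff of_int_mult)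
  obtain x y where z: "z = Complex x y" by (cases z)
  have "moebius A z = Complex (a * x + b) (a * y) / Complex (c * x + d) (c * y)"
  proof -
    have "of_int (A $ 1 $ 1) * z + of_int (A $ 1 $ 2) = Complex (a * x + b) (a * y)"
      "of_int (A $ 2 $ 1) * z + of_int (A $ 2 $ 2) = Complex (c * x + d) (c * y)"
      by (simp_all add: a_def b_def c_def d_def z complex_eq_iff)
    then show ?thesis unfolding moebius_def by simp
  qed
  moreover have "aut A z = Complex (c * x + d) (c * y)"
    by (simp add: aut_def c_def d_def z complex_eq_iff)
  moreover have "a * y * (c * x + d) - (a * x + b) * (c * y) = y" 
  proof -
    have "a * y * (c * x + d) - (a * x + b) * (c * y) = (a * d - b * c) * y" by (simp add: algebra_simps)
    then show ?thesis using det by simp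
  qed
  ultimately show ?thesis by (simp add: Im_divide cmod_power2 z)
qed

lemma moebius_in_UHP:
  assumes "A \<in> SLZ" "z \<in> UHP"
  shows "moebius A z \<in> UHP"
  using assms aut_nonzero[OF assms] by (simp add: upper_half_plane_def Im_moebius)

lemma Im_pos_moebius_iff:
  assumes "A \<in> SLZ" "Im (moebius A z) > 0"
  shows "z \<in> UHP"
  using assms by (auto simp: upper_half_plane_def Im_moebius zero_less_divide_iff)

lemma aut_mult:
  assumes "B \<in> SLZ" "z \<in> UHP"
  shows "aut (A ** B) z = aut A (moebius B z) * aut B z"
proof -
  have "moebius B z * aut B z = of_int (B $ 1 $ 1) * z + of_int (B $ 1 $ 2)"
    using aut_nonzero[OF assms] by (simp add: moebius_def aut_def)
  then have "aut A (moebius B z) * aut B z =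
      of_int (A $ 2 $ 1) * (of_int (B $ 1 $ 1) * z + of_int (B $ 1 $ 2)) + of_int (A $ 2 $ 2) * aut B z"
    by (simp only: aut_def[of A] distrib_right mult.assoc)
  also have "\<dots> = aut (A ** B) z" by (simp add: aut_def mat_mult_nth algebra_simps)
  finally show ?thesis by simp
qed

lemma moebius_mult:
  assumes "A \<in> SLZ" "B \<in> SLZ" "z \<in> UHP"
  shows "moebius (A ** B) z = moebius A (moebius B z)"
proof -
  have nB: "aut B z \<noteq> 0" using aut_nonzero assms by blast
  have nA: "aut A (moebius B z) \<noteq> 0" using aut_nonzero moebius_in_UHP assms by blast
  define N where "N = of_int (B $ 1 $ 1) * z + of_int (B $ 1 $ 2)"
  have m: "moebius B z * aut B z = N" using nB by (simp add: moebius_def aut_def N_def)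
  have "moebius (A ** B) z = (of_int (A $ 1 $ 1) * N + of_int (A $ 1 $ 2) * aut B z) / aut (A ** B) z"
    unfolding moebius_def mat_mult_nth aut_def N_def by (simp add: algebra_simps)
  also have "of_int (A $ 1 $ 1) * N + of_int (A $ 1 $ 2) * aut B z =
     (of_int (A $ 1 $ 1) * moebius B z + of_int (A $ 1 $ 2)) * aut B z"
    unfolding m[symmetric] by (simp add: algebra_simps)
  finally show ?thesis unfolding aut_mult[OF assms(2,3)] using nB nA
    by (simp add: moebius_def[of A] aut_def[of A])
qed

lemma moebius_1 [simp]: "moebius (mat 1) z = z"
  by (simp add: moebius_def)

lemma moebius_inv:
  assumes "A \<in> SLZ" "z \<in> UHP"
  shows "moebius (SL2_inv A) (moebius A z) = z" "moebius A (moebius (SL2_inv A) z) = z"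
  using moebius_mult[of "SL2_inv A" A z] moebius_mult[of A "SL2_inv A" z] SL2_inv_mult[of A] assms by auto

lemma uminus_SL2: "A \<in> SLZ \<Longrightarrow> - A \<in> SLZ"
  by (simp add: SL2_iff)

lemma moebius_uminus [simp]: "moebius (- A) z = moebius A z"
proof -
  have "(- x) / (- y) = x / y" for x y :: complex by simp
  then show ?thesis unfolding moebius_def
    by (metis (no_types, lifting) add_uminus_conv_diff minus_add_distrib minus_mult_left of_int_minus vector_uminus_component)
qed

lemma open_UHP: "open UHP"
  unfolding upper_half_plane_def by (intro open_Collect_less continuous_intros)

lemma convex_UHP: "convex UHP"
  unfolding upper_half_plane_def using convex_halfspace_Im_gt[of 0] by simp

lemma connected_UHP: "connected UHP"
  using convex_UHP by (rule convex_connected)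

lemma moebius_has_deriv:
  assumes "A \<in> SLZ" "z \<in> UHP"
  shows "(moebius A has_field_derivative 1 / (aut A z)\<^sup>2) (at z)"
proof -
  define a b c d :: complex where "a = of_int (A $ 1 $ 1)" and "b = of_int (A $ 1 $ 2)"
    and "c = of_int (A $ 2 $ 1)" and "d = of_int (A $ 2 $ 2)"
  have det: "a * d - b * c = 1"
    using assms(1) unfolding SL2_iff a_def b_def c_def d_def by (metis of_int_1 of_int_diff of_int_mult)
  have lin: "((\<lambda>z. a * z + b) has_field_derivative a) (at z)" for a b :: complex
    by (auto intro!: derivative_eq_intros)
  have nz: "c * z + d \<noteq> 0" using aut_nonzero[OF assms] by (simp add: aut_def c_def d_def)
  have "((\<lambda>z. (a * z + b) / (c * z + d)) has_field_derivative
     (a * (c * z + d) - (a * z + b) * c) / ((c * z + d) * (c * z + d))) (at z)"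
    by (rule DERIV_divide[OF lin[of a b] lin[of c d] nz])
  also have "a * (c * z + d) - (a * z + b) * c = a * d - b * c" by (simp add: algebra_simps)
  also note det
  finally show ?thesis unfolding moebius_def[abs_def] aut_def power2_eq_square a_def b_def c_def d_def .
qed

lemma moebius_holomorphic: "A \<in> SLZ \<Longrightarrow> moebius A holomorphic_on UHP"
  using moebius_has_deriv open_UHP by (auto simp: holomorphic_on_open)

lemma holomorphic_moebius_compose:
  assumes "h holomorphic_on UHP" "A \<in> SLZ"
  shows "(\<lambda>z. h (moebius A z)) holomorphic_on UHP"
  using holomorphic_on_compose_gen[OF moebius_holomorphic[OF assms(2)] assms(1)] moebius_in_UHP[OF assms(2)]
  by (auto simp: o_def)

abbreviation (input) Tm :: "int \<Rightarrow> int ^ 2 ^ 2" where "Tm \<equiv> translation_matrix"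

lemma Tm_nth [simp]:
  "Tm h $ 1 $ 1 = 1" "Tm h $ 1 $ 2 = h" "Tm h $ 2 $ 1 = 0" "Tm h $ 2 $ 2 = 1"
  by (simp_all add: translation_matrix_def)

lemma Tm_in [simp]: "Tm h \<in> SLZ"
  by (simp add: SL2_iff)

lemma moebius_Tm [simp]: "moebius (Tm h) z = z + of_int h"
  by (simp add: moebius_def)

lemma aut_Tm [simp]: "aut (Tm h) z = 1"
  by (simp add: aut_def)

text \<open>A matrix with minimal \<open>norm (aut A z)\<close> makes the imaginary part maximal.
  After a translation into the strip, comparison with the inversion gives norm at least 1, so the
  squared imaginary part is at least 3/4; the weaker bound 1/2 is convenient and sufficient.\<close>

lemma SL2_reduction:
  assumes z: "z \<in> UHP"
  shows "\<exists>A\<in>SLZ. 1/2 \<le> Im (moebius A z) \<and> \<bar>Re (moebius A z)\<bar> \<le> 1/2"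
proof -
  have y: "Im z > 0" using z by (simp add: upper_half_plane_def)
  define V where "V = {norm (aut A z) |A. A \<in> SLZ \<and> norm (aut A z) \<le> 1}"
  define C where "C = nat \<lceil>1 / Im z\<rceil>"
  define D where "D = nat \<lceil>1 + of_nat C * norm z\<rceil>"
  \<comment> \<open>The imaginary part of \<open>c z + d\<close> bounds \<open>c\<close>, and then
    its norm bounds \<open>d\<close>; so only finitely many values up to 1 occur and a minimum
    exists.\<close>
  have "V \<subseteq> (\<lambda>(c, d). norm (of_int c * z + of_int d)) ` ({- int C..int C} \<times> {- int D..int D})"
  proof
    fix v assume "v \<in> V"
    then obtain A where A: "v = norm (aut A z)" "A \<in> SLZ" "norm (aut A z) \<le> 1" by (auto simp: V_def)
    define c where "c = A $ 2 $ 1" define d where "d = A $ 2 $ 2"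
    have au: "aut A z = of_int c * z + of_int d" by (simp add: aut_def c_def d_def)
    have "\<bar>of_int c\<bar> * Im z \<le> 1" using abs_Im_le_cmod[of "aut A z"] A(3) y by (simp add: au abs_mult)
    then have "\<bar>of_int c\<bar> \<le> 1 / Im z" using y by (simp add: field_simps)
    then have c: "\<bar>c\<bar> \<le> int C" unfolding C_def by linarith
    have "\<bar>of_int d\<bar> = norm (aut A z - of_int c * z)" by (simp add: au)
    also have "\<dots> \<le> 1 + \<bar>of_int c\<bar> * norm z"
      using norm_triangle_ineq4[of "aut A z" "of_int c * z"] A(3) by (simp add: norm_mult)
    also have "\<dots> \<le> 1 + of_nat C * norm z" using c by (intro add_left_mono mult_right_mono) auto
    finally have "\<bar>d\<bar> \<le> int D" unfolding D_def by linarith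
    with c show "v \<in> (\<lambda>(c, d). norm (of_int c * z + of_int d)) ` ({- int C..int C} \<times> {- int D..int D})"
      unfolding A(1) au by (auto intro!: image_eqI[of _ _ "(c, d)"])
  qed
  then have "finite V" by (rule finite_subset) auto
  moreover have "1 \<in> V" unfolding V_def by (auto intro!: exI[of _ "mat 1"] simp: SL2_one aut_def)
  ultimately have "Min V \<in> V" and minle: "\<And>v. v \<in> V \<Longrightarrow> Min V \<le> v" by (auto intro!: Min_in)
  then obtain A where A: "Min V = norm (aut A z)" "A \<in> SLZ" "norm (aut A z) \<le> 1" by (auto simp: V_def)
  have mina: "norm (aut A z) \<le> norm (aut B z)" if "B \<in> SLZ" for B
    using minle[of "norm (aut B z)"] that A by (cases "norm (aut B z) \<le> 1") (auto simp: V_def)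
  define n where "n = - round (Re (moebius A z))"
  define B where "B = Tm n ** A"
  have B: "B \<in> SLZ" unfolding B_def using A by (intro SL2_mult) auto
  define w where "w = moebius B z"
  have w: "w = moebius A z + of_int n" unfolding w_def B_def using A z by (simp add: moebius_mult)
  have autB: "aut B z = aut A z" unfolding B_def using A z by (simp add: aut_mult)
  have re: "\<bar>Re w\<bar> \<le> 1/2" unfolding w n_def using of_int_round_abs_le[of "Re (moebius A z)"] by (simp add: abs_minus_commute)
  have wH: "w \<in> UHP" unfolding w_def using B z by (rule moebius_in_UHP)
  \<comment> \<open>The inversion multiplies the automorphy factor by \<open>w\<close>, so
    minimality forces \<open>norm w \<ge> 1\<close>.\<close>
  define S where "S = mat22 0 (-1) 1 0"
  have S: "S \<in> SLZ" by (simp add: S_def SL2_iff)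
  have "norm (aut A z) \<le> norm (aut (S ** B) z)" by (rule mina) (use S B SL2_mult in blast)
  also have "aut (S ** B) z = w * aut A z"
    using B z by (simp add: aut_mult autB) (simp add: aut_def[of "mat22 _ _ _ _"] S_def w_def)
  finally have "1 * norm (aut A z) \<le> norm w * norm (aut A z)" by (simp add: norm_mult)
  then have "1 \<le> norm w" using aut_nonzero[OF A(2) z] by (subst (asm) mult_le_cancel_right) auto
  then have "1 \<le> (norm w)\<^sup>2" by (simp add: one_le_power)
  then have "1 \<le> (Re w)\<^sup>2 + (Im w)\<^sup>2" by (simp add: cmod_power2)
  moreover have "(Re w)\<^sup>2 \<le> (1/2)\<^sup>2" using re by (metis abs_le_square_iff abs_of_nonneg zero_le_divide_1_iff zero_le_numeral)
  ultimately have "(1/2)\<^sup>2 \<le> (Im w)\<^sup>2" by (simp add: power2_eq_square)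
  then have "1/2 \<le> Im w" using wH power2_le_imp_le[of "1/2" "Im w"] by (simp add: upper_half_plane_def)
  then show ?thesis using re B unfolding w_def by blast
qed

section \<open>A Liouville theorem on the upper half-plane\<close>

abbreviation iinf :: "complex filter" where "iinf \<equiv> filtercomap Im at_top"

lemma eventually_iinf: "eventually P iinf \<longleftrightarrow> (\<exists>M. \<forall>z. Im z > M \<longrightarrow> P z)"
  unfolding eventually_filtercomap eventually_at_top_dense by auto

lemma iinf_nontrivial [simp]: "iinf \<noteq> bot"
proof
  assume "iinf = bot"
  then obtain M where "\<And>z. Im z > M \<Longrightarrow> False" using eventually_iinf[of "\<lambda>_. False"] by auto
  from this[of "Complex 0 (M + 1)"] show False by simp
qed

lemma eventually_iinf_gt: "eventually (\<lambda>z. Im z > M) iinf"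
  by (subst eventually_iinf) auto

lemma eventually_iinf_UHP: "eventually (\<lambda>z. z \<in> UHP) iinf"
  using eventually_iinf_gt[of 0] by (simp add: upper_half_plane_def)

text \<open>Holomorphic functions on a connected open set have no zero divisors: where one factor is
  nonzero at a point, the remaining product vanishes nearby and hence everywhere by the identity
  theorem.\<close>

lemma holomorphic_prod_eq_0:
  assumes "finite F" "\<And>\<phi>. \<phi> \<in> F \<Longrightarrow> \<phi> holomorphic_on S" "open S" "connected S" "S \<noteq> {}"
    and "\<And>z. z \<in> S \<Longrightarrow> (\<Prod>\<phi>\<in>F. \<phi> z) = 0"
  shows "\<exists>\<phi>\<in>F. \<forall>z\<in>S. \<phi> z = 0"
  using assms(1,2,6)
proof (induction F rule: finite_induct)
  case empty
  then show ?case using \<open>S \<noteq> {}\<close> by auto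
next
  case (insert f F)
  show ?case
  proof (cases "\<forall>z\<in>S. f z = 0")
    case False
    then obtain p where p: "p \<in> S" "f p \<noteq> 0" by blast
    have fh: "f holomorphic_on S" using insert by auto
    have "continuous_on S f" using fh by (rule holomorphic_on_imp_continuous_on)
    then have "open (S \<inter> f -` (- {0}))" using \<open>open S\<close> by (intro continuous_open_preimage) auto
    define g where "g = (\<lambda>z. \<Prod>\<phi>\<in>F. \<phi> z)"
    have gh: "g holomorphic_on S" unfolding g_def using insert by (intro holomorphic_intros) auto
    have g0: "g z = 0" if "z \<in> S \<inter> f -` (- {0})" for z
      using insert.prems(2)[of z] insert.hyps that by (auto simp: g_def)
    have "p islimpt (S \<inter> f -` (- {0}))"
      using p by (intro interior_limit_point) (simp only: interior_open[OF \<open>open (S \<inter> f -` (- {0}))\<close>], auto)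
    then have "g z = 0" if "z \<in> S" for z
      using analytic_continuation[OF gh \<open>open S\<close> \<open>connected S\<close> _ p(1) _ g0 that] by blast
    then show ?thesis using insert.IH insert.prems unfolding g_def by auto
  qed auto
qed

text \<open>Takes the place of the maximum principle on a compact quotient. The product of
  \<open>\<phi> - c\<close> over the finitely many translates \<open>\<phi>\<close> of
  \<open>h\<close> is invariant under the full modular group. It tends to 0 at infinity, because one
  factor does and the others are bounded. So its norm attains a maximum, it is constant, and the
  constant is 0; then one factor vanishes identically.\<close>

lemma modular_liouville:
  assumes hol: "h holomorphic_on UHP"
    and fin: "finite ((\<lambda>A. restrict (\<lambda>z. h (moebius A z)) UHP) ` SLZ)"
    and bnd: "\<And>A. A \<in> SLZ \<Longrightarrow> \<exists>B. eventually (\<lambda>z. norm (h (moebius A z)) \<le> B) iinf"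
    and A0: "A0 \<in> SLZ" and lim: "((\<lambda>z. h (moebius A0 z)) \<longlongrightarrow> c) iinf"
    and z: "z \<in> UHP"
  shows "h z = c"
proof -
  define r where "r = (\<lambda>A. restrict (\<lambda>z. h (moebius A z)) UHP)"
  define F where "F = r ` SLZ"
  have finF: "finite F" using fin by (simp add: F_def r_def)
  define P where "P = (\<lambda>z. \<Prod>\<phi>\<in>F. \<phi> z - c)"
  \<comment> \<open>Right translation permutes the set of translates, hence the invariance of
    \<open>P\<close>. Restriction to the half-plane identifies translates that agree there.\<close>
  define \<Phi> where "\<Phi> = (\<lambda>A \<phi>. restrict (\<lambda>z. \<phi> (moebius A z)) UHP :: complex \<Rightarrow> complex)"
  have \<Phi>r: "\<Phi> A (r B) = r (B ** A)" if "A \<in> SLZ" "B \<in> SLZ" for A B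
    unfolding \<Phi>_def r_def using that by (auto simp: fun_eq_iff moebius_mult moebius_in_UHP)
  have bij: "bij_betw (\<Phi> A) F F" if A: "A \<in> SLZ" for A
  proof (rule bij_betwI[where g = "\<Phi> (SL2_inv A)"])
    have *: "\<Phi> A (\<Phi> (SL2_inv A) \<phi>) = \<phi> \<and> \<Phi> (SL2_inv A) (\<Phi> A \<phi>) = \<phi>" if \<phi>: "\<phi> \<in> F" for \<phi>
    proof -
      obtain B where B: "\<phi> = r B" "B \<in> SLZ" using \<phi> by (auto simp: F_def)
      have "B ** SL2_inv A ** A = B" "B ** A ** SL2_inv A = B"
        using SL2_inv_mult[OF A] by (simp_all flip: matrix_mul_assoc)
      then show ?thesis using A B by (simp add: \<Phi>r SL2_mult)
    qed
    show "\<Phi> A \<in> F \<rightarrow> F" "\<Phi> (SL2_inv A) \<in> F \<rightarrow> F" using A \<Phi>r by (auto simp: F_def intro!: imageI SL2_mult)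
    show "\<And>\<phi>. \<phi> \<in> F \<Longrightarrow> \<Phi> (SL2_inv A) (\<Phi> A \<phi>) = \<phi>" "\<And>\<phi>. \<phi> \<in> F \<Longrightarrow> \<Phi> A (\<Phi> (SL2_inv A) \<phi>) = \<phi>"
      using * by auto
  qed
  have inv: "P (moebius A z) = P z" if A: "A \<in> SLZ" and z: "z \<in> UHP" for A z
  proof -
    have "P z = (\<Prod>\<phi>\<in>F. \<Phi> A \<phi> z - c)" unfolding P_def by (rule prod.reindex_bij_betw[OF bij[OF A], symmetric])
    also have "\<dots> = P (moebius A z)" unfolding P_def \<Phi>_def using z by simp
    finally show ?thesis by simp
  qed
  have Fhol: "(\<lambda>z. \<phi> z - c) holomorphic_on UHP" if \<phi>: "\<phi> \<in> F" for \<phi>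
  proof -
    obtain B where B: "\<phi> = r B" "B \<in> SLZ" using \<phi> by (auto simp: F_def)
    have "\<phi> holomorphic_on UHP \<longleftrightarrow> (\<lambda>z. h (moebius B z)) holomorphic_on UHP"
      by (rule holomorphic_cong) (auto simp: B r_def)
    then show ?thesis using holomorphic_moebius_compose[OF hol B(2)] by (auto intro!: holomorphic_intros)
  qed
  have Phol: "P holomorphic_on UHP" unfolding P_def using Fhol by (intro holomorphic_on_prod) auto
  have Plim: "(P \<longlongrightarrow> 0) iinf"
  proof -
    have r0: "r A0 \<in> F" using A0 by (auto simp: F_def)
    have "(r A0 \<longlongrightarrow> c) iinf"
      by (rule Lim_transform_eventually[OF lim])
         (use eventually_iinf_UHP in \<open>auto elim!: eventually_mono simp: r_def\<close>)
    then have l1: "((\<lambda>z. r A0 z - c) \<longlongrightarrow> 0) iinf" by (simp add: LIM_zero)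
    have "\<exists>B. eventually (\<lambda>z. norm (\<Prod>\<phi>\<in>G. \<phi> z - c) \<le> B) iinf" if "finite G" "G \<subseteq> F" for G
      using that
    proof (induction G rule: finite_induct)
      case empty
      then show ?case by (intro exI[of _ 1]) auto
    next
      case (insert \<phi> G)
      then obtain B where B: "eventually (\<lambda>z. norm (\<Prod>\<phi>\<in>G. \<phi> z - c) \<le> B) iinf" by auto
      obtain A where A: "\<phi> = r A" "A \<in> SLZ" using insert by (auto simp: F_def)
      obtain B' where B': "eventually (\<lambda>z. norm (h (moebius A z)) \<le> B') iinf" using bnd[OF A(2)] by blast
      have "eventually (\<lambda>z. norm (\<Prod>\<phi>\<in>insert \<phi> G. \<phi> z - c) \<le> (B' + norm c) * B) iinf"
        using B B' eventually_iinf_UHP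
      proof eventually_elim
        case (elim z)
        have "norm (\<phi> z - c) \<le> B' + norm c"
          using elim norm_triangle_ineq4[of "\<phi> z" c] by (simp add: A r_def)
        then show ?case using insert.hyps elim by (auto simp: norm_mult intro!: mult_mono order_trans[OF norm_ge_zero])
      qed
      then show ?case by blast
    qed
    then obtain B where "eventually (\<lambda>z. norm (\<Prod>\<phi>\<in>F - {r A0}. \<phi> z - c) \<le> B) iinf" using finF by blast
    then have "((\<lambda>z. (r A0 z - c) * (\<Prod>\<phi>\<in>F - {r A0}. \<phi> z - c)) \<longlongrightarrow> 0) iinf"
      by (rule lim_null_mult_right_bounded[OF l1])
    then show ?thesis unfolding P_def by (subst prod.remove[OF finF r0])
  qed
  have P0: "P z = 0" if z1: "z \<in> UHP" for z
  proof (rule ccontr)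
    assume nz: "P z \<noteq> 0"
    then have "eventually (\<lambda>w. norm (P w) < norm (P z)) iinf"
      using tendstoD[OF Plim, of "norm (P z)"] by simp
    then obtain M where M: "\<And>w. Im w > M \<Longrightarrow> norm (P w) < norm (P z)" by (auto simp: eventually_iinf)
    \<comment> \<open>Above height \<open>M\<close> the product is smaller in norm than at
      \<open>z\<close>, so its maximum over the reduced strip, and by invariance over the whole
      half-plane, is attained in this compact box.\<close>
    define K where "K = cbox (Complex (-1/2) (1/2)) (Complex (1/2) M)"
    have KH: "K \<subseteq> UHP" by (auto simp: K_def in_cbox_complex_iff upper_half_plane_def)
    obtain A where A: "A \<in> SLZ" "1/2 \<le> Im (moebius A z)" "\<bar>Re (moebius A z)\<bar> \<le> 1/2"
      using SL2_reduction[OF z1] by blast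
    have "\<not> Im (moebius A z) > M" using M[of "moebius A z"] inv[OF A(1) z1] by auto
    then have mK: "moebius A z \<in> K" using A by (auto simp: K_def in_cbox_complex_iff)
    have "continuous_on K (\<lambda>z. norm (P z))"
      using holomorphic_on_imp_continuous_on[OF Phol] KH by (intro continuous_intros continuous_on_subset[of UHP P K])
    then obtain p where p: "p \<in> K" "\<And>w. w \<in> K \<Longrightarrow> norm (P w) \<le> norm (P p)"
      using continuous_attains_sup[of K "\<lambda>z. norm (P z)"] mK by (auto simp: K_def)
    have ge: "norm (P z) \<le> norm (P p)" using p(2)[OF mK] inv[OF A(1) z1] by simp
    have max: "norm (P w) \<le> norm (P p)" if w: "w \<in> UHP" for w
    proof -
      obtain B where B: "B \<in> SLZ" "1/2 \<le> Im (moebius B w)" "\<bar>Re (moebius B w)\<bar> \<le> 1/2"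
        using SL2_reduction[OF w] by blast
      show ?thesis
      proof (cases "Im (moebius B w) > M")
        case True
        then show ?thesis using M[OF True] ge inv[OF B(1) w] by simp
      next
        case False
        then have "moebius B w \<in> K" using B by (auto simp: K_def in_cbox_complex_iff)
        then show ?thesis using p(2) inv[OF B(1) w] by fastforce
      qed
    qed
    have "P constant_on UHP"
      by (rule maximum_modulus_principle[OF Phol open_UHP connected_UHP open_UHP subset_refl]) (use p KH max in auto)
    then obtain k where k: "\<And>w. w \<in> UHP \<Longrightarrow> P w = k" by (auto simp: constant_on_def)
    define w where "w = Complex 0 (max M 0 + 1)"
    have "w \<in> UHP" "Im w > M" by (auto simp: w_def upper_half_plane_def)
    then show False using M[of w] k[of w] k[OF z1] by simp
  qed
  define F' where "F' = (\<lambda>\<phi> z. \<phi> z - c) ` F"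
  have inj: "inj_on (\<lambda>\<phi> z. \<phi> z - c) F" by (auto simp: inj_on_def fun_eq_iff)
  have "(\<Prod>\<psi>\<in>F'. \<psi> w) = 0" if "w \<in> UHP" for w
    using P0[OF that] unfolding F'_def P_def by (subst prod.reindex[OF inj]) (simp add: o_def)
  then have "\<exists>\<psi>\<in>F'. \<forall>w\<in>UHP. \<psi> w = 0"
    using finF Fhol z by (intro holomorphic_prod_eq_0[OF _ _ open_UHP connected_UHP]) (auto simp: F'_def)
  then obtain A where A: "A \<in> SLZ" "\<And>w. w \<in> UHP \<Longrightarrow> h (moebius A w) = c"
    by (auto simp: F'_def F_def r_def)
  then have "h (moebius A (moebius (SL2_inv A) z)) = c" using moebius_in_UHP[OF SL2_inv_in[OF A(1)] z] by blast
  then show ?thesis using moebius_inv(2)[OF A(1) z] by simp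
qed

subsection \<open>Orders at the cusp at infinity\<close>

text \<open>In the variable \<open>q = ee (z / h)\<close> the function becomes a bounded holomorphic
  function on a punctured disc, so the singularity at 0 is removable. It is defined by the principal
  logarithm; periodicity hides the branch cut.\<close>

lemma q_expansion:
  fixes h M B :: real
  assumes hol: "F holomorphic_on {z. Im z > M}" and h: "h > 0"
    and per: "\<And>z. Im z > M \<Longrightarrow> F (z + of_real h) = F z"
    and bnd: "\<And>z. Im z > M \<Longrightarrow> norm (F z) \<le> B"
  shows "\<exists>g. g analytic_on {0} \<and> (\<forall>z. Im z > M \<longrightarrow> F z = g (ee (z / of_real h)))"
proof -
  define \<rho> where "\<rho> = exp (- 2 * pi * M / h)"
  have \<rho>: "\<rho> > 0" by (simp add: \<rho>_def)
  define \<psi> where "\<psi> = (\<lambda>q. of_real h * Ln q / (2 * of_real pi * \<i>))"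
  define k where "k = (\<lambda>q. F (\<psi> q))"
  have per_nat: "F (z + of_nat n * of_real h) = F z" if "Im z > M" for z n
  proof (induction n)
    case (Suc n)
    have "z + of_nat (Suc n) * of_real h = (z + of_nat n * of_real h) + of_real h" by (simp add: algebra_simps)
    moreover have "Im (z + of_nat n * of_real h) > M" using that by simp
    ultimately show ?case using Suc per by metis
  qed simp
  have per_int: "F (z + of_int n * of_real h) = F z" if z: "Im z > M" for z n
  proof (cases "n \<ge> 0")
    case True
    then show ?thesis using per_nat[OF z, of "nat n"] by simp
  next
    case False
    have "Im (z + of_int n * of_real h) > M" using z by simp
    from per_nat[OF this, of "nat (- n)"] False show ?thesis by simp
  qed
  have small: "norm (ee (z / of_real h)) < \<rho> \<longleftrightarrow> Im z > M" for z
    unfolding norm_ee \<rho>_def using h by (simp add: field_simps)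
  have ee_eq: "ee (z / of_real h) = exp (2 * of_real pi * \<i> * z / of_real h)" for z by (simp add: ee_def)
  have eq: "F z = k (ee (z / of_real h))" if z: "Im z > M" for z
  proof -
    have "exp (Ln (ee (z / of_real h))) = exp (2 * of_real pi * \<i> * z / of_real h)" by (simp add: ee_eq)
    then obtain n :: int where n: "Ln (ee (z / of_real h)) = 2 * of_real pi * \<i> * z / of_real h + (of_int (2 * n) * pi) * \<i>"
      unfolding exp_eq by blast
    have "\<psi> (ee (z / of_real h)) = z + of_int n * of_real h"
      unfolding \<psi>_def n using h by (simp add: field_simps)
    then show ?thesis using per_int[OF z] by (simp add: k_def)
  qed
  have khol: "k holomorphic_on (ball 0 \<rho> - {0})"
  proof -
    have "k field_differentiable (at q0)" if q0: "q0 \<in> ball 0 \<rho> - {0}" for q0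
    proof -
      \<comment> \<open>A branch of the logarithm around \<open>q0\<close>: in this disc
        \<open>q / q0\<close> has positive real part and stays off the cut. It differs from the
        principal branch by periods of \<open>F\<close>, so \<open>F (\<xi> q)\<close> equals
        \<open>k q\<close>.\<close>
      define \<xi> where "\<xi> = (\<lambda>q. \<psi> q0 + of_real h * Ln (q / q0) / (2 * of_real pi * \<i>))"
      define U where "U = ball q0 (norm q0) \<inter> ball 0 \<rho>"
      have q0U: "q0 \<in> U" "open U" "q0 \<noteq> 0" using q0 by (auto simp: U_def)
      have slit: "q / q0 \<notin> \<real>\<^sub>\<le>\<^sub>0" if "q \<in> U" for q
      proof -
        have "norm (1 - q / q0) < 1"
        proof -
          have "1 - q / q0 = (q0 - q) / q0" using q0U by (simp add: field_simps)
          moreover have "norm (q0 - q) < norm q0" using that by (auto simp: U_def dist_norm)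
          ultimately show ?thesis using q0U by (simp add: norm_divide)
        qed
        then have "Re (q / q0) > 0" using complex_Re_le_cmod[of "1 - q / q0"] by simp
        then show ?thesis by (auto simp: complex_nonpos_Reals_iff)
      qed
      have \<xi>hol: "\<xi> holomorphic_on U" unfolding \<xi>_def using slit q0U by (intro holomorphic_intros) auto
      have e0: "ee (\<psi> q0 / of_real h) = q0"
      proof -
        have "2 * of_real pi * \<i> * \<psi> q0 / of_real h = Ln q0" unfolding \<psi>_def using h by (simp add: field_simps)
        then show ?thesis using q0U by (simp add: ee_eq)
      qed
      have e1: "ee (\<xi> q / of_real h) = q" if "q \<in> U" "q \<noteq> 0" for q
      proof -
        have "\<xi> q / of_real h = \<psi> q0 / of_real h + Ln (q / q0) / (2 * of_real pi * \<i>)"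
          unfolding \<xi>_def using h by (simp add: field_simps)
        then have "ee (\<xi> q / of_real h) = q0 * ee (Ln (q / q0) / (2 * of_real pi * \<i>))" using e0 by (simp add: ee_add)
        also have "ee (Ln (q / q0) / (2 * of_real pi * \<i>)) = q / q0" using that q0U by (simp add: ee_def)
        finally show ?thesis using q0U by simp
      qed
      have nz: "q \<noteq> 0" if "q \<in> U" for q using slit[OF that] by auto
      have im: "Im (\<xi> q) > M" if "q \<in> U" for q
        using small[of "\<xi> q"] e1[OF that nz[OF that]] that by (simp add: U_def)
      have "(\<lambda>q. F (\<xi> q)) holomorphic_on U"
        using holomorphic_on_compose_gen[OF \<xi>hol hol] im by (auto simp: o_def)
      moreover have "F (\<xi> q) = k q" if "q \<in> U" for q
        using eq[OF im[OF that]] e1[OF that nz[OF that]] by simp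
      ultimately have "k holomorphic_on U" by (subst holomorphic_cong[OF refl, of _ _ "\<lambda>q. F (\<xi> q)"]) auto
      then show ?thesis using q0U holomorphic_on_imp_differentiable_at by blast
    qed
    then show ?thesis unfolding holomorphic_on_def by (auto intro: field_differentiable_at_within)
  qed
  have "eventually (\<lambda>q. norm (k q) \<le> B) (at 0)"
  proof -
    have "eventually (\<lambda>q. q \<in> ball 0 \<rho> - {0}) (at 0)"
      using \<rho> by (intro eventually_at_in_open) auto
    then show ?thesis
    proof eventually_elim
      case (elim q)
      have "ee (\<psi> q / of_real h) = q"
      proof -
        have "2 * of_real pi * \<i> * \<psi> q / of_real h = Ln q" unfolding \<psi>_def using h by (simp add: field_simps)
        then show ?thesis using elim by (simp add: ee_eq)
      qed
      then have "Im (\<psi> q) > M" using small[of "\<psi> q"] elim by simp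
      then show ?case unfolding k_def by (rule bnd)
    qed
  qed
  then obtain g where g: "g holomorphic_on ball 0 \<rho>" "\<And>q. q \<in> ball 0 \<rho> - {0} \<Longrightarrow> g q = k q"
    using holomorphic_on_extend_bounded[OF khol] \<rho> by auto
  have "g analytic_on {0}" using g(1) \<rho> by (auto simp: analytic_at intro!: exI[of _ "ball 0 \<rho>"])
  moreover have "F z = g (ee (z / of_real h))" if "Im z > M" for z
    using eq[OF that] g(2)[of "ee (z / of_real h)"] small[of z] that by simp
  ultimately show ?thesis by blast
qed

text \<open>Orders in \<open>q = exp (2\<pi>iz)\<close> as \<open>Im z \<rightarrow> \<infinity>\<close>; fractional orders occur at cusps of width greater than 1.\<close>

definition order_ge :: "(complex \<Rightarrow> complex) \<Rightarrow> real \<Rightarrow> bool" where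
  "order_ge f r \<longleftrightarrow> (\<exists>B. eventually (\<lambda>z. norm (f z) \<le> B * norm (ee (of_real r * z))) iinf)"

definition has_order :: "(complex \<Rightarrow> complex) \<Rightarrow> real \<Rightarrow> bool" where
  "has_order f r \<longleftrightarrow> (\<exists>c. c \<noteq> 0 \<and> ((\<lambda>z. f z / ee (of_real r * z)) \<longlongrightarrow> c) iinf)"

lemma ee_0 [simp]: "ee 0 = 1" by (simp add: ee_def)

lemma order_geE:
  assumes "order_ge f r"
  obtains B where "B > 0" "eventually (\<lambda>z. norm (f z) \<le> B * norm (ee (of_real r * z))) iinf"
proof -
  from assms obtain B where B: "eventually (\<lambda>z. norm (f z) \<le> B * norm (ee (of_real r * z))) iinf"
    by (auto simp: order_ge_def)
  have "eventually (\<lambda>z. norm (f z) \<le> max B 1 * norm (ee (of_real r * z))) iinf"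
    using B
  proof eventually_elim
    case (elim z)
    have "B * norm (ee (of_real r * z)) \<le> max B 1 * norm (ee (of_real r * z))" by (intro mult_right_mono) auto
    with elim show ?case by linarith
  qed
  then show ?thesis by (intro that[of "max B 1"]) auto
qed

lemma order_ge_cong:
  assumes "eventually (\<lambda>z. f z = g z) iinf"
  shows "order_ge f r \<longleftrightarrow> order_ge g r"
proof -
  have *: "order_ge g r" if "eventually (\<lambda>z. f z = g z) iinf" "order_ge f r" for f g
  proof -
    from that(2) obtain B where "eventually (\<lambda>z. norm (f z) \<le> B * norm (ee (of_real r * z))) iinf"
      by (auto simp: order_ge_def)
    with that(1) have "eventually (\<lambda>z. norm (g z) \<le> B * norm (ee (of_real r * z))) iinf"
      by eventually_elim simp
    then show ?thesis by (auto simp: order_ge_def)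
  qed
  show ?thesis using *[of f g] *[of g f] assms by (auto simp: eq_commute)
qed

lemma order_ge_mono:
  assumes "order_ge f r" "s \<le> r"
  shows "order_ge f s"
proof -
  obtain B where B: "B > 0" "eventually (\<lambda>z. norm (f z) \<le> B * norm (ee (of_real r * z))) iinf"
    using order_geE[OF assms(1)] .
  have "eventually (\<lambda>z. norm (f z) \<le> B * norm (ee (of_real s * z))) iinf"
    using B(2) eventually_iinf_gt[of 0]
  proof eventually_elim
    case (elim z)
    have "norm (ee (of_real r * z)) \<le> norm (ee (of_real s * z))"
      using assms(2) elim by (simp add: norm_ee mult_right_mono)
    then have "B * norm (ee (of_real r * z)) \<le> B * norm (ee (of_real s * z))" using B(1) by (intro mult_left_mono) auto
    with elim show ?case by linarith
  qed
  then show ?thesis by (auto simp: order_ge_def)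
qed

lemma order_ge_add:
  assumes "order_ge f r" "order_ge g r"
  shows "order_ge (\<lambda>z. f z + g z) r"
proof -
  obtain B where B: "B > 0" "eventually (\<lambda>z. norm (f z) \<le> B * norm (ee (of_real r * z))) iinf"
    using order_geE[OF assms(1)] .
  obtain C where C: "C > 0" "eventually (\<lambda>z. norm (g z) \<le> C * norm (ee (of_real r * z))) iinf"
    using order_geE[OF assms(2)] .
  have "eventually (\<lambda>z. norm (f z + g z) \<le> (B + C) * norm (ee (of_real r * z))) iinf"
    using B(2) C(2)
  proof eventually_elim
    case (elim z)
    then show ?case using norm_triangle_ineq[of "f z" "g z"] by (simp add: distrib_right)
  qed
  then show ?thesis by (auto simp: order_ge_def)
qed

lemma order_ge_mult:
  assumes "order_ge f r" "order_ge g s"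
  shows "order_ge (\<lambda>z. f z * g z) (r + s)"
proof -
  obtain B where B: "B > 0" "eventually (\<lambda>z. norm (f z) \<le> B * norm (ee (of_real r * z))) iinf"
    using order_geE[OF assms(1)] .
  obtain C where C: "C > 0" "eventually (\<lambda>z. norm (g z) \<le> C * norm (ee (of_real s * z))) iinf"
    using order_geE[OF assms(2)] .
  have "eventually (\<lambda>z. norm (f z * g z) \<le> (B * C) * norm (ee (of_real (r + s) * z))) iinf"
    using B(2) C(2)
  proof eventually_elim
    case (elim z)
    have "norm (f z) * norm (g z) \<le> (B * norm (ee (of_real r * z))) * (C * norm (ee (of_real s * z)))"
      using elim B C by (intro mult_mono) auto
    also have "\<dots> = B * C * norm (ee (of_real (r + s) * z))"
      by (simp add: distrib_right ee_add norm_mult)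
    finally show ?case by (simp add: norm_mult)
  qed
  then show ?thesis by (auto simp: order_ge_def)
qed

lemma order_ge_const: "order_ge (\<lambda>_. c) 0"
  by (auto simp: order_ge_def intro!: exI[of _ "norm c"])

lemma order_ge_cmult: "order_ge f r \<Longrightarrow> order_ge (\<lambda>z. c * f z) r"
  using order_ge_mult[OF order_ge_const[of c]] by simp

lemma order_ge_minus: "order_ge f r \<Longrightarrow> order_ge g r \<Longrightarrow> order_ge (\<lambda>z. f z - g z) r"
  using order_ge_add[of f r "\<lambda>z. (- 1) * g z"] order_ge_cmult[of g r "- 1"] by simp

lemma order_ge_power: "order_ge f r \<Longrightarrow> order_ge (\<lambda>z. f z ^ n) (of_nat n * r)"
proof (induction n)
  case 0
  then show ?case using order_ge_const[of 1] by simp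
next
  case (Suc n)
  then show ?case using order_ge_mult[of f r "\<lambda>z. f z ^ n" "of_nat n * r"] by (simp add: algebra_simps)
qed

lemma order_ge_bounded: "order_ge f 0 \<longleftrightarrow> (\<exists>B. eventually (\<lambda>z. norm (f z) \<le> B) iinf)"
  by (simp add: order_ge_def)

lemma tendsto_imp_order_ge_0:
  assumes "(f \<longlongrightarrow> c) iinf"
  shows "order_ge f 0"
proof -
  have "eventually (\<lambda>z. dist (f z) c < 1) iinf" using assms by (rule tendstoD) simp
  then have "eventually (\<lambda>z. norm (f z) \<le> norm c + 1) iinf"
  proof eventually_elim
    case (elim z)
    then show ?case using norm_triangle_ineq2[of "f z" c] by (simp add: dist_norm)
  qed
  then show ?thesis by (auto simp: order_ge_bounded)
qed

lemma ee_order_tendsto_0: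
  assumes "r > 0"
  shows "((\<lambda>z. ee (of_real r * z)) \<longlongrightarrow> 0) iinf"
proof -
  have "filterlim (\<lambda>y. exp (- 2 * pi * (r * y))) (nhds 0) at_top"
    using assms by real_asymp
  then have "((\<lambda>z. exp (- 2 * pi * (r * Im z))) \<longlongrightarrow> 0) iinf"
    by (rule filterlim_compose) (rule filterlim_filtercomap)
  then have "((\<lambda>z. norm (ee (of_real r * z))) \<longlongrightarrow> 0) iinf" by (simp add: norm_ee)
  then show ?thesis by (rule tendsto_norm_zero_cancel)
qed

lemma order_ge_tendsto_0:
  assumes "order_ge f r" "r > 0"
  shows "(f \<longlongrightarrow> 0) iinf"
proof -
  obtain B where B: "B > 0" "eventually (\<lambda>z. norm (f z) \<le> B * norm (ee (of_real r * z))) iinf"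
    using order_geE[OF assms(1)] .
  have "((\<lambda>z. B * norm (ee (of_real r * z))) \<longlongrightarrow> 0) iinf"
    using tendsto_mult_right_zero[OF tendsto_norm_zero[OF ee_order_tendsto_0[OF assms(2)]], of B] .
  then show ?thesis by (rule Lim_null_comparison[OF B(2)])
qed

lemma has_order_mult:
  assumes "has_order f r" "has_order g s"
  shows "has_order (\<lambda>z. f z * g z) (r + s)"
proof -
  obtain c where c: "c \<noteq> 0" "((\<lambda>z. f z / ee (of_real r * z)) \<longlongrightarrow> c) iinf" using assms(1) by (auto simp: has_order_def)
  obtain d where d: "d \<noteq> 0" "((\<lambda>z. g z / ee (of_real s * z)) \<longlongrightarrow> d) iinf" using assms(2) by (auto simp: has_order_def)
  have "((\<lambda>z. f z * g z / ee (of_real (r + s) * z)) \<longlongrightarrow> c * d) iinf"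
    using tendsto_mult[OF c(2) d(2)] by (simp add: ee_add distrib_right)
  then show ?thesis using c d unfolding has_order_def by (intro exI[of _ "c * d"]) auto
qed

lemma has_order_divide:
  assumes "has_order f r" "has_order g s"
  shows "has_order (\<lambda>z. f z / g z) (r - s)"
proof -
  obtain c where c: "c \<noteq> 0" "((\<lambda>z. f z / ee (of_real r * z)) \<longlongrightarrow> c) iinf" using assms(1) by (auto simp: has_order_def)
  obtain d where d: "d \<noteq> 0" "((\<lambda>z. g z / ee (of_real s * z)) \<longlongrightarrow> d) iinf" using assms(2) by (auto simp: has_order_def)
  have "((\<lambda>z. f z / g z / ee (of_real (r - s) * z)) \<longlongrightarrow> c / d) iinf"
    using tendsto_divide[OF c(2) d(2,1)] by (simp add: ee_diff left_diff_distrib field_simps)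
  then show ?thesis using c d unfolding has_order_def by (intro exI[of _ "c / d"]) auto
qed

lemma has_order_cmult: "has_order f r \<Longrightarrow> k \<noteq> 0 \<Longrightarrow> has_order (\<lambda>z. k * f z) r"
proof -
  assume "has_order f r" "k \<noteq> 0"
  then obtain c where c: "c \<noteq> 0" "((\<lambda>z. f z / ee (of_real r * z)) \<longlongrightarrow> c) iinf" by (auto simp: has_order_def)
  from tendsto_mult_left[OF c(2), of k] c(1) \<open>k \<noteq> 0\<close> show ?thesis
    unfolding has_order_def by (intro exI[of _ "k * c"]) (auto simp: mult.assoc)
qed

lemma has_order_power: "has_order f r \<Longrightarrow> has_order (\<lambda>z. f z ^ n) (of_nat n * r)"
proof (induction n)
  case 0
  then show ?case by (auto simp: has_order_def intro!: exI[of _ 1])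
next
  case (Suc n)
  then show ?case using has_order_mult[of f r "\<lambda>z. f z ^ n" "of_nat n * r"] by (simp add: algebra_simps)
qed

lemma has_order_imp_order_ge:
  assumes "has_order f r"
  shows "order_ge f r"
proof -
  obtain c where c: "((\<lambda>z. f z / ee (of_real r * z)) \<longlongrightarrow> c) iinf" using assms by (auto simp: has_order_def)
  have "order_ge (\<lambda>z. ee (of_real r * z)) r" by (auto simp: order_ge_def intro!: exI[of _ 1])
  from order_ge_mult[OF tendsto_imp_order_ge_0[OF c] this] show ?thesis by simp
qed

lemma order_ge_divide:
  assumes "order_ge f r" "has_order g s"
  shows "order_ge (\<lambda>z. f z / g z) (r - s)"
proof -
  have "has_order (\<lambda>_. 1) 0" by (auto simp: has_order_def intro!: exI[of _ 1])
  from has_order_divide[OF this assms(2)] have "order_ge (\<lambda>z. 1 / g z) (- s)"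
    using has_order_imp_order_ge by fastforce
  from order_ge_mult[OF assms(1) this] show ?thesis by simp
qed

lemma has_order_cong:
  assumes "eventually (\<lambda>z. f z = g z) iinf"
  shows "has_order f r \<longleftrightarrow> has_order g r"
proof -
  have "((\<lambda>z. f z / ee (of_real r * z)) \<longlongrightarrow> c) iinf \<longleftrightarrow> ((\<lambda>z. g z / ee (of_real r * z)) \<longlongrightarrow> c) iinf" for c
    by (rule filterlim_cong[OF refl refl]) (use assms in \<open>auto elim!: eventually_mono\<close>)
  then show ?thesis by (simp add: has_order_def)
qed

text \<open>Since \<open>n\<close> is an integer, \<open>ee (n z / h)\<close> has period
  \<open>h\<close> too; dividing by it keeps the period and makes the function bounded.\<close>

lemma periodic_order_expansion:
  fixes h :: real and n :: int
  assumes hol: "F holomorphic_on UHP" and h: "h > 0"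
    and per: "\<And>z. z \<in> UHP \<Longrightarrow> F (z + of_real h) = F z"
    and ord: "order_ge F (of_int n / h)"
  shows "\<exists>g. g analytic_on {0} \<and> eventually (\<lambda>z. F z = g (ee (z / of_real h)) * ee (of_int n * z / of_real h)) iinf"
proof -
  define E where "E = (\<lambda>z. ee (of_int n * z / of_real h))"
  have Ep: "E (z + of_real h) = E z" for z
  proof -
    have "of_int n * (z + of_real h) / of_real h = of_int n * z / of_real h + of_int n" using h by (simp add: field_simps)
    then show ?thesis by (simp add: E_def ee_add)
  qed
  obtain B where B: "eventually (\<lambda>z. norm (F z) \<le> B * norm (ee (of_real (of_int n / h) * z))) iinf"
    using ord by (auto simp: order_ge_def)
  have Ee: "ee (of_real (of_int n / h) * z) = E z" for z by (simp add: E_def field_simps)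
  from B obtain M0 where M0: "\<And>z. Im z > M0 \<Longrightarrow> norm (F z) \<le> B * norm (E z)" unfolding Ee eventually_iinf by blast
  define M where "M = max M0 0"
  have "\<exists>g. g analytic_on {0} \<and> (\<forall>z. Im z > M \<longrightarrow> F z / E z = g (ee (z / of_real h)))"
  proof (rule q_expansion[where B = B])
    show "(\<lambda>z. F z / E z) holomorphic_on {z. Im z > M}"
    proof (intro holomorphic_intros)
      show "F holomorphic_on {z. Im z > M}"
        by (rule holomorphic_on_subset[OF hol]) (auto simp: M_def upper_half_plane_def)
      show "E holomorphic_on {z. Im z > M}" unfolding E_def using h by (intro holomorphic_intros) auto
    qed (auto simp: E_def)
    show "F (z + of_real h) / E (z + of_real h) = F z / E z" if "Im z > M" for z
      using per[of z] that by (simp add: Ep M_def upper_half_plane_def)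
    show "norm (F z / E z) \<le> B" if "Im z > M" for z
      using M0[of z] that by (simp add: norm_divide M_def E_def divide_simps)
  qed (use h in auto)
  then obtain g where g: "g analytic_on {0}" "\<And>z. Im z > M \<Longrightarrow> F z / E z = g (ee (z / of_real h))" by blast
  have "F z = g (ee (z / of_real h)) * E z" if "Im z > M" for z
    using g(2)[OF that] by (simp add: E_def field_simps)
  then show ?thesis using g(1) unfolding E_def by (auto simp: eventually_iinf intro!: exI[of _ g] exI[of _ M])
qed

lemma ee_at_cusp:
  assumes "h > 0"
  shows "filterlim (\<lambda>z. ee (z / of_real h)) (at 0) iinf"
proof -
  have "((\<lambda>z. ee (of_real (1 / h) * z)) \<longlongrightarrow> 0) iinf" by (rule ee_order_tendsto_0) (use assms in auto)
  then show ?thesis by (simp add: filterlim_at)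
qed

text \<open>The exponents of a function of period \<open>h\<close> lie in the multiples of
  \<open>1 / h\<close>, so removing the leading term gains a full step. This drives the induction
  over pole orders and the rounding of orders at cusps.\<close>

lemma periodic_order_leading:
  fixes h :: real and n :: int
  assumes hol: "F holomorphic_on UHP" and h: "h > 0"
    and per: "\<And>z. z \<in> UHP \<Longrightarrow> F (z + of_real h) = F z"
    and ord: "order_ge F (of_int n / h)"
  shows "\<exists>a. ((\<lambda>z. F z / ee (of_int n * z / of_real h)) \<longlongrightarrow> a) iinf \<and>
    order_ge (\<lambda>z. F z - a * ee (of_int n * z / of_real h)) (of_int (n + 1) / h)"
proof -
  obtain g where g: "g analytic_on {0}" "eventually (\<lambda>z. F z = g (ee (z / of_real h)) * ee (of_int n * z / of_real h)) iinf"
    using periodic_order_expansion[OF assms] by blast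
  define E where "E = (\<lambda>z. ee (of_int n * z / of_real h))"
  define q where "q = (\<lambda>z. ee (z / of_real h))"
  have q0: "filterlim q (at 0) iinf" unfolding q_def by (rule ee_at_cusp[OF h])
  obtain g' where "(g has_field_derivative g') (at 0)"
    using g(1) analytic_on_imp_differentiable_at field_differentiable_def by blast
  then have dq: "((\<lambda>x. (g x - g 0) / x) \<longlongrightarrow> g') (at 0)" by (simp add: has_field_derivative_iff)
  have "isCont g 0" using g(1) analytic_at_imp_isCont by blast
  then have "((\<lambda>z. g (q z)) \<longlongrightarrow> g 0) iinf" using q0 filterlim_compose isCont_def by blast
  moreover have "eventually (\<lambda>z. g (q z) = F z / E z) iinf"
    using g(2) by eventually_elim (simp add: q_def E_def)
  ultimately have lim: "((\<lambda>z. F z / E z) \<longlongrightarrow> g 0) iinf" by (rule Lim_transform_eventually)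
  have "order_ge (\<lambda>z. (g (q z) - g 0) / q z) 0"
    by (rule tendsto_imp_order_ge_0[OF filterlim_compose[OF dq q0]])
  moreover have "order_ge (\<lambda>z. q z * E z) (of_int (n + 1) / h)"
  proof -
    have "q z * E z = ee (of_real (of_int (n + 1) / h) * z)" for z
      unfolding q_def E_def ee_add[symmetric] by (simp add: field_simps add_divide_distrib)
    then show ?thesis by (auto simp: order_ge_def intro!: exI[of _ 1])
  qed
  ultimately have "order_ge (\<lambda>z. (g (q z) - g 0) / q z * (q z * E z)) (0 + of_int (n + 1) / h)"
    by (rule order_ge_mult)
  moreover have "eventually (\<lambda>z. (g (q z) - g 0) / q z * (q z * E z) = F z - g 0 * E z) iinf"
    using g(2)
  proof eventually_elim
    case (elim z)
    then have "F z = g (q z) * E z" by (simp add: q_def E_def)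
    moreover have "q z \<noteq> 0" by (simp add: q_def)
    ultimately have "(g (q z) - g 0) / q z * (q z * E z) = (g (q z) - g 0) * E z" by simp
    then show ?case unfolding \<open>F z = g (q z) * E z\<close> by (simp only: left_diff_distrib)
  qed
  ultimately have "order_ge (\<lambda>z. F z - g 0 * E z) (of_int (n + 1) / h)" using order_ge_cong by fastforce
  with lim show ?thesis unfolding E_def by blast
qed

text \<open>Turns meromorphy in the cusp coordinate, as in the definition of modular functions, into
  a lower bound for the order: a power of the coordinate clears the principal part of the Laurent
  series.\<close>

lemma meromorphic_cusp_order:
  assumes g: "g meromorphic_on {0}" and h: "h > 0"
  shows "\<exists>n::nat. order_ge (\<lambda>z. g (ee (z / of_real h))) (- of_nat n / h)"
proof -
  obtain L where L: "(\<lambda>w. g (0 + w)) has_laurent_expansion L" using g by (auto simp: meromorphic_on_def)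
  define n where "n = nat (- fls_subdegree L)"
  have "(\<lambda>w. w ^ n * g w) has_laurent_expansion (fls_X ^ n * L)"
    using L by (intro laurent_expansion_intros) simp
  moreover have "fls_subdegree (fls_X ^ n * L) \<ge> 0"
  proof (cases "L = 0")
    case False
    then show ?thesis by (simp add: fls_subdegree_mult n_def)
  qed simp
  ultimately have "(\<lambda>w. w ^ n * g w) \<midarrow>0\<rightarrow> fls_nth (fls_X ^ n * L) 0"
    by (rule has_laurent_expansion_imp_tendsto_0)
  then have "((\<lambda>z. ee (z / of_real h) ^ n * g (ee (z / of_real h))) \<longlongrightarrow> fls_nth (fls_X ^ n * L) 0) iinf"
    using filterlim_compose[OF _ ee_at_cusp[OF h]] by blast
  then have "order_ge (\<lambda>z. ee (z / of_real h) ^ n * g (ee (z / of_real h))) 0" by (rule tendsto_imp_order_ge_0)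
  moreover have "has_order (\<lambda>z. ee (z / of_real h)) (1 / h)"
    by (auto simp: has_order_def intro!: exI[of _ 1])
  then have "has_order (\<lambda>z. ee (z / of_real h) ^ n) (of_nat n * (1 / h))" by (rule has_order_power)
  ultimately have "order_ge (\<lambda>z. ee (z / of_real h) ^ n * g (ee (z / of_real h)) / ee (z / of_real h) ^ n) (0 - of_nat n * (1 / h))"
    by (rule order_ge_divide)
  then show ?thesis by (intro exI[of _ n]) simp
qed

subsection \<open>Division values\<close>

lemma lattice_rational:
  fixes a b N :: int
  assumes z: "z \<in> UHP" and N: "N \<noteq> 0" and mem: "(of_int a * z + of_int b) / of_int N \<in> period_lattice z"
  shows "N dvd a \<and> N dvd b"
proof -
  obtain m n where "(of_int a * z + of_int b) / of_int N = of_int m * z + of_int n"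
    using mem by (auto simp: period_lattice_def)
  then have eq: "of_int a * z + of_int b = of_int (N * m) * z + of_int (N * n)" using N by (simp add: field_simps)
  then have "of_int a * Im z = of_int (N * m) * Im z" by (simp add: complex_eq_iff)
  then have a: "a = N * m" using z by (simp add: upper_half_plane_def del: of_int_mult)
  with eq have "(of_int b :: complex) = of_int (N * n)" by simp
  then have "b = N * n" by (simp only: of_int_eq_iff)
  with a show ?thesis by simp
qed

lemma wp_rational_cong:
  fixes a b a' b' N :: int
  assumes "N \<noteq> 0" "N dvd a - a'" "N dvd b - b'"
  shows "wp z ((of_int a * z + of_int b) / of_int N) = wp z ((of_int a' * z + of_int b') / of_int N)"
proof -
  obtain k l where kl: "a - a' = N * k" "b - b' = N * l" using assms by (auto elim!: dvdE)
  have "(of_int a * z + of_int b) / of_int N - (of_int a' * z + of_int b') / of_int N = (of_int (a - a') * z + of_int (b - b')) / of_int N"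
    by (simp add: diff_divide_distrib algebra_simps add_divide_distrib)
  also have "\<dots> = of_int k * z + of_int l" unfolding kl using assms(1) by (simp add: add_divide_distrib)
  finally have "(of_int a * z + of_int b) / of_int N = (of_int a' * z + of_int b') / of_int N + (of_int k * z + of_int l)"
    by (simp add: algebra_simps)
  moreover have "of_int k * z + of_int l \<in> period_lattice z" by (auto simp: period_lattice_def)
  ultimately show ?thesis using wp_plus_lattice by metis
qed

lemma wp_rational_minus:
  "wp z ((of_int (- a) * z + of_int (- b)) / of_int N) = wp z ((of_int a * z + of_int b) / of_int N)"
proof -
  have "(of_int (- a) * z + of_int (- b)) / of_int N = - ((of_int a * z + of_int b) / of_int N)"
    by (simp add: minus_divide_left)
  then show ?thesis by (simp only: wp_minus)
qed

lemma wp_diff_moebius: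
  assumes A: "A \<in> SLZ" and z: "z \<in> UHP" and "u \<notin> period_lattice z" "v \<notin> period_lattice z"
  shows "wp (moebius A z) (u / aut A z) - wp (moebius A z) (v / aut A z) = (aut A z)\<^sup>2 * (wp z u - wp z v)"
  unfolding moebius_def aut_def
  using assms moebius_in_UHP[OF A z]
  by (intro wp_diff_transform) (auto simp: SL2_iff upper_half_plane_def moebius_def)

subsection \<open>Two-torsion and the discriminant\<close>

definition ehalf :: "int \<Rightarrow> int \<Rightarrow> complex \<Rightarrow> complex" where
  "ehalf m n z = wp z ((of_int m * z + of_int n) / 2)"

text \<open>Up to a constant, a square root of the discriminant of the Weierstrass cubic, that is,
  the twelfth power of the Dedekind eta function.\<close>

definition delta :: "complex \<Rightarrow> complex" where
  "delta z = (ehalf 0 1 z - ehalf 1 0 z) * (ehalf 1 0 z - ehalf 1 1 z) * (ehalf 1 1 z - ehalf 0 1 z)"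

lemma ehalf_cong: "even (m - m') \<Longrightarrow> even (n - n') \<Longrightarrow> ehalf m n z = ehalf m' n' z"
  using wp_rational_cong[of 2 m m' n n' z] by (simp add: ehalf_def)

lemma ehalf_parity:
  "\<lbrakk>even m; odd n\<rbrakk> \<Longrightarrow> ehalf m n z = ehalf 0 1 z"
  "\<lbrakk>odd m; even n\<rbrakk> \<Longrightarrow> ehalf m n z = ehalf 1 0 z"
  "\<lbrakk>odd m; odd n\<rbrakk> \<Longrightarrow> ehalf m n z = ehalf 1 1 z"
  by (rule ehalf_cong; simp)+

lemma half_not_lattice:
  assumes "z \<in> UHP" "odd m \<or> odd n"
  shows "(of_int m * z + of_int n) / 2 \<notin> period_lattice z"
  using lattice_rational[OF assms(1), of 2 m n] assms(2) by auto

lemma ehalf_distinct: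
  assumes z: "z \<in> UHP" and "odd m \<or> odd n" "odd m' \<or> odd n'" "odd (m - m') \<or> odd (n - n')"
  shows "ehalf m n z \<noteq> ehalf m' n' z"
proof
  assume "ehalf m n z = ehalf m' n' z"
  then have "wp z ((of_int m * z + of_int n) / 2) = wp z ((of_int m' * z + of_int n') / 2)" by (simp add: ehalf_def)
  moreover have "Im z > 0" using z by (simp add: upper_half_plane_def)
  ultimately have "(of_int m * z + of_int n) / 2 + (of_int m' * z + of_int n') / 2 \<in> period_lattice z \<or>
     (of_int m * z + of_int n) / 2 - (of_int m' * z + of_int n') / 2 \<in> period_lattice z"
    using assms by (intro wp_eq_imp half_not_lattice) auto
  moreover have "(of_int m * z + of_int n) / 2 + (of_int m' * z + of_int n') / 2 = (of_int (m + m') * z + of_int (n + n')) / 2"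
    "(of_int m * z + of_int n) / 2 - (of_int m' * z + of_int n') / 2 = (of_int (m - m') * z + of_int (n - n')) / 2"
    by (auto simp: add_divide_distrib diff_divide_distrib algebra_simps)
  moreover have "odd (m + m') \<or> odd (n + n')" using assms(4) by simp
  ultimately show False using half_not_lattice[OF z] assms(4) by metis
qed

lemma delta_nonzero: "z \<in> UHP \<Longrightarrow> delta z \<noteq> 0"
  using ehalf_distinct[of z 0 1 1 0] ehalf_distinct[of z 1 0 1 1] ehalf_distinct[of z 1 1 0 1]
  by (simp add: delta_def)

lemma ehalf_holomorphic:
  assumes "odd m \<or> odd n"
  shows "ehalf m n holomorphic_on UHP"
  unfolding ehalf_def[abs_def]
  by (rule wp_holomorphic[OF open_UHP]) (use assms half_not_lattice in \<open>auto intro!: holomorphic_intros simp: upper_half_plane_def\<close>)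

lemma delta_holomorphic: "delta holomorphic_on UHP"
  unfolding delta_def[abs_def] by (intro holomorphic_intros ehalf_holomorphic) auto

lemma ehalf_diff_moebius:
  assumes A: "A \<in> SLZ" and z: "z \<in> UHP" and par: "odd m \<or> odd n" "odd m' \<or> odd n'"
  shows "ehalf m n (moebius A z) - ehalf m' n' (moebius A z) = (aut A z)\<^sup>2 *
     (ehalf (m * A $ 1 $ 1 + n * A $ 2 $ 1) (m * A $ 1 $ 2 + n * A $ 2 $ 2) z -
      ehalf (m' * A $ 1 $ 1 + n' * A $ 2 $ 1) (m' * A $ 1 $ 2 + n' * A $ 2 $ 2) z)"
proof -
  define U where "U = (\<lambda>m n. (of_int (m * A $ 1 $ 1 + n * A $ 2 $ 1) * z + of_int (m * A $ 1 $ 2 + n * A $ 2 $ 2)) / 2)"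
  have nz: "aut A z \<noteq> 0" using A z by (rule aut_nonzero)
  have m: "moebius A z = (of_int (A $ 1 $ 1) * z + of_int (A $ 1 $ 2)) / aut A z" by (simp add: moebius_def aut_def)
  have U: "U m n / aut A z = (of_int m * moebius A z + of_int n) / 2" for m n
  proof -
    have "(of_int m * moebius A z + of_int n) * aut A z = of_int (m * A $ 1 $ 1 + n * A $ 2 $ 1) * z + of_int (m * A $ 1 $ 2 + n * A $ 2 $ 2)"
      unfolding m using nz by (simp add: distrib_right) (simp add: aut_def algebra_simps)
    then show ?thesis unfolding U_def using nz by (simp add: field_simps)
  qed
  have det: "A $ 1 $ 1 * A $ 2 $ 2 - A $ 1 $ 2 * A $ 2 $ 1 = 1" using A by (simp add: SL2_iff)
  have par': "odd (m * A $ 1 $ 1 + n * A $ 2 $ 1) \<or> odd (m * A $ 1 $ 2 + n * A $ 2 $ 2)" if "odd m \<or> odd n" for m n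
  proof -
    have "odd (A $ 1 $ 1 * A $ 2 $ 2 - A $ 1 $ 2 * A $ 2 $ 1)" unfolding det by simp
    then show ?thesis using that by (auto simp: even_add even_mult_iff)
  qed
  have nl: "U m n \<notin> period_lattice z" if "odd m \<or> odd n" for m n
    unfolding U_def by (rule half_not_lattice[OF z par'[OF that]])
  from wp_diff_moebius[OF A z nl[OF par(1)] nl[OF par(2)]] show ?thesis
    unfolding U by (simp add: ehalf_def U_def)
qed

text \<open>The matrix permutes the three points of order 2 evenly, i.e. its reduction modulo 2 is the identity
  or has order 3.\<close>

definition even_perm :: "int ^ 2 ^ 2 \<Rightarrow> bool" where
  "even_perm A \<longleftrightarrow> (odd (A $ 1 $ 1) \<and> even (A $ 1 $ 2) \<and> even (A $ 2 $ 1) \<and> odd (A $ 2 $ 2)) \<or>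
     (odd (A $ 1 $ 2) \<and> odd (A $ 2 $ 1) \<and> (odd (A $ 1 $ 1) \<noteq> odd (A $ 2 $ 2)))"

definition psign :: "int ^ 2 ^ 2 \<Rightarrow> complex" where
  "psign A = (if even_perm A then 1 else -1)"

lemma psign_sq [simp]: "psign A * psign A = 1" "(psign A)\<^sup>2 = 1"
  by (auto simp: psign_def)

text \<open>Each difference contributes weight 2, while the matrix permutes the three half-periods.
  The six parity patterns are the elements of \<open>SL\<^sub>2\<close> over the field of two
  elements, and an alternating product picks up the sign of the permutation.\<close>

lemma delta_moebius:
  assumes A: "A \<in> SLZ" and z: "z \<in> UHP"
  shows "delta (moebius A z) = psign A * aut A z ^ 6 * delta z"
proof -
  define a b c d where "a = A $ 1 $ 1" and "b = A $ 1 $ 2" and "c = A $ 2 $ 1" and "d = A $ 2 $ 2"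
  have det: "a * d - b * c = 1" using A by (simp add: SL2_iff a_def b_def c_def d_def)
  have "odd (a * d - b * c)" unfolding det by simp
  then have par: "odd (a * d) \<noteq> odd (b * c)" by (simp add: even_add)
  have "delta (moebius A z) = (aut A z)\<^sup>2 * (ehalf c d z - ehalf a b z) * ((aut A z)\<^sup>2 * (ehalf a b z - ehalf (a + c) (b + d) z))
     * ((aut A z)\<^sup>2 * (ehalf (a + c) (b + d) z - ehalf c d z))"
    unfolding delta_def by (simp add: ehalf_diff_moebius[OF A z] a_def b_def c_def d_def)
  also have "\<dots> = aut A z ^ 6 * ((ehalf c d z - ehalf a b z) * (ehalf a b z - ehalf (a + c) (b + d) z) * (ehalf (a + c) (b + d) z - ehalf c d z))"
    by (simp add: power_numeral_reduce mult_ac)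
  also have "(ehalf c d z - ehalf a b z) * (ehalf a b z - ehalf (a + c) (b + d) z) * (ehalf (a + c) (b + d) z - ehalf c d z)
     = psign A * delta z"
  proof -
    define x y w where "x = ehalf 0 1 z" and "y = ehalf 1 0 z" and "w = ehalf 1 1 z"
    have del: "delta z = (x - y) * (y - w) * (w - x)" by (simp add: delta_def x_def y_def w_def)
    have ep: "even_perm A \<longleftrightarrow> (odd a \<and> even b \<and> even c \<and> odd d) \<or> (odd b \<and> odd c \<and> (odd a \<noteq> odd d))"
      by (simp add: even_perm_def a_def b_def c_def d_def)
    note par2 = ehalf_parity(1)[of _ _ z, folded x_def] ehalf_parity(2)[of _ _ z, folded y_def] ehalf_parity(3)[of _ _ z, folded w_def]
    consider "odd a" "even b" "even c" "odd d" | "odd a" "odd b" "even c" "odd d" | "odd a" "even b" "odd c" "odd d"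
      | "even a" "odd b" "odd c" "odd d" | "odd a" "odd b" "odd c" "even d" | "even a" "odd b" "odd c" "even d"
      using par by (auto simp: even_mult_iff)
    then show ?thesis
      unfolding del psign_def ep
      by cases (simp_all add: par2 even_add, simp_all add: algebra_simps)
  qed
  finally show ?thesis by simp
qed

text \<open>Multiplicativity is read off from the transformation of \<open>delta\<close> at one
  point, where neither \<open>delta\<close> nor the automorphy factor vanishes; no products of
  parity patterns have to be inspected.\<close>

lemma psign_mult:
  assumes "A \<in> SLZ" "B \<in> SLZ"
  shows "psign (A ** B) = psign A * psign B"
proof -
  have z: "\<i> \<in> UHP" by (simp add: upper_half_plane_def)
  have zB: "moebius B \<i> \<in> UHP" using assms z moebius_in_UHP by blast
  have "psign (A ** B) * aut (A ** B) \<i> ^ 6 * delta \<i> = delta (moebius (A ** B) \<i>)"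
    using delta_moebius[OF SL2_mult[OF assms] z] by simp
  also have "\<dots> = psign A * aut A (moebius B \<i>) ^ 6 * (psign B * aut B \<i> ^ 6 * delta \<i>)"
    using assms z zB by (simp add: moebius_mult delta_moebius)
  also have "\<dots> = psign A * psign B * aut (A ** B) \<i> ^ 6 * delta \<i>"
    using assms z by (simp add: aut_mult power_mult_distrib)
  finally show ?thesis using delta_nonzero[OF z] aut_nonzero[OF SL2_mult[OF assms] z] by simp
qed

lemma psign_uminus [simp]: "psign (- A) = psign A"
  by (simp add: psign_def even_perm_def)

subsection \<open>Seven-torsion\<close>

text \<open>The pair \<open>(c, d)\<close> is the bottom row of a matrix of \<open>SL\<^sub>2(\<int>)\<close>, modulo 7. The matrix carries the difference for
  \<open>(0, 1)\<close> to the one for \<open>(c, d)\<close>; all functions indexed by \<open>c\<close> and \<open>d\<close> below follow this convention.\<close>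

definition dd :: "int \<Rightarrow> int \<Rightarrow> int \<Rightarrow> int \<Rightarrow> complex \<Rightarrow> complex" where
  "dd i j c d z = wp z ((of_int (i * c) * z + of_int (i * d)) / 7) - wp z ((of_int (j * c) * z + of_int (j * d)) / 7)"

definition prim7 :: "int \<Rightarrow> int \<Rightarrow> bool" where
  "prim7 c d \<longleftrightarrow> \<not> (7 dvd c \<and> 7 dvd d)"

lemma prime_7_int: "prime (7::int)"
  by (simp add: prime_int_numeral_eq)

lemma dvd7_mult_iff: "(7::int) dvd i * c \<longleftrightarrow> 7 dvd i \<or> 7 dvd c"
  using prime_7_int by (rule prime_dvd_mult_iff)

lemma prim7_SL2: "A \<in> SLZ \<Longrightarrow> prim7 (A $ 2 $ 1) (A $ 2 $ 2)"
proof -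
  assume A: "A \<in> SLZ"
  show ?thesis unfolding prim7_def
  proof
    assume "7 dvd A $ 2 $ 1 \<and> 7 dvd A $ 2 $ 2"
    then have "7 dvd A $ 1 $ 1 * A $ 2 $ 2 - A $ 1 $ 2 * A $ 2 $ 1" by (intro dvd_diff dvd_mult) auto
    with A show False by (simp add: SL2_iff)
  qed
qed

lemma seventh_not_lattice:
  assumes z: "z \<in> UHP" and "\<not> 7 dvd i" and "prim7 c d"
  shows "(of_int (i * c) * z + of_int (i * d)) / 7 \<notin> period_lattice z"
  using lattice_rational[OF z, of 7 "i * c" "i * d"] assms by (auto simp: dvd7_mult_iff prim7_def)

lemma dd_nonzero:
  assumes z: "z \<in> UHP" and "prim7 c d" "\<not> 7 dvd i" "\<not> 7 dvd j" "\<not> 7 dvd i + j" "\<not> 7 dvd i - j"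
  shows "dd i j c d z \<noteq> 0"
proof
  assume "dd i j c d z = 0"
  then have "wp z ((of_int (i * c) * z + of_int (i * d)) / 7) = wp z ((of_int (j * c) * z + of_int (j * d)) / 7)"
    by (simp add: dd_def)
  moreover have "Im z > 0" using z by (simp add: upper_half_plane_def)
  ultimately have "(of_int (i * c) * z + of_int (i * d)) / 7 + (of_int (j * c) * z + of_int (j * d)) / 7 \<in> period_lattice z \<or>
     (of_int (i * c) * z + of_int (i * d)) / 7 - (of_int (j * c) * z + of_int (j * d)) / 7 \<in> period_lattice z"
    using assms by (intro wp_eq_imp seventh_not_lattice) auto
  moreover have "(of_int (i * c) * z + of_int (i * d)) / 7 + (of_int (j * c) * z + of_int (j * d)) / 7
       = (of_int ((i + j) * c) * z + of_int ((i + j) * d)) / 7"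
    "(of_int (i * c) * z + of_int (i * d)) / 7 - (of_int (j * c) * z + of_int (j * d)) / 7
       = (of_int ((i - j) * c) * z + of_int ((i - j) * d)) / 7"
    by (auto simp: add_divide_distrib diff_divide_distrib algebra_simps)
  ultimately show False using seventh_not_lattice[OF z] assms by metis
qed

lemma dd_holomorphic:
  assumes "prim7 c d" "\<not> 7 dvd i" "\<not> 7 dvd j"
  shows "dd i j c d holomorphic_on UHP"
  unfolding dd_def[abs_def]
  by (intro holomorphic_on_diff wp_holomorphic[OF open_UHP])
     (use assms seventh_not_lattice in \<open>auto intro!: holomorphic_intros simp: upper_half_plane_def simp del: of_int_mult\<close>)

lemma dd_moebius:
  assumes A: "A \<in> SLZ" and z: "z \<in> UHP" and ij: "\<not> 7 dvd i" "\<not> 7 dvd j"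
  shows "dd i j 0 1 (moebius A z) = (aut A z)\<^sup>2 * dd i j (A $ 2 $ 1) (A $ 2 $ 2) z"
proof -
  have nz: "aut A z \<noteq> 0" using A z by (rule aut_nonzero)
  have U: "(of_int (i * A $ 2 $ 1) * z + of_int (i * A $ 2 $ 2)) / 7 / aut A z = (of_int (i * 0) * moebius A z + of_int (i * 1)) / 7" for i
  proof -
    have "of_int (i * A $ 2 $ 1) * z + of_int (i * A $ 2 $ 2) = of_int i * aut A z" by (simp add: aut_def algebra_simps)
    then show ?thesis using nz by simp
  qed
  from wp_diff_moebius[OF A z seventh_not_lattice[OF z ij(1) prim7_SL2[OF A]] seventh_not_lattice[OF z ij(2) prim7_SL2[OF A]]]
  show ?thesis unfolding U by (simp only: dd_def)
qed

lemma dd_cong: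
  assumes "7 dvd c - c'" "7 dvd d - d'"
  shows "dd i j c d z = dd i j c' d' z"
proof -
  have "wp z ((of_int (i * c) * z + of_int (i * d)) / of_int 7) = wp z ((of_int (i * c') * z + of_int (i * d')) / of_int 7)" for i
    by (rule wp_rational_cong) (use assms in \<open>auto simp: right_diff_distrib[symmetric]\<close>)
  then show ?thesis by (simp add: dd_def)
qed

subsection \<open>Behaviour at the cusps\<close>

lemma csc_sq_limit:
  fixes \<alpha> :: real
  assumes "\<alpha> > 0"
  shows "((\<lambda>z. csc_sq (of_real \<alpha> * z + \<beta>) / ee (of_real \<alpha> * z)) \<longlongrightarrow> - 4 * ee \<beta>) iinf"
proof -
  have "((\<lambda>z. - 4 * ee \<beta> / (1 - ee (of_real \<alpha> * z) * ee \<beta>)\<^sup>2) \<longlongrightarrow> - 4 * ee \<beta> / (1 - 0 * ee \<beta>)\<^sup>2) iinf"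
    by (intro tendsto_intros ee_order_tendsto_0 assms) auto
  moreover have "(\<lambda>z. csc_sq (of_real \<alpha> * z + \<beta>) / ee (of_real \<alpha> * z)) = (\<lambda>z. - 4 * ee \<beta> / (1 - ee (of_real \<alpha> * z) * ee \<beta>)\<^sup>2)"
    by (auto simp: csc_sq_ee ee_add)
  ultimately show ?thesis by simp
qed

lemma csc_sq_has_order: "(\<alpha>::real) > 0 \<Longrightarrow> has_order (\<lambda>z. csc_sq (of_real \<alpha> * z + \<beta>)) \<alpha>"
  using csc_sq_limit[of \<alpha> \<beta>] unfolding has_order_def by (intro exI[of _ "- 4 * ee \<beta>"]) auto

text \<open>The row \<open>n = -1\<close> is reflected by evenness so that its exponent is
  \<open>1 - \<sigma>\<close>; both exponents are then nonnegative and the error has order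
  1.\<close>

lemma wp_cusp_approx:
  fixes \<sigma> :: real and \<beta> :: real
  assumes "0 \<le> \<sigma>" "\<sigma> < 1"
  shows "order_ge (\<lambda>z. wp z (of_real \<sigma> * z + of_real \<beta>) - csc_sq (of_real \<sigma> * z + of_real \<beta>)
      - csc_sq (of_real (1 - \<sigma>) * z + of_real (- \<beta>))) 1"
proof -
  have "eventually (\<lambda>z. norm (wp z (of_real \<sigma> * z + of_real \<beta>) - csc_sq (of_real \<sigma> * z + of_real \<beta>)
      - csc_sq (of_real (1 - \<sigma>) * z + of_real (- \<beta>))) \<le> 64 * norm (ee (of_real 1 * z))) iinf"
    using eventually_iinf_gt[of 1]
  proof eventually_elim
    case (elim z)
    have "norm (wp z (of_real \<sigma> * z + of_real \<beta>) - csc_sq (of_real \<sigma> * z + of_real \<beta>) - csc_sq (of_real \<sigma> * z + of_real \<beta> - z))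
        \<le> 64 * exp (- 2 * pi * Im z)"
    proof (rule wp_approx)
      have "\<sigma> * Im z < 1 * Im z" using elim assms by (intro mult_strict_right_mono) auto
      then show "Im (of_real \<sigma> * z + of_real \<beta>) < Im z" by simp
    qed (use elim assms in auto)
    moreover have "of_real \<sigma> * z + of_real \<beta> - z = - (of_real (1 - \<sigma>) * z + of_real (- \<beta>))" by (simp add: algebra_simps)
    then have "csc_sq (of_real \<sigma> * z + of_real \<beta> - z) = csc_sq (of_real (1 - \<sigma>) * z + of_real (- \<beta>))"
      by (simp only: csc_sq_minus)
    ultimately show ?case by (simp add: norm_ee)
  qed
  then show ?thesis unfolding order_ge_def by blast
qed

text \<open>For \<open>\<sigma>\<close> below 1/2 the exponent \<open>\<sigma>\<close> is smaller
  than \<open>1 - \<sigma>\<close>, so the row \<open>n = 0\<close> alone determines the leading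
  term.\<close>

lemma wp_has_limit:
  fixes \<sigma> :: real and \<beta> :: real
  assumes "0 < \<sigma>" "\<sigma> < 1/2"
  shows "((\<lambda>z. wp z (of_real \<sigma> * z + of_real \<beta>) / ee (of_real \<sigma> * z)) \<longlongrightarrow> - 4 * ee (of_real \<beta>)) iinf"
proof -
  have o1: "has_order (\<lambda>z. ee (of_real \<sigma> * z)) \<sigma>" by (auto simp: has_order_def intro!: exI[of _ 1])
  have "order_ge (\<lambda>z. csc_sq (of_real (1 - \<sigma>) * z + of_real (- \<beta>))) (1 - \<sigma>)"
    using assms by (intro has_order_imp_order_ge csc_sq_has_order) auto
  from order_ge_divide[OF this o1] assms
  have l1: "((\<lambda>z. csc_sq (of_real (1 - \<sigma>) * z + of_real (- \<beta>)) / ee (of_real \<sigma> * z)) \<longlongrightarrow> 0) iinf"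
    by (elim order_ge_tendsto_0) auto
  have "order_ge (\<lambda>z. wp z (of_real \<sigma> * z + of_real \<beta>) - csc_sq (of_real \<sigma> * z + of_real \<beta>)
      - csc_sq (of_real (1 - \<sigma>) * z + of_real (- \<beta>))) 1"
    using assms by (intro wp_cusp_approx) auto
  from order_ge_divide[OF this o1] assms
  have l2: "((\<lambda>z. (wp z (of_real \<sigma> * z + of_real \<beta>) - csc_sq (of_real \<sigma> * z + of_real \<beta>)
      - csc_sq (of_real (1 - \<sigma>) * z + of_real (- \<beta>))) / ee (of_real \<sigma> * z)) \<longlongrightarrow> 0) iinf"
    by (elim order_ge_tendsto_0) auto
  from tendsto_add[OF tendsto_add[OF l2 l1] csc_sq_limit[OF assms(1), of "of_real \<beta>"]]
  show ?thesis by (simp add: diff_divide_distrib)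
qed

lemma wp_limit_0:
  "((\<lambda>z. wp z (of_real \<beta>)) \<longlongrightarrow> csc_sq (of_real \<beta>)) iinf"
proof -
  have l1: "((\<lambda>z. csc_sq (of_real (1 - 0) * z + of_real (- \<beta>))) \<longlongrightarrow> 0) iinf"
    by (rule order_ge_tendsto_0[OF has_order_imp_order_ge[OF csc_sq_has_order]]) auto
  have "order_ge (\<lambda>z. wp z (of_real 0 * z + of_real \<beta>) - csc_sq (of_real 0 * z + of_real \<beta>)
      - csc_sq (of_real (1 - 0) * z + of_real (- \<beta>))) 1" by (rule wp_cusp_approx) auto
  then have l2: "((\<lambda>z. wp z (of_real 0 * z + of_real \<beta>) - csc_sq (of_real 0 * z + of_real \<beta>)
      - csc_sq (of_real (1 - 0) * z + of_real (- \<beta>))) \<longlongrightarrow> 0) iinf" by (rule order_ge_tendsto_0) auto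
  from tendsto_add[OF tendsto_add[OF l2 l1] tendsto_const[of "csc_sq (of_real \<beta>)"]] show ?thesis by simp
qed

text \<open>At \<open>\<sigma> = 1/2\<close> the two rows have the same order and in fact coincide
  by periodicity, which doubles -4 to -8. The sign of the last limit is
  \<open>ee (1 / 2) = - 1\<close>.\<close>

lemma ehalf_limits:
  "(ehalf 0 1 \<longlongrightarrow> 1) iinf"
  "((\<lambda>z. ehalf 1 0 z / ee (of_real (1/2) * z)) \<longlongrightarrow> - 8) iinf"
  "((\<lambda>z. ehalf 1 1 z / ee (of_real (1/2) * z)) \<longlongrightarrow> 8) iinf"
proof -
  have ee_half: "ee (1 / 2) = -1"
  proof -
    have "2 * of_real pi * \<i> * (1 / 2) = of_real pi * \<i>" by simp
    then show ?thesis unfolding ee_def by (simp only: exp_pi_i)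
  qed
  then have "csc_sq (of_real (1/2)) = 1" by (simp add: csc_sq_ee)
  then show "(ehalf 0 1 \<longlongrightarrow> 1) iinf" using wp_limit_0[of "1/2"] by (simp add: ehalf_def[abs_def])
  have gen: "((\<lambda>z. ehalf 1 n z / ee (of_real (1/2) * z)) \<longlongrightarrow> - 8 * ee (of_int n / 2)) iinf" for n
  proof -
    have o1: "has_order (\<lambda>z. ee (of_real (1/2) * z)) (1/2)" by (auto simp: has_order_def intro!: exI[of _ 1])
    define \<beta> where "\<beta> = real_of_int n / 2"
    have s: "csc_sq (of_real (1 - 1/2) * z + of_real (- \<beta>)) = csc_sq (of_real (1/2) * z + of_real \<beta>)" for z
      using csc_sq_plus_of_int[of "of_real (1/2) * z + of_real (- \<beta>)" n] by (simp add: \<beta>_def algebra_simps)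
    have "order_ge (\<lambda>z. wp z (of_real (1/2) * z + of_real \<beta>) - csc_sq (of_real (1/2) * z + of_real \<beta>)
      - csc_sq (of_real (1 - 1/2) * z + of_real (- \<beta>))) 1" by (rule wp_cusp_approx) auto
    from order_ge_divide[OF this o1]
    have l2: "((\<lambda>z. (wp z (of_real (1/2) * z + of_real \<beta>) - csc_sq (of_real (1/2) * z + of_real \<beta>)
      - csc_sq (of_real (1 - 1/2) * z + of_real (- \<beta>))) / ee (of_real (1/2) * z)) \<longlongrightarrow> 0) iinf"
      by (elim order_ge_tendsto_0) auto
    have l1: "((\<lambda>z. csc_sq (of_real (1/2) * z + of_real \<beta>) / ee (of_real (1/2) * z)) \<longlongrightarrow> - 4 * ee (of_real \<beta>)) iinf"
      by (rule csc_sq_limit) auto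
    have "((\<lambda>z. wp z (of_real (1/2) * z + of_real \<beta>) / ee (of_real (1/2) * z)) \<longlongrightarrow> 0 + (- 4 * ee (of_real \<beta>)) + (- 4 * ee (of_real \<beta>))) iinf"
      using tendsto_add[OF tendsto_add[OF l2 l1] l1] unfolding s by (simp add: diff_divide_distrib)
    moreover have "wp z (of_real (1/2) * z + of_real \<beta>) = ehalf 1 n z" for z
      by (simp add: ehalf_def \<beta>_def add_divide_distrib)
    ultimately show ?thesis by (simp add: \<beta>_def)
  qed
  show "((\<lambda>z. ehalf 1 0 z / ee (of_real (1/2) * z)) \<longlongrightarrow> - 8) iinf" using gen[of 0] by simp
  show "((\<lambda>z. ehalf 1 1 z / ee (of_real (1/2) * z)) \<longlongrightarrow> 8) iinf" using gen[of 1] ee_half by simp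
qed

lemma delta_has_order: "has_order delta (1/2)"
proof -
  have e0: "((\<lambda>z. ee (of_real (1/2) * z)) \<longlongrightarrow> 0) iinf" by (rule ee_order_tendsto_0) auto
  have "((\<lambda>z. ehalf 1 0 z / ee (of_real (1/2) * z) * ee (of_real (1/2) * z)) \<longlongrightarrow> - 8 * 0) iinf"
    by (intro tendsto_mult ehalf_limits e0)
  then have l2: "(ehalf 1 0 \<longlongrightarrow> 0) iinf" by simp
  have "((\<lambda>z. ehalf 1 1 z / ee (of_real (1/2) * z) * ee (of_real (1/2) * z)) \<longlongrightarrow> 8 * 0) iinf"
    by (intro tendsto_mult ehalf_limits e0)
  then have l3: "(ehalf 1 1 \<longlongrightarrow> 0) iinf" by simp
  \<comment> \<open>The leading coefficients -8 and 8 reinforce each other in the middle difference,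
    so its order is exactly 1/2 and no cancellation occurs.\<close>
  have "((\<lambda>z. (ehalf 0 1 z - ehalf 1 0 z) * (ehalf 1 0 z / ee (of_real (1/2) * z) - ehalf 1 1 z / ee (of_real (1/2) * z)) * (ehalf 1 1 z - ehalf 0 1 z))
      \<longlongrightarrow> (1 - 0) * (- 8 - 8) * (0 - 1)) iinf"
    by (intro tendsto_intros ehalf_limits l2 l3)
  then have "((\<lambda>z. delta z / ee (of_real (1/2) * z)) \<longlongrightarrow> 16) iinf"
    by (simp add: delta_def diff_divide_distrib[symmetric])
  then show ?thesis unfolding has_order_def by (intro exI[of _ 16]) auto
qed

text \<open>By evenness and periodicity the coefficient of \<open>z\<close> may be folded to its
  representative 1, 2 or 3; folding by a sign also negates \<open>n\<close>.\<close>

lemma wp7_has_order: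
  assumes "s \<in> {1, 2, 3}" "7 dvd m - s \<or> 7 dvd m + s"
  shows "has_order (\<lambda>z. wp z ((of_int m * z + of_int n) / 7)) (of_int s / 7)"
proof -
  define n' where "n' = (if 7 dvd m - s then n else - n)"
  have eq: "wp z ((of_int m * z + of_int n) / 7) = wp z (of_real (of_int s / 7) * z + of_real (of_int n' / 7))" for z
  proof (cases "7 dvd m - s")
    case True
    then show ?thesis using wp_rational_cong[of 7 m s n n z] by (simp add: n'_def add_divide_distrib)
  next
    case False
    then have "7 dvd - m - s" using assms(2) by (metis add.commute diff_minus_eq_add dvd_minus_iff minus_diff_eq uminus_add_conv_diff)
    then show ?thesis using False wp_rational_cong[of 7 "- m" s "- n" "- n" z] wp_rational_minus[of z m n 7]
      by (simp add: n'_def add_divide_distrib diff_divide_distrib)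
  qed
  have "((\<lambda>z. wp z (of_real (of_int s / 7) * z + of_real (of_int n' / 7)) / ee (of_real (of_int s / 7) * z)) \<longlongrightarrow> - 4 * ee (of_real (of_int n' / 7))) iinf"
    using assms(1) by (intro wp_has_limit) auto
  then show ?thesis unfolding has_order_def eq by (intro exI[of _ "- 4 * ee (of_real (of_int n' / 7))"]) auto
qed

lemma wp7_limit:
  assumes "7 dvd m"
  shows "((\<lambda>z. wp z ((of_int m * z + of_int n) / 7)) \<longlongrightarrow> csc_sq (of_int n / 7)) iinf"
proof -
  have "wp z ((of_int m * z + of_int n) / 7) = wp z (of_real (of_int n / 7))" for z
    using wp_rational_cong[of 7 m 0 n n z] assms by simp
  then show ?thesis using wp_limit_0[of "of_int n / 7"] by simp
qed

lemma has_order_minus: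
  assumes f: "has_order f r" and g: "has_order g s" and rs: "r < s"
  shows "has_order (\<lambda>z. f z - g z) r" "has_order (\<lambda>z. g z - f z) r"
proof -
  obtain c where c: "c \<noteq> 0" "((\<lambda>z. f z / ee (of_real r * z)) \<longlongrightarrow> c) iinf" using f by (auto simp: has_order_def)
  have "has_order (\<lambda>z. ee (of_real r * z)) r" by (auto simp: has_order_def intro!: exI[of _ 1])
  from order_ge_divide[OF has_order_imp_order_ge[OF g] this]
  have "((\<lambda>z. g z / ee (of_real r * z)) \<longlongrightarrow> 0) iinf" using rs by (elim order_ge_tendsto_0) auto
  from tendsto_diff[OF c(2) this] tendsto_diff[OF this c(2)]
  show "has_order (\<lambda>z. f z - g z) r" "has_order (\<lambda>z. g z - f z) r"
    using c(1) unfolding has_order_def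
    by (intro exI[of _ c] exI[of _ "- c"]; simp add: diff_divide_distrib)+
qed

text \<open>The two terms have different orders \<open>s / 7\<close> and \<open>t / 7\<close>, so
  the smaller one survives in the difference.\<close>

lemma dd_has_order:
  assumes "s \<in> {1, 2, 3}" "t \<in> {1, 2, 3}" "s \<noteq> t"
    and "7 dvd i * c - s \<or> 7 dvd i * c + s" "7 dvd j * c - t \<or> 7 dvd j * c + t"
  shows "has_order (dd i j c d) (of_int (min s t) / 7)"
proof -
  note f = wp7_has_order[OF assms(1,4), of "i * d"] and g = wp7_has_order[OF assms(2,5), of "j * d"]
  show ?thesis unfolding dd_def[abs_def]
    using has_order_minus(1)[OF f g] has_order_minus(2)[OF g f] assms(1-3)
    by (cases "s < t") (auto simp: min_def)
qed

lemma dd_limit: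
  assumes "7 dvd c"
  shows "(dd i j c d \<longlongrightarrow> csc_sq (of_int (i * d) / 7) - csc_sq (of_int (j * d) / 7)) iinf"
  unfolding dd_def[abs_def] using assms by (intro tendsto_diff wp7_limit) auto

text \<open>In \<open>w = ee a\<close> and \<open>v = ee b\<close> the equation
  \<open>w (1 - v)^2 = v (1 - w)^2\<close> factors as \<open>(w - v) (1 - w v) = 0\<close>.\<close>

lemma csc_sq_eq_imp:
  assumes "csc_sq a = csc_sq b" "a \<notin> \<int>" "b \<notin> \<int>"
  shows "a - b \<in> \<int> \<or> a + b \<in> \<int>"
proof -
  define w v where "w = ee a" and "v = ee b"
  have "1 - w \<noteq> 0" "1 - v \<noteq> 0" using assms ee_eq_1_iff by (auto simp: w_def v_def)
  then have "w * (1 - v)\<^sup>2 = v * (1 - w)\<^sup>2" using assms(1) by (simp add: csc_sq_ee w_def v_def field_simps)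
  then have "(w - v) * (1 - w * v) = 0" by (simp add: power2_eq_square algebra_simps)
  then have "ee (a - b) = 1 \<or> ee (a + b) = 1" by (auto simp: w_def v_def ee_diff ee_add)
  then show ?thesis by (simp add: ee_eq_1_iff)
qed

lemma seventh_Ints_iff: "(of_int n / 7 :: complex) \<in> \<int> \<longleftrightarrow> 7 dvd n"
proof
  assume "(of_int n / 7 :: complex) \<in> \<int>"
  then obtain k :: int where "(of_int n / 7 :: complex) = of_int k" by (elim Ints_cases)
  then have "(of_int n :: complex) = of_int (7 * k)" by simp
  then have "n = 7 * k" by (simp only: of_int_eq_iff)
  then show "7 dvd n" by simp
next
  assume "7 dvd n" then show "(of_int n / 7 :: complex) \<in> \<int>" by (auto elim!: dvdE)
qed

lemma dd_limit_nonzero: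
  assumes "\<not> 7 dvd d" "\<not> 7 dvd i" "\<not> 7 dvd j" "\<not> 7 dvd i + j" "\<not> 7 dvd i - j"
  shows "csc_sq (of_int (i * d) / 7) - csc_sq (of_int (j * d) / 7) \<noteq> 0"
proof
  assume "csc_sq (of_int (i * d) / 7) - csc_sq (of_int (j * d) / 7) = 0"
  then have "csc_sq (of_int (i * d) / 7) = csc_sq (of_int (j * d) / 7)" by simp
  from csc_sq_eq_imp[OF this] have "(of_int (i * d) / 7 - of_int (j * d) / 7 :: complex) \<in> \<int> \<or> (of_int (i * d) / 7 + of_int (j * d) / 7 :: complex) \<in> \<int>"
    using assms by (auto simp: seventh_Ints_iff dvd7_mult_iff simp del: of_int_mult)
  then have "(of_int ((i - j) * d) / 7 :: complex) \<in> \<int> \<or> (of_int ((i + j) * d) / 7 :: complex) \<in> \<int>"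
    by (simp add: diff_divide_distrib add_divide_distrib algebra_simps)
  then show False using assms by (auto simp: seventh_Ints_iff dvd7_mult_iff simp del: of_int_mult)
qed

subsection \<open>The Hauptmodul of \<open>\<Gamma>\<^sub>1(7)\<close>\<close>

definition Xc :: "int \<Rightarrow> int \<Rightarrow> complex \<Rightarrow> complex" where
  "Xc c d z = dd 3 2 c d z / dd 1 2 c d z"

text \<open>The weight 6 divisor that cancels the weight of \<open>delta\<close> in the construction
  of \<open>W\<close>.\<close>

definition Mc :: "int \<Rightarrow> int \<Rightarrow> complex \<Rightarrow> complex" where
  "Mc c d z = dd 1 2 c d z * dd 1 3 c d z * dd 3 2 c d z"

abbreviation X7 :: "complex \<Rightarrow> complex" where "X7 \<equiv> Xc 0 1"

lemma prim7_0_1 [simp]: "prim7 0 1" by (simp add: prim7_def)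

lemma dd_nz:
  assumes "z \<in> UHP" "prim7 c d"
  shows "dd 1 2 c d z \<noteq> 0" "dd 1 3 c d z \<noteq> 0" "dd 3 2 c d z \<noteq> 0"
  using dd_nonzero[of z c d 1 2] dd_nonzero[of z c d 1 3] dd_nonzero[of z c d 3 2] assms by simp_all

lemma dd_hol:
  assumes "prim7 c d"
  shows "dd 1 2 c d holomorphic_on UHP" "dd 1 3 c d holomorphic_on UHP" "dd 3 2 c d holomorphic_on UHP"
  using dd_holomorphic[of c d 1 2] dd_holomorphic[of c d 1 3] dd_holomorphic[of c d 3 2] assms by simp_all

text \<open>Differences of values at the multiples 1, 2, 3 add up, so \<open>1 - X\<close> is again
  a quotient of two forms without zeros. In particular \<open>X\<close> omits 0 and 1 on the
  half-plane.\<close>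

lemma Xc_minus_1:
  assumes "z \<in> UHP" "prim7 c d"
  shows "1 - Xc c d z = dd 1 3 c d z / dd 1 2 c d z"
proof -
  have "dd 1 2 c d z - dd 3 2 c d z = dd 1 3 c d z" by (simp add: dd_def)
  then show ?thesis using dd_nz(1)[OF assms] by (simp add: Xc_def field_simps)
qed

lemma Xc_hol: "prim7 c d \<Longrightarrow> Xc c d holomorphic_on UHP"
  unfolding Xc_def[abs_def] using dd_nz dd_hol by (intro holomorphic_intros) auto

lemma Mc_hol: "prim7 c d \<Longrightarrow> Mc c d holomorphic_on UHP"
  unfolding Mc_def[abs_def] using dd_hol by (intro holomorphic_intros) auto

lemma Mc_nz: "z \<in> UHP \<Longrightarrow> prim7 c d \<Longrightarrow> Mc c d z \<noteq> 0"
  using dd_nz by (simp add: Mc_def)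

lemma Xc_neq:
  assumes "z \<in> UHP" "prim7 c d"
  shows "Xc c d z \<noteq> 0" "Xc c d z \<noteq> 1"
  using dd_nz[OF assms] Xc_minus_1[OF assms] by (auto simp: Xc_def)

lemma Xc_moebius:
  assumes "A \<in> SLZ" "z \<in> UHP"
  shows "X7 (moebius A z) = Xc (A $ 2 $ 1) (A $ 2 $ 2) z"
  using aut_nonzero[OF assms] by (simp add: Xc_def dd_moebius[OF assms])

lemma Mc_moebius:
  assumes "A \<in> SLZ" "z \<in> UHP"
  shows "Mc 0 1 (moebius A z) = aut A z ^ 6 * Mc (A $ 2 $ 1) (A $ 2 $ 2) z"
  by (simp add: Mc_def dd_moebius[OF assms] power_numeral_reduce mult_ac)

lemma Xc_cong: "7 dvd c - c' \<Longrightarrow> 7 dvd d - d' \<Longrightarrow> Xc c d z = Xc c' d' z"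
  unfolding Xc_def using dd_cong[of c c' d d'] by metis

definition inv7 :: "(complex \<Rightarrow> complex) \<Rightarrow> bool" where
  "inv7 h \<longleftrightarrow> (\<forall>A\<in>Gamma1 7. \<forall>z\<in>UHP. h (moebius A z) = h z)"

lemma Gamma1_iff:
  "A \<in> Gamma1 7 \<longleftrightarrow> A \<in> SLZ \<and> 7 dvd A $ 1 $ 1 - 1 \<and> 7 dvd A $ 2 $ 2 - 1 \<and> 7 dvd A $ 2 $ 1"
  by (auto simp: Gamma1_def cong_iff_dvd_diff)

text \<open>Bottom rows that agree modulo 7 make \<open>A ** SL2_inv B\<close> an element of
  \<open>\<Gamma>\<^sub>1(7)\<close>, so translates of an invariant function are indexed by bottom
  rows modulo 7.\<close>

lemma inv7_bottom_row:
  assumes h: "inv7 h" and A: "A \<in> SLZ" and B: "B \<in> SLZ" and z: "z \<in> UHP"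
    and c: "7 dvd A $ 2 $ 1 - B $ 2 $ 1" and d: "7 dvd A $ 2 $ 2 - B $ 2 $ 2"
  shows "h (moebius A z) = h (moebius B z)"
proof -
  define a1 b1 c1 d1 where "a1 = A $ 1 $ 1" and "b1 = A $ 1 $ 2" and "c1 = A $ 2 $ 1" and "d1 = A $ 2 $ 2"
  define a2 b2 c2 d2 where "a2 = B $ 1 $ 1" and "b2 = B $ 1 $ 2" and "c2 = B $ 2 $ 1" and "d2 = B $ 2 $ 2"
  have dets: "a1 * d1 - b1 * c1 = 1" "a2 * d2 - b2 * c2 = 1"
    using A B by (simp_all add: SL2_iff a1_def b1_def c1_def d1_def a2_def b2_def c2_def d2_def)
  obtain k l where kl: "c1 = c2 + 7 * k" "d1 = d2 + 7 * l"
    using c d by (auto simp: c1_def c2_def d1_def d2_def elim!: dvdE) (metis add.commute diff_add_cancel)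
  define C where "C = A ** SL2_inv B"
  have CS: "C \<in> SLZ" unfolding C_def using A B by (intro SL2_mult) auto
  have "C $ 1 $ 1 = a1 * d2 - b1 * c2" "C $ 2 $ 1 = c1 * d2 - d1 * c2" "C $ 2 $ 2 = d1 * a2 - c1 * b2"
    by (simp_all add: C_def mat_mult_nth a1_def b1_def c1_def d1_def a2_def b2_def c2_def d2_def)
  moreover have "a1 * d2 - b1 * c2 - 1 = 7 * (b1 * k - a1 * l)" using dets(1) unfolding kl by (simp add: algebra_simps)
  moreover have "c1 * d2 - d1 * c2 = 7 * (k * d2 - l * c2)" unfolding kl by (simp add: algebra_simps)
  moreover have "d1 * a2 - c1 * b2 - 1 = 7 * (l * a2 - k * b2)" using dets(2) unfolding kl by (simp add: algebra_simps)
  ultimately have "C \<in> Gamma1 7" using CS by (simp add: Gamma1_iff)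
  then have "h (moebius C (moebius B z)) = h (moebius B z)" using h moebius_in_UHP[OF B z] by (simp add: inv7_def)
  moreover have "C ** B = A" unfolding C_def using SL2_inv_mult(1)[OF B] by (simp flip: matrix_mul_assoc)
  then have "moebius C (moebius B z) = moebius A z" using moebius_mult[OF CS B z] by simp
  ultimately show ?thesis by simp
qed

text \<open>Supplies the finiteness hypothesis of \<open>modular_liouville\<close>: at most 49
  bottom rows modulo 7 are possible.\<close>

lemma inv7_finite:
  assumes h: "inv7 h"
  shows "finite ((\<lambda>A. restrict (\<lambda>z. h (moebius A z)) UHP) ` SLZ)"
proof -
  define r where "r = (\<lambda>A. restrict (\<lambda>z. h (moebius A z)) UHP)"
  define k where "k = (\<lambda>A :: int ^ 2 ^ 2. (A $ 2 $ 1 mod 7, A $ 2 $ 2 mod 7))"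
  have fin: "finite (k ` SLZ)"
    by (rule finite_subset[of _ "{0..<7} \<times> {0..<7}"]) (auto simp: k_def)
  have dep: "r A = r B" if "A \<in> SLZ" "B \<in> SLZ" "k A = k B" for A B
  proof -
    have "7 dvd A $ 2 $ 1 - B $ 2 $ 1" "7 dvd A $ 2 $ 2 - B $ 2 $ 2"
      using that(3) by (auto simp: k_def mod_eq_dvd_iff)
    then show ?thesis unfolding r_def using inv7_bottom_row[OF h that(1,2)] by (auto simp: fun_eq_iff)
  qed
  have "r ` SLZ \<subseteq> (\<lambda>x. r (inv_into SLZ k x)) ` (k ` SLZ)"
  proof
    fix f assume "f \<in> r ` SLZ"
    then obtain A where A: "A \<in> SLZ" "f = r A" by auto
    have "r (inv_into SLZ k (k A)) = r A"
      by (rule dep) (use A in \<open>auto intro: inv_into_into f_inv_into_f\<close>)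
    then show "f \<in> (\<lambda>x. r (inv_into SLZ k x)) ` (k ` SLZ)" using A by (auto intro!: image_eqI[of _ _ "k A"])
  qed
  then show ?thesis using fin finite_subset unfolding r_def by blast
qed

text \<open>A matrix sending \<open>\<infinity>\<close> to the only cusp of \<open>\<Gamma>\<^sub>1(7)\<close> at which \<open>X7\<close> has a pole.\<close>

definition g0 :: "int ^ 2 ^ 2" where "g0 = mat22 1 3 2 7"

lemma g0_in [simp]: "g0 \<in> SLZ" by (simp add: g0_def SL2_iff)

lemma g0_nth [simp]: "g0 $ 2 $ 1 = 2" "g0 $ 2 $ 2 = 7" by (simp_all add: g0_def)

lemma moebius_translate:
  assumes "A \<in> SLZ" "z \<in> UHP"
  shows "moebius A (z + of_int k) = moebius (A ** translation_matrix k) z"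
  using moebius_mult[OF assms(1) Tm_in assms(2), of k] by simp

lemma translate_nth:
  fixes A :: "int ^ 2 ^ 2"
  shows "(A ** translation_matrix k) $ 2 $ 1 = A $ 2 $ 1" "(A ** translation_matrix k) $ 2 $ 2 = A $ 2 $ 1 * k + A $ 2 $ 2"
  by (simp_all add: mat_mult_nth)

lemma inv7_g0_periodic:
  assumes "inv7 h" "z \<in> UHP"
  shows "h (moebius g0 (z + 7)) = h (moebius g0 z)"
proof -
  have "h (moebius g0 (z + of_int 7)) = h (moebius (g0 ** translation_matrix 7) z)" using assms by (simp only: moebius_translate[OF g0_in])
  also have "\<dots> = h (moebius g0 z)"
    by (rule inv7_bottom_row[OF assms(1) _ _ assms(2)]) (auto simp: translate_nth intro!: SL2_mult)
  finally show ?thesis by simp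
qed

lemma order_ge_eq: "order_ge f r \<Longrightarrow> eventually (\<lambda>z. f z = g z) iinf \<Longrightarrow> order_ge g r"
  using order_ge_cong[of f g r] by simp

lemma order_ge_0_translate:
  assumes "order_ge f 0"
  shows "order_ge (\<lambda>z. f (z + of_int k)) 0"
proof -
  obtain B M where "\<And>z. Im z > M \<Longrightarrow> norm (f z) \<le> B" using assms unfolding order_ge_bounded eventually_iinf by blast
  then have "norm (f (z + of_int k)) \<le> B" if "Im z > M" for z using that by simp
  then show ?thesis unfolding order_ge_bounded eventually_iinf by blast
qed

lemma inv7_pole_cusps:
  assumes h: "inv7 h" and A: "A \<in> SLZ" and c: "7 dvd A $ 2 $ 1 - 2 \<or> 7 dvd A $ 2 $ 1 + 2"
  shows "\<exists>k::int. \<forall>z\<in>UHP. h (moebius A z) = h (moebius g0 (z + of_int k))"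
proof -
  define A' where "A' = (if 7 dvd A $ 2 $ 1 - 2 then A else - A)"
  have A': "A' \<in> SLZ" "7 dvd A' $ 2 $ 1 - 2" "moebius A' = moebius A"
    using A c uminus_SL2[OF A] by (auto simp: A'_def fun_eq_iff dvd_minus_iff[symmetric, of 7 "_ + 2"])
  \<comment> \<open>The bottom row of \<open>g0 ** translation_matrix k\<close> is
    \<open>(2, 2 k + 7)\<close>, and 4 is the inverse of 2 modulo 7.\<close>
  define k where "k = 4 * A' $ 2 $ 2"
  have "h (moebius A' z) = h (moebius (g0 ** translation_matrix k) z)" if "z \<in> UHP" for z
    by (rule inv7_bottom_row[OF h A'(1) _ that]) (use A' in \<open>auto simp: translate_nth k_def intro!: SL2_mult, presburger?\<close>)
  then show ?thesis using A'(3) by (auto simp: moebius_translate[OF g0_in] intro!: exI[of _ k])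
qed

text \<open>Up to sign modulo 7, the multiples \<open>c\<close>, \<open>2 c\<close>,
  \<open>3 c\<close> of a residue prime to 7 are a permutation of 1, 2, 3. The order of a difference
  is the smaller of its two residues, divided by 7.\<close>

lemma dd_orders:
  "7 dvd c - 1 \<or> 7 dvd c + 1 \<Longrightarrow> has_order (dd 1 2 c d) (1/7)"
  "7 dvd c - 1 \<or> 7 dvd c + 1 \<Longrightarrow> has_order (dd 1 3 c d) (1/7)"
  "7 dvd c - 1 \<or> 7 dvd c + 1 \<Longrightarrow> has_order (dd 3 2 c d) (2/7)"
  "7 dvd c - 2 \<or> 7 dvd c + 2 \<Longrightarrow> has_order (dd 1 2 c d) (2/7)"
  "7 dvd c - 2 \<or> 7 dvd c + 2 \<Longrightarrow> has_order (dd 1 3 c d) (1/7)"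
  "7 dvd c - 2 \<or> 7 dvd c + 2 \<Longrightarrow> has_order (dd 3 2 c d) (1/7)"
  "7 dvd c - 3 \<or> 7 dvd c + 3 \<Longrightarrow> has_order (dd 1 2 c d) (1/7)"
  "7 dvd c - 3 \<or> 7 dvd c + 3 \<Longrightarrow> has_order (dd 1 3 c d) (2/7)"
  "7 dvd c - 3 \<or> 7 dvd c + 3 \<Longrightarrow> has_order (dd 3 2 c d) (1/7)"
proof -
  have 1: "7 dvd 1 * c - 1 \<or> 7 dvd 1 * c + 1" "7 dvd 2 * c - 2 \<or> 7 dvd 2 * c + 2" "7 dvd 3 * c - 3 \<or> 7 dvd 3 * c + 3"
    if "7 dvd c - 1 \<or> 7 dvd c + 1" for c :: int using that by presburger+
  have 2: "7 dvd 1 * c - 2 \<or> 7 dvd 1 * c + 2" "7 dvd 2 * c - 3 \<or> 7 dvd 2 * c + 3" "7 dvd 3 * c - 1 \<or> 7 dvd 3 * c + 1"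
    if "7 dvd c - 2 \<or> 7 dvd c + 2" for c :: int using that by presburger+
  have 3: "7 dvd 1 * c - 3 \<or> 7 dvd 1 * c + 3" "7 dvd 2 * c - 1 \<or> 7 dvd 2 * c + 1" "7 dvd 3 * c - 2 \<or> 7 dvd 3 * c + 2"
    if "7 dvd c - 3 \<or> 7 dvd c + 3" for c :: int using that by presburger+
  show "7 dvd c - 1 \<or> 7 dvd c + 1 \<Longrightarrow> has_order (dd 1 2 c d) (1/7)" using dd_has_order[of 1 2 1 c 2 d] 1[of c] by simp
  show "7 dvd c - 1 \<or> 7 dvd c + 1 \<Longrightarrow> has_order (dd 1 3 c d) (1/7)" using dd_has_order[of 1 3 1 c 3 d] 1[of c] by simp
  show "7 dvd c - 1 \<or> 7 dvd c + 1 \<Longrightarrow> has_order (dd 3 2 c d) (2/7)" using dd_has_order[of 3 2 3 c 2 d] 1[of c] by simp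
  show "7 dvd c - 2 \<or> 7 dvd c + 2 \<Longrightarrow> has_order (dd 1 2 c d) (2/7)" using dd_has_order[of 2 3 1 c 2 d] 2[of c] by simp
  show "7 dvd c - 2 \<or> 7 dvd c + 2 \<Longrightarrow> has_order (dd 1 3 c d) (1/7)" using dd_has_order[of 2 1 1 c 3 d] 2[of c] by simp
  show "7 dvd c - 2 \<or> 7 dvd c + 2 \<Longrightarrow> has_order (dd 3 2 c d) (1/7)" using dd_has_order[of 1 3 3 c 2 d] 2[of c] by simp
  show "7 dvd c - 3 \<or> 7 dvd c + 3 \<Longrightarrow> has_order (dd 1 2 c d) (1/7)" using dd_has_order[of 3 1 1 c 2 d] 3[of c] by simp
  show "7 dvd c - 3 \<or> 7 dvd c + 3 \<Longrightarrow> has_order (dd 1 3 c d) (2/7)" using dd_has_order[of 3 2 1 c 3 d] 3[of c] by simp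
  show "7 dvd c - 3 \<or> 7 dvd c + 3 \<Longrightarrow> has_order (dd 3 2 c d) (1/7)" using dd_has_order[of 2 1 3 c 2 d] 3[of c] by simp
qed

lemma has_order_0I: "c \<noteq> 0 \<Longrightarrow> (f \<longlongrightarrow> c) iinf \<Longrightarrow> has_order f 0"
  by (auto simp: has_order_def)

lemma dd_orders_0:
  assumes "7 dvd c" "prim7 c d"
  shows "has_order (dd 1 2 c d) 0" "has_order (dd 1 3 c d) 0" "has_order (dd 3 2 c d) 0"
proof -
  have d: "\<not> 7 dvd d" using assms by (simp add: prim7_def)
  show "has_order (dd 1 2 c d) 0" "has_order (dd 1 3 c d) 0" "has_order (dd 3 2 c d) 0"
    by (rule has_order_0I[OF dd_limit_nonzero[OF d] dd_limit[OF assms(1)]]; simp)+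
qed

text \<open>In the coordinate of a cusp of width 7 the orders 1/7 and -1/7 are a simple zero and a
  simple pole; the pole occurs at the single cusp with \<open>c\<close> equal to \<plusminus>2
  modulo 7.\<close>

lemma Xc_orders:
  "7 dvd c - 1 \<or> 7 dvd c + 1 \<Longrightarrow> has_order (Xc c d) (1/7)"
  "7 dvd c - 2 \<or> 7 dvd c + 2 \<Longrightarrow> has_order (Xc c d) (- 1/7)"
  "7 dvd c - 3 \<or> 7 dvd c + 3 \<Longrightarrow> has_order (Xc c d) 0"
  "7 dvd c \<Longrightarrow> prim7 c d \<Longrightarrow> has_order (Xc c d) 0"
  using has_order_divide[OF dd_orders(3) dd_orders(1), of c c d d] has_order_divide[OF dd_orders(6) dd_orders(4), of c c d d]
    has_order_divide[OF dd_orders(9) dd_orders(7), of c c d d] has_order_divide[OF dd_orders_0(3) dd_orders_0(1), of c d c d]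
  unfolding Xc_def[abs_def] by simp_all

lemma Xc1_orders:
  assumes "prim7 c d"
  shows "7 dvd c - 1 \<or> 7 dvd c + 1 \<Longrightarrow> has_order (\<lambda>z. Xc c d z - 1) 0"
    "7 dvd c - 2 \<or> 7 dvd c + 2 \<Longrightarrow> has_order (\<lambda>z. Xc c d z - 1) (- 1/7)"
    "7 dvd c - 3 \<or> 7 dvd c + 3 \<Longrightarrow> has_order (\<lambda>z. Xc c d z - 1) (1/7)"
    "7 dvd c \<Longrightarrow> has_order (\<lambda>z. Xc c d z - 1) 0"
proof -
  have ev: "eventually (\<lambda>z. (- 1) * (dd 1 3 c d z / dd 1 2 c d z) = Xc c d z - 1) iinf"
    using eventually_iinf_UHP by eventually_elim (use Xc_minus_1[OF _ assms] in \<open>simp add: algebra_simps\<close>)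
  have *: "has_order (\<lambda>z. Xc c d z - 1) r" if "has_order (\<lambda>z. dd 1 3 c d z / dd 1 2 c d z) r" for r
    using has_order_cmult[OF that, of "-1"] has_order_cong[OF ev] by auto
  show "7 dvd c - 1 \<or> 7 dvd c + 1 \<Longrightarrow> has_order (\<lambda>z. Xc c d z - 1) 0"
    using *[OF has_order_divide[OF dd_orders(2) dd_orders(1), of c c d d]] by simp
  show "7 dvd c - 2 \<or> 7 dvd c + 2 \<Longrightarrow> has_order (\<lambda>z. Xc c d z - 1) (- 1/7)"
    using *[OF has_order_divide[OF dd_orders(5) dd_orders(4), of c c d d]] by simp
  show "7 dvd c - 3 \<or> 7 dvd c + 3 \<Longrightarrow> has_order (\<lambda>z. Xc c d z - 1) (1/7)"
    using *[OF has_order_divide[OF dd_orders(8) dd_orders(7), of c c d d]] by simp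
  show "7 dvd c \<Longrightarrow> has_order (\<lambda>z. Xc c d z - 1) 0"
    using *[OF has_order_divide[OF dd_orders_0(2) dd_orders_0(1), of c d c d]] assms by simp
qed

lemma Mc_orders:
  "7 dvd c - 1 \<or> 7 dvd c + 1 \<Longrightarrow> has_order (Mc c d) (4/7)"
  "7 dvd c - 2 \<or> 7 dvd c + 2 \<Longrightarrow> has_order (Mc c d) (4/7)"
  "7 dvd c - 3 \<or> 7 dvd c + 3 \<Longrightarrow> has_order (Mc c d) (4/7)"
  "7 dvd c \<Longrightarrow> prim7 c d \<Longrightarrow> has_order (Mc c d) 0"
  using has_order_mult[OF has_order_mult[OF dd_orders(1) dd_orders(2)] dd_orders(3), of c c c d d d]
    has_order_mult[OF has_order_mult[OF dd_orders(4) dd_orders(5)] dd_orders(6), of c c c d d d]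
    has_order_mult[OF has_order_mult[OF dd_orders(7) dd_orders(8)] dd_orders(9), of c c c d d d]
    has_order_mult[OF has_order_mult[OF dd_orders_0(1) dd_orders_0(2)] dd_orders_0(3), of c d c d c d]
  unfolding Mc_def[abs_def] by simp_all

lemma residue7_cases:
  fixes c :: int
  obtains (0) "7 dvd c" | (1) "7 dvd c - 1 \<or> 7 dvd c + 1" | (2) "7 dvd c - 2 \<or> 7 dvd c + 2" | (3) "7 dvd c - 3 \<or> 7 dvd c + 3"
proof -
  have "7 dvd c \<or> (7 dvd c - 1 \<or> 7 dvd c + 1) \<or> (7 dvd c - 2 \<or> 7 dvd c + 2) \<or> (7 dvd c - 3 \<or> 7 dvd c + 3)" by presburger
  then show ?thesis using that by blast
qed

lemma Xc_bounded:
  assumes "prim7 c d" "\<not> (7 dvd c - 2 \<or> 7 dvd c + 2)"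
  shows "order_ge (Xc c d) 0"
  using assms
proof (cases c rule: residue7_cases)
  case 0 then show ?thesis using Xc_orders(4) assms has_order_imp_order_ge by blast
next
  case 1 then show ?thesis using order_ge_mono[OF has_order_imp_order_ge[OF Xc_orders(1)], of c 0 d] by simp
next
  case 3 then show ?thesis using Xc_orders(3) has_order_imp_order_ge by blast
qed auto

lemma inv7_X7: "inv7 X7"
  unfolding inv7_def
proof (intro ballI)
  fix A z assume A: "A \<in> Gamma1 7" and z: "z \<in> UHP"
  then have "X7 (moebius A z) = Xc (A $ 2 $ 1) (A $ 2 $ 2) z" by (intro Xc_moebius) (auto simp: Gamma1_iff)
  also have "\<dots> = X7 z" using A by (intro Xc_cong) (auto simp: Gamma1_iff)
  finally show "X7 (moebius A z) = X7 z" .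
qed

text \<open>Induction on the pole order at the cusp of \<open>g0\<close>: a multiple of a power of
  \<open>X7\<close> removes the leading term without creating poles elsewhere. Once no pole is left,
  \<open>modular_liouville\<close> makes the function constant.\<close>

lemma inv7_polynomial:
  assumes "h holomorphic_on UHP" "inv7 h"
    and "\<And>A. A \<in> SLZ \<Longrightarrow> \<not> (7 dvd A $ 2 $ 1 - 2 \<or> 7 dvd A $ 2 $ 1 + 2) \<Longrightarrow> order_ge (\<lambda>z. h (moebius A z)) 0"
    and "order_ge (\<lambda>z. h (moebius g0 z)) (- of_nat N / 7)"
  shows "\<exists>p. degree p \<le> N \<and> (\<forall>z\<in>UHP. h z = poly p (X7 z))"
  using assms
proof (induction N arbitrary: h)
  case 0
  have hol: "(\<lambda>z. h (moebius g0 z)) holomorphic_on UHP" using 0 by (intro holomorphic_moebius_compose) auto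
  have per: "h (moebius g0 (z + of_real 7)) = h (moebius g0 z)" if "z \<in> UHP" for z
    using inv7_g0_periodic[OF 0(2) that] by simp
  obtain a where a: "((\<lambda>z. h (moebius g0 z) / ee (of_int 0 * z / of_real 7)) \<longlongrightarrow> a) iinf"
    using periodic_order_leading[OF hol _ per, of 0] 0(4) by auto
  have "h z = a" if z: "z \<in> UHP" for z
  proof (rule modular_liouville[OF 0(1) inv7_finite[OF 0(2)] _ g0_in _ z])
    show "((\<lambda>z. h (moebius g0 z)) \<longlongrightarrow> a) iinf" using a by simp
    fix A assume A: "A \<in> SLZ"
    have "order_ge (\<lambda>z. h (moebius A z)) 0"
    \<comment> \<open>Matrices of this residue class give the same cusp as \<open>g0\<close>, up to
      a translation of the argument, so boundedness carries over.\<close>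
    proof (cases "7 dvd A $ 2 $ 1 - 2 \<or> 7 dvd A $ 2 $ 1 + 2")
      case True
      then obtain k :: int where k: "\<And>z. z \<in> UHP \<Longrightarrow> h (moebius A z) = h (moebius g0 (z + of_int k))"
        using inv7_pole_cusps[OF 0(2) A] by blast
      have "order_ge (\<lambda>z. h (moebius g0 (z + of_int k))) 0" using order_ge_0_translate[OF 0(4)[simplified]] .
      moreover have "eventually (\<lambda>z. h (moebius g0 (z + of_int k)) = h (moebius A z)) iinf"
        using eventually_iinf_UHP by eventually_elim (simp only: k)
      ultimately show ?thesis by (rule order_ge_eq)
    qed (use 0(3) A in auto)
    then show "\<exists>B. eventually (\<lambda>z. norm (h (moebius A z)) \<le> B) iinf" by (simp add: order_ge_bounded)
  qed
  then show ?case by (intro exI[of _ "[:a:]"]) auto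
next
  case (Suc N)
  define n where "n = - int (Suc N)"
  have hol: "(\<lambda>z. h (moebius g0 z)) holomorphic_on UHP" using Suc.prems by (intro holomorphic_moebius_compose) auto
  have per: "h (moebius g0 (z + of_real 7)) = h (moebius g0 z)" if "z \<in> UHP" for z
    using inv7_g0_periodic[OF Suc.prems(2) that] by simp
  have ordn: "order_ge (\<lambda>z. h (moebius g0 z)) (of_int n / 7)" using Suc.prems(4) by (simp add: n_def)
  obtain a where a: "((\<lambda>z. h (moebius g0 z) / ee (of_int n * z / of_real 7)) \<longlongrightarrow> a) iinf"
    using periodic_order_leading[OF hol _ per ordn] by auto
  have "has_order (Xc 2 7) (- 1/7)" by (rule Xc_orders(2)) auto
  then obtain b where b: "b \<noteq> 0" "((\<lambda>z. Xc 2 7 z / ee (of_real (-1/7) * z)) \<longlongrightarrow> b) iinf" by (auto simp: has_order_def)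
  \<comment> \<open>The quotient of the leading coefficients of \<open>h\<close> and of
    \<open>X7 ^ Suc N\<close> at this cusp.\<close>
  define k where "k = a / b ^ Suc N"
  define h' where "h' = (\<lambda>z. h z - k * X7 z ^ Suc N)"
  have h'_hol: "h' holomorphic_on UHP" unfolding h'_def using Suc.prems by (intro holomorphic_intros Xc_hol) auto
  have h'_inv: "inv7 h'" using Suc.prems(2) inv7_X7 by (simp add: h'_def inv7_def)
  have h'_bnd: "order_ge (\<lambda>z. h' (moebius A z)) 0"
    if A: "A \<in> SLZ" and nA: "\<not> (7 dvd A $ 2 $ 1 - 2 \<or> 7 dvd A $ 2 $ 1 + 2)" for A
  proof -
    have "order_ge (\<lambda>z. k * Xc (A $ 2 $ 1) (A $ 2 $ 2) z ^ Suc N) 0"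
      using order_ge_cmult[OF order_ge_power[OF Xc_bounded[OF prim7_SL2[OF A] nA], of "Suc N"], of k] by simp
    from order_ge_minus[OF Suc.prems(3)[OF A nA] this]
    have "order_ge (\<lambda>z. h (moebius A z) - k * Xc (A $ 2 $ 1) (A $ 2 $ 2) z ^ Suc N) 0" .
    moreover have "eventually (\<lambda>z. h (moebius A z) - k * Xc (A $ 2 $ 1) (A $ 2 $ 2) z ^ Suc N = h' (moebius A z)) iinf"
      using eventually_iinf_UHP by eventually_elim (simp add: h'_def Xc_moebius[OF A])
    ultimately show ?thesis by (rule order_ge_eq)
  qed
  have lim0: "((\<lambda>z. h' (moebius g0 z) / ee (of_int n * z / of_real 7)) \<longlongrightarrow> 0) iinf"
  proof -
    have "((\<lambda>z. h (moebius g0 z) / ee (of_int n * z / of_real 7) - k * (Xc 2 7 z / ee (of_real (-1/7) * z)) ^ Suc N) \<longlongrightarrow> a - k * b ^ Suc N) iinf"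
      by (intro tendsto_intros a b)
    also have "a - k * b ^ Suc N = 0" using b by (simp add: k_def)
    finally have l: "((\<lambda>z. h (moebius g0 z) / ee (of_int n * z / of_real 7) - k * (Xc 2 7 z / ee (of_real (-1/7) * z)) ^ Suc N) \<longlongrightarrow> 0) iinf" .
    have pw: "ee (of_real (-1/7) * z) ^ Suc N = ee (of_int n * z / of_real 7)" for z
    proof -
      have "ee x ^ m = ee (of_nat m * x)" for x m by (simp add: ee_def mult_ac flip: exp_of_nat_mult)
      then have "ee (of_real (-1/7) * z) ^ Suc N = ee (of_nat (Suc N) * (of_real (-1/7) * z))" .
      also have "of_nat (Suc N) * (of_real (-1/7) * z) = of_int n * z / of_real 7" by (simp add: n_def algebra_simps)
      finally show ?thesis .
    qed
    show ?thesis
    proof (rule Lim_transform_eventually[OF l])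
      show "eventually (\<lambda>z. h (moebius g0 z) / ee (of_int n * z / of_real 7) - k * (Xc 2 7 z / ee (of_real (-1/7) * z)) ^ Suc N
          = h' (moebius g0 z) / ee (of_int n * z / of_real 7)) iinf"
        using eventually_iinf_UHP
      proof eventually_elim
        case (elim z)
        have "X7 (moebius g0 z) = Xc 2 7 z" using Xc_moebius[OF g0_in elim] by simp
        then show ?case unfolding h'_def power_divide pw by (simp add: diff_divide_distrib)
      qed
    qed
  qed
  have h'_hol0: "(\<lambda>z. h' (moebius g0 z)) holomorphic_on UHP" using h'_hol by (intro holomorphic_moebius_compose) auto
  have h'_per: "h' (moebius g0 (z + of_real 7)) = h' (moebius g0 z)" if "z \<in> UHP" for z
    using inv7_g0_periodic[OF h'_inv that] by simp
  have h'_ord: "order_ge (\<lambda>z. h' (moebius g0 z)) (of_int n / 7)"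
  proof -
    have "has_order (\<lambda>z. ee (of_int n * z / of_real 7)) (of_int n / 7)"
      by (auto simp: has_order_def intro!: exI[of _ 1])
    from order_ge_mult[OF tendsto_imp_order_ge_0[OF lim0] has_order_imp_order_ge[OF this]]
    show ?thesis by simp
  qed
  obtain a' where a': "((\<lambda>z. h' (moebius g0 z) / ee (of_int n * z / of_real 7)) \<longlongrightarrow> a') iinf"
    "order_ge (\<lambda>z. h' (moebius g0 z) - a' * ee (of_int n * z / of_real 7)) (of_int (n + 1) / 7)"
    using periodic_order_leading[OF h'_hol0 _ h'_per h'_ord] by auto
  \<comment> \<open>The leading coefficient of \<open>h'\<close> was arranged to vanish, so its
    order rises by one step, to \<open>- N / 7\<close>.\<close>
  have "a' = 0" using tendsto_unique[OF iinf_nontrivial a'(1) lim0] .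
  then have ord': "order_ge (\<lambda>z. h' (moebius g0 z)) (- of_nat N / 7)" using a'(2) by (simp add: n_def)
  obtain p where p: "degree p \<le> N" "\<And>z. z \<in> UHP \<Longrightarrow> h' z = poly p (X7 z)"
    using Suc.IH[OF h'_hol h'_inv h'_bnd ord'] by blast
  have "degree (p + monom k (Suc N)) \<le> Suc N"
    using p(1) degree_monom_le[of k "Suc N"] by (intro degree_add_le) auto
  moreover have "h z = poly (p + monom k (Suc N)) (X7 z)" if "z \<in> UHP" for z
    using p(2)[OF that] by (simp add: h'_def poly_monom algebra_simps)
  ultimately show ?case by blast
qed

subsection \<open>The square root of the quintic\<close>

text \<open>The values of \<open>X7\<close> at the three cusps of width 1; they are the roots of \<open>cubic7\<close>.\<close>

definition xval :: "int \<Rightarrow> complex" where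
  "xval d = (csc_sq (of_int (3 * d) / 7) - csc_sq (of_int (2 * d) / 7)) / (csc_sq (of_int (1 * d) / 7) - csc_sq (of_int (2 * d) / 7))"

text \<open>This is \<open>2 cos (2 \<pi> d / 7)\<close>; the squared cosecant at
  \<open>d / 7\<close> is a rational function of it.\<close>

definition cval :: "int \<Rightarrow> complex" where
  "cval d = ee (of_int d / 7) + ee (- (of_int d / 7))"

lemma Xc_limit:
  assumes "7 dvd c" "prim7 c d"
  shows "(Xc c d \<longlongrightarrow> xval d) iinf"
proof -
  have d: "\<not> 7 dvd d" using assms by (simp add: prim7_def)
  show ?thesis unfolding Xc_def[abs_def] xval_def
    by (rule tendsto_divide[OF dd_limit[OF assms(1)] dd_limit[OF assms(1)] dd_limit_nonzero[OF d]]) auto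
qed

lemma csc_sq_via_sum: "csc_sq u = - 4 / (ee u + ee (- u) - 2)"
proof -
  have "ee u * (ee u + ee (- u) - 2) = (1 - ee u)\<^sup>2"
    by (simp add: ee_minus power2_eq_square algebra_simps)
  then have "(1 - ee u)\<^sup>2 = ee u * (ee u + ee (- u) - 2)" by simp
  then show ?thesis unfolding csc_sq_ee by (simp only: mult_divide_mult_cancel_left_if ee_nonzero mult.commute[of _ "ee u"]) simp
qed

text \<open>The seventh cyclotomic polynomial in \<open>w\<close>, divided by \<open>w ^ 3\<close>,
  becomes this cubic in \<open>w + inverse w\<close>.\<close>

lemma cval_cubic:
  assumes "\<not> 7 dvd d"
  shows "cval d ^ 3 + cval d ^ 2 - 2 * cval d - 1 = 0"
proof -
  define w where "w = ee (of_int d / 7)"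
  have w1: "w \<noteq> 1" using assms seventh_Ints_iff[of d] by (simp add: w_def ee_eq_1_iff)
  have w0: "w \<noteq> 0" by (simp add: w_def)
  have "w ^ 7 = ee (of_nat 7 * (of_int d / 7))" unfolding w_def ee_def exp_of_nat_mult[symmetric] by (simp add: mult_ac)
  also have "\<dots> = 1" by simp
  finally have w7: "w ^ 7 = 1" .
  have "(w - 1) * (1 + w + w^2 + w^3 + w^4 + w^5 + w^6) = w ^ 7 - 1" by (simp add: power_numeral_reduce algebra_simps)
  then have S: "1 + w + w^2 + w^3 + w^4 + w^5 + w^6 = 0" using w7 w1 by simp
  define v where "v = inverse w"
  have wv: "w * v = 1" using w0 by (simp add: v_def)
  have c: "cval d = w + v" by (simp add: cval_def w_def v_def ee_minus)
  have "w ^ 3 * (cval d ^ 3 + cval d ^ 2 - 2 * cval d - 1) = 1 + w + w^2 + w^3 + w^4 + w^5 + w^6"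
  proof -
    have wc: "w * cval d = w ^ 2 + 1" unfolding c distrib_left wv by (simp add: power2_eq_square)
    have "w ^ 3 * (cval d ^ 3 + cval d ^ 2 - 2 * cval d - 1) =
        (w * cval d) ^ 3 + w * (w * cval d) ^ 2 - 2 * w ^ 2 * (w * cval d) - w ^ 3"
      by (simp add: power_numeral_reduce algebra_simps)
    also have "\<dots> = 1 + w + w^2 + w^3 + w^4 + w^5 + w^6"
      unfolding wc by (simp add: power_numeral_reduce algebra_simps)
    finally show ?thesis .
  qed
  then show ?thesis using S w0 by simp
qed

lemma cval_mult:
  "cval (2 * d) = cval d ^ 2 - 2" "cval (3 * d) = cval d ^ 3 - 3 * cval d"
proof -
  define w where "w = ee (of_int d / 7)"
  define v where "v = inverse w"
  have wv: "w * v = 1" by (simp add: v_def w_def)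
  have pw: "ee (of_nat n * x) = ee x ^ n" for n x by (simp add: ee_def mult_ac flip: exp_of_nat_mult)
  have c: "cval d = w + v" by (simp add: cval_def w_def v_def ee_minus)
  have "cval (2 * d) = w ^ 2 + v ^ 2" using pw[of 2 "of_int d / 7"] pw[of 2 "- (of_int d / 7)"]
    by (simp add: cval_def w_def v_def ee_minus)
  moreover have "(w + v) ^ 2 = w ^ 2 + v ^ 2 + 2 * (w * v)" by (simp add: power2_eq_square algebra_simps)
  ultimately show "cval (2 * d) = cval d ^ 2 - 2" unfolding c wv by simp
  have "cval (3 * d) = w ^ 3 + v ^ 3" using pw[of 3 "of_int d / 7"] pw[of 3 "- (of_int d / 7)"]
    by (simp add: cval_def w_def v_def ee_minus)
  moreover have "(w + v) ^ 3 = w ^ 3 + v ^ 3 + 3 * (w * v) * (w + v)" by (simp add: power3_eq_cube algebra_simps)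
  ultimately show "cval (3 * d) = cval d ^ 3 - 3 * cval d" unfolding c wv by simp
qed

text \<open>The value is a rational function of \<open>c = cval d\<close>; the cubic equation for
  \<open>c\<close> reduces it to a polynomial of degree 2. The denominators \<open>A\<close>,
  \<open>B\<close>, \<open>C\<close> vanish only for \<open>c\<close> in 2, -2, -1, none of which is
  a root of that cubic.\<close>

lemma xval_eq:
  assumes d: "\<not> 7 dvd d"
  shows "xval d = 7 - 2 * cval d - 3 * cval d ^ 2"
proof -
  define c where "c = cval d"
  have cub: "c ^ 3 + c ^ 2 - 2 * c - 1 = 0" unfolding c_def by (rule cval_cubic[OF d])
  define A B C where "A = c - 2" and "B = c ^ 2 - 4" and "C = c ^ 3 - 3 * c - 2"
  have p: "csc_sq (of_int n / 7) = - 4 / (cval n - 2)" for n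
    unfolding csc_sq_via_sum cval_def by simp
  have p1: "csc_sq (of_int (1 * d) / 7) = - 4 / A" "csc_sq (of_int (2 * d) / 7) = - 4 / B" "csc_sq (of_int (3 * d) / 7) = - 4 / C"
    unfolding p by (simp_all add: cval_mult A_def B_def C_def c_def)
  have nz: "A \<noteq> 0" "B \<noteq> 0" "C \<noteq> 0"
  proof -
    show "A \<noteq> 0"
    proof
      assume "A = 0"
      then have "c = 2" by (simp add: A_def)
      with cub show False by simp
    qed
    show "B \<noteq> 0"
    proof
      assume "B = 0"
      then have "A * (c + 2) = 0" by (simp add: A_def B_def power2_eq_square algebra_simps)
      then have "c = - 2" using \<open>A \<noteq> 0\<close> by (simp add: eq_neg_iff_add_eq_0)
      with cub show False by simp
    qed
    show "C \<noteq> 0"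
    proof
      assume "C = 0"
      then have "A * (c + 1) ^ 2 = 0" by (simp add: A_def C_def power2_eq_square power3_eq_cube algebra_simps)
      then have "c = - 1" using \<open>A \<noteq> 0\<close> by (simp add: eq_neg_iff_add_eq_0)
      with cub show False by simp
    qed
  qed
  have den: "- 4 / A - - 4 / B \<noteq> 0" using dd_limit_nonzero[OF d, of 1 2] unfolding p1 by simp
  have key: "(7 - 2 * c - 3 * c ^ 2) * (B - A) * C = (B - C) * A"
  proof -
    \<comment> \<open>The first factor on the right is the quotient of polynomial division by the
      cubic of \<open>c\<close>; the same device proves the next identities for
      \<open>xval\<close>.\<close>
    have "(7 - 2 * c - 3 * c ^ 2) * (B - A) * C - (B - C) * A =
        (- 24 - 8 * c + 14 * c ^ 2 + 4 * c ^ 3 - 3 * c ^ 4) * (c ^ 3 + c ^ 2 - 2 * c - 1)"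
      unfolding A_def B_def C_def by (simp add: power_numeral_reduce algebra_simps)
    then show ?thesis unfolding cub by simp
  qed
  have "(- 4 / C - - 4 / B) = (7 - 2 * c - 3 * c ^ 2) * (- 4 / A - - 4 / B)"
  proof -
    define k where "k = 7 - 2 * c - 3 * c ^ 2"
    have "(- 4 / C - - 4 / B) = - 4 * ((B - C) * A) / (A * B * C)" using nz by (simp add: field_simps)
    also have "\<dots> = - 4 * (k * (B - A) * C) / (A * B * C)" by (simp only: key k_def)
    also have "\<dots> = k * (- 4 / A - - 4 / B)" using nz by (simp add: field_simps)
    finally show ?thesis unfolding k_def .
  qed
  then show ?thesis unfolding xval_def p1 using den by (simp add: c_def)
qed

lemma xval_cubic:
  assumes d: "\<not> 7 dvd d"
  shows "xval d ^ 3 - 8 * xval d ^ 2 + 5 * xval d + 1 = 0"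
proof -
  define c where "c = cval d"
  have "(7 - 2 * c - 3 * c ^ 2) ^ 3 - 8 * (7 - 2 * c - 3 * c ^ 2) ^ 2 + 5 * (7 - 2 * c - 3 * c ^ 2) + 1 =
      (13 + 54 * c - 27 * c ^ 2 - 27 * c ^ 3) * (c ^ 3 + c ^ 2 - 2 * c - 1)"
    by (simp add: power_numeral_reduce algebra_simps)
  also have "\<dots> = 0" using cval_cubic[OF d] by (simp add: c_def)
  finally show ?thesis unfolding xval_eq[OF d] c_def .
qed

text \<open>Doubling \<open>d\<close> maps the value \<open>x\<close> to \<open>1 - 1 / x\<close>. A
  fixed point satisfies \<open>x^2 = x - 1\<close> and hence \<open>x^3 = - 1\<close>; the cubic
  then gives \<open>x = 8 / 3\<close>, a contradiction.\<close>

lemma xval_double: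
  assumes d: "\<not> 7 dvd d"
  shows "xval (2 * d) \<noteq> xval d"
proof
  assume eq: "xval (2 * d) = xval d"
  have d2: "\<not> 7 dvd 2 * d" using d by (simp add: dvd7_mult_iff)
  have "xval (2 * d) * xval d = xval d - 1"
  proof -
    define c where "c = cval d"
    have "(7 - 2 * (c ^ 2 - 2) - 3 * (c ^ 2 - 2) ^ 2) * (7 - 2 * c - 3 * c ^ 2) - (7 - 2 * c - 3 * c ^ 2 - 1) =
        (13 - 30 * c - 3 * c ^ 2 + 9 * c ^ 3) * (c ^ 3 + c ^ 2 - 2 * c - 1)"
      by (simp add: power_numeral_reduce algebra_simps)
    also have "\<dots> = 0" using cval_cubic[OF d] by (simp add: c_def)
    finally show ?thesis unfolding xval_eq[OF d] xval_eq[OF d2] cval_mult c_def by simp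
  qed
  then have q: "xval d ^ 2 = xval d - 1" unfolding eq by (simp add: power2_eq_square)
  have "xval d ^ 3 = xval d * xval d ^ 2" by (simp add: power3_eq_cube power2_eq_square)
  also have "\<dots> = xval d ^ 2 - xval d" unfolding q by (simp add: power2_eq_square algebra_simps q[unfolded power2_eq_square])
  finally have "xval d ^ 3 = - 1" unfolding q by simp
  with xval_cubic[OF d] q have "8 - 3 * xval d = 0" by (simp add: algebra_simps)
  then have "xval d = 8 / 3" by (simp add: field_simps)
  with q show False by (simp add: power2_eq_square)
qed

lemma xval_cong: "7 dvd d - d' \<Longrightarrow> \<not> 7 dvd d \<Longrightarrow> xval d = xval d'"
proof -
  assume dd': "7 dvd d - d'" and d: "\<not> 7 dvd d"
  then have d': "\<not> 7 dvd d'" by (metis diff_add_cancel dvd_add_right_iff)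
  obtain k where "d = d' + 7 * k" using dd' by (metis add.commute diff_add_cancel dvdE)
  then have e: "(of_int d / 7 :: complex) = of_int d' / 7 + of_int k" by (simp add: add_divide_distrib)
  have "cval d = cval d'" unfolding cval_def ee_minus e by (simp add: ee_add)
  then show ?thesis by (simp add: xval_eq d d')
qed

section \<open>The cubic factor and the construction of \<open>W\<close>\<close>

definition cubic7 :: "complex poly" where "cubic7 = [:1, 5, - 8, 1:]"

lemma poly_cubic7: "poly cubic7 x = x ^ 3 - 8 * x ^ 2 + 5 * x + 1"
  by (simp add: cubic7_def power2_eq_square power3_eq_cube algebra_simps)

text \<open>Subtracting the multiple of \<open>cubic7\<close> with the same leading coefficient
  leaves degree below 3 but three roots. They are distinct because doubling runs through 1, 2, 4 and
  back to 8, congruent to 1, and never fixes a value.\<close>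

lemma poly_vanishing_at_xvals:
  assumes "degree p \<le> 3" "poly p (xval 1) = 0" "poly p (xval 2) = 0" "poly p (xval 4) = 0"
  shows "p = smult (coeff p 3) cubic7"
proof (rule ccontr)
  define q where "q = p - smult (coeff p 3) cubic7"
  assume "p \<noteq> smult (coeff p 3) cubic7"
  then have q0: "q \<noteq> 0" by (simp add: q_def)
  have "coeff q 3 = 0" by (simp add: q_def cubic7_def numeral_3_eq_3)
  moreover have "degree q \<le> 3" unfolding q_def using assms(1) degree_smult_le[of "coeff p 3" cubic7]
    by (intro degree_diff_le) (auto simp: cubic7_def)
  ultimately have dq: "degree q < 3" using q0 by (metis le_neq_implies_less leading_coeff_0_iff)
  have root: "poly cubic7 (xval d) = 0" if "\<not> 7 dvd d" for d
    using xval_cubic[OF that] by (simp add: poly_cubic7)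
  have "{xval 1, xval 2, xval 4} \<subseteq> {x. poly q x = 0}"
    using assms root[of 1] root[of 2] root[of 4] by (auto simp: q_def)
  then have "card {xval 1, xval 2, xval 4} \<le> card {x. poly q x = 0}"
    using poly_roots_finite[OF q0] by (rule card_mono[rotated])
  also have "\<dots> \<le> degree q" using q0 by (rule card_poly_roots_bound)
  finally have "card {xval 1, xval 2, xval 4} < 3" using dq by simp
  moreover have "xval 2 \<noteq> xval 1" "xval 4 \<noteq> xval 2" "xval 8 \<noteq> xval 4" "xval 8 = xval 1"
    using xval_double[of 1] xval_double[of 2] xval_double[of 4] xval_cong[of 8 1] by simp_all
  then have "card {xval 1, xval 2, xval 4} = 3" by auto
  ultimately show False by simp
qed

text \<open>The orders of this quotient at \<open>c\<close> equal to \<plusminus>1, \<plusminus>2,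
  \<plusminus>3 and 0 modulo 7 are 0, -3/7, 0 and 1. So it is a polynomial in \<open>X7\<close> of
  degree at most 3 that vanishes at the three values at the cusps of width 1. The constant is
  nonzero since the quotient has no zeros. The factor \<open>X (X - 1)\<close> is there to clear the
  poles of the squared quotient of \<open>delta\<close> and \<open>Mc\<close> at \<plusminus>1 and
  \<plusminus>3.\<close>

lemma delta_sq_polynomial:
  "\<exists>a. a \<noteq> 0 \<and> (\<forall>z\<in>UHP. X7 z * (X7 z - 1) * delta z ^ 2 / Mc 0 1 z ^ 2 = a * poly cubic7 (X7 z))"
proof -
  define H where "H = (\<lambda>c d z. Xc c d z * (Xc c d z - 1) * delta z ^ 2 / Mc c d z ^ 2)"
  have Hm: "H 0 1 (moebius A z) = H (A $ 2 $ 1) (A $ 2 $ 2) z" if A: "A \<in> SLZ" and z: "z \<in> UHP" for A z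
  proof -
    have n: "aut A z \<noteq> 0" using A z by (rule aut_nonzero)
    have "delta (moebius A z) ^ 2 = aut A z ^ 12 * delta z ^ 2"
      unfolding delta_moebius[OF A z] power_mult_distrib by (simp flip: power_mult)
    moreover have "Mc 0 1 (moebius A z) ^ 2 = aut A z ^ 12 * Mc (A $ 2 $ 1) (A $ 2 $ 2) z ^ 2"
      unfolding Mc_moebius[OF A z] power_mult_distrib by (simp flip: power_mult)
    ultimately show ?thesis unfolding H_def Xc_moebius[OF A z] using n by simp
  qed
  have Hcong: "H c d z = H 0 1 z" if "7 dvd c" "7 dvd d - 1" for c d z
  proof -
    have "Mc c d z = Mc 0 1 z" unfolding Mc_def using dd_cong[of c 0 d 1] that by simp
    then show ?thesis unfolding H_def using Xc_cong[of c 0 d 1] that by simp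
  qed
  have hol: "H 0 1 holomorphic_on UHP"
    unfolding H_def using Mc_nz by (intro holomorphic_intros Xc_hol Mc_hol delta_holomorphic) auto
  have inv: "inv7 (H 0 1)" unfolding inv7_def
  proof (intro ballI)
    fix A z assume A: "A \<in> Gamma1 7" and z: "z \<in> UHP"
    then have "H 0 1 (moebius A z) = H (A $ 2 $ 1) (A $ 2 $ 2) z" by (intro Hm) (auto simp: Gamma1_iff)
    also have "\<dots> = H 0 1 z" using A by (intro Hcong) (auto simp: Gamma1_iff)
    finally show "H 0 1 (moebius A z) = H 0 1 z" .
  qed
  have d2: "has_order (\<lambda>z. delta z ^ 2) 1" using has_order_power[OF delta_has_order, of 2] by simp
  have ord: "has_order (H c d) (r1 + r2 + 1 - 2 * r3)"
    if "has_order (Xc c d) r1" "has_order (\<lambda>z. Xc c d z - 1) r2" "has_order (Mc c d) r3" for c d r1 r2 r3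
    unfolding H_def using has_order_divide[OF has_order_mult[OF has_order_mult[OF that(1,2)] d2] has_order_power[OF that(3), of 2]] by simp
  have bnd: "order_ge (\<lambda>z. H 0 1 (moebius A z)) 0" if A: "A \<in> SLZ" and nA: "\<not> (7 dvd A $ 2 $ 1 - 2 \<or> 7 dvd A $ 2 $ 1 + 2)" for A
  proof -
    define c d where "c = A $ 2 $ 1" and "d = A $ 2 $ 2"
    have pr: "prim7 c d" using prim7_SL2[OF A] by (simp add: c_def d_def)
    have "order_ge (H c d) 0"
    proof (cases c rule: residue7_cases)
      case 0
      show ?thesis using order_ge_mono[OF has_order_imp_order_ge[OF ord[OF Xc_orders(4)[OF 0 pr] Xc1_orders(4)[OF pr 0] Mc_orders(4)[OF 0 pr]]], of 0] by simp
    next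
      case 1
      show ?thesis using has_order_imp_order_ge[OF ord[OF Xc_orders(1)[OF 1] Xc1_orders(1)[OF pr 1] Mc_orders(1)[OF 1]]] by simp
    next
      case 2 then show ?thesis using nA by (simp add: c_def)
    next
      case 3
      show ?thesis using has_order_imp_order_ge[OF ord[OF Xc_orders(3)[OF 3] Xc1_orders(3)[OF pr 3] Mc_orders(3)[OF 3]]] by simp
    qed
    moreover have "eventually (\<lambda>z. H c d z = H 0 1 (moebius A z)) iinf"
      using eventually_iinf_UHP by eventually_elim (simp add: Hm[OF A] c_def d_def)
    ultimately show ?thesis by (rule order_ge_eq)
  qed
  have pole: "order_ge (\<lambda>z. H 0 1 (moebius g0 z)) (- of_nat 3 / 7)"
  proof -
    have pr: "prim7 2 7" by (simp add: prim7_def)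
    have "order_ge (H 2 7) (- of_nat 3 / 7)"
      using has_order_imp_order_ge[OF ord[OF Xc_orders(2) Xc1_orders(2)[OF pr] Mc_orders(2)], of ] by simp
    moreover have "eventually (\<lambda>z. H 2 7 z = H 0 1 (moebius g0 z)) iinf"
      using eventually_iinf_UHP by eventually_elim (simp add: Hm[OF g0_in])
    ultimately show ?thesis by (rule order_ge_eq)
  qed
  obtain p where p: "degree p \<le> 3" "\<And>z. z \<in> UHP \<Longrightarrow> H 0 1 z = poly p (X7 z)"
    using inv7_polynomial[OF hol inv bnd pole] by blast
  have root: "poly p (xval (A $ 2 $ 2)) = 0" if A: "A \<in> SLZ" and c0: "7 dvd A $ 2 $ 1" for A
  proof -
    define c d where "c = A $ 2 $ 1" and "d = A $ 2 $ 2"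
    have pr: "prim7 c d" using prim7_SL2[OF A] by (simp add: c_def d_def)
    have c: "7 dvd c" using c0 by (simp add: c_def)
    have "(H c d \<longlongrightarrow> 0) iinf"
      using order_ge_tendsto_0[OF has_order_imp_order_ge[OF ord[OF Xc_orders(4)[OF c pr] Xc1_orders(4)[OF pr c] Mc_orders(4)[OF c pr]]]] by simp
    moreover have "eventually (\<lambda>z. H c d z = poly p (Xc c d z)) iinf"
      using eventually_iinf_UHP
    proof eventually_elim
      case (elim z)
      have "H c d z = H 0 1 (moebius A z)" using Hm[OF A elim] by (simp add: c_def d_def)
      also have "\<dots> = poly p (X7 (moebius A z))" by (rule p(2)[OF moebius_in_UHP[OF A elim]])
      also have "X7 (moebius A z) = Xc c d z" using Xc_moebius[OF A elim] by (simp add: c_def d_def)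
      finally show ?case .
    qed
    ultimately have "((\<lambda>z. poly p (Xc c d z)) \<longlongrightarrow> 0) iinf" by (rule Lim_transform_eventually)
    moreover have "((\<lambda>z. poly p (Xc c d z)) \<longlongrightarrow> poly p (xval d)) iinf"
      by (rule tendsto_poly[OF Xc_limit[OF c pr]])
    ultimately show ?thesis using tendsto_unique[OF iinf_nontrivial] d_def by blast
  qed
  \<comment> \<open>The bottom rows \<open>(0, 1)\<close>, \<open>(7, 2)\<close>,
    \<open>(7, 4)\<close> represent the three classes of \<open>d\<close> modulo 7 up to
    sign.\<close>
  have "poly p (xval 1) = 0" using root[of "mat 1"] SL2_one by simp
  moreover have "poly p (xval 2) = 0" using root[of "mat22 4 1 7 2"] by (simp add: SL2_iff)
  moreover have "poly p (xval 4) = 0" using root[of "mat22 2 1 7 4"] by (simp add: SL2_iff)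
  ultimately have pc: "p = smult (coeff p 3) cubic7" by (intro poly_vanishing_at_xvals p(1)) auto
  have eq: "H 0 1 z = coeff p 3 * poly cubic7 (X7 z)" if "z \<in> UHP" for z
    using p(2)[OF that] by (subst (asm) pc) simp
  have "\<i> \<in> UHP" by (simp add: upper_half_plane_def)
  then have "H 0 1 \<i> \<noteq> 0" using Xc_neq[of \<i> 0 1] Mc_nz[of \<i> 0 1] delta_nonzero[of \<i>] by (simp add: H_def)
  then have "coeff p 3 \<noteq> 0" using eq[OF \<open>\<i> \<in> UHP\<close>] by auto
  then show ?thesis using eq unfolding H_def by blast
qed

definition quintic7 :: "complex poly" where "quintic7 = [:0, 1:] * ([:0, 1:] - 1) * cubic7"

lemma poly_quintic7: "poly quintic7 x = x * (x - 1) * (x ^ 3 - 8 * x ^ 2 + 5 * x + 1)"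
  by (simp add: quintic7_def poly_cubic7)

definition Wfun :: "complex \<Rightarrow> int \<Rightarrow> int \<Rightarrow> complex \<Rightarrow> complex" where
  "Wfun k c d z = k * (Xc c d z * (Xc c d z - 1) * delta z / Mc c d z)"

text \<open>Determined only up to sign: its square is the inverse of the constant in
  \<open>delta_sq_polynomial\<close>, whose value is never computed.\<close>

definition Wscale :: complex where
  "Wscale = (SOME k. k \<noteq> 0 \<and> (\<forall>z\<in>UHP. Wfun k 0 1 z ^ 2 = poly quintic7 (X7 z)))"

abbreviation Wc :: "int \<Rightarrow> int \<Rightarrow> complex \<Rightarrow> complex" where "Wc \<equiv> Wfun Wscale"

abbreviation W7 :: "complex \<Rightarrow> complex" where "W7 \<equiv> Wc 0 1"

lemma Wscale: "Wscale \<noteq> 0" "z \<in> UHP \<Longrightarrow> W7 z ^ 2 = poly quintic7 (X7 z)"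
proof -
  obtain a where a: "a \<noteq> 0" "\<And>z. z \<in> UHP \<Longrightarrow> X7 z * (X7 z - 1) * delta z ^ 2 / Mc 0 1 z ^ 2 = a * poly cubic7 (X7 z)"
    using delta_sq_polynomial by blast
  define k where "k = csqrt (1 / a)"
  have k: "k ^ 2 = 1 / a" by (simp add: k_def)
  have "Wfun k 0 1 z ^ 2 = poly quintic7 (X7 z)" if z: "z \<in> UHP" for z
  proof -
    have "Wfun k 0 1 z ^ 2 = k ^ 2 * (X7 z * (X7 z - 1)) * (X7 z * (X7 z - 1) * delta z ^ 2 / Mc 0 1 z ^ 2)"
      by (simp add: Wfun_def power_mult_distrib power_divide) (simp add: power2_eq_square mult_ac)
    also have "\<dots> = poly quintic7 (X7 z)" unfolding a(2)[OF z] k using a(1) by (simp add: quintic7_def)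
    finally show ?thesis .
  qed
  moreover have "k \<noteq> 0" using k a(1) by auto
  ultimately have "\<exists>k. k \<noteq> 0 \<and> (\<forall>z\<in>UHP. Wfun k 0 1 z ^ 2 = poly quintic7 (X7 z))" by blast
  from someI_ex[OF this] show "Wscale \<noteq> 0" "z \<in> UHP \<Longrightarrow> W7 z ^ 2 = poly quintic7 (X7 z)"
    unfolding Wscale_def by blast+
qed

lemma W7_moebius:
  assumes A: "A \<in> SLZ" and z: "z \<in> UHP"
  shows "W7 (moebius A z) = psign A * Wc (A $ 2 $ 1) (A $ 2 $ 2) z"
  using aut_nonzero[OF assms] unfolding Wfun_def Xc_moebius[OF assms] Mc_moebius[OF assms] delta_moebius[OF assms]
  by simp

lemma Wc_hol: "prim7 c d \<Longrightarrow> Wc c d holomorphic_on UHP"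
  unfolding Wfun_def[abs_def] using Mc_nz by (intro holomorphic_intros Xc_hol Mc_hol delta_holomorphic) auto

lemma Wc_nz: "z \<in> UHP \<Longrightarrow> prim7 c d \<Longrightarrow> Wc c d z \<noteq> 0"
  using Xc_neq Mc_nz delta_nonzero Wscale(1) by (simp add: Wfun_def)

text \<open>Measured in the coordinate of \<open>\<Gamma>\<^sub>1(7)\<close>, of width 7 or 1, every
  order is half an odd integer: \<open>W\<close> branches at all six cusps.\<close>

lemma Wc_orders:
  assumes pr: "prim7 c d"
  shows "7 dvd c - 1 \<or> 7 dvd c + 1 \<Longrightarrow> has_order (Wc c d) (1/14)"
    "7 dvd c - 2 \<or> 7 dvd c + 2 \<Longrightarrow> has_order (Wc c d) (- 5/14)"
    "7 dvd c - 3 \<or> 7 dvd c + 3 \<Longrightarrow> has_order (Wc c d) (1/14)"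
    "7 dvd c \<Longrightarrow> has_order (Wc c d) (1/2)"
proof -
  have ord: "has_order (Wc c d) (r1 + r2 + 1/2 - r3)"
    if "has_order (Xc c d) r1" "has_order (\<lambda>z. Xc c d z - 1) r2" "has_order (Mc c d) r3" for r1 r2 r3
    unfolding Wfun_def[abs_def]
    by (intro has_order_cmult has_order_divide has_order_mult that delta_has_order Wscale(1))
  show "7 dvd c - 1 \<or> 7 dvd c + 1 \<Longrightarrow> has_order (Wc c d) (1/14)"
    using ord[OF Xc_orders(1) Xc1_orders(1)[OF pr] Mc_orders(1)] by simp
  show "7 dvd c - 2 \<or> 7 dvd c + 2 \<Longrightarrow> has_order (Wc c d) (- 5/14)"
    using ord[OF Xc_orders(2) Xc1_orders(2)[OF pr] Mc_orders(2)] by simp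
  show "7 dvd c - 3 \<or> 7 dvd c + 3 \<Longrightarrow> has_order (Wc c d) (1/14)"
    using ord[OF Xc_orders(3) Xc1_orders(3)[OF pr] Mc_orders(3)] by simp
  show "7 dvd c \<Longrightarrow> has_order (Wc c d) (1/2)"
    using ord[OF Xc_orders(4)[OF _ pr] Xc1_orders(4)[OF pr] Mc_orders(4)[OF _ pr]] by simp
qed

text \<open>The quintic has the values of \<open>X7\<close> at the five cusps without a pole as its
  roots. Its powers can therefore clear poles there, which is how it is used for meromorphic
  functions.\<close>

lemma quintic_vanishes:
  assumes A: "A \<in> SLZ" and nA: "\<not> (7 dvd A $ 2 $ 1 - 2 \<or> 7 dvd A $ 2 $ 1 + 2)"
  shows "order_ge (\<lambda>z. poly quintic7 (X7 (moebius A z))) (1/7)"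
proof -
  define c d where "c = A $ 2 $ 1" and "d = A $ 2 $ 2"
  have pr: "prim7 c d" using prim7_SL2[OF A] by (simp add: c_def d_def)
  have "order_ge (\<lambda>z. Wc c d z ^ 2) (1/7)"
  proof (cases c rule: residue7_cases)
    case 0
    show ?thesis using order_ge_mono[OF has_order_imp_order_ge[OF has_order_power[OF Wc_orders(4)[OF pr 0], of 2]], of "1/7"] by simp
  next
    case 1
    show ?thesis using has_order_imp_order_ge[OF has_order_power[OF Wc_orders(1)[OF pr 1], of 2]] by simp
  next
    case 2 then show ?thesis using nA by (simp add: c_def)
  next
    case 3
    show ?thesis using has_order_imp_order_ge[OF has_order_power[OF Wc_orders(3)[OF pr 3], of 2]] by simp
  qed
  moreover have "eventually (\<lambda>z. Wc c d z ^ 2 = poly quintic7 (X7 (moebius A z))) iinf"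
    using eventually_iinf_UHP
  proof eventually_elim
    case (elim z)
    have "W7 (moebius A z) ^ 2 = Wc c d z ^ 2"
      unfolding W7_moebius[OF A elim] power_mult_distrib by (simp add: c_def d_def)
    then show ?case using Wscale(2)[OF moebius_in_UHP[OF A elim]] by simp
  qed
  ultimately show ?thesis by (rule order_ge_eq)
qed

text \<open>A nonzero polynomial would confine \<open>X7\<close> to finitely many values, but
  \<open>X7\<close> is unbounded because of its pole at a cusp. So \<open>X7\<close> is
  transcendental over the constants.\<close>

lemma poly_X7_eq_0:
  assumes "\<And>z. z \<in> UHP \<Longrightarrow> poly p (X7 z) = 0"
  shows "p = 0"
proof (rule ccontr)
  assume "p \<noteq> 0"
  then have fin: "finite {x. poly p x = 0}" by (rule poly_roots_finite)
  define B where "B = Max (insert 0 (norm ` {x. poly p x = 0}))"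
  have bnd: "norm (X7 z) \<le> B" if "z \<in> UHP" for z
    unfolding B_def using fin assms[OF that] by (intro Max_ge) auto
  have "has_order (Xc 2 7) (- 1/7)" by (rule Xc_orders(2)) auto
  then obtain b where b: "b \<noteq> 0" "((\<lambda>z. Xc 2 7 z / ee (of_real (-1/7) * z)) \<longlongrightarrow> b) iinf" by (auto simp: has_order_def)
  have "eventually (\<lambda>z. norm (Xc 2 7 z) \<le> B) iinf"
    using eventually_iinf_UHP
  proof eventually_elim
    case (elim z)
    show ?case using bnd[OF moebius_in_UHP[OF g0_in elim]] Xc_moebius[OF g0_in elim] by simp
  qed
  then have "order_ge (Xc 2 7) 0" by (auto simp: order_ge_bounded)
  moreover have "has_order (\<lambda>z. ee (of_real (-1/7) * z)) (-1/7)" by (auto simp: has_order_def intro!: exI[of _ 1])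
  ultimately have "order_ge (\<lambda>z. Xc 2 7 z / ee (of_real (-1/7) * z)) (0 - (-1/7))" by (rule order_ge_divide)
  then have "((\<lambda>z. Xc 2 7 z / ee (of_real (-1/7) * z)) \<longlongrightarrow> 0) iinf" by (rule order_ge_tendsto_0) simp
  then show False using tendsto_unique[OF iinf_nontrivial b(2)] b(1) by blast
qed

subsection \<open>The group \<open>\<Gamma>\<^sup>2 \<inter> \<Gamma>\<^sub>1(7)\<close>\<close>

definition bmat :: "bit \<Rightarrow> bit \<Rightarrow> bit \<Rightarrow> bit \<Rightarrow> bit ^ 2 ^ 2" where
  "bmat a b c d = vector [vector [a, b], vector [c, d]]"

lemma bmat_nth [simp]:
  "bmat a b c d $ 1 $ 1 = a" "bmat a b c d $ 1 $ 2 = b" "bmat a b c d $ 2 $ 1 = c" "bmat a b c d $ 2 $ 2 = d"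
  by (simp_all add: bmat_def)

lemma bmat_eq_iff: "A = bmat a b c d \<longleftrightarrow> A $ 1 $ 1 = a \<and> A $ 1 $ 2 = b \<and> A $ 2 $ 1 = c \<and> A $ 2 $ 2 = d"
  by (auto intro!: mat22_eqI)

lemma bit_cases: "(x::bit) = 0 \<or> x = 1"
  by (cases x) auto

lemma bmat_mult: "bmat a b c d ** bmat a' b' c' d' = bmat (a * a' + b * c') (a * b' + b * d') (c * a' + d * c') (c * b' + d * d')"
  by (subst bmat_eq_iff) (simp add: mat_mult_nth del: add_bit_eq_xor mult_bit_eq_and)

lemma bmat_1: "(mat 1 :: bit ^ 2 ^ 2) = bmat 1 0 0 1"
  by (simp add: bmat_eq_iff)

lemma SL2_bit_cases:
  assumes "A \<in> carrier (SL2 :: (bit ^ 2 ^ 2) monoid)"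
  shows "A \<in> {bmat 1 0 0 1, bmat 0 1 1 1, bmat 1 1 1 0, bmat 1 1 0 1, bmat 1 0 1 1, bmat 0 1 1 0}"
proof -
  have "A $ 1 $ 1 * A $ 2 $ 2 - A $ 1 $ 2 * A $ 2 $ 1 = 1" using assms by (simp add: SL2_iff del: mult_bit_eq_and)
  then show ?thesis
    using bit_cases[of "A $ 1 $ 1"] bit_cases[of "A $ 1 $ 2"] bit_cases[of "A $ 2 $ 1"] bit_cases[of "A $ 2 $ 2"]
    by (auto simp: bmat_eq_iff)
qed

lemma group_SL2_bit: "group (SL2 :: (bit ^ 2 ^ 2) monoid)"
proof (rule groupI)
  show "\<exists>y\<in>carrier SL2. y \<otimes>\<^bsub>SL2\<^esub> x = \<one>\<^bsub>SL2\<^esub>" if x: "x \<in> carrier (SL2 :: (bit ^ 2 ^ 2) monoid)" for x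
  proof -
    \<comment> \<open>Each of the six elements has order dividing 2 or 3, so its inverse is
      \<open>x\<close> or \<open>x ** x\<close>.\<close>
    have "x ** x = mat 1 \<or> (x ** x) ** x = mat 1"
      using SL2_bit_cases[OF x] by (auto simp: bmat_mult bmat_1)
    moreover have "x ** x \<in> carrier SL2" using x by (rule SL2_mult[OF _ x])
    ultimately show ?thesis using x by (auto simp: SL2_def)
  qed
qed (auto simp: SL2_def det_mul matrix_mul_assoc)

text \<open>Evaluates the definite description in \<open>Gamma_sup2\<close>. The elements outside
  the displayed set are involutions; if such an \<open>x\<close> lay in a subgroup of order 3, any
  \<open>y\<close> in it other than 1 and \<open>x\<close> would give four elements 1,
  \<open>x\<close>, \<open>y\<close>, \<open>x y\<close>.\<close>

lemma subgroup3_SL2_bit: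
  "(THE H. subgroup H (SL2 :: (bit ^ 2 ^ 2) monoid) \<and> card H = 3) = {bmat 1 0 0 1, bmat 0 1 1 1, bmat 1 1 1 0}"
proof (rule the_equality)
  interpret group "SL2 :: (bit ^ 2 ^ 2) monoid" by (rule group_SL2_bit)
  let ?H = "{bmat 1 0 0 1, bmat 0 1 1 1, bmat 1 1 1 0}"
  have mult: "x \<otimes>\<^bsub>SL2\<^esub> y = x ** y" for x y :: "bit ^ 2 ^ 2" by (simp add: SL2_def)
  have one: "\<one>\<^bsub>SL2\<^esub> = bmat 1 0 0 1" by (simp add: SL2_def bmat_1)
  have HC: "?H \<subseteq> carrier SL2" by (auto simp: SL2_iff)
  have card: "card ?H = 3" by (simp add: bmat_eq_iff card_insert_if)
  have "subgroup ?H SL2"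
  proof (rule subgroupI[OF HC])
    fix a assume a: "a \<in> ?H"
    define b where "b = a ** a"
    have b: "b \<in> ?H" "b \<otimes>\<^bsub>SL2\<^esub> a = \<one>\<^bsub>SL2\<^esub>"
      unfolding mult one b_def using a by (auto simp: bmat_mult)
    then have "inv\<^bsub>SL2\<^esub> a = b" using a HC by (intro inv_equality) auto
    with b show "inv\<^bsub>SL2\<^esub> a \<in> ?H" by simp
  next
    fix a b assume "a \<in> ?H" "b \<in> ?H"
    then show "a \<otimes>\<^bsub>SL2\<^esub> b \<in> ?H" unfolding mult by (auto simp: bmat_mult)
  qed auto
  with card show "subgroup ?H SL2 \<and> card ?H = 3" by simp
  fix K assume K: "subgroup K (SL2 :: (bit ^ 2 ^ 2) monoid) \<and> card K = 3"
  then have KC: "K \<subseteq> carrier SL2" and K1: "\<one>\<^bsub>SL2\<^esub> \<in> K" and Km: "\<And>x y. x \<in> K \<Longrightarrow> y \<in> K \<Longrightarrow> x \<otimes>\<^bsub>SL2\<^esub> y \<in> K"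
    and finK: "finite K" by (auto simp: subgroup_def intro: card_ge_0_finite)
  have "K \<subseteq> ?H"
  proof (rule ccontr)
    assume "\<not> K \<subseteq> ?H"
    then obtain x where x: "x \<in> K" "x \<notin> ?H" by blast
    have xC: "x \<in> carrier SL2" using x KC by blast
    have xx: "x \<otimes>\<^bsub>SL2\<^esub> x = \<one>\<^bsub>SL2\<^esub>" using SL2_bit_cases[OF xC] x(2) unfolding mult one by (auto simp: bmat_mult)
    have x1: "x \<noteq> \<one>\<^bsub>SL2\<^esub>" using x(2) one by auto
    have "\<not> K \<subseteq> {\<one>\<^bsub>SL2\<^esub>, x}"
    proof
      assume "K \<subseteq> {\<one>\<^bsub>SL2\<^esub>, x}"
      then have "card K \<le> card {\<one>\<^bsub>SL2\<^esub>, x}" by (intro card_mono) auto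
      also have "\<dots> \<le> 2" by (simp add: card_insert_if)
      finally show False using K by simp
    qed
    then obtain y where y: "y \<in> K" "y \<noteq> \<one>\<^bsub>SL2\<^esub>" "y \<noteq> x" by blast
    have yC: "y \<in> carrier SL2" using y KC by blast
    have xyK: "x \<otimes>\<^bsub>SL2\<^esub> y \<in> K" using Km x y by blast
    have ne: "x \<otimes>\<^bsub>SL2\<^esub> y \<noteq> \<one>\<^bsub>SL2\<^esub>" "x \<otimes>\<^bsub>SL2\<^esub> y \<noteq> x" "x \<otimes>\<^bsub>SL2\<^esub> y \<noteq> y"
    proof -
      show "x \<otimes>\<^bsub>SL2\<^esub> y \<noteq> \<one>\<^bsub>SL2\<^esub>" using xx y(3) xC yC by (metis m_assoc l_one r_one)
      show "x \<otimes>\<^bsub>SL2\<^esub> y \<noteq> x" using xx y(2) xC yC by (metis m_assoc l_one)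
      show "x \<otimes>\<^bsub>SL2\<^esub> y \<noteq> y" using x1 xC yC by (metis m_assoc r_inv r_one inv_closed)
    qed
    have "card {\<one>\<^bsub>SL2\<^esub>, x, y, x \<otimes>\<^bsub>SL2\<^esub> y} = 4" using ne x1 y(2,3) by (auto simp: card_insert_if)
    moreover have "card {\<one>\<^bsub>SL2\<^esub>, x, y, x \<otimes>\<^bsub>SL2\<^esub> y} \<le> card K" using K1 x y xyK finK by (intro card_mono) auto
    ultimately show False using K by simp
  qed
  then show "K = ?H" using card K by (intro card_subset_eq) auto
qed

lemma of_int_bit: "(of_int n :: bit) = (if even n then 0 else 1)"
proof (cases "even n")
  case True
  then obtain k where "n = 2 * k" by (elim evenE)
  then have "(of_int n :: bit) = 2 * of_int k" by (simp only: of_int_mult of_int_numeral)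
  then show ?thesis using True by (simp only: bit_2_eq_0 mult_zero_left) simp
next
  case False
  then obtain k where "n = 2 * k + 1" by (elim oddE)
  then have "(of_int n :: bit) = 2 * of_int k + 1" by (simp only: of_int_mult of_int_numeral of_int_add of_int_1)
  then show ?thesis using False by (simp only: bit_2_eq_0 mult_zero_left add_0_left) simp
qed

lemma Gamma_sup2_iff: "A \<in> Gamma_sup2 \<longleftrightarrow> A \<in> SLZ \<and> even_perm A"
  unfolding Gamma_sup2_def subgroup3_SL2_bit
  by (auto simp: bmat_eq_iff reduce_mod2_def of_int_bit even_perm_def split: if_splits)

abbreviation G7 :: "(int ^ 2 ^ 2) set" where "G7 \<equiv> Gamma_sup2 \<inter> Gamma1 7"

lemma G7_iff: "A \<in> G7 \<longleftrightarrow> A \<in> Gamma1 7 \<and> psign A = 1"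
  by (auto simp: Gamma_sup2_iff Gamma1_iff psign_def)

lemma Gamma1_SLZ: "A \<in> Gamma1 7 \<Longrightarrow> A \<in> SLZ" by (simp add: Gamma1_iff)

lemma Gamma1_mult: "A \<in> Gamma1 7 \<Longrightarrow> B \<in> Gamma1 7 \<Longrightarrow> A ** B \<in> Gamma1 7"
proof -
  assume A: "A \<in> Gamma1 7" and B: "B \<in> Gamma1 7"
  define a b c d where "a = A $ 1 $ 1" and "b = A $ 1 $ 2" and "c = A $ 2 $ 1" and "d = A $ 2 $ 2"
  define a' b' c' d' where "a' = B $ 1 $ 1" and "b' = B $ 1 $ 2" and "c' = B $ 2 $ 1" and "d' = B $ 2 $ 2"
  have "7 dvd a - 1" "7 dvd d - 1" "7 dvd c" "7 dvd a' - 1" "7 dvd d' - 1" "7 dvd c'"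
    using A B by (auto simp: Gamma1_iff a_def c_def d_def a'_def c'_def d'_def)
  then have "7 dvd (a - 1) * a' + (a' - 1) + b * c'" "7 dvd c * b' + (d - 1) * d' + (d' - 1)" and e3: "7 dvd c * a' + d * c'" by auto
  moreover have "(a - 1) * a' + (a' - 1) + b * c' = a * a' + b * c' - 1" "c * b' + (d - 1) * d' + (d' - 1) = c * b' + d * d' - 1"
    by (simp_all add: algebra_simps)
  ultimately have "7 dvd a * a' + b * c' - 1" "7 dvd c * b' + d * d' - 1" by metis+
  with e3 have "7 dvd (A ** B) $ 1 $ 1 - 1" "7 dvd (A ** B) $ 2 $ 2 - 1" "7 dvd (A ** B) $ 2 $ 1"
    unfolding mat_mult_nth a_def b_def c_def d_def a'_def b'_def c'_def d'_def by blast+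
  moreover have "A ** B \<in> SLZ" using A B by (auto simp: Gamma1_iff intro: SL2_mult)
  ultimately show ?thesis by (simp add: Gamma1_iff)
qed

lemma T1_in: "translation_matrix k \<in> Gamma1 7"
  by (simp add: Gamma1_iff)

text \<open>Translation by 1 lies in \<open>\<Gamma>\<^sub>1(7)\<close> but is an odd permutation;
  it represents the nontrivial coset of \<open>G7\<close> and induces the involution of the double
  cover.\<close>

lemma psign_T1 [simp]: "psign (translation_matrix 1) = - 1"
  by (simp add: psign_def even_perm_def)

lemma psign_cases: "psign A = 1 \<or> psign A = - 1"
  by (simp add: psign_def)

section \<open>Widths and coordinates at the cusps\<close>

lemma conj_translation:
  assumes S: "S \<in> SLZ"
  shows "\<exists>A\<in>SLZ. S ** A = translation_matrix h ** S \<and> A = SL2_inv S ** translation_matrix h ** S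
     \<and> A $ 1 $ 1 = 1 + h * (S $ 2 $ 1 * S $ 2 $ 2) \<and> A $ 1 $ 2 = h * (S $ 2 $ 2)\<^sup>2
     \<and> A $ 2 $ 1 = - h * (S $ 2 $ 1)\<^sup>2 \<and> A $ 2 $ 2 = 1 - h * (S $ 2 $ 1 * S $ 2 $ 2)"
proof -
  define A where "A = SL2_inv S ** translation_matrix h ** S"
  have "A \<in> SLZ" unfolding A_def using S by (intro SL2_mult) auto
  moreover have "S ** A = translation_matrix h ** S"
    unfolding A_def using SL2_inv_mult(2)[OF S] by (simp add: matrix_mul_assoc)
  moreover have det: "S $ 1 $ 1 * S $ 2 $ 2 = 1 + S $ 1 $ 2 * S $ 2 $ 1" using S by (simp add: SL2_iff)
  have "A $ 1 $ 1 = (S $ 1 $ 1 * S $ 2 $ 2) + h * (S $ 2 $ 1 * S $ 2 $ 2) - S $ 1 $ 2 * S $ 2 $ 1"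
    "A $ 2 $ 2 = (S $ 1 $ 1 * S $ 2 $ 2) - h * (S $ 2 $ 1 * S $ 2 $ 2) - S $ 1 $ 2 * S $ 2 $ 1"
    "A $ 1 $ 2 = h * (S $ 2 $ 2)\<^sup>2" "A $ 2 $ 1 = - h * (S $ 2 $ 1)\<^sup>2"
    by (simp_all add: A_def mat_mult_nth power2_eq_square algebra_simps)
  then have "A $ 1 $ 1 = 1 + h * (S $ 2 $ 1 * S $ 2 $ 2) \<and> A $ 1 $ 2 = h * (S $ 2 $ 2)\<^sup>2
     \<and> A $ 2 $ 1 = - h * (S $ 2 $ 1)\<^sup>2 \<and> A $ 2 $ 2 = 1 - h * (S $ 2 $ 1 * S $ 2 $ 2)" unfolding det by simp
  ultimately show ?thesis using A_def by blast
qed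

text \<open>The conjugate differs from the identity by a multiple of \<open>h\<close>, so evenness
  of \<open>h\<close> settles reduction modulo 2. Modulo 7 the relevant entries carry the factor
  \<open>h\<close> times the lower left entry of \<open>S\<close>. Thus 14 is always a period, and 2
  is one where that entry is divisible by 7.\<close>

lemma conj_translation_in_G7:
  assumes S: "S \<in> SLZ" and h: "even h" "7 dvd h \<or> 7 dvd S $ 2 $ 1"
  shows "\<exists>A\<in>G7. S ** A = translation_matrix h ** S"
proof -
  obtain A where A: "A \<in> SLZ" "S ** A = translation_matrix h ** S" "A $ 1 $ 1 = 1 + h * (S $ 2 $ 1 * S $ 2 $ 2)"
    "A $ 1 $ 2 = h * (S $ 2 $ 2)\<^sup>2" "A $ 2 $ 1 = - h * (S $ 2 $ 1)\<^sup>2" "A $ 2 $ 2 = 1 - h * (S $ 2 $ 1 * S $ 2 $ 2)"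
    using conj_translation[OF S, of h] by blast
  have "even_perm A" using h by (simp add: even_perm_def A)
  moreover have "7 dvd h * (S $ 2 $ 1 * S $ 2 $ 2)" "7 dvd h * (S $ 2 $ 1)\<^sup>2"
    using h(2) by (auto simp: dvd7_mult_iff power2_eq_square)
  ultimately have "A \<in> G7" using A by (simp add: Gamma_sup2_iff Gamma1_iff)
  with A show ?thesis by blast
qed

lemma cusp_width_props:
  assumes S: "S \<in> SLZ"
  shows "cusp_width G7 S > 0"
    "\<exists>A\<in>G7. S ** A = translation_matrix (int (cusp_width G7 S)) ** S \<or> S ** A = - (translation_matrix (int (cusp_width G7 S)) ** S)"
proof -
  define P where "P = (\<lambda>h. h > 0 \<and> (\<exists>A\<in>G7. S ** A = translation_matrix (int h) ** S \<or> S ** A = - (translation_matrix (int h) ** S)))"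
  have "P 14" unfolding P_def using conj_translation_in_G7[OF S, of 14] by auto
  then have "P (LEAST h. P h)" by (rule LeastI)
  then show "cusp_width G7 S > 0"
    "\<exists>A\<in>G7. S ** A = translation_matrix (int (cusp_width G7 S)) ** S \<or> S ** A = - (translation_matrix (int (cusp_width G7 S)) ** S)"
    unfolding cusp_width_def P_def by auto
qed

lemma moebius_conj_translation:
  assumes S: "S \<in> SLZ" and A: "A \<in> SLZ" and eq: "S ** A = translation_matrix h ** S \<or> S ** A = - (translation_matrix h ** S)"
    and w: "w \<in> UHP"
  shows "moebius (SL2_inv S) (w + of_int h) = moebius A (moebius (SL2_inv S) w)"
proof -
  define z where "z = moebius (SL2_inv S) w"
  have z: "z \<in> UHP" "moebius S z = w" using S w moebius_in_UHP moebius_inv(2) by (auto simp: z_def)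
  have "moebius (S ** A) z = moebius (translation_matrix h ** S) z" using eq by auto
  then have "moebius S (moebius A z) = w + of_int h" using S A z by (simp add: moebius_mult)
  then have "moebius (SL2_inv S) (w + of_int h) = moebius (SL2_inv S) (moebius S (moebius A z))" by simp
  also have "\<dots> = moebius A z" using moebius_inv(1)[OF S moebius_in_UHP[OF A z(1)]] .
  finally show ?thesis by (simp add: z_def)
qed

lemma SL2_inv_inv [simp]: "SL2_inv (SL2_inv A) = A"
  by (intro mat22_eqI) simp_all

text \<open>Moves statements near a cusp to \<open>iinf\<close>. The cusp filter ranges over all
  complex numbers; the bound \<open>max M 0\<close> ensures that both points lie in the upper
  half-plane, where the matrix is invertible.\<close>

lemma eventually_cusp_filter:
  assumes S: "S \<in> SLZ"
  shows "eventually P (cusp_filter S) \<longleftrightarrow> eventually (\<lambda>w. P (moebius (SL2_inv S) w)) iinf"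
proof -
  have "eventually P (cusp_filter S) \<longleftrightarrow> (\<exists>M. \<forall>z. Im (moebius S z) > M \<longrightarrow> P z)"
    unfolding cusp_filter_def eventually_filtercomap eventually_at_top_dense by auto
  also have "\<dots> \<longleftrightarrow> (\<exists>M. \<forall>w. Im w > M \<longrightarrow> P (moebius (SL2_inv S) w))"
  proof
    assume "\<exists>M. \<forall>z. Im (moebius S z) > M \<longrightarrow> P z"
    then obtain M where M: "\<And>z. Im (moebius S z) > M \<Longrightarrow> P z" by blast
    have "P (moebius (SL2_inv S) w)" if "Im w > max M 0" for w
    proof (rule M)
      have "w \<in> UHP" using that by (simp add: upper_half_plane_def)
      then show "Im (moebius S (moebius (SL2_inv S) w)) > M" using moebius_inv(2)[OF S] that by simp
    qed
    then show "\<exists>M. \<forall>w. Im w > M \<longrightarrow> P (moebius (SL2_inv S) w)" by blast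
  next
    assume "\<exists>M. \<forall>w. Im w > M \<longrightarrow> P (moebius (SL2_inv S) w)"
    then obtain M where M: "\<And>w. Im w > M \<Longrightarrow> P (moebius (SL2_inv S) w)" by blast
    have "P z" if z: "Im (moebius S z) > max M 0" for z
    proof -
      have "z \<in> UHP" using Im_pos_moebius_iff[OF S] z by simp
      then show ?thesis using M[of "moebius S z"] z moebius_inv(1)[OF S] by simp
    qed
    then show "\<exists>M. \<forall>z. Im (moebius S z) > M \<longrightarrow> P z" by blast
  qed
  finally show ?thesis by (simp add: eventually_iinf)
qed

lemma cusp_coord_inv:
  assumes "S \<in> SLZ" "w \<in> UHP"
  shows "cusp_coord G7 S (moebius (SL2_inv S) w) = ee (w / of_real (real (cusp_width G7 S)))"
  using moebius_inv(2)[OF assms] by (simp add: cusp_coord_def ee_def)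

lemma modular_functions_cusp_iff:
  assumes "S \<in> SLZ"
  shows "eventually (\<lambda>z. f z = g (cusp_coord G7 S z)) (cusp_filter S) \<longleftrightarrow>
    eventually (\<lambda>w. f (moebius (SL2_inv S) w) = g (ee (w / of_real (real (cusp_width G7 S))))) iinf"
proof -
  have "eventually (\<lambda>w. f (moebius (SL2_inv S) w) = g (cusp_coord G7 S (moebius (SL2_inv S) w)) \<longleftrightarrow>
     f (moebius (SL2_inv S) w) = g (ee (w / of_real (real (cusp_width G7 S))))) iinf"
    using eventually_iinf_UHP by eventually_elim (simp add: cusp_coord_inv[OF assms])
  then show ?thesis unfolding eventually_cusp_filter[OF assms] by (rule eventually_subst)
qed

subsection \<open>Meromorphic functions for \<open>\<Gamma>\<^sub>1(7)\<close>\<close>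

lemma moebius_filterlim:
  assumes A: "A \<in> SLZ" and z: "z \<in> UHP"
  shows "filterlim (moebius A) (at (moebius A z)) (at z)"
proof -
  have "isCont (moebius A) z" using moebius_has_deriv[OF A z] by (rule DERIV_isCont)
  then have lim: "(moebius A \<longlongrightarrow> moebius A z) (at z)" by (simp add: isCont_def)
  have "eventually (\<lambda>w. w \<in> UHP - {z}) (at z)" by (rule eventually_at_in_open[OF open_UHP z])
  then have "eventually (\<lambda>w. moebius A w \<noteq> moebius A z) (at z)"
  proof eventually_elim
    case (elim w)
    then show ?case using moebius_inv(1)[OF A, of w] moebius_inv(1)[OF A z] by auto
  qed
  with lim show ?thesis by (simp add: filterlim_at)
qed

lemma eventually_at_UHP: "z \<in> UHP \<Longrightarrow> eventually (\<lambda>w. w \<in> UHP) (at z)"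
  using eventually_at_in_open'[OF open_UHP] by blast

lemma meromorphic_moebius:
  assumes "f meromorphic_on UHP" "A \<in> SLZ"
  shows "(\<lambda>z. f (moebius A z)) meromorphic_on UHP"
proof -
  have "(\<lambda>z. f (moebius A z)) meromorphic_on UHP"
  proof (rule meromorphic_on_compose[OF assms(1)])
    show "moebius A analytic_on UHP" using moebius_holomorphic[OF assms(2)] open_UHP by (simp add: analytic_on_open)
  qed (use moebius_in_UHP[OF assms(2)] in auto)
  then show ?thesis .
qed

text \<open>A Moebius map carries punctured neighbourhoods to punctured neighbourhoods, so limits
  exist at both points or at neither; in the latter case both values are the default 0.\<close>

lemma remove_sings_invariant:
  assumes A: "A \<in> SLZ" and z: "z \<in> UHP" and inv: "\<And>w. w \<in> UHP \<Longrightarrow> f (moebius A w) = f w"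
  shows "remove_sings f (moebius A z) = remove_sings f z"
proof -
  have 1: "f \<midarrow>z\<rightarrow> c" if "f \<midarrow>moebius A z\<rightarrow> c" for c
  proof (rule Lim_transform_eventually[OF filterlim_compose[OF that moebius_filterlim[OF A z]]])
    show "eventually (\<lambda>w. f (moebius A w) = f w) (at z)" using eventually_at_UHP[OF z] by eventually_elim (rule inv)
  qed
  have 2: "f \<midarrow>moebius A z\<rightarrow> c" if "f \<midarrow>z\<rightarrow> c" for c
  proof -
    have Az: "moebius A z \<in> UHP" using A z by (rule moebius_in_UHP)
    have "f \<midarrow>moebius (SL2_inv A) (moebius A z)\<rightarrow> c" using that moebius_inv(1)[OF A z] by simp
    from filterlim_compose[OF this moebius_filterlim[OF SL2_inv_in[OF A] Az]]
    have l: "(\<lambda>w. f (moebius (SL2_inv A) w)) \<midarrow>moebius A z\<rightarrow> c" .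
    show ?thesis
    proof (rule Lim_transform_eventually[OF l])
      show "eventually (\<lambda>w. f (moebius (SL2_inv A) w) = f w) (at (moebius A z))"
        using eventually_at_UHP[OF Az]
      proof eventually_elim
        case (elim w)
        have "f (moebius A (moebius (SL2_inv A) w)) = f (moebius (SL2_inv A) w)"
          by (rule inv) (use A elim moebius_in_UHP SL2_inv_in in blast)
        then show ?case using moebius_inv(2)[OF A elim] by simp
      qed
    qed
  qed
  show ?thesis
  proof (cases "\<exists>c. f \<midarrow>z\<rightarrow> c")
    case True
    then obtain c where "f \<midarrow>z\<rightarrow> c" by blast
    with 2[OF this] show ?thesis using remove_sings_eqI by metis
  next
    case False
    then show ?thesis using 1 by (auto simp: remove_sings_def)
  qed
qed

lemma bounded_imp_not_pole:
  assumes "eventually (\<lambda>w. norm (f w) \<le> B) (at (z::complex))"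
  shows "\<not> is_pole f z"
proof
  assume "is_pole f z"
  then have "eventually (\<lambda>w. norm (f w) \<ge> B + 1) (at z)" unfolding is_pole_def filterlim_at_infinity[OF order_refl]
    by (metis (no_types, lifting) eventually_mono filterlim_at_infinity_conv_norm_at_top filterlim_at_top is_pole_def \<open>is_pole f z\<close>)
  with assms have "eventually (\<lambda>w. False) (at z)" by eventually_elim simp
  then show False by simp
qed

text \<open>With \<open>n\<close> the pole order, \<open>u ^ n\<close> vanishes at least to order
  \<open>n\<close>. This remains true for \<open>u' = 0\<close>, so nothing has to be known about
  critical points of \<open>X7\<close>.\<close>

lemma meromorphic_kill_pole:
  assumes f: "f meromorphic_on {p}" and u: "(u has_field_derivative u') (at p)" "u p = 0"
  shows "\<exists>n B. eventually (\<lambda>w. norm (u w ^ n * f w) \<le> B) (at p)"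
proof -
  obtain L where L: "(\<lambda>w. f (p + w)) has_laurent_expansion L" using f by (auto simp: meromorphic_on_def)
  define n where "n = nat (- fls_subdegree L)"
  have "(\<lambda>w. w ^ n * f (p + w)) has_laurent_expansion (fls_X ^ n * L)"
    using L by (intro laurent_expansion_intros)
  moreover have "fls_subdegree (fls_X ^ n * L) \<ge> 0"
    by (cases "L = 0") (auto simp: fls_subdegree_mult n_def)
  ultimately have "(\<lambda>w. w ^ n * f (p + w)) \<midarrow>0\<rightarrow> fls_nth (fls_X ^ n * L) 0"
    by (rule has_laurent_expansion_imp_tendsto_0)
  then have l1: "(\<lambda>w. (w - p) ^ n * f w) \<midarrow>p\<rightarrow> fls_nth (fls_X ^ n * L) 0"
    by (subst at_to_0) (simp add: filterlim_filtermap add.commute)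
  have l2: "(\<lambda>w. u w / (w - p)) \<midarrow>p\<rightarrow> u'" using u by (simp add: has_field_derivative_iff)
  have "(\<lambda>w. (u w / (w - p)) ^ n * ((w - p) ^ n * f w)) \<midarrow>p\<rightarrow> u' ^ n * fls_nth (fls_X ^ n * L) 0"
    by (intro tendsto_intros l1 l2)
  moreover have "eventually (\<lambda>w. (u w / (w - p)) ^ n * ((w - p) ^ n * f w) = u w ^ n * f w) (at p)"
    unfolding eventually_at_filter by (rule always_eventually) (auto simp: power_divide)
  ultimately have l: "(\<lambda>w. u w ^ n * f w) \<midarrow>p\<rightarrow> u' ^ n * fls_nth (fls_X ^ n * L) 0" by (rule Lim_transform_eventually)
  define c where "c = u' ^ n * fls_nth (fls_X ^ n * L) 0"
  have "eventually (\<lambda>w. dist (u w ^ n * f w) c < 1) (at p)" using l unfolding c_def by (rule tendstoD) simp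
  then have "eventually (\<lambda>w. norm (u w ^ n * f w) \<le> norm c + 1) (at p)"
  proof eventually_elim
    case (elim w)
    then show ?case using norm_triangle_ineq2[of "u w ^ n * f w" c] by (simp add: dist_norm)
  qed
  then show ?thesis by blast
qed

lemma order_ge_poly:
  assumes g: "order_ge g r" and r: "r \<le> 0"
  shows "\<exists>s. order_ge (\<lambda>z. poly p (g z)) s"
proof -
  have "order_ge (\<lambda>z. poly p (g z)) (of_nat (degree p) * r)"
  proof (induction p)
    case 0
    show ?case using order_ge_const[of 0] by simp
  next
    case (pCons a p)
    show ?case
    proof (cases "p = 0")
      case True
      then show ?thesis using order_ge_const[of a] by simp
    next
      case False
      have "order_ge (\<lambda>z. g z * poly p (g z)) (r + of_nat (degree p) * r)" using g pCons.IH by (rule order_ge_mult)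
      moreover have "order_ge (\<lambda>_. a) (r + of_nat (degree p) * r)"
        using order_ge_mono[OF order_ge_const[of a]] r by (simp add: mult_nonneg_nonpos add_nonpos_nonpos)
      ultimately show ?thesis using False order_ge_add by (fastforce simp: algebra_simps)
    qed
  qed
  then show ?thesis by blast
qed

lemma X7_order:
  assumes "A \<in> SLZ"
  shows "order_ge (\<lambda>z. X7 (moebius A z)) (- 1/7)"
proof -
  define c d where "c = A $ 2 $ 1" and "d = A $ 2 $ 2"
  have pr: "prim7 c d" using prim7_SL2[OF assms] by (simp add: c_def d_def)
  have "order_ge (Xc c d) (- 1/7)"
  proof (cases "7 dvd c - 2 \<or> 7 dvd c + 2")
    case True then show ?thesis using has_order_imp_order_ge[OF Xc_orders(2)] by blast
  next
    case False then show ?thesis using order_ge_mono[OF Xc_bounded[OF pr]] by simp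
  qed
  moreover have "eventually (\<lambda>z. Xc c d z = X7 (moebius A z)) iinf"
    using eventually_iinf_UHP by eventually_elim (simp add: Xc_moebius[OF assms] c_def d_def)
  ultimately show ?thesis by (rule order_ge_eq)
qed

text \<open>Each corrected value is a limit of values of \<open>f\<close>, and the majorant is
  continuous, so the bound survives the limit.\<close>

lemma order_ge_remove_sings:
  assumes f: "f meromorphic_on UHP" and A: "A \<in> SLZ" and ord: "order_ge (\<lambda>z. f (moebius A z)) r"
    and np: "\<And>z. z \<in> UHP \<Longrightarrow> \<not> is_pole f z"
  shows "order_ge (\<lambda>z. remove_sings f (moebius A z)) r"
proof -
  obtain B M0 where M0: "\<And>z. Im z > M0 \<Longrightarrow> norm (f (moebius A z)) \<le> B * norm (ee (of_real r * z))"
    using ord unfolding order_ge_def eventually_iinf by blast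
  define M where "M = max M0 0"
  have "norm (remove_sings f (moebius A z)) \<le> B * norm (ee (of_real r * z))" if z: "Im z > M" for z
  proof -
    have zU: "z \<in> UHP" using z by (simp add: M_def upper_half_plane_def)
    have Az: "moebius A z \<in> UHP" using A zU by (rule moebius_in_UHP)
    have "not_essential f (moebius A z)" using meromorphic_on_not_essential[OF meromorphic_on_subset[OF f]] Az by blast
    then obtain c where c: "f \<midarrow>moebius A z\<rightarrow> c" using np[OF Az] by (auto simp: not_essential_def)
    have "(\<lambda>w. f (moebius A w)) \<midarrow>z\<rightarrow> c" using filterlim_compose[OF c moebius_filterlim[OF A zU]] .
    then have l1: "((\<lambda>w. norm (f (moebius A w))) \<longlongrightarrow> norm c) (at z)" by (rule tendsto_norm)
    have "isCont (\<lambda>w. B * norm (ee (of_real r * w))) z" unfolding ee_def by (intro continuous_intros)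
    then have l2: "((\<lambda>w. B * norm (ee (of_real r * w))) \<longlongrightarrow> B * norm (ee (of_real r * z))) (at z)" by (simp add: isCont_def)
    have "open {w. Im w > M}" by (intro open_Collect_less continuous_intros)
    then have "eventually (\<lambda>w. w \<in> {w. Im w > M}) (at z)" using z by (intro eventually_at_in_open') auto
    then have "eventually (\<lambda>w. norm (f (moebius A w)) \<le> B * norm (ee (of_real r * w))) (at z)"
      by eventually_elim (use M0 in \<open>simp add: M_def\<close>)
    then have "norm c \<le> B * norm (ee (of_real r * z))" using l1 l2 by (intro tendsto_le[OF _ l2 l1]) auto
    moreover have "remove_sings f (moebius A z) = c" using c by (rule remove_sings_eqI)
    ultimately show ?thesis by simp
  qed
  then show ?thesis unfolding order_ge_def eventually_iinf by blast
qed

lemma inv7_representatives: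
  "\<exists>R. finite R \<and> R \<subseteq> SLZ \<and> (\<forall>A\<in>SLZ. \<exists>B\<in>R. 7 dvd A $ 2 $ 1 - B $ 2 $ 1 \<and> 7 dvd A $ 2 $ 2 - B $ 2 $ 2)"
proof -
  define k where "k = (\<lambda>A :: int ^ 2 ^ 2. (A $ 2 $ 1 mod 7, A $ 2 $ 2 mod 7))"
  have fin: "finite (k ` SLZ)"
    by (rule finite_subset[of _ "{0..<7} \<times> {0..<7}"]) (auto simp: k_def)
  define R where "R = inv_into SLZ k ` (k ` SLZ)"
  have "\<exists>B\<in>R. 7 dvd A $ 2 $ 1 - B $ 2 $ 1 \<and> 7 dvd A $ 2 $ 2 - B $ 2 $ 2" if A: "A \<in> SLZ" for A
  proof -
    define B where "B = inv_into SLZ k (k A)"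
    have "k B = k A" unfolding B_def using A by (intro f_inv_into_f) auto
    then have "7 dvd A $ 2 $ 1 - B $ 2 $ 1 \<and> 7 dvd A $ 2 $ 2 - B $ 2 $ 2" by (auto simp: k_def mod_eq_dvd_iff[symmetric])
    moreover have "B \<in> R" using A by (auto simp: R_def B_def)
    ultimately show ?thesis by blast
  qed
  moreover have "R \<subseteq> SLZ" unfolding R_def by (auto intro: inv_into_into)
  ultimately show ?thesis using fin R_def by blast
qed

text \<open>Only finitely many poles occur modulo \<open>\<Gamma>\<^sub>1(7)\<close>; a polynomial
  in \<open>X7\<close> clears them, and a power of the quintic clears the poles at the cusps other
  than that of \<open>g0\<close>. Then \<open>inv7_polynomial\<close> applies. The conclusion is
  stated on punctured neighbourhoods because \<open>f\<close> may take arbitrary values at isolated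
  points.\<close>

lemma inv7_meromorphic_rational:
  assumes f: "f meromorphic_on UHP" and inv: "inv7 f"
    and ord: "\<And>A. A \<in> SLZ \<Longrightarrow> \<exists>r. order_ge (\<lambda>z. f (moebius A z)) r"
  shows "\<exists>D p. D \<noteq> 0 \<and> (\<forall>z\<in>UHP. eventually (\<lambda>w. poly D (X7 w) * f w = poly p (X7 w)) (at z))"
proof -
  obtain R where R: "finite R" "R \<subseteq> SLZ"
    "\<And>A. A \<in> SLZ \<Longrightarrow> \<exists>B\<in>R. 7 dvd A $ 2 $ 1 - B $ 2 $ 1 \<and> 7 dvd A $ 2 $ 2 - B $ 2 $ 2"
    using inv7_representatives by blast
  have fB: "(\<lambda>z. f (moebius B z)) meromorphic_on UHP" if "B \<in> R" for B
    using meromorphic_moebius[OF f] R(2) that by blast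
  have X7B: "(\<lambda>z. X7 (moebius B z)) holomorphic_on UHP" if "B \<in> R" for B
    using holomorphic_moebius_compose[OF Xc_hol] R(2) that by auto
  \<comment> \<open>An order at infinity bounds the translate locally at every point high up, so its
    poles lie below some height, and those in the reduced strip lie in a compact box.\<close>
  have "\<exists>M. \<forall>z\<in>UHP. is_pole (\<lambda>z. f (moebius B z)) z \<longrightarrow> Im z \<le> M" if B: "B \<in> R" for B
  proof -
    obtain r where "order_ge (\<lambda>z. f (moebius B z)) r" using ord R(2) B by blast
    then obtain C M where M: "\<And>z. Im z > M \<Longrightarrow> norm (f (moebius B z)) \<le> C * norm (ee (of_real r * z))"
      unfolding order_ge_def eventually_iinf by blast
    have "\<not> is_pole (\<lambda>z. f (moebius B z)) z" if z: "Im z > M" for z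
    proof -
      have "isCont (\<lambda>w. C * norm (ee (of_real r * w))) z" unfolding ee_def by (intro continuous_intros)
      then have "((\<lambda>w. C * norm (ee (of_real r * w))) \<longlongrightarrow> C * norm (ee (of_real r * z))) (at z)" by (simp add: isCont_def)
      then have "eventually (\<lambda>w. C * norm (ee (of_real r * w)) < C * norm (ee (of_real r * z)) + 1) (at z)"
        by (rule order_tendstoD) simp
      moreover have "open {w. Im w > M}" by (intro open_Collect_less continuous_intros)
      then have "eventually (\<lambda>w. w \<in> {w. Im w > M}) (at z)" using z by (intro eventually_at_in_open') auto
      ultimately have "eventually (\<lambda>w. norm (f (moebius B w)) \<le> C * norm (ee (of_real r * z)) + 1) (at z)"
      proof eventually_elim
        case (elim w)
        then show ?case using M[of w] by simp
      qed
      then show ?thesis by (rule bounded_imp_not_pole)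
    qed
    then show ?thesis by (intro exI[of _ M]) (auto simp: not_less[symmetric])
  qed
  then obtain M where M: "\<And>B z. B \<in> R \<Longrightarrow> z \<in> UHP \<Longrightarrow> is_pole (\<lambda>z. f (moebius B z)) z \<Longrightarrow> Im z \<le> M B" by metis
  define K where "K = (\<lambda>B. cbox (Complex (-1/2) (1/2)) (Complex (1/2) (M B)))"
  have KH: "K B \<subseteq> UHP" for B by (auto simp: K_def in_cbox_complex_iff upper_half_plane_def)
  define Ps where "Ps = (\<lambda>B. {z \<in> K B. is_pole (\<lambda>z. f (moebius B z)) z})"
  have finP: "finite (Ps B)" if "B \<in> R" for B
  proof -
    have "{z. is_pole (\<lambda>z. f (moebius B z)) z} sparse_in UHP"
      using meromorphic_on_imp_not_pole_cosparse[OF fB[OF that]] by (simp add: eventually_cosparse)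
    then have "{z. is_pole (\<lambda>z. f (moebius B z)) z} sparse_in K B" by (rule sparse_in_subset[OF _ KH])
    then have "finite (K B \<inter> {z. is_pole (\<lambda>z. f (moebius B z)) z})"
      by (rule sparse_in_compact_finite) (auto simp: K_def)
    moreover have "Ps B = K B \<inter> {z. is_pole (\<lambda>z. f (moebius B z)) z}" by (auto simp: Ps_def)
    ultimately show ?thesis by simp
  qed
  have "\<exists>n C. eventually (\<lambda>w. norm ((X7 (moebius B w) - X7 (moebius B p)) ^ n * f (moebius B w)) \<le> C) (at p)"
    if B: "B \<in> R" and p: "p \<in> Ps B" for B p
  proof -
    have pU: "p \<in> UHP" using p KH by (auto simp: Ps_def)
    have "((\<lambda>w. X7 (moebius B w)) has_field_derivative deriv (\<lambda>w. X7 (moebius B w)) p) (at p)"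
      by (rule holomorphic_derivI[OF X7B[OF B] open_UHP pU])
    then have "((\<lambda>w. X7 (moebius B w) - X7 (moebius B p)) has_field_derivative deriv (\<lambda>w. X7 (moebius B w)) p) (at p)"
      by (auto intro!: derivative_eq_intros)
    moreover have "(\<lambda>z. f (moebius B z)) meromorphic_on {p}" using fB[OF B] pU by (auto intro: meromorphic_on_subset)
    ultimately show ?thesis using meromorphic_kill_pole[where u = "\<lambda>w. X7 (moebius B w) - X7 (moebius B p)"] by auto
  qed
  note ex = this
  define ok where "ok = (\<lambda>B p (x::nat \<times> real).
      eventually (\<lambda>w. norm ((X7 (moebius B w) - X7 (moebius B p)) ^ fst x * f (moebius B w)) \<le> snd x) (at p))"
  define n where "n = (\<lambda>B p. fst (SOME x. ok B p x))"
  define C where "C = (\<lambda>B p. snd (SOME x. ok B p x))"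
  have nC: "eventually (\<lambda>w. norm ((X7 (moebius B w) - X7 (moebius B p)) ^ n B p * f (moebius B w)) \<le> C B p) (at p)"
    if Bp: "B \<in> R" "p \<in> Ps B" for B p
  proof -
    obtain m c where "eventually (\<lambda>w. norm ((X7 (moebius B w) - X7 (moebius B p)) ^ m * f (moebius B w)) \<le> c) (at p)"
      using ex[OF Bp] by blast
    then have "ok B p (m, c)" by (simp add: ok_def)
    then have "ok B p (SOME x. ok B p x)" by (rule someI)
    then show ?thesis unfolding n_def C_def by (simp only: ok_def)
  qed
  define I where "I = (SIGMA B:R. Ps B)"
  have finI: "finite I" unfolding I_def using R(1) finP by auto
  \<comment> \<open>One factor for each listed pole of each representative translate, raised to a
    power that makes the product bounded near that pole.\<close>
  define D where "D = (\<Prod>(B,p)\<in>I. [:- X7 (moebius B p), 1:] ^ n B p)"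
  have D0: "D \<noteq> 0" unfolding D_def using finI by (auto simp: prod_zero_iff)
  define h where "h = (\<lambda>z. poly D (X7 z) * f z)"
  have DX: "(\<lambda>z. poly D (X7 z)) holomorphic_on UHP" using Xc_hol[of 0 1] by (intro holomorphic_intros) auto
  have h_mero: "h meromorphic_on UHP"
    unfolding h_def using DX open_UHP
    by (intro meromorphic_on_mult[OF analytic_on_imp_meromorphic_on f]) (simp add: analytic_on_open)
  have h_inv: "inv7 h" using inv inv7_X7 by (simp add: h_def inv7_def)
  have not_pole: "\<not> is_pole h z0" if z0: "z0 \<in> UHP" for z0
  proof
    assume pole: "is_pole h z0"
    \<comment> \<open>Moving \<open>z0\<close> into the reduced strip turns \<open>h\<close> near
      \<open>z0\<close> into a representative translate near \<open>w\<close>; a pole of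
      \<open>f\<close> there is one of the listed ones, and \<open>D\<close> cancels it.\<close>
    obtain A where A: "A \<in> SLZ" "1/2 \<le> Im (moebius A z0)" "\<bar>Re (moebius A z0)\<bar> \<le> 1/2"
      using SL2_reduction[OF z0] by blast
    define w where "w = moebius A z0"
    have w: "w \<in> UHP" unfolding w_def using A z0 moebius_in_UHP by blast
    define E where "E = SL2_inv A"
    have E: "E \<in> SLZ" "moebius E w = z0" using A z0 moebius_inv(1) by (auto simp: E_def w_def)
    obtain B where B: "B \<in> R" "7 dvd E $ 2 $ 1 - B $ 2 $ 1" "7 dvd E $ 2 $ 2 - B $ 2 $ 2" using R(3)[OF E(1)] by blast
    have BS: "B \<in> SLZ" using B R by blast
    have hE: "h (moebius E y) = poly D (X7 (moebius B y)) * f (moebius B y)" if "y \<in> UHP" for y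
      using inv7_bottom_row[OF inv E(1) BS that B(2,3)] inv7_bottom_row[OF inv7_X7 E(1) BS that B(2,3)] by (simp add: h_def)
    have "is_pole h (moebius E w)" using pole E by simp
    then have fl: "filterlim (\<lambda>y. h (moebius E y)) at_infinity (at w)"
      unfolding is_pole_def by (rule filterlim_compose[OF _ moebius_filterlim[OF E(1) w]])
    have ev: "eventually (\<lambda>y. h (moebius E y) = poly D (X7 (moebius B y)) * f (moebius B y)) (at w)"
      using eventually_at_UHP[OF w] by eventually_elim (rule hE)
    have pole': "is_pole (\<lambda>y. poly D (X7 (moebius B y)) * f (moebius B y)) w"
      unfolding is_pole_def using fl filterlim_cong[OF refl refl ev] by simp
    have lb: "\<exists>C. eventually (\<lambda>y. norm (g y) \<le> C) (at w)" if "g holomorphic_on UHP" for g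
    proof -
      have "isCont g w" using that w open_UHP holomorphic_on_imp_continuous_on continuous_on_eq_continuous_at by blast
      then have "eventually (\<lambda>y. dist (g y) (g w) < 1) (at w)" unfolding isCont_def by (rule tendstoD) simp
      then have "eventually (\<lambda>y. norm (g y) \<le> norm (g w) + 1) (at w)"
      proof eventually_elim
        case (elim y)
        then show ?case using norm_triangle_ineq2[of "g y" "g w"] by (simp add: dist_norm)
      qed
      then show ?thesis by blast
    qed
    have polyX: "(\<lambda>y. poly q (X7 (moebius B y))) holomorphic_on UHP" for q
      using X7B[OF B(1)] by (intro holomorphic_intros)
    show False
    proof (cases "is_pole (\<lambda>z. f (moebius B z)) w")
      case True
      then have "Im w \<le> M B" using M B w by blast
      then have wP: "w \<in> Ps B" using True A by (auto simp: Ps_def K_def in_cbox_complex_iff w_def)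
      then have wI: "(B, w) \<in> I" using B by (auto simp: I_def)
      define D' where "D' = (\<Prod>(B,p)\<in>I - {(B, w)}. [:- X7 (moebius B p), 1:] ^ n B p)"
      have DD: "D = [:- X7 (moebius B w), 1:] ^ n B w * D'" unfolding D_def D'_def by (subst prod.remove[OF finI wI]) simp
      have pe: "poly D (X7 (moebius B y)) * f (moebius B y) =
          poly D' (X7 (moebius B y)) * ((X7 (moebius B y) - X7 (moebius B w)) ^ n B w * f (moebius B y))" for y
        unfolding DD by simp
      obtain C' where C': "eventually (\<lambda>y. norm (poly D' (X7 (moebius B y))) \<le> C') (at w)"
        using lb[OF polyX[of D']] by blast
      have nb: "eventually (\<lambda>y. norm (poly D (X7 (moebius B y)) * f (moebius B y)) \<le> C' * C B w) (at w)"
        using C' nC[OF B(1) wP]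
      proof eventually_elim
        case (elim y)
        have "0 \<le> C'" using elim(1) norm_ge_zero order_trans by blast
        then show ?case unfolding pe norm_mult[of "poly D' _"] using elim by (intro mult_mono) auto
      qed
      show False using bounded_imp_not_pole[OF nb] pole' by blast
    next
      case False
      have "not_essential (\<lambda>z. f (moebius B z)) w" using meromorphic_on_not_essential[OF meromorphic_on_subset[OF fB[OF B(1)]]] w by blast
      then obtain c where c: "(\<lambda>z. f (moebius B z)) \<midarrow>w\<rightarrow> c" using False by (auto simp: not_essential_def)
      have "isCont (\<lambda>y. poly D (X7 (moebius B y))) w"
        using polyX[of D] w open_UHP holomorphic_on_imp_continuous_on continuous_on_eq_continuous_at by blast
      then have "(\<lambda>y. poly D (X7 (moebius B y)) * f (moebius B y)) \<midarrow>w\<rightarrow> poly D (X7 (moebius B w)) * c"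
        unfolding isCont_def using c by (intro tendsto_mult)
      then show False using pole'[unfolded is_pole_def] not_tendsto_and_filterlim_at_infinity[OF at_neq_bot] by blast
    qed
  qed
  define H where "H = remove_sings h"
  have H_hol: "H holomorphic_on UHP"
  proof (rule analytic_imp_holomorphic, subst analytic_on_analytic_at, intro ballI)
    fix z assume z: "z \<in> UHP"
    have "not_essential h z" using meromorphic_on_not_essential[OF meromorphic_on_subset[OF h_mero]] z by blast
    then obtain c where "h \<midarrow>z\<rightarrow> c" using not_pole[OF z] by (auto simp: not_essential_def)
    moreover have "isolated_singularity_at h z" using meromorphic_on_isolated_singularity[OF meromorphic_on_subset[OF h_mero]] z by blast
    ultimately show "H analytic_on {z}" unfolding H_def by (intro remove_sings_analytic_at)
  qed
  have H_inv: "inv7 H" unfolding inv7_def H_def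
  proof (intro ballI)
    fix A z assume A: "A \<in> Gamma1 7" and z: "z \<in> UHP"
    show "remove_sings h (moebius A z) = remove_sings h z"
      by (rule remove_sings_invariant) (use A z h_inv in \<open>auto simp: inv7_def Gamma1_iff\<close>)
  qed
  have H_ord: "\<exists>r. order_ge (\<lambda>z. H (moebius A z)) r" if A: "A \<in> SLZ" for A
  proof -
    obtain r where r: "order_ge (\<lambda>z. f (moebius A z)) r" using ord[OF A] by blast
    obtain s where s: "order_ge (\<lambda>z. poly D (X7 (moebius A z))) s" using order_ge_poly[OF X7_order[OF A], of D] by auto
    have "order_ge (\<lambda>z. h (moebius A z)) (s + r)" unfolding h_def using order_ge_mult[OF s r] .
    then show ?thesis unfolding H_def using order_ge_remove_sings[OF h_mero A _ not_pole] by blast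
  qed
  then obtain rr where rr: "\<And>A. A \<in> SLZ \<Longrightarrow> order_ge (\<lambda>z. H (moebius A z)) (rr A)" by metis
  \<comment> \<open>The quintic has order at least 1/7 at each of the five cusps, so the power
    \<open>m\<close> lifts every order \<open>rr B\<close> there to at least 0. One exponent
    suffices as there are finitely many representatives.\<close>
  define m where "m = nat \<lceil>Max (insert 0 ((\<lambda>B. - 7 * rr B) ` R))\<rceil>"
  have m: "- 7 * rr B \<le> real m" if "B \<in> R" for B
  proof -
    have "- 7 * rr B \<le> Max (insert 0 ((\<lambda>B. - 7 * rr B) ` R))" using R(1) that by (intro Max_ge) auto
    then show ?thesis unfolding m_def by linarith
  qed
  define H2 where "H2 = (\<lambda>z. poly (quintic7 ^ m) (X7 z) * H z)"
  have H2_hol: "H2 holomorphic_on UHP" unfolding H2_def using H_hol Xc_hol[of 0 1] by (intro holomorphic_intros) auto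
  have H2_inv: "inv7 H2" using H_inv inv7_X7 by (simp add: H2_def inv7_def)
  have H2_bnd: "order_ge (\<lambda>z. H2 (moebius A z)) 0"
    if A: "A \<in> SLZ" and nA: "\<not> (7 dvd A $ 2 $ 1 - 2 \<or> 7 dvd A $ 2 $ 1 + 2)" for A
  proof -
    obtain B where B: "B \<in> R" "7 dvd A $ 2 $ 1 - B $ 2 $ 1" "7 dvd A $ 2 $ 2 - B $ 2 $ 2" using R(3)[OF A] by blast
    have BS: "B \<in> SLZ" using B R by blast
    have nB: "\<not> (7 dvd B $ 2 $ 1 - 2 \<or> 7 dvd B $ 2 $ 1 + 2)" using nA B(2) by presburger
    have "order_ge (\<lambda>z. poly quintic7 (X7 (moebius B z)) ^ m * H (moebius B z)) (of_nat m * (1/7) + rr B)"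
      by (rule order_ge_mult[OF order_ge_power[OF quintic_vanishes[OF BS nB]] rr[OF BS]])
    then have "order_ge (\<lambda>z. H2 (moebius B z)) (of_nat m * (1/7) + rr B)" by (simp add: H2_def)
    then have "order_ge (\<lambda>z. H2 (moebius B z)) 0" by (rule order_ge_mono) (use m[OF B(1)] in simp)
    moreover have "eventually (\<lambda>z. H2 (moebius B z) = H2 (moebius A z)) iinf"
      using eventually_iinf_UHP by eventually_elim (use inv7_bottom_row[OF H2_inv A BS _ B(2,3)] in simp)
    ultimately show ?thesis by (rule order_ge_eq)
  qed
  obtain s where s: "order_ge (\<lambda>z. poly (quintic7 ^ m) (X7 (moebius g0 z))) s" using order_ge_poly[OF X7_order[OF g0_in], of "quintic7 ^ m"] by auto
  have "order_ge (\<lambda>z. H2 (moebius g0 z)) (s + rr g0)" unfolding H2_def by (rule order_ge_mult[OF s rr[OF g0_in]])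
  moreover define N where "N = nat \<lceil>- 7 * (s + rr g0)\<rceil>"
  have "- 7 * (s + rr g0) \<le> real N" unfolding N_def by linarith
  then have "- real N / 7 \<le> s + rr g0" by (simp add: field_simps)
  ultimately have "order_ge (\<lambda>z. H2 (moebius g0 z)) (- of_nat N / 7)" by (rule order_ge_mono)
  then obtain p where p: "\<And>z. z \<in> UHP \<Longrightarrow> H2 z = poly p (X7 z)"
    using inv7_polynomial[OF H2_hol H2_inv H2_bnd] by blast
  have "eventually (\<lambda>w. poly (quintic7 ^ m * D) (X7 w) * f w = poly p (X7 w)) (at z)" if z: "z \<in> UHP" for z
  proof -
    have "eventually (\<lambda>w. H w = h w) (at z)" unfolding H_def
      by (rule eventually_remove_sings_eq_at[OF meromorphic_on_isolated_singularity[OF meromorphic_on_subset[OF h_mero]]])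
        (use z in auto)
    with eventually_at_UHP[OF z] show ?thesis
    proof eventually_elim
      case (elim w)
      then show ?case using p[of w] by (simp add: H2_def h_def mult.assoc)
    qed
  qed
  moreover have "poly quintic7 2 \<noteq> 0" by (simp add: poly_quintic7)
  then have "quintic7 \<noteq> 0" by auto
  then have "quintic7 ^ m * D \<noteq> 0" using D0 by simp
  ultimately show ?thesis by blast
qed

subsection \<open>Evaluating rational functions of the curve\<close>

definition curve7 :: "complex poly poly" where "curve7 = [:- quintic7, 0, 1:]"

definition ev :: "complex poly poly \<Rightarrow> complex \<Rightarrow> complex" where
  "ev P z = poly (poly P [:W7 z:]) (X7 z)"

lemma ev_add: "ev (P + Q) z = ev P z + ev Q z" by (simp add: ev_def)
lemma ev_mult: "ev (P * Q) z = ev P z * ev Q z" by (simp add: ev_def)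
lemma ev_1 [simp]: "ev 1 z = 1" by (simp add: ev_def)
lemma ev_0 [simp]: "ev 0 z = 0" by (simp add: ev_def)
lemma ev_const: "ev [:c:] z = poly c (X7 z)" by (simp add: ev_def)
lemma ev_linear: "ev [:c, d:] z = poly c (X7 z) + W7 z * poly d (X7 z)" by (simp add: ev_def)

lemma ev_curve7: "z \<in> UHP \<Longrightarrow> ev curve7 z = 0"
  using Wscale(2)[of z] by (simp add: ev_def curve7_def power2_eq_square)

lemma X7_hol: "X7 holomorphic_on UHP" by (rule Xc_hol) simp
lemma W7_hol: "W7 holomorphic_on UHP" by (rule Wc_hol) simp

lemma ev_hol: "ev P holomorphic_on UHP"
proof (induction P)
  case 0
  have "ev 0 = (\<lambda>_. 0)" by (simp add: fun_eq_iff)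
  then show ?case by simp
next
  case (pCons c P)
  have eq: "ev (pCons c P) = (\<lambda>z. poly c (X7 z) + W7 z * ev P z)" by (simp add: ev_def fun_eq_iff)
  show ?case unfolding eq using pCons X7_hol W7_hol by (intro holomorphic_intros)
qed

lemma W7_T1: "z \<in> UHP \<Longrightarrow> W7 (z + 1) = - W7 z"
proof -
  assume z: "z \<in> UHP"
  have "W7 (moebius (translation_matrix 1) z) = psign (translation_matrix 1) * Wc 0 1 z"
    using W7_moebius[OF Tm_in z, of 1] by simp
  then show ?thesis by simp
qed

lemma X7_T1: "z \<in> UHP \<Longrightarrow> X7 (z + 1) = X7 z"
  using Xc_moebius[OF Tm_in, of z 1] by simp

lemma curve7_division: "\<exists>A r s. P = curve7 * A + [:r, s:]"
proof (induction P)
  case 0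
  show ?case by (intro exI[of _ 0]) simp
next
  case (pCons c P)
  then obtain A r s where P: "P = curve7 * A + [:r, s:]" by blast
  have "pCons c P = [:c:] + [:0, 1:] * P" by simp
  also have "\<dots> = curve7 * ([:0, 1:] * A + [:s:]) + [:c + s * quintic7, r:]"
    unfolding P curve7_def by (simp add: algebra_simps)
  finally show ?case by blast
qed

text \<open>Modulo the curve every polynomial is \<open>r + s W\<close> with \<open>r\<close> and
  \<open>s\<close> polynomials in \<open>X\<close>. Replacing \<open>z\<close> by
  \<open>z + 1\<close> fixes \<open>X\<close> and negates \<open>W\<close>, so both summands vanish,
  and \<open>X7\<close> satisfies no polynomial equation.\<close>

lemma ev_eq_0_iff: "(\<forall>z\<in>UHP. ev P z = 0) \<longleftrightarrow> curve7 dvd P"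
proof
  assume "curve7 dvd P"
  then show "\<forall>z\<in>UHP. ev P z = 0" by (auto elim!: dvdE simp: ev_mult ev_curve7)
next
  assume P0: "\<forall>z\<in>UHP. ev P z = 0"
  obtain A r s where P: "P = curve7 * A + [:r, s:]" using curve7_division by blast
  have 0: "poly r (X7 z) + W7 z * poly s (X7 z) = 0" if "z \<in> UHP" for z
    using P0 that unfolding P by (simp add: ev_add ev_mult ev_curve7 ev_linear)
  have 1: "poly r (X7 z) - W7 z * poly s (X7 z) = 0" if z: "z \<in> UHP" for z
  proof -
    have "z + 1 \<in> UHP" using z by (simp add: upper_half_plane_def)
    from 0[OF this] show ?thesis using z by (simp add: W7_T1 X7_T1)
  qed
  have "poly r (X7 z) = 0" "poly s (X7 z) = 0" if z: "z \<in> UHP" for z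
  proof -
    have "2 * poly r (X7 z) = 0" using 0[OF z] 1[OF z] by (simp add: algebra_simps)
    then show r: "poly r (X7 z) = 0" by simp
    show "poly s (X7 z) = 0" using 0[OF z] Wc_nz[OF z prim7_0_1] by (simp add: r)
  qed
  then have "r = 0" "s = 0" using poly_X7_eq_0 by blast+
  then show "curve7 dvd P" by (simp add: P)
qed

lemma ev_eventually_nonzero:
  assumes "\<not> curve7 dvd Q" "z \<in> UHP"
  shows "eventually (\<lambda>w. ev Q w \<noteq> 0) (at z)"
proof -
  obtain p where p: "p \<in> UHP" "ev Q p \<noteq> 0" using assms(1) ev_eq_0_iff by blast
  from non_zero_neighbour_alt[OF ev_hol open_UHP connected_UHP assms(2) p]
  show ?thesis by (auto elim: eventually_mono)
qed

text \<open>The multiples of \<open>curve7\<close> are the kernel of evaluation into functions on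
  the half-plane; two functions not identically 0 are both nonzero at some common point.
  Irreducibility follows without any factorization of polynomials.\<close>

lemma curve7_prime: "curve7 dvd P * Q \<longleftrightarrow> curve7 dvd P \<or> curve7 dvd Q"
proof
  assume PQ: "curve7 dvd P * Q"
  show "curve7 dvd P \<or> curve7 dvd Q"
  proof (rule ccontr)
    assume n: "\<not> (curve7 dvd P \<or> curve7 dvd Q)"
    have i: "\<i> \<in> UHP" by (simp add: upper_half_plane_def)
    have evPQ: "eventually (\<lambda>w. ev P w \<noteq> 0 \<and> ev Q w \<noteq> 0 \<and> w \<in> UHP) (at \<i>)"
      using ev_eventually_nonzero[OF _ i] n eventually_at_UHP[OF i] by (auto intro!: eventually_conj)
    obtain w where "ev P w \<noteq> 0" "ev Q w \<noteq> 0" "w \<in> UHP" using eventually_happens'[OF at_neq_bot evPQ] by blast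
    then have "ev (P * Q) w \<noteq> 0" by (simp add: ev_mult)
    then show False using PQ ev_eq_0_iff[of "P * Q"] \<open>w \<in> UHP\<close> by blast
  qed
qed (auto intro: dvd_mult dvd_mult2)

lemma curve7_not_dvd_1: "\<not> curve7 dvd 1"
proof
  assume "curve7 dvd 1"
  then have "\<forall>z\<in>UHP. ev 1 z = 0" by (simp only: ev_eq_0_iff)
  moreover have "\<i> \<in> UHP" by (simp add: upper_half_plane_def)
  ultimately have "ev 1 \<i> = 0" by blast
  then show False by simp
qed

lemma curve7_nonzero: "curve7 \<noteq> 0"
  by (simp add: curve7_def)

lemma irreducible_curve7: "irreducible curve7"
proof (rule irreducibleI)
  fix a b assume ab: "curve7 = a * b"
  then have "curve7 dvd a \<or> curve7 dvd b" using curve7_prime by (metis dvd_refl)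
  then show "is_unit a \<or> is_unit b"
  proof
    assume "curve7 dvd a"
    then obtain c where "a = curve7 * c" by (elim dvdE)
    then have "curve7 * 1 = curve7 * (c * b)" using ab by (simp add: mult.assoc)
    then have "1 = c * b" using curve7_nonzero by (simp only: mult_cancel_left) simp
    then show ?thesis by (metis dvd_triv_right)
  next
    assume "curve7 dvd b"
    then obtain c where "b = curve7 * c" by (elim dvdE)
    then have "curve7 * 1 = curve7 * (a * c)" using ab by (simp add: mult_ac)
    then have "1 = a * c" using curve7_nonzero by (simp only: mult_cancel_left) simp
    then show ?thesis by (metis dvd_triv_left)
  qed
qed (use curve7_nonzero curve7_not_dvd_1 in auto)

section \<open>The evaluation map from fractions to modular functions\<close>

lemma normalize_cong:
  assumes "\<And>z. z \<in> UHP \<Longrightarrow> eventually (\<lambda>w. f w = g w) (at z)"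
  shows "normalize_merom f = normalize_merom g"
  unfolding normalize_merom_def using remove_sings_cong[OF assms] by (auto simp: fun_eq_iff)

lemma normalize_eventually:
  assumes "f meromorphic_on UHP" "z \<in> UHP"
  shows "eventually (\<lambda>w. normalize_merom f w = f w) (at z)"
proof -
  have "isolated_singularity_at f z"
    using meromorphic_on_isolated_singularity[OF meromorphic_on_subset[OF assms(1)]] assms(2) by blast
  from eventually_remove_sings_eq_at[OF this] eventually_at_UHP[OF assms(2)]
  show ?thesis by eventually_elim (simp add: normalize_merom_def)
qed

lemma normalize_nicely:
  assumes "f nicely_meromorphic_on UHP" "\<And>z. z \<notin> UHP \<Longrightarrow> f z = 0"
  shows "normalize_merom f = f"
proof
  fix z
  show "normalize_merom f z = f z"
  proof (cases "z \<in> UHP")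
    case True
    then have "(is_pole f z \<and> f z = 0) \<or> f \<midarrow>z\<rightarrow> f z" using assms(1) by (auto simp: nicely_meromorphic_on_def)
    then show ?thesis using True by (auto simp: normalize_merom_def)
  qed (use assms(2) in \<open>simp add: normalize_merom_def\<close>)
qed

definition quot :: "complex poly poly \<Rightarrow> complex poly poly \<Rightarrow> complex \<Rightarrow> complex" where
  "quot P Q z = ev P z / ev Q z"

lemma quot_mero: "quot P Q meromorphic_on UHP"
  unfolding quot_def[abs_def] using ev_hol open_UHP
  by (intro meromorphic_on_divide analytic_on_imp_meromorphic_on) (auto simp: analytic_on_open)

text \<open>Representatives of a fraction give quotients that agree only off isolated points; after
  normalization the choice is immaterial, see \<open>fmap_Fract\<close>.\<close>

definition fmap :: "complex poly poly fract \<Rightarrow> complex \<Rightarrow> complex" where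
  "fmap x = normalize_merom (SOME f. \<exists>P Q. x = Fract P Q \<and> \<not> curve7 dvd Q \<and> f = quot P Q)"

lemma not_dvd_nonzero: "\<not> curve7 dvd Q \<Longrightarrow> Q \<noteq> 0" by auto

lemma quot_eventually_eq:
  assumes "Fract P Q = Fract P' Q'" "\<not> curve7 dvd Q" "\<not> curve7 dvd Q'" "z \<in> UHP"
  shows "eventually (\<lambda>w. quot P Q w = quot P' Q' w) (at z)"
proof -
  have "P * Q' = P' * Q" using assms not_dvd_nonzero by (simp add: eq_fract)
  then have eq: "ev P w * ev Q' w = ev P' w * ev Q w" for w by (metis ev_mult)
  from ev_eventually_nonzero[OF assms(2,4)] ev_eventually_nonzero[OF assms(3,4)]
  show ?thesis by eventually_elim (use eq in \<open>simp add: quot_def frac_eq_eq\<close>)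
qed

lemma fmap_Fract:
  assumes "\<not> curve7 dvd Q"
  shows "fmap (Fract P Q) = normalize_merom (quot P Q)"
proof -
  define f where "f = (SOME f. \<exists>P' Q'. Fract P Q = Fract P' Q' \<and> \<not> curve7 dvd Q' \<and> f = quot P' Q')"
  have "\<exists>f. \<exists>P' Q'. Fract P Q = Fract P' Q' \<and> \<not> curve7 dvd Q' \<and> f = quot P' Q'" using assms by blast
  from someI_ex[OF this] obtain P' Q' where PQ: "Fract P Q = Fract P' Q'" "\<not> curve7 dvd Q'" "f = quot P' Q'"
    unfolding f_def by blast
  have "normalize_merom f = normalize_merom (quot P Q)"
    unfolding PQ(3) by (rule normalize_cong[OF quot_eventually_eq[OF PQ(1)[symmetric] PQ(2) assms]])
  then show ?thesis unfolding fmap_def f_def .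
qed

lemma fmap_eventually:
  assumes "\<not> curve7 dvd Q" "z \<in> UHP"
  shows "eventually (\<lambda>w. fmap (Fract P Q) w = quot P Q w) (at z)"
  unfolding fmap_Fract[OF assms(1)] by (rule normalize_eventually[OF quot_mero assms(2)])

lemma fmap_add:
  assumes "\<not> curve7 dvd Q" "\<not> curve7 dvd Q'"
  shows "fmap (Fract P Q + Fract P' Q') = normalize_merom (\<lambda>z. fmap (Fract P Q) z + fmap (Fract P' Q') z)"
proof -
  have QQ: "\<not> curve7 dvd Q * Q'" using assms curve7_prime by blast
  have eq: "Fract P Q + Fract P' Q' = Fract (P * Q' + P' * Q) (Q * Q')" using assms not_dvd_nonzero by simp
  show ?thesis unfolding eq fmap_Fract[OF QQ]
  proof (rule normalize_cong)
    fix z assume z: "z \<in> UHP"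
    from fmap_eventually[OF assms(1) z, of P] fmap_eventually[OF assms(2) z, of P'] ev_eventually_nonzero[OF assms(1) z] ev_eventually_nonzero[OF assms(2) z]
    show "eventually (\<lambda>w. quot (P * Q' + P' * Q) (Q * Q') w = fmap (Fract P Q) w + fmap (Fract P' Q') w) (at z)"
      by eventually_elim (simp add: quot_def ev_add ev_mult field_simps)
  qed
qed

lemma fmap_mult:
  assumes "\<not> curve7 dvd Q" "\<not> curve7 dvd Q'"
  shows "fmap (Fract P Q * Fract P' Q') = normalize_merom (\<lambda>z. fmap (Fract P Q) z * fmap (Fract P' Q') z)"
proof -
  have QQ: "\<not> curve7 dvd Q * Q'" using assms curve7_prime by blast
  have eq: "Fract P Q * Fract P' Q' = Fract (P * P') (Q * Q')" by simp
  show ?thesis unfolding eq fmap_Fract[OF QQ]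
  proof (rule normalize_cong)
    fix z assume z: "z \<in> UHP"
    from fmap_eventually[OF assms(1) z, of P] fmap_eventually[OF assms(2) z, of P']
    show "eventually (\<lambda>w. quot (P * P') (Q * Q') w = fmap (Fract P Q) w * fmap (Fract P' Q') w) (at z)"
      by eventually_elim (simp add: quot_def ev_mult)
  qed
qed

lemma fmap_const: "fmap (Fract [:[:c:]:] 1) = const_modular_function c"
proof -
  have q: "quot [:[:c:]:] 1 = (\<lambda>_. c)" by (simp add: quot_def ev_const fun_eq_iff)
  show ?thesis unfolding fmap_Fract[OF curve7_not_dvd_1] q
    by (auto simp: normalize_merom_def const_modular_function_def fun_eq_iff)
qed

lemma fmap_eq_0_iff:
  assumes "\<not> curve7 dvd Q"
  shows "fmap (Fract P Q) = const_modular_function 0 \<longleftrightarrow> curve7 dvd P"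
proof
  assume "curve7 dvd P"
  then have 0: "ev P z = 0" if "z \<in> UHP" for z using ev_eq_0_iff that by blast
  have "normalize_merom (quot P Q) = normalize_merom (\<lambda>_. 0)"
  proof (rule normalize_cong)
    fix z assume "z \<in> UHP"
    from eventually_at_UHP[OF this] show "eventually (\<lambda>w. quot P Q w = 0) (at z)"
      by eventually_elim (simp add: quot_def 0)
  qed
  then show "fmap (Fract P Q) = const_modular_function 0"
    unfolding fmap_Fract[OF assms] by (auto simp: normalize_merom_def const_modular_function_def fun_eq_iff)
next
  assume eq: "fmap (Fract P Q) = const_modular_function 0"
  show "curve7 dvd P"
  proof (rule ccontr)
    assume nP: "\<not> curve7 dvd P"
    have i: "\<i> \<in> UHP" by (simp add: upper_half_plane_def)
    from fmap_eventually[OF assms i, of P] ev_eventually_nonzero[OF nP i] ev_eventually_nonzero[OF assms i]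
    have "eventually (\<lambda>w. False) (at \<i>)"
      by eventually_elim (simp add: eq quot_def const_modular_function_def)
    then show False by simp
  qed
qed

lemma inv_G7:
  assumes A: "A \<in> G7" and z: "z \<in> UHP"
  shows "X7 (moebius A z) = X7 z" "W7 (moebius A z) = W7 z"
proof -
  have A': "A \<in> SLZ" "psign A = 1" "7 dvd A $ 2 $ 1" "7 dvd A $ 2 $ 2 - 1"
    using iffD1[OF G7_iff A] by (auto simp: Gamma1_iff)
  have "Xc (A $ 2 $ 1) (A $ 2 $ 2) z = X7 z" by (rule Xc_cong) (use A' in auto)
  then show X: "X7 (moebius A z) = X7 z" using Xc_moebius[OF A'(1) z] by simp
  have "Mc (A $ 2 $ 1) (A $ 2 $ 2) z = Mc 0 1 z" unfolding Mc_def using dd_cong[of "A $ 2 $ 1" 0 "A $ 2 $ 2" 1] A' by simp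
  then have "Wc (A $ 2 $ 1) (A $ 2 $ 2) z = W7 z" unfolding Wfun_def using \<open>Xc _ _ z = X7 z\<close> by simp
  then show "W7 (moebius A z) = W7 z" using W7_moebius[OF A'(1) z] A'(2) by simp
qed

lemma G7_SLZ: "A \<in> G7 \<Longrightarrow> A \<in> SLZ" by (simp add: Gamma1_iff)

lemma W7_order:
  assumes "A \<in> SLZ"
  shows "order_ge (\<lambda>z. W7 (moebius A z)) (- 1)"
proof -
  define c d where "c = A $ 2 $ 1" and "d = A $ 2 $ 2"
  have pr: "prim7 c d" using prim7_SL2[OF assms] by (simp add: c_def d_def)
  have "order_ge (Wc c d) (- 1)"
  proof (cases c rule: residue7_cases)
    case 0 then show ?thesis using order_ge_mono[OF has_order_imp_order_ge[OF Wc_orders(4)[OF pr]], of "-1"] by simp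
  next
    case 1 then show ?thesis using order_ge_mono[OF has_order_imp_order_ge[OF Wc_orders(1)[OF pr]], of "-1"] by simp
  next
    case 2 then show ?thesis using order_ge_mono[OF has_order_imp_order_ge[OF Wc_orders(2)[OF pr]], of "-1"] by simp
  next
    case 3 then show ?thesis using order_ge_mono[OF has_order_imp_order_ge[OF Wc_orders(3)[OF pr]], of "-1"] by simp
  qed
  from order_ge_cmult[OF this, of "psign A"] show ?thesis
    by (rule order_ge_eq) (use eventually_iinf_UHP in \<open>eventually_elim, simp add: W7_moebius[OF assms] c_def d_def\<close>)
qed

lemma cusp_expansion_hol:
  assumes S: "S \<in> SLZ" and hol: "f holomorphic_on UHP" and inv: "\<And>A z. A \<in> G7 \<Longrightarrow> z \<in> UHP \<Longrightarrow> f (moebius A z) = f z"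
    and ord: "order_ge (\<lambda>w. f (moebius (SL2_inv S) w)) r"
  shows "\<exists>g. g meromorphic_on {0} \<and> eventually (\<lambda>w. f (moebius (SL2_inv S) w) = g (ee (w / of_real (real (cusp_width G7 S))))) iinf"
proof -
  define h where "h = real (cusp_width G7 S)"
  have h: "h > 0" using cusp_width_props(1)[OF S] by (simp add: h_def)
  define F where "F = (\<lambda>w. f (moebius (SL2_inv S) w))"
  have Fhol: "F holomorphic_on UHP" unfolding F_def using hol S by (intro holomorphic_moebius_compose) auto
  have per: "F (w + of_real h) = F w" if w: "w \<in> UHP" for w
  proof -
    obtain A where A: "A \<in> G7" "S ** A = translation_matrix (int (cusp_width G7 S)) ** S \<or> S ** A = - (translation_matrix (int (cusp_width G7 S)) ** S)"
      using cusp_width_props(2)[OF S] by blast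
    have "F (w + of_real h) = f (moebius A (moebius (SL2_inv S) w))"
      unfolding F_def h_def using moebius_conj_translation[OF S G7_SLZ[OF A(1)] A(2) w] by simp
    also have "\<dots> = F w" unfolding F_def by (rule inv[OF A(1)]) (use S w moebius_in_UHP SL2_inv_in in blast)
    finally show ?thesis .
  qed
  \<comment> \<open>The real order \<open>r\<close> is rounded down to a multiple of
    \<open>1 / h\<close>, as an expansion with integer exponents requires.\<close>
  define n where "n = \<lfloor>r * h\<rfloor>"
  have "of_int n / h \<le> r" using h by (simp add: n_def field_simps)
  with ord have "order_ge F (of_int n / h)" unfolding F_def by (rule order_ge_mono)
  then obtain g where g: "g analytic_on {0}" "eventually (\<lambda>z. F z = g (ee (z / of_real h)) * ee (of_int n * z / of_real h)) iinf"
    using periodic_order_expansion[OF Fhol h per] by blast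
  have pw: "ee (of_int n * z / of_real h) = ee (z / of_real h) powi n" for z
  proof -
    have "ee (of_int n * z / of_real h) = exp (of_int n * (2 * of_real pi * \<i> * (z / of_real h)))" by (simp add: ee_def mult_ac)
    also have "\<dots> = ee (z / of_real h) powi n" by (simp add: ee_def exp_power_int mult_ac)
    finally show ?thesis .
  qed
  have "(\<lambda>q. g q * q powi n) meromorphic_on {0}"
    using analytic_on_imp_meromorphic_on[OF g(1)] by (intro meromorphic_intros)
  moreover have "eventually (\<lambda>w. F w = g (ee (w / of_real h)) * ee (w / of_real h) powi n) iinf"
    using g(2) unfolding pw .
  ultimately show ?thesis unfolding F_def h_def by (intro exI[of _ "\<lambda>q. g q * q powi n"]) auto
qed

lemma meromorphic_ev:
  assumes "a meromorphic_on {0}" "b meromorphic_on {0}"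
  shows "(\<lambda>q. poly (poly P [:b q:]) (a q)) meromorphic_on {0}"
proof (induction P)
  case (pCons c P)
  have pm: "(\<lambda>q. poly p (a q)) meromorphic_on {0}" for p
    by (induction p) (use assms(1) in \<open>auto intro!: meromorphic_intros\<close>)
  have eq: "(\<lambda>q. poly (poly (pCons c P) [:b q:]) (a q)) = (\<lambda>q. poly c (a q) + b q * poly (poly P [:b q:]) (a q))"
    by (simp add: fun_eq_iff)
  show ?case unfolding eq by (intro meromorphic_on_add meromorphic_on_mult pm assms(2) pCons.IH)
qed auto

text \<open>The given expansion holds for \<open>f\<close>, while normalization may change values at
  isolated points. Sufficiently high up the expansion is analytic, so the limits of \<open>f\<close>
  agree with it and it carries over.\<close>

lemma normalize_modular:
  assumes f: "f meromorphic_on UHP" and inv: "\<And>A z. A \<in> G7 \<Longrightarrow> z \<in> UHP \<Longrightarrow> f (moebius A z) = f z"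
    and cusp: "\<And>S. S \<in> SLZ \<Longrightarrow> \<exists>g. g meromorphic_on {0} \<and>
        eventually (\<lambda>w. f (moebius (SL2_inv S) w) = g (ee (w / of_real (real (cusp_width G7 S))))) iinf"
  shows "normalize_merom f \<in> modular_functions G7"
  unfolding modular_functions_def mem_Collect_eq
proof (intro conjI ballI allI impI)
  have eq: "normalize_merom f z = remove_sings f z" if "z \<in> UHP" for z using that by (simp add: normalize_merom_def)
  have nm: "remove_sings f nicely_meromorphic_on UHP" using f by (rule remove_sings_nicely_meromorphic)
  show "normalize_merom f nicely_meromorphic_on UHP"
    unfolding nicely_meromorphic_on_def
  proof (intro conjI ballI)
    have ev: "eventually (\<lambda>w. normalize_merom f w = remove_sings f w) (at z)" if "z \<in> UHP" for z
      using eventually_at_UHP[OF that] by eventually_elim (rule eq)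
    show "normalize_merom f meromorphic_on UHP"
    proof -
      have "remove_sings f meromorphic_on UHP" using nm by (simp add: nicely_meromorphic_on_def)
      then show ?thesis using ev by (subst meromorphic_on_cong[where g = "remove_sings f"]) auto
    qed
    fix z assume z: "z \<in> UHP"
    have "(is_pole (remove_sings f) z \<and> remove_sings f z = 0) \<or> remove_sings f \<midarrow>z\<rightarrow> remove_sings f z"
      using nm z by (auto simp: nicely_meromorphic_on_def)
    moreover have "is_pole (normalize_merom f) z \<longleftrightarrow> is_pole (remove_sings f) z"
      by (rule is_pole_cong[OF ev[OF z] refl])
    moreover have "(normalize_merom f \<midarrow>z\<rightarrow> c) \<longleftrightarrow> (remove_sings f \<midarrow>z\<rightarrow> c)" for c
      by (rule filterlim_cong[OF refl refl ev[OF z]])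
    ultimately show "(is_pole (normalize_merom f) z \<and> normalize_merom f z = 0) \<or> normalize_merom f \<midarrow>z\<rightarrow> normalize_merom f z"
      using eq[OF z] by simp
  qed
  show "normalize_merom f z = 0" if "z \<notin> UHP" for z using that by (simp add: normalize_merom_def)
  show "normalize_merom f (moebius A z) = normalize_merom f z" if "A \<in> G7" "z \<in> UHP" for A z
  proof -
    have "remove_sings f (moebius A z) = remove_sings f z"
      by (rule remove_sings_invariant[OF G7_SLZ[OF that(1)] that(2)]) (use inv[OF that(1)] in blast)
    then show ?thesis using that(2) moebius_in_UHP[OF G7_SLZ[OF that(1)] that(2)] by (simp add: normalize_merom_def)
  qed
  fix S assume S: "S \<in> carrier (SL2 :: (int ^ 2 ^ 2) monoid)"
  define h where "h = real (cusp_width G7 S)"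
  have h: "h > 0" using cusp_width_props(1)[OF S] by (simp add: h_def)
  obtain g where g: "g meromorphic_on {0}" "eventually (\<lambda>w. f (moebius (SL2_inv S) w) = g (ee (w / of_real h))) iinf"
    using cusp[OF S] unfolding h_def by blast
  \<comment> \<open>Poles of \<open>g\<close> do not accumulate at 0, so \<open>g\<close> is
    continuous at every value of the coordinate close enough to the cusp.\<close>
  obtain e where e: "e > 0" "g analytic_on ball 0 e - {0}"
    using meromorphic_on_isolated_singularity[OF g(1)] by (auto simp: isolated_singularity_at_def)
  have "eventually (\<lambda>w. ee (w / of_real h) \<in> ball 0 e - {0}) iinf"
    using ee_at_cusp[OF h] eventually_at_in_open[of "ball 0 e" "0::complex"] e(1) by (auto simp: filterlim_iff)
  with g(2) have "eventually (\<lambda>w. f (moebius (SL2_inv S) w) = g (ee (w / of_real h)) \<and> ee (w / of_real h) \<in> ball 0 e - {0}) iinf"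
    by eventually_elim simp
  then obtain M0 where M0: "\<And>w. Im w > M0 \<Longrightarrow> f (moebius (SL2_inv S) w) = g (ee (w / of_real h))"
    "\<And>w. Im w > M0 \<Longrightarrow> ee (w / of_real h) \<in> ball 0 e - {0}" unfolding eventually_iinf by blast
  define M where "M = max M0 0"
  have "normalize_merom f (moebius (SL2_inv S) w) = g (ee (w / of_real h))" if w: "Im w > M" for w
  proof -
    define z where "z = moebius (SL2_inv S) w"
    have wU: "w \<in> UHP" using w by (simp add: M_def upper_half_plane_def)
    have zU: "z \<in> UHP" unfolding z_def using S wU moebius_in_UHP SL2_inv_in by blast
    have Sz: "moebius S z = w" unfolding z_def using moebius_inv(2)[OF S wU] .
    have "isCont g (ee (w / of_real h))"
      using e(2) M0(2)[of w] w by (intro analytic_at_imp_isCont) (auto simp: M_def intro: analytic_on_subset)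
    moreover have "isCont (\<lambda>y. ee (moebius S y / of_real h)) z"
    proof -
      have "isCont (moebius S) z" using moebius_has_deriv[OF S zU] by (rule DERIV_isCont)
      then show ?thesis unfolding ee_def using h by (intro continuous_intros) auto
    qed
    ultimately have "isCont (\<lambda>y. g (ee (moebius S y / of_real h))) z"
      using isCont_o2[of z "\<lambda>y. ee (moebius S y / of_real h)" g] by (simp add: Sz)
    then have lim: "(\<lambda>y. g (ee (moebius S y / of_real h))) \<midarrow>z\<rightarrow> g (ee (w / of_real h))" by (simp add: isCont_def Sz)
    have "open (UHP \<inter> moebius S -` {y. Im y > M})"
      by (rule continuous_open_preimage[OF holomorphic_on_imp_continuous_on[OF moebius_holomorphic[OF S]] open_UHP])
         (intro open_Collect_less continuous_intros)
    then have "eventually (\<lambda>y. y \<in> UHP \<inter> moebius S -` {y. Im y > M}) (at z)"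
      using zU w Sz by (intro eventually_at_in_open') auto
    then have "eventually (\<lambda>y. g (ee (moebius S y / of_real h)) = f y) (at z)"
    proof eventually_elim
      case (elim y)
      then show ?case using M0(1)[of "moebius S y"] moebius_inv(1)[OF S, of y] by (simp add: M_def)
    qed
    from Lim_transform_eventually[OF lim this] have "remove_sings f z = g (ee (w / of_real h))" by (rule remove_sings_eqI)
    then show ?thesis using zU by (simp add: normalize_merom_def z_def)
  qed
  then have "eventually (\<lambda>w. normalize_merom f (moebius (SL2_inv S) w) = g (ee (w / of_real h))) iinf"
    unfolding eventually_iinf by blast
  then show "\<exists>g. g meromorphic_on {0} \<and> (\<forall>\<^sub>F z in cusp_filter S. normalize_merom f z = g (cusp_coord G7 S z))"
    unfolding modular_functions_cusp_iff[OF S] using g(1) h_def by blast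
qed

lemma quot_modular: "normalize_merom (quot P Q) \<in> modular_functions G7"
proof (rule normalize_modular[OF quot_mero])
  show "quot P Q (moebius A z) = quot P Q z" if "A \<in> G7" "z \<in> UHP" for A z
    using inv_G7[OF that] by (simp add: quot_def ev_def)
  fix S assume S: "S \<in> SLZ"
  obtain a where a: "a meromorphic_on {0}"
    "eventually (\<lambda>w. X7 (moebius (SL2_inv S) w) = a (ee (w / of_real (real (cusp_width G7 S))))) iinf"
    using cusp_expansion_hol[OF S X7_hol _ X7_order[OF SL2_inv_in[OF S]]] inv_G7(1) by blast
  obtain b where b: "b meromorphic_on {0}"
    "eventually (\<lambda>w. W7 (moebius (SL2_inv S) w) = b (ee (w / of_real (real (cusp_width G7 S))))) iinf"
    using cusp_expansion_hol[OF S W7_hol _ W7_order[OF SL2_inv_in[OF S]]] inv_G7(2) by blast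
  define g where "g = (\<lambda>q. poly (poly P [:b q:]) (a q) / poly (poly Q [:b q:]) (a q))"
  have "g meromorphic_on {0}" unfolding g_def by (intro meromorphic_on_divide meromorphic_ev a b)
  moreover have "eventually (\<lambda>w. quot P Q (moebius (SL2_inv S) w) = g (ee (w / of_real (real (cusp_width G7 S))))) iinf"
    using a(2) b(2) by eventually_elim (simp add: quot_def ev_def g_def)
  ultimately show "\<exists>g. g meromorphic_on {0} \<and> eventually (\<lambda>w. quot P Q (moebius (SL2_inv S) w) = g (ee (w / of_real (real (cusp_width G7 S))))) iinf"
    by blast
qed

subsection \<open>The function field isomorphism\<close>

lemma modular_functionD:
  assumes "f \<in> modular_functions G7"
  shows "f nicely_meromorphic_on UHP" "\<And>z. z \<notin> UHP \<Longrightarrow> f z = 0"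
    "\<And>A z. A \<in> G7 \<Longrightarrow> z \<in> UHP \<Longrightarrow> f (moebius A z) = f z"
  using assms by (auto simp: modular_functions_def)

lemma modular_order:
  assumes f: "f \<in> modular_functions G7" and A: "A \<in> SLZ"
  shows "\<exists>r. order_ge (\<lambda>z. f (moebius A z)) r"
proof -
  define S where "S = SL2_inv A"
  have S: "S \<in> SLZ" using A by (simp add: S_def)
  obtain g where g: "g meromorphic_on {0}" "eventually (\<lambda>z. f z = g (cusp_coord G7 S z)) (cusp_filter S)"
    using f S unfolding modular_functions_def by blast
  define h where "h = real (cusp_width G7 S)"
  have h: "h > 0" using cusp_width_props(1)[OF S] by (simp add: h_def)
  have ev: "eventually (\<lambda>w. g (ee (w / of_real h)) = f (moebius A w)) iinf"
    using g(2)[unfolded modular_functions_cusp_iff[OF S]] by eventually_elim (simp add: S_def h_def)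
  obtain n :: nat where "order_ge (\<lambda>z. g (ee (z / of_real h))) (- of_nat n / h)"
    using meromorphic_cusp_order[OF g(1) h] by blast
  from order_ge_eq[OF this ev] show ?thesis by blast
qed

lemma psign_T1' [simp]: "psign (translation_matrix (- 1)) = - 1"
  by (simp add: psign_def even_perm_def)

text \<open>Elements of \<open>\<Gamma>\<^sub>1(7)\<close> of sign 1 lie in the group, and so do
  their conjugates by the translation. For sign -1, composing with a translation on either side
  lands in the group, so the two points \<open>z\<close> and \<open>z + 1\<close> are interchanged
  modulo \<open>G7\<close>.\<close>

lemma G7_translate:
  assumes inv: "\<And>A z. A \<in> G7 \<Longrightarrow> z \<in> UHP \<Longrightarrow> f (moebius A z) = f z"
    and A: "A \<in> Gamma1 7" and z: "z \<in> UHP"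
  shows "psign A = 1 \<Longrightarrow> f (moebius A z) = f z \<and> f (moebius A z + 1) = f (z + 1)"
    "psign A = - 1 \<Longrightarrow> f (moebius A z) = f (z + 1) \<and> f (moebius A z + 1) = f z"
proof -
  let ?T = "translation_matrix 1" and ?T' = "translation_matrix (- 1)"
  have AS: "A \<in> SLZ" using A by (rule Gamma1_SLZ)
  have z1: "z + 1 \<in> UHP" using z by (simp add: upper_half_plane_def)
  have TA: "?T ** A \<in> Gamma1 7" by (rule Gamma1_mult[OF T1_in A])
  have AT: "A ** ?T' \<in> Gamma1 7" by (rule Gamma1_mult[OF A T1_in])
  have TAT: "?T ** A ** ?T' \<in> Gamma1 7" by (rule Gamma1_mult[OF TA T1_in])
  have sTA: "psign (?T ** A) = - psign A" using psign_mult[OF Tm_in AS] by simp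
  have sAT: "psign (A ** ?T') = - psign A" using psign_mult[OF AS Tm_in] by simp
  have sTAT: "psign (?T ** A ** ?T') = psign A" using psign_mult[OF Gamma1_SLZ[OF TA] Tm_in] sTA by simp
  have m1: "moebius (?T ** A) z = moebius A z + 1" using moebius_mult[OF Tm_in AS z] by simp
  have m2: "moebius (A ** ?T') (z + 1) = moebius A z" using moebius_mult[OF AS Tm_in z1] by simp
  have m3: "moebius (?T ** A ** ?T') (z + 1) = moebius A z + 1"
    using moebius_mult[OF Gamma1_SLZ[OF TA] Tm_in z1] m1 by simp
  show "f (moebius A z) = f z \<and> f (moebius A z + 1) = f (z + 1)" if s: "psign A = 1"
  proof -
    have "A \<in> G7" "?T ** A ** ?T' \<in> G7" using s A TAT sTAT by (simp_all only: G7_iff)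
    from inv[OF this(1) z] inv[OF this(2) z1] m3 show ?thesis by simp
  qed
  show "f (moebius A z) = f (z + 1) \<and> f (moebius A z + 1) = f z" if s: "psign A = - 1"
  proof -
    have "A ** ?T' \<in> G7" "?T ** A \<in> G7" using s AT TA sAT sTA by (simp_all only: G7_iff minus_minus)
    from inv[OF this(1) z1] inv[OF this(2) z] m1 m2 show ?thesis by simp
  qed
qed

lemma W7_Gamma1:
  assumes A: "A \<in> Gamma1 7" and z: "z \<in> UHP"
  shows "W7 (moebius A z) = psign A * W7 z"
proof -
  have A': "A \<in> SLZ" "7 dvd A $ 2 $ 1 - 0" "7 dvd A $ 2 $ 2 - 1" using A by (auto simp: Gamma1_iff)
  have "Xc (A $ 2 $ 1) (A $ 2 $ 2) z = X7 z" by (rule Xc_cong[OF A'(2,3)])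
  moreover have "Mc (A $ 2 $ 1) (A $ 2 $ 2) z = Mc 0 1 z" unfolding Mc_def using dd_cong[OF A'(2,3)] by simp
  ultimately have "Wc (A $ 2 $ 1) (A $ 2 $ 2) z = W7 z" unfolding Wfun_def by simp
  then show ?thesis using W7_moebius[OF A'(1) z] by simp
qed

lemma inv7_even_part:
  assumes inv: "\<And>A z. A \<in> G7 \<Longrightarrow> z \<in> UHP \<Longrightarrow> f (moebius A z) = f z"
  shows "inv7 (\<lambda>z. (f z + f (z + 1)) / 2)"
  unfolding inv7_def
proof (intro ballI)
  fix A z assume A: "A \<in> Gamma1 7" and z: "z \<in> UHP"
  show "(f (moebius A z) + f (moebius A z + 1)) / 2 = (f z + f (z + 1)) / 2"
    using G7_translate[OF inv A z] psign_cases[of A] by (auto simp: add.commute)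
qed

lemma inv7_odd_part:
  assumes inv: "\<And>A z. A \<in> G7 \<Longrightarrow> z \<in> UHP \<Longrightarrow> f (moebius A z) = f z"
  shows "inv7 (\<lambda>z. (f z - f (z + 1)) / 2 * W7 z)"
  unfolding inv7_def
proof (intro ballI)
  fix A z assume A: "A \<in> Gamma1 7" and z: "z \<in> UHP"
  have W: "W7 (moebius A z) = psign A * W7 z" by (rule W7_Gamma1[OF A z])
  from psign_cases[of A]
  show "(f (moebius A z) - f (moebius A z + 1)) / 2 * W7 (moebius A z) = (f z - f (z + 1)) / 2 * W7 z"
  proof
    assume s: "psign A = 1"
    then have "f (moebius A z) = f z" "f (moebius A z + 1) = f (z + 1)" using G7_translate(1)[OF inv A z] by auto
    then show ?thesis unfolding W s by simp
  next
    assume s: "psign A = - 1"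
    then have "f (moebius A z) = f (z + 1)" "f (moebius A z + 1) = f z" using G7_translate(2)[OF inv A z] by auto
    then show ?thesis unfolding W s by (simp add: algebra_simps)
  qed
qed

lemma fmap_surj:
  assumes f: "f \<in> modular_functions G7"
  shows "\<exists>P Q. \<not> curve7 dvd Q \<and> f = fmap (Fract P Q)"
proof -
  note fD = modular_functionD[OF f]
  have fm: "f meromorphic_on UHP" using fD(1) by (simp add: nicely_meromorphic_on_def)
  have fm1: "(\<lambda>z. f (z + 1)) meromorphic_on UHP" using meromorphic_moebius[OF fm Tm_in, of 1] by simp
  have ord: "\<exists>r. order_ge (\<lambda>z. f (moebius A z)) r \<and> order_ge (\<lambda>z. f (moebius A z + 1)) r" if A: "A \<in> SLZ" for A
  proof -
    obtain r where r: "order_ge (\<lambda>z. f (moebius A z)) r" using modular_order[OF f A] by blast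
    have TA: "translation_matrix 1 ** A \<in> SLZ" by (rule SL2_mult[OF Tm_in A])
    obtain s where s: "order_ge (\<lambda>z. f (moebius (translation_matrix 1 ** A) z)) s" using modular_order[OF f TA] by blast
    have ev: "eventually (\<lambda>z. f (moebius (translation_matrix 1 ** A) z) = f (moebius A z + 1)) iinf"
      using eventually_iinf_UHP by eventually_elim (simp add: moebius_mult[OF Tm_in A])
    from order_ge_eq[OF s ev] have "order_ge (\<lambda>z. f (moebius A z + 1)) s" .
    then show ?thesis using r order_ge_mono[of _ r "min r s"] order_ge_mono[of _ s "min r s"] by (intro exI[of _ "min r s"]) auto
  qed
  define fp where "fp = (\<lambda>z. (f z + f (z + 1)) / 2)"
  define fq where "fq = (\<lambda>z. (f z - f (z + 1)) / 2 * W7 z)"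
  have fp_m: "fp meromorphic_on UHP" unfolding fp_def by (intro meromorphic_intros fm fm1)
  have "W7 meromorphic_on UHP" using W7_hol open_UHP by (intro analytic_on_imp_meromorphic_on) (simp add: analytic_on_open)
  then have fq_m: "fq meromorphic_on UHP" unfolding fq_def by (intro meromorphic_intros fm fm1)
  have fp_o: "\<exists>r. order_ge (\<lambda>z. fp (moebius A z)) r" if A: "A \<in> SLZ" for A
  proof -
    obtain r where r: "order_ge (\<lambda>z. f (moebius A z)) r" "order_ge (\<lambda>z. f (moebius A z + 1)) r" using ord[OF A] by blast
    from order_ge_cmult[OF order_ge_add[OF r], of "1/2"] show ?thesis unfolding fp_def by (intro exI[of _ r]) simp
  qed
  have fq_o: "\<exists>r. order_ge (\<lambda>z. fq (moebius A z)) r" if A: "A \<in> SLZ" for A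
  proof -
    obtain r where r: "order_ge (\<lambda>z. f (moebius A z)) r" "order_ge (\<lambda>z. f (moebius A z + 1)) r" using ord[OF A] by blast
    from order_ge_mult[OF order_ge_cmult[OF order_ge_minus[OF r], of "1/2"] W7_order[OF A]]
    show ?thesis unfolding fq_def by (intro exI[of _ "r + - 1"]) simp
  qed
  obtain D1 p1 where 1: "D1 \<noteq> 0" "\<And>z. z \<in> UHP \<Longrightarrow> eventually (\<lambda>w. poly D1 (X7 w) * fp w = poly p1 (X7 w)) (at z)"
    using inv7_meromorphic_rational[OF fp_m inv7_even_part[OF fD(3), folded fp_def] fp_o] by blast
  obtain D2 p2 where 2: "D2 \<noteq> 0" "\<And>z. z \<in> UHP \<Longrightarrow> eventually (\<lambda>w. poly D2 (X7 w) * fq w = poly p2 (X7 w)) (at z)"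
    using inv7_meromorphic_rational[OF fq_m inv7_odd_part[OF fD(3), folded fq_def] fq_o] by blast
  \<comment> \<open>With \<open>W^2\<close> equal to the quintic,
    \<open>f = fp + fq / W = fp + W fq / quintic7\<close>. Bringing \<open>fp = p1 / D1\<close> and
    \<open>fq = p2 / D2\<close> to the common denominator \<open>q\<close> gives the numerator
    \<open>P\<close>.\<close>
  define q where "q = D1 * D2 * quintic7"
  define P where "P = [:p1 * D2 * quintic7, p2 * D1:]"
  define Q where "Q = [:q:]"
  have "poly quintic7 2 \<noteq> 0" by (simp add: poly_quintic7)
  then have "quintic7 \<noteq> 0" by auto
  then have q0: "q \<noteq> 0" using 1 2 by (simp add: q_def)
  have nQ: "\<not> curve7 dvd Q"
  proof
    assume "curve7 dvd Q"
    then have "\<forall>z\<in>UHP. ev Q z = 0" by (simp only: ev_eq_0_iff)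
    then have "\<And>z. z \<in> UHP \<Longrightarrow> poly q (X7 z) = 0" by (simp add: Q_def ev_const)
    then show False using poly_X7_eq_0 q0 by blast
  qed
  have evq: "eventually (\<lambda>w. f w = quot P Q w) (at z)" if z: "z \<in> UHP" for z
    using 1(2)[OF z] 2(2)[OF z] ev_eventually_nonzero[OF nQ z] eventually_at_UHP[OF z]
  proof eventually_elim
    case (elim w)
    define x y where "x = X7 w" and "y = W7 w"
    have y2: "y ^ 2 = poly quintic7 x" unfolding x_def y_def by (rule Wscale(2)[OF elim(4)])
    have nz: "poly D1 x * poly D2 x * poly quintic7 x \<noteq> 0" using elim(3) by (simp add: Q_def q_def ev_const x_def)
    have e1: "poly p1 x = poly D1 x * fp w" and e2: "poly p2 x = poly D2 x * ((f w - f (w + 1)) / 2 * y)"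
      using elim(1,2) by (simp_all add: x_def y_def fq_def)
    have fsum: "f w = fp w + (f w - f (w + 1)) / 2" unfolding fp_def by (simp add: field_simps)
    have "ev P w = poly D1 x * poly D2 x * poly quintic7 x * fp w + y * (poly D2 x * ((f w - f (w + 1)) / 2 * y) * poly D1 x)"
      unfolding P_def ev_linear x_def[symmetric] y_def[symmetric] poly_mult e1 e2 by (simp only: mult_ac)
    also have "\<dots> = poly D1 x * poly D2 x * (poly quintic7 x * fp w + y ^ 2 * ((f w - f (w + 1)) / 2))"
      unfolding power2_eq_square distrib_left by (simp only: mult_ac)
    also have "\<dots> = (poly D1 x * poly D2 x * poly quintic7 x) * f w"
      unfolding y2 distrib_left[symmetric] fsum[symmetric] by (simp only: mult.assoc)
    finally show ?case using nz unfolding quot_def by (simp add: Q_def q_def ev_const x_def[symmetric])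
  qed
  have "f = normalize_merom f" using normalize_nicely[OF fD(1,2)] by simp
  also have "\<dots> = normalize_merom (quot P Q)" by (rule normalize_cong[OF evq])
  also have "\<dots> = fmap (Fract P Q)" by (rule fmap_Fract[OF nQ, symmetric])
  finally show ?thesis using nQ by blast
qed

section \<open>Ring structures and the isomorphism\<close>

abbreviation Rloc where "Rloc \<equiv> curve_local_ring curve7"
abbreviation Smod where "Smod \<equiv> modular_function_field G7"

lemma Rloc_simps:
  "carrier Rloc = {Fract P Q | P Q. \<not> curve7 dvd Q}" "mult Rloc = (*)" "one Rloc = 1" "zero Rloc = 0" "add Rloc = (+)"
  by (simp_all add: curve_local_ring_def)

lemma Smod_simps:
  "carrier Smod = modular_functions G7" "mult Smod = (\<lambda>f g. normalize_merom (\<lambda>z. f z * g z))"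
  "one Smod = const_modular_function 1" "zero Smod = const_modular_function 0"
  "add Smod = (\<lambda>f g. normalize_merom (\<lambda>z. f z + g z))"
  by (simp_all add: modular_function_field_def)

lemma Rloc_closed:
  assumes "x \<in> carrier Rloc" "y \<in> carrier Rloc"
  shows "x + y \<in> carrier Rloc" "x * y \<in> carrier Rloc" "- x \<in> carrier Rloc"
proof -
  obtain P Q P' Q' where x: "x = Fract P Q" "\<not> curve7 dvd Q" and y: "y = Fract P' Q'" "\<not> curve7 dvd Q'"
    using assms by (auto simp: Rloc_simps)
  have QQ: "\<not> curve7 dvd Q * Q'" using x y curve7_prime by blast
  have "x + y = Fract (P * Q' + P' * Q) (Q * Q')" using x y not_dvd_nonzero by simp
  then show "x + y \<in> carrier Rloc" using QQ unfolding Rloc_simps by blast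
  have "x * y = Fract (P * P') (Q * Q')" using x y by simp
  then show "x * y \<in> carrier Rloc" using QQ unfolding Rloc_simps by blast
  have "- x = Fract (- P) Q" using x by simp
  then show "- x \<in> carrier Rloc" using x(2) unfolding Rloc_simps by blast
qed

lemma Rloc_const: "Fract P 1 \<in> carrier Rloc"
  using curve7_not_dvd_1 unfolding Rloc_simps by blast

lemma Rloc_0_1: "0 \<in> carrier Rloc" "1 \<in> carrier Rloc"
  using Rloc_const[of 0] Rloc_const[of 1] by (simp_all add: Zero_fract_def One_fract_def)

lemma ring_Rloc: "ring Rloc"
proof (rule ringI)
  show "abelian_group Rloc"
  proof (rule abelian_groupI)
    fix x assume x: "x \<in> carrier Rloc"
    have "- x \<in> carrier Rloc" using Rloc_closed(3)[OF x x] .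
    moreover have "- x \<oplus>\<^bsub>Rloc\<^esub> x = \<zero>\<^bsub>Rloc\<^esub>" by (simp add: Rloc_simps)
    ultimately show "\<exists>y\<in>carrier Rloc. y \<oplus>\<^bsub>Rloc\<^esub> x = \<zero>\<^bsub>Rloc\<^esub>" by blast
  qed (use Rloc_closed Rloc_0_1 in \<open>auto simp: Rloc_simps(2-) algebra_simps\<close>)
  show "monoid Rloc"
    by (rule monoidI) (use Rloc_closed Rloc_0_1 in \<open>auto simp: Rloc_simps(2-) algebra_simps\<close>)
qed (auto simp: Rloc_simps(2-) algebra_simps)

lemma fmap_hom: "fmap \<in> ring_hom Rloc Smod"
proof (rule ring_hom_memI)
  fix x assume "x \<in> carrier Rloc"
  then obtain P Q where x: "x = Fract P Q" "\<not> curve7 dvd Q" by (auto simp: Rloc_simps)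
  show "fmap x \<in> carrier Smod" unfolding x fmap_Fract[OF x(2)] Smod_simps by (rule quot_modular)
next
  fix x y assume "x \<in> carrier Rloc" "y \<in> carrier Rloc"
  then obtain P Q P' Q' where x: "x = Fract P Q" "\<not> curve7 dvd Q" and y: "y = Fract P' Q'" "\<not> curve7 dvd Q'"
    by (auto simp: Rloc_simps)
  show "fmap (x \<otimes>\<^bsub>Rloc\<^esub> y) = fmap x \<otimes>\<^bsub>Smod\<^esub> fmap y"
    unfolding x y Rloc_simps(2-) Smod_simps by (rule fmap_mult[OF x(2) y(2)])
  show "fmap (x \<oplus>\<^bsub>Rloc\<^esub> y) = fmap x \<oplus>\<^bsub>Smod\<^esub> fmap y"
    unfolding x y Rloc_simps(2-) Smod_simps by (rule fmap_add[OF x(2) y(2)])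
next
  have "Fract [:[:1:]:] 1 = (1 :: complex poly poly fract)" by (simp add: One_fract_def one_pCons)
  then show "fmap \<one>\<^bsub>Rloc\<^esub> = \<one>\<^bsub>Smod\<^esub>" unfolding Rloc_simps(2-) Smod_simps using fmap_const[of 1] by simp
qed

lemma fmap_image: "fmap ` carrier Rloc = carrier Smod"
proof
  show "fmap ` carrier Rloc \<subseteq> carrier Smod" using fmap_hom by (auto simp: ring_hom_def)
  show "carrier Smod \<subseteq> fmap ` carrier Rloc"
  proof
    fix f assume "f \<in> carrier Smod"
    then obtain P Q where "\<not> curve7 dvd Q" "f = fmap (Fract P Q)" using fmap_surj[of f] unfolding Smod_simps by blast
    then show "f \<in> fmap ` carrier Rloc" unfolding Rloc_simps by blast
  qed
qed

lemma fmap_0: "fmap 0 = const_modular_function 0"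
  using fmap_eq_0_iff[OF curve7_not_dvd_1, of 0] by (simp add: Zero_fract_def)

text \<open>The normalized operations inherit the ring axioms from the local ring through the
  surjective map \<open>fmap\<close>, which avoids checking associativity and distributivity through
  repeated normalization.\<close>

lemma ring_Smod: "ring Smod"
proof -
  interpret ring Rloc by (rule ring_Rloc)
  have "ring (Smod\<lparr>carrier := fmap ` carrier Rloc, zero := fmap \<zero>\<^bsub>Rloc\<^esub>\<rparr>)"
    by (rule ring_hom_imp_img_ring[OF fmap_hom])
  also have "Smod\<lparr>carrier := fmap ` carrier Rloc, zero := fmap \<zero>\<^bsub>Rloc\<^esub>\<rparr> = Smod"
    unfolding fmap_image Rloc_simps(4) fmap_0 Smod_simps(1) by (simp add: modular_function_field_def)
  finally show ?thesis .
qed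

text \<open>The homomorphism theorem for \<open>fmap\<close>: it is onto the modular functions, its
  kernel is the vanishing ideal, and it carries constants to constants.\<close>

lemma is_model_curve7: "is_model_of_modular_curve G7 curve7"
proof -
  interpret R: ring Rloc by (rule ring_Rloc)
  interpret S: ring Smod by (rule ring_Smod)
  interpret hom: ring_hom_ring Rloc Smod fmap by unfold_locales (rule fmap_hom)
  have ker: "a_kernel Rloc Smod fmap = curve_vanishing_ideal curve7"
  proof -
    have "a_kernel Rloc Smod fmap = {x \<in> carrier Rloc. fmap x = const_modular_function 0}"
      unfolding a_kernel_def' Smod_simps ..
    also have "\<dots> = curve_vanishing_ideal curve7"
    proof (rule Set.set_eqI, rule iffI)
      fix x assume "x \<in> {x \<in> carrier Rloc. fmap x = const_modular_function 0}"
      then obtain P Q where x: "x = Fract P Q" "\<not> curve7 dvd Q" "fmap x = const_modular_function 0"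
        unfolding Rloc_simps by blast
      from x(3) have "curve7 dvd P" unfolding x(1) fmap_eq_0_iff[OF x(2)] .
      with x show "x \<in> curve_vanishing_ideal curve7" unfolding curve_vanishing_ideal_def by blast
    next
      fix x assume "x \<in> curve_vanishing_ideal curve7"
      then obtain P Q where x: "x = Fract P Q" "curve7 dvd P" "\<not> curve7 dvd Q"
        unfolding curve_vanishing_ideal_def by blast
      have "x \<in> carrier Rloc" unfolding Rloc_simps using x by blast
      moreover have "fmap x = const_modular_function 0" unfolding x(1) fmap_eq_0_iff[OF x(3)] by (rule x(2))
      ultimately show "x \<in> {x \<in> carrier Rloc. fmap x = const_modular_function 0}" by blast
    qed
    finally show ?thesis .
  qed
  have iso: "(\<lambda>Y. the_elem (fmap ` Y)) \<in> ring_iso (curve_function_field curve7) Smod"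
    using hom.FactRing_iso_set[OF fmap_image] unfolding ker curve_function_field_def .
  have "the_elem (fmap ` const_on_curve curve7 c) = const_modular_function c" for c
    using hom.the_elem_simp[OF Rloc_const[of "[:[:c:]:]"]] unfolding ker const_on_curve_def fmap_const .
  then show ?thesis unfolding is_model_of_modular_curve_def
    by (intro conjI irreducible_curve7 bexI[OF _ iso] allI)
qed

subsection \<open>Differentials of weight two\<close>

text \<open>This weight-2 form has no zeros in the upper half-plane, and its orders at the cusps are those of
  \<open>dX / W\<close>.\<close>

definition om :: "int \<Rightarrow> int \<Rightarrow> complex \<Rightarrow> complex" where
  "om c d z = delta z / (dd 1 3 c d z * dd 3 2 c d z)"

lemma om_hol: "prim7 c d \<Longrightarrow> om c d holomorphic_on UHP"
  unfolding om_def[abs_def] by (intro holomorphic_intros delta_holomorphic dd_hol) (auto simp: dd_nz)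

lemma om_nz: "z \<in> UHP \<Longrightarrow> prim7 c d \<Longrightarrow> om c d z \<noteq> 0"
  unfolding om_def using delta_nonzero dd_nz by simp

lemma om_moebius:
  assumes A: "A \<in> SLZ" and z: "z \<in> UHP"
  shows "om 0 1 (moebius A z) = (aut A z)\<^sup>2 * (psign A * om (A $ 2 $ 1) (A $ 2 $ 2) z)"
proof -
  let ?a = "aut A z"
  have a: "?a \<noteq> 0" by (rule aut_nonzero[OF A z])
  have 1: "dd 1 3 0 1 (moebius A z) = ?a\<^sup>2 * dd 1 3 (A $ 2 $ 1) (A $ 2 $ 2) z"
    "dd 3 2 0 1 (moebius A z) = ?a\<^sup>2 * dd 3 2 (A $ 2 $ 1) (A $ 2 $ 2) z"
    by (rule dd_moebius[OF A z]; simp)+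
  have 2: "?a ^ 6 = ?a\<^sup>2 * (?a\<^sup>2 * ?a\<^sup>2)" by (simp flip: power_add)
  have "om 0 1 (moebius A z) = (psign A * (?a\<^sup>2 * (?a\<^sup>2 * ?a\<^sup>2)) * delta z) /
      ((?a\<^sup>2 * dd 1 3 (A $ 2 $ 1) (A $ 2 $ 2) z) * (?a\<^sup>2 * dd 3 2 (A $ 2 $ 1) (A $ 2 $ 2) z))"
    unfolding om_def delta_moebius[OF A z] 1 2 ..
  also have "\<dots> = (?a\<^sup>2 * ?a\<^sup>2) * (?a\<^sup>2 * psign A * delta z) /
      ((?a\<^sup>2 * ?a\<^sup>2) * (dd 1 3 (A $ 2 $ 1) (A $ 2 $ 2) z * dd 3 2 (A $ 2 $ 1) (A $ 2 $ 2) z))"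
    by (simp only: mult_ac)
  also have "\<dots> = (?a\<^sup>2 * psign A * delta z) / (dd 1 3 (A $ 2 $ 1) (A $ 2 $ 2) z * dd 3 2 (A $ 2 $ 1) (A $ 2 $ 2) z)"
    by (rule mult_divide_mult_cancel_left) (use a in simp)
  finally show ?thesis unfolding om_def by (simp add: mult.assoc)
qed

text \<open>In the coordinates \<open>q\<close> to the power 1/14, or 1/2 where 7 divides
  \<open>c\<close>, the orders are 1, 3, 1 and 1. Passing from \<open>dz\<close> to the differential
  of the coordinate lowers each by one, which leaves only a double zero at the pole of
  \<open>X\<close>.\<close>

lemma om_orders:
  "7 dvd c - 1 \<or> 7 dvd c + 1 \<Longrightarrow> has_order (om c d) (1/14)"
  "7 dvd c - 2 \<or> 7 dvd c + 2 \<Longrightarrow> has_order (om c d) (3/14)"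
  "7 dvd c - 3 \<or> 7 dvd c + 3 \<Longrightarrow> has_order (om c d) (1/14)"
  "7 dvd c \<Longrightarrow> prim7 c d \<Longrightarrow> has_order (om c d) (1/2)"
proof -
  assume c: "7 dvd c - 1 \<or> 7 dvd c + 1"
  from has_order_divide[OF delta_has_order has_order_mult[OF dd_orders(2,3)[OF c]], of d d]
  show "has_order (om c d) (1/14)" unfolding om_def[abs_def] by simp
next
  assume c: "7 dvd c - 2 \<or> 7 dvd c + 2"
  from has_order_divide[OF delta_has_order has_order_mult[OF dd_orders(5,6)[OF c]], of d d]
  show "has_order (om c d) (3/14)" unfolding om_def[abs_def] by simp
next
  assume c: "7 dvd c - 3 \<or> 7 dvd c + 3"
  from has_order_divide[OF delta_has_order has_order_mult[OF dd_orders(8,9)[OF c]], of d d]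
  show "has_order (om c d) (1/14)" unfolding om_def[abs_def] by simp
next
  assume c: "7 dvd c" "prim7 c d"
  from has_order_divide[OF delta_has_order has_order_mult[OF dd_orders_0(2,3)[OF c]]]
  show "has_order (om c d) (1/2)" unfolding om_def[abs_def] by simp
qed

definition wt2 :: "(complex \<Rightarrow> complex) \<Rightarrow> bool" where
  "wt2 f \<longleftrightarrow> (\<forall>A\<in>G7. \<forall>z\<in>UHP. f (moebius A z) = (aut A z)\<^sup>2 * f z)"

definition slash :: "(complex \<Rightarrow> complex) \<Rightarrow> int ^ 2 ^ 2 \<Rightarrow> complex \<Rightarrow> complex" where
  "slash f A z = f (moebius A z) / (aut A z)\<^sup>2"

lemma G7_om: "A \<in> G7 \<Longrightarrow> z \<in> UHP \<Longrightarrow> om 0 1 (moebius A z) = (aut A z)\<^sup>2 * om 0 1 z"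
proof -
  assume A: "A \<in> G7" and z: "z \<in> UHP"
  have A': "A \<in> SLZ" "7 dvd A $ 2 $ 1 - 0" "7 dvd A $ 2 $ 2 - 1" "psign A = 1"
    using iffD1[OF G7_iff A] by (auto simp: Gamma1_iff)
  have "om (A $ 2 $ 1) (A $ 2 $ 2) z = om 0 1 z" unfolding om_def using dd_cong[OF A'(2,3)] by simp
  then show ?thesis using om_moebius[OF A'(1) z] A'(4) by simp
qed

lemma deriv_moebius: "A \<in> SLZ \<Longrightarrow> z \<in> UHP \<Longrightarrow> deriv (moebius A) z = 1 / (aut A z)\<^sup>2"
  by (rule DERIV_imp_deriv[OF moebius_has_deriv])

lemma wt2_iff: "wt2 f \<longleftrightarrow> (\<forall>A\<in>G7. \<forall>z\<in>UHP. f (moebius A z) * deriv (moebius A) z = f z)"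
proof -
  have "f (moebius A z) * deriv (moebius A) z = f z \<longleftrightarrow> f (moebius A z) = (aut A z)\<^sup>2 * f z"
    if A: "A \<in> G7" and z: "z \<in> UHP" for A z
    using aut_nonzero[OF G7_SLZ[OF A] z] by (simp add: deriv_moebius[OF G7_SLZ[OF A] z] divide_eq_eq mult.commute)
  then show ?thesis unfolding wt2_def by auto
qed

lemma slash_hol: "f holomorphic_on UHP \<Longrightarrow> A \<in> SLZ \<Longrightarrow> slash f A holomorphic_on UHP"
proof -
  assume f: "f holomorphic_on UHP" and A: "A \<in> SLZ"
  have "aut A holomorphic_on UHP" unfolding aut_def[abs_def] by (intro holomorphic_intros)
  then show ?thesis unfolding slash_def[abs_def]
    using aut_nonzero[OF A] by (intro holomorphic_intros holomorphic_moebius_compose f A) auto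
qed

lemma aut_uminus: "aut (- A) z = - aut A z" by (simp add: aut_def)

lemma aut_inv:
  assumes S: "S \<in> SLZ" and w: "w \<in> UHP"
  shows "aut S (moebius (SL2_inv S) w) * aut (SL2_inv S) w = 1"
proof -
  have "aut (mat 1) w = 1" by (simp add: aut_def)
  then show ?thesis using aut_mult[OF SL2_inv_in[OF S] w, of S] SL2_inv_mult(2)[OF S] by simp
qed

lemma slash_periodic:
  assumes f: "wt2 f" and S: "S \<in> SLZ" and A: "A \<in> G7"
    and eq: "S ** A = translation_matrix h ** S \<or> S ** A = - (translation_matrix h ** S)" and w: "w \<in> UHP"
  shows "slash f (SL2_inv S) (w + of_int h) = slash f (SL2_inv S) w"
proof -
  let ?g = "SL2_inv S"
  have g: "?g \<in> SLZ" using S by simp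
  have gw: "moebius ?g w \<in> UHP" by (rule moebius_in_UHP[OF g w])
  have AS: "A \<in> SLZ" by (rule G7_SLZ[OF A])
  have m: "moebius ?g (w + of_int h) = moebius A (moebius ?g w)" by (rule moebius_conj_translation[OF S AS eq w])
  have "A ** ?g = (?g ** S) ** A ** ?g" using SL2_inv_mult[OF S] by simp
  also have "\<dots> = ?g ** (S ** A) ** ?g" by (simp only: matrix_mul_assoc)
  finally have Ag: "A ** ?g = ?g ** (S ** A) ** ?g" .
  have TS: "?g ** (translation_matrix h ** S) ** ?g = ?g ** translation_matrix h"
  proof -
    have "?g ** (translation_matrix h ** S) ** ?g = ?g ** translation_matrix h ** (S ** ?g)"
      by (simp only: matrix_mul_assoc)
    then show ?thesis using SL2_inv_mult[OF S] by simp
  qed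
  have "A ** ?g = ?g ** translation_matrix h \<or> A ** ?g = - (?g ** translation_matrix h)"
    using eq
  proof
    assume "S ** A = translation_matrix h ** S"
    then show ?thesis using Ag TS by simp
  next
    assume e: "S ** A = - (translation_matrix h ** S)"
    have "?g ** (- (translation_matrix h ** S)) ** ?g = - (?g ** (translation_matrix h ** S) ** ?g)"
      by (rule mat22_eqI) (simp_all add: mat_mult_nth algebra_simps)
    then show ?thesis using Ag TS e by simp
  qed
  \<comment> \<open>The sign ambiguity in the definition of the width disappears because the weight
    is even.\<close>
  then have "(aut (A ** ?g) w)\<^sup>2 = (aut (?g ** translation_matrix h) w)\<^sup>2" by (auto simp: aut_uminus)
  then have "(aut A (moebius ?g w) * aut ?g w)\<^sup>2 = (aut ?g (w + of_int h))\<^sup>2"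
    by (simp only: aut_mult[OF g w] aut_mult[OF Tm_in w] aut_Tm moebius_Tm mult_1_right)
  then have a: "(aut ?g (w + of_int h))\<^sup>2 = (aut A (moebius ?g w))\<^sup>2 * (aut ?g w)\<^sup>2" by (simp add: power_mult_distrib)
  have "f (moebius A (moebius ?g w)) = (aut A (moebius ?g w))\<^sup>2 * f (moebius ?g w)"
    using f A gw unfolding wt2_def by blast
  then show ?thesis unfolding slash_def m a using aut_nonzero[OF AS gw] by simp
qed

text \<open>Exponents are multiples of \<open>1 / h\<close>, so vanishing in the limit already means
  vanishing to a full step.\<close>

lemma periodic_vanishing_order:
  assumes hol: "F holomorphic_on UHP" and h: "h > 0"
    and per: "\<And>z. z \<in> UHP \<Longrightarrow> F (z + of_real h) = F z" and lim: "(F \<longlongrightarrow> 0) iinf"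
  shows "order_ge F (1 / h)"
proof -
  have 0: "order_ge F (of_int 0 / h)" using tendsto_imp_order_ge_0[OF lim] by simp
  obtain a where a: "((\<lambda>z. F z / ee (of_int 0 * z / of_real h)) \<longlongrightarrow> a) iinf"
    "order_ge (\<lambda>z. F z - a * ee (of_int 0 * z / of_real h)) (of_int (0 + 1) / h)"
    using periodic_order_leading[OF hol h per 0] by blast
  have "(F \<longlongrightarrow> a) iinf" using a(1) by simp
  then have "a = 0" using lim by (intro tendsto_unique[of iinf F a 0]) auto
  then show ?thesis using a(2) by simp
qed

text \<open>There are no elliptic points: a matrix with nonzero lower left entry that fixes a point
  of the half-plane has trace of absolute value below 2, whereas the trace is congruent to 2 modulo
  7. The negative of the identity is excluded by the diagonal modulo 7.\<close>

lemma stabilizer_G7: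
  assumes z: "z \<in> UHP"
  shows "stabilizer_order G7 z = 1"
proof -
  have st: "A = mat 1" if A: "A \<in> G7" and fx: "moebius A z = z" for A
  proof -
    define a b c d where "a = A $ 1 $ 1" and "b = A $ 1 $ 2" and "c = A $ 2 $ 1" and "d = A $ 2 $ 2"
    note defs = a_def[symmetric] b_def[symmetric] c_def[symmetric] d_def[symmetric]
    have AS: "A \<in> SLZ" by (rule G7_SLZ[OF A])
    have det: "a * d - b * c = 1" using AS by (simp add: SL2_iff defs)
    have m: "7 dvd a - 1" "7 dvd d - 1" using iffD1[OF G7_iff A] by (auto simp: Gamma1_iff defs)
    have nz: "of_int c * z + of_int d \<noteq> 0" using aut_nonzero[OF AS z] by (simp add: aut_def defs)
    have y: "Im z > 0" using z by (simp add: upper_half_plane_def)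
    have "(of_int a * z + of_int b) / (of_int c * z + of_int d) = z" using fx by (simp add: moebius_def defs)
    then have e: "of_int a * z + of_int b = z * (of_int c * z + of_int d)" using nz by (simp add: divide_eq_eq)
    from arg_cong[OF e, of Im] have "of_int a * Im z = of_int c * (2 * Re z * Im z) + of_int d * Im z"
      by (simp add: algebra_simps)
    then have "(of_int a - of_int d) * Im z = (2 * of_int c * Re z) * Im z" by (simp add: algebra_simps)
    then have ad: "of_int a - of_int d = 2 * of_int c * Re z" using y by simp
    from arg_cong[OF e, of Re] have re: "of_int a * Re z + of_int b = of_int c * ((Re z)\<^sup>2 - (Im z)\<^sup>2) + of_int d * Re z"
      by (simp add: algebra_simps power2_eq_square)
    have "c = 0"
    proof (rule ccontr)
      assume c: "c \<noteq> 0"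
      have detR: "real_of_int a * of_int d - of_int b * of_int c = 1" using arg_cong[OF det, of real_of_int] by simp
      have b: "real_of_int b = of_int c * ((Re z)\<^sup>2 - (Im z)\<^sup>2) - (of_int a - of_int d) * Re z" using re by (simp add: algebra_simps)
      \<comment> \<open>The discriminant of the fixed-point equation: with \<open>y = Im z\<close>,
        the squared trace equals \<open>4 - 4 c^2 y^2\<close>.\<close>
      have "(real_of_int (a + d))\<^sup>2 = (of_int a - of_int d)\<^sup>2 + 4 * (real_of_int a * of_int d)" by (simp add: power2_eq_square algebra_simps)
      also have "real_of_int a * of_int d = 1 + of_int b * of_int c" using detR by simp
      finally have "(real_of_int (a + d))\<^sup>2 = 4 - 4 * ((of_int c)\<^sup>2 * (Im z)\<^sup>2)"
        unfolding b ad by (simp add: power2_eq_square algebra_simps)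
      moreover have "(real_of_int c)\<^sup>2 * (Im z)\<^sup>2 > 0" using c y by simp
      ultimately have "(real_of_int (a + d))\<^sup>2 < 4" by linarith
      then have "\<bar>real_of_int (a + d)\<bar>\<^sup>2 < 2\<^sup>2" by simp
      then have "\<bar>real_of_int (a + d)\<bar> < 2" by (rule power2_less_imp_less) simp
      then have "\<bar>a + d\<bar> < 2" by linarith
      moreover have "7 dvd (a - 1) + (d - 1)" using m by (rule dvd_add)
      ultimately show False by presburger
    qed
    then have "a * d = 1" "of_int a - of_int d = (0::real)" using det ad by auto
    then have "a = d" "a = 1 \<or> a = - 1" using zmult_eq_1_iff[of a d] by auto
    then have a1: "a = 1" "d = 1" using m by auto
    have "b = 0" using re \<open>c = 0\<close> a1 by simp
    then show ?thesis using a1 \<open>c = 0\<close> by (intro mat22_eqI) (simp_all add: defs)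
  qed
  have one: "mat 1 \<in> G7"
    unfolding G7_iff Gamma1_iff psign_def even_perm_def using SL2_one by simp
  have "{A \<in> G7. moebius A z = z} = {mat 1}"
  proof (intro equalityI subsetI)
    fix A assume "A \<in> {A \<in> G7. moebius A z = z}"
    then have "A \<in> G7" "moebius A z = z" by (simp_all only: mem_Collect_eq)
    then have "A = mat 1" by (rule st)
    then show "A \<in> {mat 1}" by (rule ssubst) (rule singletonI)
  next
    fix A :: "int ^ 2 ^ 2" assume "A \<in> {mat 1}"
    then have "A = mat 1" by (rule singletonD)
    then show "A \<in> {A \<in> G7. moebius A z = z}" using one moebius_1 by (simp only: mem_Collect_eq)
  qed
  then show ?thesis by (simp add: stabilizer_order_def)
qed

section \<open>Holomorphic differentials in local coordinates\<close>

definition cayley :: "complex \<Rightarrow> complex \<Rightarrow> complex" where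
  "cayley z0 z = (z - z0) / (z - cnj z0)"

lemma interior_coord_G7: "z0 \<in> UHP \<Longrightarrow> interior_coord G7 z0 = cayley z0"
  by (rule ext) (simp only: interior_coord_def stabilizer_G7 power_one_right cayley_def)

lemma UHP_neq_cnj: "z \<in> UHP \<Longrightarrow> z0 \<in> UHP \<Longrightarrow> z - cnj z0 \<noteq> 0"
  by (auto simp: upper_half_plane_def complex_eq_iff)

lemma deriv_cayley:
  assumes "z \<in> UHP" "z0 \<in> UHP"
  shows "(cayley z0 has_field_derivative (z0 - cnj z0) / (z - cnj z0)\<^sup>2) (at z)"
  unfolding cayley_def[abs_def]
  by (rule derivative_eq_intros refl UHP_neq_cnj[OF assms])+ (simp add: power2_eq_square)

lemma cayley_hol: "z0 \<in> UHP \<Longrightarrow> cayley z0 holomorphic_on UHP"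
  unfolding cayley_def[abs_def] by (intro holomorphic_intros) (auto dest: UHP_neq_cnj)

lemma eventually_nhds_UHP: "z \<in> UHP \<Longrightarrow> eventually (\<lambda>w. w \<in> UHP) (nhds z)"
  using open_UHP by (auto simp: eventually_nhds)

lemma interior_intro:
  assumes hol: "f holomorphic_on UHP" and z0: "z0 \<in> UHP"
  shows "\<exists>g. g analytic_on {0} \<and> eventually (\<lambda>z. f z = g (cayley z0 z) * deriv (cayley z0) z) (nhds z0)"
proof -
  define k where "k = z0 - cnj z0"
  have k: "k \<noteq> 0" unfolding k_def by (rule UHP_neq_cnj[OF z0 z0])
  \<comment> \<open>The inverse of the Cayley map; the factor
    \<open>(v t - cnj z0)\<^sup>2 / k\<close> in \<open>g\<close> is the reciprocal of its
    derivative.\<close>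
  define v where "v = (\<lambda>t. (z0 - cnj z0 * t) / (1 - t))"
  define g where "g = (\<lambda>t. f (v t) * ((v t - cnj z0)\<^sup>2 / k))"
  have v: "v analytic_on {0}" unfolding v_def by (intro analytic_intros) auto
  have v0: "v 0 = z0" by (simp add: v_def)
  have fa: "f analytic_on {z0}" using hol z0 open_UHP by (meson analytic_on_holomorphic empty_subsetI insert_subset)
  have "(f \<circ> v) analytic_on {0}" by (rule analytic_on_compose[OF v]) (simp add: v0 fa)
  then have "(\<lambda>t. f (v t)) analytic_on {0}" by (simp add: o_def)
  then have "g analytic_on {0}" unfolding g_def using k v by (intro analytic_intros) auto
  moreover have "eventually (\<lambda>z. f z = g (cayley z0 z) * deriv (cayley z0) z) (nhds z0)"
    using eventually_nhds_UHP[OF z0]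
  proof eventually_elim
    case (elim z)
    have n: "z - cnj z0 \<noteq> 0" by (rule UHP_neq_cnj[OF elim z0])
    have e1: "1 - cayley z0 z = k / (z - cnj z0)" using n by (simp add: cayley_def k_def diff_divide_eq_iff[symmetric] field_simps)
    have e2: "z0 - cnj z0 * cayley z0 z = z * (k / (z - cnj z0))"
      using n by (simp add: cayley_def k_def field_simps)
    have vz: "v (cayley z0 z) = z" unfolding v_def e1 e2 using n k by simp
    have "g (cayley z0 z) * deriv (cayley z0) z = f z * ((z - cnj z0)\<^sup>2 / k) * (k / (z - cnj z0)\<^sup>2)"
      unfolding g_def vz DERIV_imp_deriv[OF deriv_cayley[OF elim z0]] k_def ..
    then show ?case using n k by simp
  qed
  ultimately show ?thesis by blast
qed

lemma interior_elim:
  assumes z0: "z0 \<in> UHP" and g: "g analytic_on {0}" "eventually (\<lambda>z. f z = g (cayley z0 z) * deriv (cayley z0) z) (nhds z0)"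
  shows "f analytic_on {z0}"
proof -
  have c: "cayley z0 analytic_on {z0}" using cayley_hol[OF z0] z0 open_UHP by (meson analytic_on_holomorphic empty_subsetI insert_subset)
  have "(g \<circ> cayley z0) analytic_on {z0}" by (rule analytic_on_compose[OF c]) (simp add: cayley_def g)
  then have "(\<lambda>z. g (cayley z0 z) * deriv (cayley z0) z) analytic_on {z0}"
    using c by (intro analytic_intros analytic_deriv) (auto simp: o_def)
  then show ?thesis using analytic_at_cong[OF g(2) refl] by simp
qed

lemma deriv_cusp_coord:
  assumes S: "S \<in> SLZ" and w: "w \<in> UHP"
  defines "h \<equiv> real (cusp_width G7 S)"
  shows "deriv (cusp_coord G7 S) (moebius (SL2_inv S) w) =
    ee (w / of_real h) * (2 * of_real pi * \<i> / of_real h) * (aut (SL2_inv S) w)\<^sup>2"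
proof -
  let ?z = "moebius (SL2_inv S) w"
  have z: "?z \<in> UHP" by (rule moebius_in_UHP[OF SL2_inv_in[OF S] w])
  have c: "cusp_coord G7 S = (\<lambda>z. exp ((2 * of_real pi * \<i> / of_real h) * moebius S z))"
    unfolding cusp_coord_def[abs_def] h_def by simp
  have "(cusp_coord G7 S has_field_derivative exp ((2 * of_real pi * \<i> / of_real h) * moebius S ?z) *
      ((2 * of_real pi * \<i> / of_real h) * (1 / (aut S ?z)\<^sup>2))) (at ?z)"
    unfolding c by (rule derivative_eq_intros moebius_has_deriv[OF S z] refl)+ (simp only: mult_zero_left add_0 mult.commute)
  moreover have "1 / (aut S ?z)\<^sup>2 = (aut (SL2_inv S) w)\<^sup>2"
  proof -
    have i: "aut S ?z * aut (SL2_inv S) w = 1" by (rule aut_inv[OF S w])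
    then have n: "aut S ?z \<noteq> 0" by auto
    have "(aut S ?z)\<^sup>2 * (aut (SL2_inv S) w)\<^sup>2 = 1" using i by (simp flip: power_mult_distrib)
    then show ?thesis using n by (simp add: divide_eq_eq mult.commute)
  qed
  moreover have "exp ((2 * of_real pi * \<i> / of_real h) * moebius S ?z) = ee (w / of_real h)"
    unfolding moebius_inv(2)[OF S w] by (simp add: ee_def)
  ultimately show ?thesis using DERIV_imp_deriv by (metis mult.assoc)
qed

lemma cusp_period:
  assumes f: "wt2 f" and S: "S \<in> SLZ" and w: "w \<in> UHP"
  shows "slash f (SL2_inv S) (w + of_real (real (cusp_width G7 S))) = slash f (SL2_inv S) w"
proof -
  obtain A where A: "A \<in> G7" "S ** A = translation_matrix (int (cusp_width G7 S)) ** S \<or> S ** A = - (translation_matrix (int (cusp_width G7 S)) ** S)"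
    using cusp_width_props(2)[OF S] by blast
  from slash_periodic[OF f S A w] show ?thesis by simp
qed

text \<open>Up to a nonzero constant the differential of the cusp coordinate is the coordinate times
  \<open>dz\<close>. Holomorphy at a cusp therefore means that the slashed function is divisible by
  the coordinate, i.e. tends to 0, as for cusp forms of weight 2.\<close>

lemma differentials_intro:
  assumes hol: "f holomorphic_on UHP" and f: "wt2 f" and lim: "\<And>A. A \<in> SLZ \<Longrightarrow> (slash f A \<longlongrightarrow> 0) iinf"
  shows "(\<lambda>z. if z \<in> UHP then f z else 0) \<in> holomorphic_differentials G7"
proof -
  let ?u = "\<lambda>z. if z \<in> UHP then f z else 0"
  have "wt2 ?u" using f G7_SLZ moebius_in_UHP unfolding wt2_def by simp
  then have 1: "\<forall>A\<in>G7. \<forall>z\<in>UHP. ?u (moebius A z) * deriv (moebius A) z = ?u z" by (simp only: wt2_iff)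
  have u: "?u holomorphic_on UHP" using hol by (rule holomorphic_transform) simp
  have 2: "\<exists>g. g analytic_on {0} \<and> eventually (\<lambda>z. ?u z = g (interior_coord G7 z0 z) * deriv (interior_coord G7 z0) z) (nhds z0)"
    if z0: "z0 \<in> UHP" for z0 unfolding interior_coord_G7[OF z0] by (rule interior_intro[OF u z0])
  have 3: "\<exists>g. g analytic_on {0} \<and> eventually (\<lambda>z. ?u z = g (cusp_coord G7 S z) * deriv (cusp_coord G7 S) z) (cusp_filter S)"
    if S: "S \<in> SLZ" for S
  proof -
    define h where "h = real (cusp_width G7 S)"
    have h: "h > 0" using cusp_width_props(1)[OF S] by (simp add: h_def)
    define F where "F = slash f (SL2_inv S)"
    have Sm: "SL2_inv S \<in> SLZ" using S by simp
    have Fh: "F holomorphic_on UHP" unfolding F_def by (rule slash_hol[OF hol Sm])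
    have per: "F (w + of_real h) = F w" if "w \<in> UHP" for w unfolding F_def h_def by (rule cusp_period[OF f S that])
    have "order_ge F (1 / h)" by (rule periodic_vanishing_order[OF Fh h per lim[OF Sm, folded F_def]])
    then have "order_ge F (of_int 1 / h)" by simp
    from periodic_order_expansion[OF Fh h per this]
    obtain g where g: "g analytic_on {0}" "eventually (\<lambda>z. F z = g (ee (z / of_real h)) * ee (of_int 1 * z / of_real h)) iinf"
      by blast
    define K where "K = 2 * of_real pi * \<i> / of_real h"
    have K: "K \<noteq> 0" using h by (simp add: K_def)
    \<comment> \<open>One factor of the coordinate and the constant \<open>K\<close> are supplied by
      the derivative of \<open>cusp_coord\<close>.\<close>
    define g' where "g' = (\<lambda>q. g q / K)"
    have "g' analytic_on {0}" unfolding g'_def using g(1) K by (intro analytic_intros) auto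
    moreover have "eventually (\<lambda>z. ?u z = g' (cusp_coord G7 S z) * deriv (cusp_coord G7 S) z) (cusp_filter S)"
      unfolding eventually_cusp_filter[OF S] using g(2) eventually_iinf_UHP
    proof eventually_elim
      case (elim w)
      have gw: "moebius (SL2_inv S) w \<in> UHP" by (rule moebius_in_UHP[OF Sm elim(2)])
      have a: "aut (SL2_inv S) w \<noteq> 0" by (rule aut_nonzero[OF Sm elim(2)])
      have "?u (moebius (SL2_inv S) w) = F w * (aut (SL2_inv S) w)\<^sup>2" using gw a by (simp add: F_def slash_def)
      also have "\<dots> = g (ee (w / of_real h)) * ee (w / of_real h) * (aut (SL2_inv S) w)\<^sup>2" using elim(1) by simp
      also have "\<dots> = g' (ee (w / of_real h)) * (ee (w / of_real h) * K * (aut (SL2_inv S) w)\<^sup>2)"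
        using K by (simp add: g'_def)
      finally show ?case unfolding deriv_cusp_coord[OF S elim(2)] cusp_coord_inv[OF S elim(2)] K_def h_def .
    qed
    ultimately show ?thesis by blast
  qed
  show ?thesis unfolding holomorphic_differentials_def
  proof (intro CollectI conjI ballI)
    show "\<forall>z. z \<notin> UHP \<longrightarrow> ?u z = 0" by simp
  qed (rule 1[rule_format] 2 3; assumption)+
qed

lemma differentials_elim:
  assumes u: "f \<in> holomorphic_differentials G7"
  shows "f holomorphic_on UHP" "wt2 f" "\<And>A. A \<in> SLZ \<Longrightarrow> (slash f A \<longlongrightarrow> 0) iinf"
proof -
  have "f analytic_on {z0}" if z0: "z0 \<in> UHP" for z0
  proof -
    obtain g where "g analytic_on {0}" "eventually (\<lambda>z. f z = g (interior_coord G7 z0 z) * deriv (interior_coord G7 z0) z) (nhds z0)"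
      using u z0 unfolding holomorphic_differentials_def by blast
    then show ?thesis using interior_elim[OF z0] unfolding interior_coord_G7[OF z0] by blast
  qed
  then have "f analytic_on UHP" using analytic_on_analytic_at by blast
  then show "f holomorphic_on UHP" by (rule analytic_imp_holomorphic)
  show "wt2 f" unfolding wt2_iff using u unfolding holomorphic_differentials_def by blast
  fix A assume A: "A \<in> SLZ"
  define S where "S = SL2_inv A"
  have S: "S \<in> SLZ" using A by (simp add: S_def)
  have AS: "SL2_inv S = A" by (simp add: S_def)
  obtain g where g: "g analytic_on {0}" "eventually (\<lambda>z. f z = g (cusp_coord G7 S z) * deriv (cusp_coord G7 S) z) (cusp_filter S)"
    using u S unfolding holomorphic_differentials_def by blast
  define h where "h = real (cusp_width G7 S)"
  have h: "h > 0" using cusp_width_props(1)[OF S] by (simp add: h_def)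
  have q: "filterlim (\<lambda>w. ee (w / of_real h)) (at 0) iinf" by (rule ee_at_cusp[OF h])
  have q0: "((\<lambda>w. ee (w / of_real h)) \<longlongrightarrow> 0) iinf" using q by (simp add: filterlim_at)
  have "isCont g 0" using g(1) by (simp add: analytic_at_imp_isCont)
  then have "((\<lambda>w. g (ee (w / of_real h))) \<longlongrightarrow> g 0) iinf" by (rule isCont_tendsto_compose[OF _ q0])
  then have lim: "((\<lambda>w. g (ee (w / of_real h)) * (ee (w / of_real h) * (2 * of_real pi * \<i> / of_real h))) \<longlongrightarrow> g 0 * (0 * (2 * of_real pi * \<i> / of_real h))) iinf"
    by (intro tendsto_intros q0)
  have "eventually (\<lambda>w. g (ee (w / of_real h)) * (ee (w / of_real h) * (2 * of_real pi * \<i> / of_real h)) = slash f A w) iinf"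
    using g(2)[unfolded eventually_cusp_filter[OF S]] eventually_iinf_UHP
  proof eventually_elim
    case (elim w)
    have a: "aut A w \<noteq> 0" by (rule aut_nonzero[OF A elim(2)])
    have "f (moebius A w) = g (ee (w / of_real h)) * (ee (w / of_real h) * (2 * of_real pi * \<i> / of_real h) * (aut A w)\<^sup>2)"
      using elim(1)[unfolded deriv_cusp_coord[OF S elim(2)] cusp_coord_inv[OF S elim(2)]] unfolding h_def AS .
    then show ?case using a unfolding slash_def by (simp only: mult.assoc[symmetric]) simp
  qed
  from Lim_transform_eventually[OF lim this] show "(slash f A \<longlongrightarrow> 0) iinf" by simp
qed

subsection \<open>The genus\<close>

lemma slash_om: "A \<in> SLZ \<Longrightarrow> z \<in> UHP \<Longrightarrow> slash (om 0 1) A z = psign A * om (A $ 2 $ 1) (A $ 2 $ 2) z"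
  unfolding slash_def using aut_nonzero om_moebius by simp

lemma om_X7_orders:
  assumes p: "prim7 c d"
  shows "\<exists>r>0. has_order (om c d) r" "\<exists>r>0. has_order (\<lambda>z. Xc c d z * om c d z) r"
proof -
  have "(\<exists>r>0. has_order (om c d) r) \<and> (\<exists>r>0. has_order (\<lambda>z. Xc c d z * om c d z) r)"
  proof (cases c rule: residue7_cases)
    case 0
    from has_order_mult[OF Xc_orders(4)[OF 0 p] om_orders(4)[OF 0 p]] om_orders(4)[OF 0 p]
    show ?thesis by (intro conjI exI[of _ "1/2"]) simp_all
  next
    case 1
    from has_order_mult[OF Xc_orders(1)[OF 1] om_orders(1)[OF 1], of d d] om_orders(1)[OF 1, of d]
    show ?thesis by (intro conjI, intro exI[of _ "1/14"], simp, intro exI[of _ "3/14"], simp)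
  next
    case 2
    from has_order_mult[OF Xc_orders(2)[OF 2] om_orders(2)[OF 2], of d d] om_orders(2)[OF 2, of d]
    show ?thesis by (intro conjI, intro exI[of _ "3/14"], simp, intro exI[of _ "1/14"], simp)
  next
    case 3
    from has_order_mult[OF Xc_orders(3)[OF 3] om_orders(3)[OF 3], of d d] om_orders(3)[OF 3, of d]
    show ?thesis by (intro conjI, intro exI[of _ "1/14"], simp, intro exI[of _ "1/14"], simp)
  qed
  then show "\<exists>r>0. has_order (om c d) r" "\<exists>r>0. has_order (\<lambda>z. Xc c d z * om c d z) r" by auto
qed

definition u0 :: "complex \<Rightarrow> complex" where "u0 z = (if z \<in> UHP then om 0 1 z else 0)"
definition u1 :: "complex \<Rightarrow> complex" where "u1 z = (if z \<in> UHP then X7 z * om 0 1 z else 0)"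

lemma u0_differential: "u0 \<in> holomorphic_differentials G7"
proof -
  have "(slash (om 0 1) A \<longlongrightarrow> 0) iinf" if A: "A \<in> SLZ" for A
  proof -
    obtain r where r: "r > 0" "has_order (om (A $ 2 $ 1) (A $ 2 $ 2)) r" using om_X7_orders(1)[OF prim7_SL2[OF A]] by blast
    have "order_ge (\<lambda>z. psign A * om (A $ 2 $ 1) (A $ 2 $ 2) z) r"
      by (rule order_ge_cmult[OF has_order_imp_order_ge[OF r(2)]])
    then have "order_ge (slash (om 0 1) A) r"
      by (rule order_ge_eq) (use eventually_iinf_UHP in \<open>eventually_elim, simp add: slash_om[OF A]\<close>)
    then show ?thesis using r(1) by (rule order_ge_tendsto_0)
  qed
  moreover have "wt2 (om 0 1)" unfolding wt2_def using G7_om by blast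
  ultimately show ?thesis unfolding u0_def[abs_def] by (intro differentials_intro om_hol) auto
qed

lemma u1_differential: "u1 \<in> holomorphic_differentials G7"
proof -
  have sl: "slash (\<lambda>z. X7 z * om 0 1 z) A z = psign A * (Xc (A $ 2 $ 1) (A $ 2 $ 2) z * om (A $ 2 $ 1) (A $ 2 $ 2) z)"
    if "A \<in> SLZ" "z \<in> UHP" for A z
    unfolding slash_def using aut_nonzero[OF that] om_moebius[OF that] Xc_moebius[OF that] by simp
  have "(slash (\<lambda>z. X7 z * om 0 1 z) A \<longlongrightarrow> 0) iinf" if A: "A \<in> SLZ" for A
  proof -
    obtain r where r: "r > 0" "has_order (\<lambda>z. Xc (A $ 2 $ 1) (A $ 2 $ 2) z * om (A $ 2 $ 1) (A $ 2 $ 2) z) r"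
      using om_X7_orders(2)[OF prim7_SL2[OF A]] by blast
    have "order_ge (\<lambda>z. psign A * (Xc (A $ 2 $ 1) (A $ 2 $ 2) z * om (A $ 2 $ 1) (A $ 2 $ 2) z)) r"
      by (rule order_ge_cmult[OF has_order_imp_order_ge[OF r(2)]])
    then have "order_ge (slash (\<lambda>z. X7 z * om 0 1 z) A) r"
      by (rule order_ge_eq) (use eventually_iinf_UHP in \<open>eventually_elim, simp add: sl[OF A]\<close>)
    then show ?thesis using r(1) by (rule order_ge_tendsto_0)
  qed
  moreover have "wt2 (\<lambda>z. X7 z * om 0 1 z)" unfolding wt2_def
  proof (intro ballI)
    fix A z assume A: "A \<in> G7" and z: "z \<in> UHP"
    have "A \<in> Gamma1 7" using A by blast
    then have "X7 (moebius A z) = X7 z" using inv7_X7 z unfolding inv7_def by blast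
    then show "X7 (moebius A z) * om 0 1 (moebius A z) = (aut A z)\<^sup>2 * (X7 z * om 0 1 z)" using G7_om[OF A z] by simp
  qed
  ultimately show ?thesis unfolding u1_def[abs_def] by (intro differentials_intro holomorphic_on_mult om_hol X7_hol) auto
qed

text \<open>The slashed function has period 14, and period 2 where 7 divides the lower left entry;
  vanishing at the cusp then gives a full step of \<open>1 / 14\<close> or
  \<open>1 / 2\<close>.\<close>

lemma differential_order:
  assumes f: "f \<in> holomorphic_differentials G7" and A: "A \<in> SLZ"
  shows "order_ge (slash f A) (1/14)" "7 dvd A $ 2 $ 1 \<Longrightarrow> order_ge (slash f A) (1/2)"
proof -
  define S where "S = SL2_inv A"
  have S: "S \<in> SLZ" using A by (simp add: S_def)
  have AS: "SL2_inv S = A" by (simp add: S_def)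
  have Fh: "slash f A holomorphic_on UHP" by (rule slash_hol[OF differentials_elim(1)[OF f] A])
  have lim: "(slash f A \<longlongrightarrow> 0) iinf" by (rule differentials_elim(3)[OF f A])
  have per: "slash f A (w + of_real (real_of_int h)) = slash f A w"
    if h: "even h" "7 dvd h \<or> 7 dvd S $ 2 $ 1" and w: "w \<in> UHP" for h w
  proof -
    obtain B where B: "B \<in> G7" "S ** B = translation_matrix h ** S" using conj_translation_in_G7[OF S h] by blast
    from slash_periodic[OF differentials_elim(2)[OF f] S B(1) disjI1[OF B(2)] w] show ?thesis unfolding AS by simp
  qed
  have "order_ge (slash f A) (1 / real_of_int 14)"
    by (rule periodic_vanishing_order[OF Fh _ per lim]) simp_all
  then show "order_ge (slash f A) (1/14)" by simp
  assume "7 dvd A $ 2 $ 1"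
  then have c: "7 dvd S $ 2 $ 1" by (simp add: S_def)
  have "order_ge (slash f A) (1 / real_of_int 2)"
    by (rule periodic_vanishing_order[OF Fh _ per lim]) (simp_all add: c)
  then show "order_ge (slash f A) (1/2)" by simp
qed

text \<open>The lower bounds for a differential equal the orders of \<open>om\<close> except at the
  cusp of \<open>g0\<close>, where \<open>om\<close> has order 3/14 and the quotient drops to 1/14 -
  3/14 = -1/7.\<close>

lemma quotient_order:
  assumes f: "f \<in> holomorphic_differentials G7" and A: "A \<in> SLZ"
  shows "order_ge (\<lambda>z. f (moebius A z) / om 0 1 (moebius A z)) (if 7 dvd A $ 2 $ 1 - 2 \<or> 7 dvd A $ 2 $ 1 + 2 then - 1/7 else 0)"
    (is "order_ge _ ?r")
proof -
  let ?c = "A $ 2 $ 1" and ?d = "A $ 2 $ 2"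
  have p: "prim7 ?c ?d" by (rule prim7_SL2[OF A])
  have "order_ge (\<lambda>z. slash f A z / om ?c ?d z) ?r"
  proof (cases ?c rule: residue7_cases)
    case 0
    have "\<not> (7 dvd ?c - 2 \<or> 7 dvd ?c + 2)" using 0 by presburger
    with order_ge_divide[OF differential_order(2)[OF f A 0] om_orders(4)[OF 0 p]] show ?thesis by simp
  next
    case 1
    then have "\<not> (7 dvd ?c - 2 \<or> 7 dvd ?c + 2)" by presburger
    with order_ge_divide[OF differential_order(1)[OF f A] om_orders(1)[OF 1, of ?d]] show ?thesis by simp
  next
    case 2
    with order_ge_divide[OF differential_order(1)[OF f A] om_orders(2)[OF 2, of ?d]] show ?thesis by simp
  next
    case 3
    then have "\<not> (7 dvd ?c - 2 \<or> 7 dvd ?c + 2)" by presburger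
    with order_ge_divide[OF differential_order(1)[OF f A] om_orders(3)[OF 3, of ?d]] show ?thesis by simp
  qed
  from order_ge_cmult[OF this, of "psign A"] show ?thesis
  proof (rule order_ge_eq)
    show "eventually (\<lambda>z. psign A * (slash f A z / om ?c ?d z) = f (moebius A z) / om 0 1 (moebius A z)) iinf"
      using eventually_iinf_UHP
    proof eventually_elim
      case (elim z)
      show ?case using psign_cases[of A] unfolding slash_def om_moebius[OF A elim] by auto
    qed
  qed
qed

lemma Xc_cusp_limits: "(Xc 1 0 \<longlongrightarrow> 0) iinf" "(Xc 3 1 \<longlongrightarrow> 1) iinf"
proof -
  have "has_order (Xc 1 0) (1/7)" by (rule Xc_orders(1)) simp
  then show "(Xc 1 0 \<longlongrightarrow> 0) iinf" by (intro order_ge_tendsto_0[OF has_order_imp_order_ge]) auto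
  have "has_order (\<lambda>z. Xc 3 1 z - 1) (1/7)" by (rule Xc1_orders(3)) (simp_all add: prim7_def)
  then have "((\<lambda>z. Xc 3 1 z - 1) \<longlongrightarrow> 0) iinf" by (intro order_ge_tendsto_0[OF has_order_imp_order_ge]) auto
  then show "(Xc 3 1 \<longlongrightarrow> 1) iinf" by (simp add: LIM_zero_iff)
qed

lemma poly_vanishing_at_cusps:
  assumes deg: "degree p \<le> 4"
    and lim: "\<And>A. A \<in> SLZ \<Longrightarrow> \<not> (7 dvd A $ 2 $ 1 - 2 \<or> 7 dvd A $ 2 $ 1 + 2) \<Longrightarrow> ((\<lambda>z. poly p (X7 (moebius A z))) \<longlongrightarrow> 0) iinf"
  shows "p = 0"
proof (rule ccontr)
  assume p: "p \<noteq> 0"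
  have root: "poly p x = 0"
    if A: "mat22 a b c d \<in> SLZ" and c: "\<not> (7 dvd c - 2 \<or> 7 dvd c + 2)" and x: "(Xc c d \<longlongrightarrow> x) iinf" for a b c d x
  proof -
    have "((\<lambda>z. poly p (Xc c d z)) \<longlongrightarrow> poly p x) iinf" by (intro tendsto_intros x)
    moreover have "((\<lambda>z. poly p (Xc c d z)) \<longlongrightarrow> 0) iinf"
      by (rule Lim_transform_eventually[OF lim[OF A]]) (use c eventually_iinf_UHP in \<open>auto elim!: eventually_mono simp: Xc_moebius[OF A]\<close>)
    ultimately show ?thesis by (intro tendsto_unique[of iinf]) auto
  qed
  have x1: "xval 2 \<noteq> xval 1" using xval_double[of 1] by simp
  have x2: "xval 4 \<noteq> xval 2" using xval_double[of 2] by simp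
  have "xval 8 \<noteq> xval 4" using xval_double[of 4] by simp
  moreover have "xval 8 = xval 1" by (rule xval_cong) simp_all
  ultimately have x4: "xval 4 \<noteq> xval 1" by simp
  \<comment> \<open>The cubic takes the values 1 and -1 at 0 and 1, so these are not among its
    roots.\<close>
  have xn: "xval d \<noteq> 0" "xval d \<noteq> 1" if "\<not> 7 dvd d" for d using xval_cubic[OF that] by auto
  let ?R = "{0, 1, xval 1, xval 2, xval 4}"
  have "card ?R = 5" using x1 x2 x4 xn[of 1] xn[of 2] xn[of 4] by simp
  moreover have "?R \<subseteq> {x. poly p x = 0}"
  proof -
    \<comment> \<open>The bottom rows \<open>(1, 0)\<close>, \<open>(3, 1)\<close>,
      \<open>(0, 1)\<close>, \<open>(7, 2)\<close>, \<open>(7, 4)\<close> represent the five cusps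
      at which \<open>X7\<close> is finite.\<close>
    have "poly p 0 = 0" by (rule root[of 0 "-1" 1 0]) (simp_all add: SL2_iff Xc_cusp_limits)
    moreover have "poly p 1 = 0" by (rule root[of 1 0 3 1]) (simp_all add: SL2_iff Xc_cusp_limits)
    moreover have "poly p (xval 1) = 0" by (rule root[of 1 0 0 1]) (simp_all add: SL2_iff Xc_limit)
    moreover have "poly p (xval 2) = 0" by (rule root[of 4 1 7 2]) (simp_all add: SL2_iff Xc_limit prim7_def)
    moreover have "poly p (xval 4) = 0" by (rule root[of 2 1 7 4]) (simp_all add: SL2_iff Xc_limit prim7_def)
    ultimately show ?thesis by simp
  qed
  ultimately have "5 \<le> card {x. poly p x = 0}" using card_mono[OF poly_roots_finite[OF p], of ?R] by simp
  also have "\<dots> \<le> degree p" using p by (rule card_poly_roots_bound)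
  finally show False using deg by simp
qed

lemma differentials_span:
  assumes f: "f \<in> holomorphic_differentials G7"
  shows "\<exists>a b. f = (\<lambda>z. a * u0 z + b * u1 z)"
proof -
  define hh where "hh = (\<lambda>z. f z / om 0 1 z)"
  have hol: "hh holomorphic_on UHP" unfolding hh_def
    using differentials_elim(1)[OF f] by (intro holomorphic_intros om_hol) (auto simp: om_nz)
  have inv: "hh (moebius A z) = hh z" if A: "A \<in> G7" and z: "z \<in> UHP" for A z
    using differentials_elim(2)[OF f] A z aut_nonzero[OF G7_SLZ[OF A] z] unfolding hh_def wt2_def by (simp add: G7_om)
  have hol1: "(\<lambda>z. hh (z + 1)) holomorphic_on UHP"
    using holomorphic_moebius_compose[OF hol Tm_in, of 1] by simp
  define r :: "int \<Rightarrow> real" where "r = (\<lambda>c. if 7 dvd c - 2 \<or> 7 dvd c + 2 then - 1/7 else 0)"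
  have ord: "order_ge (\<lambda>z. hh (moebius A z)) (r (A $ 2 $ 1))" if "A \<in> SLZ" for A
    using quotient_order[OF f that] unfolding hh_def r_def .
  have ord1: "order_ge (\<lambda>z. hh (moebius A z + 1)) (r (A $ 2 $ 1))" if A: "A \<in> SLZ" for A
  proof -
    have TA: "translation_matrix 1 ** A \<in> SLZ" by (rule SL2_mult[OF Tm_in A])
    have c: "(translation_matrix 1 ** A) $ 2 $ 1 = A $ 2 $ 1" by (simp add: mat_mult_nth)
    have ev: "eventually (\<lambda>z. hh (moebius (translation_matrix 1 ** A) z) = hh (moebius A z + 1)) iinf"
      using eventually_iinf_UHP by eventually_elim (simp add: moebius_mult[OF Tm_in A])
    from order_ge_eq[OF ord[OF TA] ev] show ?thesis unfolding c .
  qed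
  define hp where "hp = (\<lambda>z. (hh z + hh (z + 1)) / 2)"
  define hm where "hm = (\<lambda>z. (hh z - hh (z + 1)) / 2 * W7 z)"
  have hp_hol: "hp holomorphic_on UHP" unfolding hp_def by (intro holomorphic_intros hol hol1) auto
  have hm_hol: "hm holomorphic_on UHP" unfolding hm_def by (intro holomorphic_intros hol hol1 W7_hol) auto
  have hp_ord: "order_ge (\<lambda>z. hp (moebius A z)) (r (A $ 2 $ 1))" if A: "A \<in> SLZ" for A
    using order_ge_cmult[OF order_ge_add[OF ord[OF A] ord1[OF A]], of "1/2"] unfolding hp_def by simp
  have hm_ord: "order_ge (\<lambda>z. hm (moebius A z)) (r (A $ 2 $ 1) + s)"
    if A: "A \<in> SLZ" and s: "has_order (Wc (A $ 2 $ 1) (A $ 2 $ 2)) s" for A s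
  proof -
    have "order_ge (\<lambda>z. W7 (moebius A z)) s"
      by (rule order_ge_eq[OF order_ge_cmult[OF has_order_imp_order_ge[OF s], of "psign A"]])
         (use eventually_iinf_UHP in \<open>eventually_elim, simp add: W7_moebius[OF A]\<close>)
    from order_ge_mult[OF order_ge_cmult[OF order_ge_minus[OF ord[OF A] ord1[OF A]], of "1/2"] this]
    show ?thesis unfolding hm_def by simp
  qed
  have hm_pos: "\<exists>s>0. order_ge (\<lambda>z. hm (moebius A z)) s"
    if A: "A \<in> SLZ" and c: "\<not> (7 dvd A $ 2 $ 1 - 2 \<or> 7 dvd A $ 2 $ 1 + 2)" for A
  proof -
    have p: "prim7 (A $ 2 $ 1) (A $ 2 $ 2)" by (rule prim7_SL2[OF A])
    have r0: "r (A $ 2 $ 1) = 0" using c by (simp add: r_def)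
    have "\<exists>s>0. has_order (Wc (A $ 2 $ 1) (A $ 2 $ 2)) s"
    proof (cases "A $ 2 $ 1" rule: residue7_cases)
      case 0
      from Wc_orders(4)[OF p 0] show ?thesis by (intro exI[of _ "1/2"]) simp
    next
      case 1
      from Wc_orders(1)[OF p 1] show ?thesis by (intro exI[of _ "1/14"]) simp
    next
      case 2
      with c show ?thesis by blast
    next
      case 3
      from Wc_orders(3)[OF p 3] show ?thesis by (intro exI[of _ "1/14"]) simp
    qed
    then obtain s where s: "s > 0" "has_order (Wc (A $ 2 $ 1) (A $ 2 $ 2)) s" by blast
    from hm_ord[OF A s(2)] s(1) show ?thesis unfolding r0 by (intro exI[of _ s]) simp
  qed
  have "\<exists>p. degree p \<le> 1 \<and> (\<forall>z\<in>UHP. hp z = poly p (X7 z))"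
  proof (rule inv7_polynomial[OF hp_hol])
    show "inv7 hp" unfolding hp_def by (rule inv7_even_part[OF inv])
    show "order_ge (\<lambda>z. hp (moebius A z)) 0" if "A \<in> SLZ" "\<not> (7 dvd A $ 2 $ 1 - 2 \<or> 7 dvd A $ 2 $ 1 + 2)" for A
      using hp_ord[OF that(1)] that(2) by (simp add: r_def)
    show "order_ge (\<lambda>z. hp (moebius g0 z)) (- of_nat 1 / 7)" using hp_ord[OF g0_in] by (simp add: r_def)
  qed
  then obtain p where p: "degree p \<le> 1" "\<And>z. z \<in> UHP \<Longrightarrow> hp z = poly p (X7 z)" by blast
  have "\<exists>q. degree q \<le> 4 \<and> (\<forall>z\<in>UHP. hm z = poly q (X7 z))"
  proof (rule inv7_polynomial[OF hm_hol])
    show "inv7 hm" unfolding hm_def by (rule inv7_odd_part[OF inv])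
    show "order_ge (\<lambda>z. hm (moebius A z)) 0" if A: "A \<in> SLZ" "\<not> (7 dvd A $ 2 $ 1 - 2 \<or> 7 dvd A $ 2 $ 1 + 2)" for A
    proof -
      obtain s where s: "s > 0" "order_ge (\<lambda>z. hm (moebius A z)) s" using hm_pos[OF A] by blast
      then show ?thesis using order_ge_mono[OF s(2), of 0] by simp
    qed
    \<comment> \<open>The order of the product is at least -1/7 - 5/14 = -1/2, which exceeds -4/7;
      hence degree at most 4, one less than the number of finite cusp values.\<close>
    have "has_order (Wc (g0 $ 2 $ 1) (g0 $ 2 $ 2)) (- 5/14)"
      by (rule Wc_orders(2)[OF prim7_SL2[OF g0_in]]) simp
    from hm_ord[OF g0_in this] show "order_ge (\<lambda>z. hm (moebius g0 z)) (- of_nat 4 / 7)"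
      by (rule order_ge_mono) (simp add: r_def)
  qed
  then obtain q where q: "degree q \<le> 4" "\<And>z. z \<in> UHP \<Longrightarrow> hm z = poly q (X7 z)" by blast
  have "q = 0"
  proof (rule poly_vanishing_at_cusps[OF q(1)])
    fix A :: "int ^ 2 ^ 2" assume A: "A \<in> SLZ" "\<not> (7 dvd A $ 2 $ 1 - 2 \<or> 7 dvd A $ 2 $ 1 + 2)"
    obtain s where s: "s > 0" "order_ge (\<lambda>z. hm (moebius A z)) s" using hm_pos[OF A] by blast
    have "((\<lambda>z. hm (moebius A z)) \<longlongrightarrow> 0) iinf" by (rule order_ge_tendsto_0[OF s(2,1)])
    then show "((\<lambda>z. poly q (X7 (moebius A z))) \<longlongrightarrow> 0) iinf"
      by (rule Lim_transform_eventually) (use eventually_iinf_UHP in \<open>eventually_elim, simp add: q(2) moebius_in_UHP[OF A(1)]\<close>)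
  qed
  define a b where "a = coeff p 0" and "b = coeff p 1"
  have pe: "poly p x = a + b * x" for x
  proof -
    have "p = [:a, b:]" using p(1) by (intro poly_eqI) (auto simp: a_def b_def coeff_pCons coeff_eq_0 split: nat.split)
    then show ?thesis by (simp add: mult.commute)
  qed
  have "f z = a * u0 z + b * u1 z" for z
  proof (cases "z \<in> UHP")
    case True
    have "hm z = 0" using q(2)[OF True] \<open>q = 0\<close> by simp
    \<comment> \<open>As \<open>W7\<close> has no zeros on the half-plane, vanishing of
      \<open>hm\<close> means that the odd part itself is 0.\<close>
    then have "hh z = hh (z + 1)" using Wc_nz[OF True prim7_0_1] unfolding hm_def by simp
    then have "hh z = hp z" unfolding hp_def by simp
    then have "hh z = a + b * X7 z" using p(2)[OF True] pe by simp
    moreover have "f z = hh z * om 0 1 z" using om_nz[OF True prim7_0_1] by (simp add: hh_def)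
    ultimately show ?thesis using True by (simp add: u0_def u1_def distrib_right)
  next
    case False
    then have "f z = 0" using f unfolding holomorphic_differentials_def by blast
    then show ?thesis using False by (simp add: u0_def u1_def)
  qed
  then show ?thesis by blast
qed

lemma i_in_UHP: "\<i> \<in> UHP" by (simp add: upper_half_plane_def)

lemma modular_curve_genus_G7: "modular_curve_genus G7 = 2"
proof -
  interpret vs: vector_space "\<lambda>(c::complex) (f::complex \<Rightarrow> complex) z. c * f z"
    by unfold_locales (auto simp: fun_eq_iff algebra_simps)
  let ?V = "holomorphic_differentials G7"
  have nz: "u0 \<noteq> 0"
  proof
    assume "u0 = 0"
    from fun_cong[OF this, of \<i>] show False using om_nz[OF i_in_UHP prim7_0_1] i_in_UHP by (simp add: u0_def)
  qed
  have nsp: "u1 \<notin> vs.span {u0}"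
  proof
    assume "u1 \<in> vs.span {u0}"
    then obtain k where k: "u1 = (\<lambda>z. k * u0 z)" unfolding vs.span_singleton by blast
    have "poly [:- k, 1:] (X7 z) = 0" if z: "z \<in> UHP" for z
      using fun_cong[OF k, of z] z om_nz[OF z prim7_0_1] by (simp add: u0_def u1_def)
    then have "[:- k, 1:] = 0" by (rule poly_X7_eq_0)
    then show False by simp
  qed
  have ne: "u1 \<noteq> u0" using nsp vs.span_base[of u0 "{u0}"] by auto
  have "vs.independent {u0}" using nz by (simp add: vs.independent_insert)
  then have ind: "vs.independent {u1, u0}" using nsp ne by (simp add: vs.independent_insert)
  have "{u1, u0} \<subseteq> vs.span ?V" using u0_differential u1_differential vs.span_superset by blast
  moreover have "?V \<subseteq> vs.span {u1, u0}"
  proof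
    fix f assume "f \<in> ?V"
    then obtain a b where f: "f = (\<lambda>z. a * u0 z + b * u1 z)" using differentials_span by blast
    have "f = (\<lambda>z. a * u0 z) + (\<lambda>z. b * u1 z)" unfolding f by (simp add: fun_eq_iff)
    also have "\<dots> \<in> vs.span {u1, u0}"
      by (intro vs.span_add vs.span_scale vs.span_base) auto
    finally show "f \<in> vs.span {u1, u0}" .
  qed
  ultimately have "vs.span {u1, u0} = vs.span ?V" by (simp add: vs.span_eq)
  from vs.dim_eq_card[OF this ind] show ?thesis unfolding modular_curve_genus_def using ne by simp
qed

theorem proposition6p6:
  fixes X W :: "complex poly poly"
  defines "X \<equiv> [:[:0, 1:]:]" and "W \<equiv> [:0, 1:]"
  shows "is_model_of_modular_curve (Gamma_sup2 \<inter> Gamma1 7)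
           (W\<^sup>2 - X * (X - 1) * (X ^ 3 - 8 * X\<^sup>2 + 5 * X + 1))
       \<and> modular_curve_genus (Gamma_sup2 \<inter> Gamma1 7) = 2"
proof -
  \<comment> \<open>The right-hand side involves \<open>X\<close> alone, so it is a constant in
    \<open>W\<close>; these rules move the computation into polynomials in one variable.\<close>
  have hom: "[:a:] * [:b:] = [:a * b:]" "[:a:] - [:b:] = [:a - b:]" "[:a:] + [:b:] = [:a + b:]" for a b :: "complex poly"
    by simp_all
  have c: "(1 :: complex poly poly) = [:1:]" "(8 :: complex poly poly) = [:8:]" "(5 :: complex poly poly) = [:5:]"
    by (simp_all add: one_pCons numeral_poly)
  have "X * (X - 1) * (X ^ 3 - 8 * X\<^sup>2 + 5 * X + 1) = [:quintic7:]"
  proof -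
    have cub: "cubic7 = [:0, 1:] ^ 3 - 8 * [:0, 1:] ^ 2 + 5 * [:0, 1:] + 1"
      by (simp add: cubic7_def power2_eq_square power3_eq_cube numeral_poly one_pCons)
    show ?thesis unfolding X_def c poly_const_pow hom quintic7_def cub ..
  qed
  moreover have "W\<^sup>2 - [:quintic7:] = curve7"
    unfolding W_def curve7_def by (simp add: power2_eq_square)
  ultimately show ?thesis using is_model_curve7 modular_curve_genus_G7 by simp
qed

end
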